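(* Let $A=kQ/I$ and let $\mathcal R$ be a reduction system satisfying condition $(\lozenge)$ for $I$, with associated sets $\mathcal A_n$ ($n\ge -1$), maps $\delta_n$ and sets $\overline{\mathcal L}_n^{\prec}(q)$. Set $d_{-1}:=\delta_{-1}$ and $d_0:=\delta_0$. Let $N\in\mathbb N_0$ and let $d_i:A\otimes_E k\mathcal A_i\otimes_E A\to A\otimes_E k\mathcal A_{i-1}\otimes_E A$, $1\le i\le N$, be morphisms of $A$-bimodules. If (1) $d_{i-1}\circ d_i=0$ for all $i$ with $1\le i\le N$, and (2) $(d_i-\delta_i)(1\otimes q\otimes 1)\in\langle\overline{\mathcal L}_{i-1}^{\prec}(q)\rangle_k$ for all $i\in\{1,\dots,N\}$ and all $q\in\mathcal A_i$, then the complex $$A\otimes_E k\mathcal A_N\otimes_E A\xrightarrow{d_N}\cdots\xrightarrow{d_1}A\otimes_E k\mathcal A_0\otimes_E A\xrightarrow{d_0}A\otimes_E A\xrightarrow{d_{-1}}A\to 0$$ is exact.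
   Context: Let $k$ be a field, $Q$ a quiver with finitely many vertices, $Q_n$ the set of paths of length $n$, $Q_{\ge n}=\bigcup_{i\ge n}Q_i$, $E=kQ_0$. Let $I$ be a two-sided ideal of $kQ$, $A=kQ/I$, $\pi:kQ\to A$ the projection; assume $\pi(Q_0\cup Q_1)$ is linearly independent. A path $p$ is a divisor of a path $q$ if $q=apb$ for paths $a,b$; it is a left divisor if moreover $a$ is a vertex, and a right divisor if $b$ is a vertex. An element $f\in kQ$ is parallel to a path $s$ if all paths in the support of $f$ have the same source and target as $s$. $p\in x$ means that the path $p$ is in the support of $x\in kQ$. $\langle X\rangle_R$ denotes the $R$-linear span of $X$. Reduction systems. A reduction system is a set $\mathcal R=\{(s_i,f_i)\}_{i\in\Gamma}$ with $s_i\in Q_{\ge0}$, $f_i\in kQ$ parallel to $s_i$, $f_i\ne s_i$, and $s_i$ not dividing $s_j$ for $i\neq j$. For $(s,f)\in\mathcal R$ and paths $a,c$ with $asc\ne0$ in $kQ$, the basic reduction $r_{a,s,c}:kQ\to kQ$ is the linear map with $r_{a,s,c}(asc)=afc$ and $r_{a,s,c}(q)=q$ for every path $q\ne asc$. A reduction $r=(r_n,\dots,r_1)$ is a finite sequence of basic reductions, acting on $kQ$ as $r_n\circ\cdots\circ r_1$. $x\in kQ$ is irreducible if $r(x)=x$ for all basic reductions $r$ (otherwise reducible). A path $p$ is reduction-finite if for every infinite sequence $(r_i)_{i\in\mathbb N}$ of basic reductions the sequence $r_n\circ\cdots\circ r_1(p)$ is eventually constant in $n$; it is reduction-unique if it is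 reduction-finite and $r(p)=r'(p)$ for any two reductions $r,r'$ with $r(p),r'(p)$ both irreducible. $\mathcal R$ satisfies $(\lozenge)$ for $I$ if $I$ is the two-sided ideal generated by $\{s-f\}_{(s,f)\in\mathcal R}$, every path is reduction-unique, and $f$ is irreducible for each $(s,f)\in\mathcal R$. Put $S=\{s:(s,f)\in\mathcal R\}$, assumed to satisfy $S\subseteq Q_{\ge2}$, and let $\mathcal B$ be the set of irreducible paths; $\{\pi(b):b\in\mathcal B\}$ is a basis of $A$. Ambiguities. $\mathcal A_{-1}=Q_0$, $\mathcal A_0=Q_1$, $\mathcal A_1=S$. For $n\ge2$, $\mathcal A_n$ is the set of $n$-ambiguities: paths $p=u_0u_1\cdots u_n$ with $u_0\in Q_1$, $u_1,\dots,u_n$ irreducible paths, such that for all $0\le i<n$, $u_iu_{i+1}$ is reducible but $u_id$ is irreducible for each proper left divisor $d$ of $u_{i+1}$ (left factorization). It is a known fact that these are the same as the paths $p=v_n\cdots v_0$ with $v_0\in Q_1$, $v_1,\dots,v_n$ irreducible, such that for all $0\le i<n$, $v_{i+1}v_i$ is reducible but $dv_i$ is irreducible for each proper right divisor $d$ of $v_{i+1}$ (right factorization), and that the factorizations are unique. Maps. $\delta_{-1}:A\otimes_E k\mathcal A_{-1}\otimes_E A\cong A\otimes_E A\to A$ is multiplication. For $n\ge0$, $\delta_n:A\otimes_E k\mathcal A_n\otimes_E A\to A\otimes_E k\mathcal A_{n-1}\otimes_E A$ is the $A$-bimodule map given on $q\in\mathcal A_n$ as follows: if $n$ is even and $q=u_0\cdots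 u_n=v_n\cdots v_0$ are the left and right factorizations, $\delta_n(1\otimes q\otimes1)=\pi(v_n)\otimes v_{n-1}\cdots v_0\otimes 1-1\otimes u_0\cdots u_{n-1}\otimes\pi(u_n)$ (for $n=0$: $\delta_0(1\otimes\alpha\otimes1)=\pi(\alpha)\otimes1-1\otimes\pi(\alpha)$); if $n$ is odd, $\delta_n(1\otimes q\otimes1)=\sum\pi(a)\otimes p\otimes\pi(c)$, summed over all $p\in\mathcal A_{n-1}$ and paths $a,c$ with $apc=q$. Order. On $k^\times Q_{\ge0}:=\{\lambda p:\lambda\in k^\times,p\in Q_{\ge0}\}\cup\{0\}$ let $\preceq$ be the least reflexive and transitive relation such that $\lambda p\preceq\mu q$ whenever there is a reduction $r$ with $r(\mu q)=\lambda p+x$, $p\notin x$, and such that $0\preceq\lambda p$ always. Write $\prec$ for $\preceq$ and $\neq$. For $n\ge-1$, $\overline{\mathcal L}_n^{\prec}(\mu q)=\{\lambda\pi(b)\otimes p\otimes\pi(b'): b,b'\in\mathcal B,\ p\in\mathcal A_n,\ \lambda bpb'\prec\mu q\}\subseteq A\otimes_E k\mathcal A_n\otimes_E A.$ *)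

theory Defs
  imports
    "HOL-Library.Poly_Mapping"
    "HOL-Algebra.QuotRing"
    "HOL-Algebra.Module"
    "Graph_Theory.Arc_Walk"
begin

section \<open>Paths in a quiver\<close>

text \<open>
  A quiver is a \<^typ>\<open>('v, 'e) pre_digraph\<close> satisfying \<^locale>\<open>wf_digraph\<close>: multiple arrows and loops are
  allowed, and neither the set of vertices nor the set of arrows is required to be finite by that
  locale. A path is stored as \<open>(source, list of arrows, target)\<close>, so that every vertex \<open>v\<close> gives its
  own path \<open>(v, [], v)\<close> of length 0. Paths are read from left to right: \<open>p q\<close> is
  nonzero in the path algebra iff the target of \<open>p\<close> is the source of \<open>q\<close>.
\<close>

type_synonym ('v, 'e) qpath = "'v \<times> 'e list \<times> 'v"

definition psrc :: "('v, 'e) qpath \<Rightarrow> 'v" where "psrc p = fst p"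
definition parr :: "('v, 'e) qpath \<Rightarrow> 'e list" where "parr p = fst (snd p)"
definition ptgt :: "('v, 'e) qpath \<Rightarrow> 'v" where "ptgt p = snd (snd p)"

definition qpaths :: "('v, 'e) pre_digraph \<Rightarrow> ('v, 'e) qpath set" where
  "qpaths Q = {(u, es, v). pre_digraph.awalk Q u es v}"

definition qpaths_of_length :: "('v, 'e) pre_digraph \<Rightarrow> nat \<Rightarrow> ('v, 'e) qpath set" where
  "qpaths_of_length Q n = {p \<in> qpaths Q. length (parr p) = n}"

definition composable :: "('v, 'e) qpath \<Rightarrow> ('v, 'e) qpath \<Rightarrow> bool" where
  "composable p q \<longleftrightarrow> ptgt p = psrc q"

definition pcomp :: "('v, 'e) qpath \<Rightarrow> ('v, 'e) qpath \<Rightarrow> ('v, 'e) qpath" where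
  "pcomp p q = (psrc p, parr p @ parr q, ptgt q)"

text \<open>The product of a nonempty list of consecutively composable paths.\<close>

fun pprod :: "('v, 'e) qpath list \<Rightarrow> ('v, 'e) qpath" where
  "pprod [] = undefined"
| "pprod [p] = p"
| "pprod (p # q # ps) = pcomp p (pprod (q # ps))"

definition path_divides :: "('v, 'e) pre_digraph \<Rightarrow> ('v, 'e) qpath \<Rightarrow> ('v, 'e) qpath \<Rightarrow> bool" where
  "path_divides Q p q \<longleftrightarrow> (\<exists>a \<in> qpaths Q. \<exists>b \<in> qpaths Q.
     composable a p \<and> composable p b \<and> q = pcomp a (pcomp p b))"

definition left_divisor :: "('v, 'e) pre_digraph \<Rightarrow> ('v, 'e) qpath \<Rightarrow> ('v, 'e) qpath \<Rightarrow> bool" where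
  "left_divisor Q p q \<longleftrightarrow> (\<exists>a \<in> qpaths_of_length Q 0. \<exists>b \<in> qpaths Q.
     composable a p \<and> composable p b \<and> q = pcomp a (pcomp p b))"

definition right_divisor :: "('v, 'e) pre_digraph \<Rightarrow> ('v, 'e) qpath \<Rightarrow> ('v, 'e) qpath \<Rightarrow> bool" where
  "right_divisor Q p q \<longleftrightarrow> (\<exists>a \<in> qpaths Q. \<exists>b \<in> qpaths_of_length Q 0.
     composable a p \<and> composable p b \<and> q = pcomp a (pcomp p b))"

section \<open>The path algebra\<close>

text \<open>
  Elements of the path algebra are finitely supported functions on paths; the support of \<open>x\<close> is
  \<open>keys x\<close>, and a path \<open>p\<close> is identified with \<open>bas p\<close>.
\<close>

definition pscale :: "'k::field \<Rightarrow> ('x \<Rightarrow>\<^sub>0 'k) \<Rightarrow> ('x \<Rightarrow>\<^sub>0 'k)" where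
  "pscale c x = Poly_Mapping.map ((*) c) x"

definition bas :: "'x \<Rightarrow> ('x \<Rightarrow>\<^sub>0 'k::field)" where
  "bas p = Poly_Mapping.single p 1"

text \<open>The linear extension of a function given on the basis elements \<^term>\<open>bas p\<close>.\<close>

definition lin_ext :: "('x \<Rightarrow> ('y \<Rightarrow>\<^sub>0 'k::field)) \<Rightarrow> ('x \<Rightarrow>\<^sub>0 'k) \<Rightarrow> ('y \<Rightarrow>\<^sub>0 'k)" where
  "lin_ext g x = (\<Sum>p \<in> Poly_Mapping.keys x. pscale (Poly_Mapping.lookup x p) (g p))"

type_synonym ('v, 'e, 'k) kq = "('v, 'e) qpath \<Rightarrow>\<^sub>0 'k"

definition kspace :: "'x set \<Rightarrow> ('x \<Rightarrow>\<^sub>0 'k::field) set" where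
  "kspace X = {x. Poly_Mapping.keys x \<subseteq> X}"

definition kq_mult :: "('v, 'e, 'k::field) kq \<Rightarrow> ('v, 'e, 'k) kq \<Rightarrow> ('v, 'e, 'k) kq" where
  "kq_mult x y =
     lin_ext (\<lambda>p. lin_ext (\<lambda>q. if composable p q then bas (pcomp p q) else 0) y) x"

definition path_algebra :: "('v, 'e) pre_digraph \<Rightarrow> ('v, 'e, 'k::field) kq ring" where
  "path_algebra Q =
     \<lparr>carrier = kspace (qpaths Q), mult = kq_mult, one = (\<Sum>v \<in> verts Q. bas (v, [], v)),
      zero = 0, add = (+)\<rparr>"

text \<open>The algebra \<open>A = kQ/I\<close>, the projection onto it, and the action of scalars on \<open>A\<close>-modules.\<close>

type_synonym ('v, 'e, 'k) qa = "('v, 'e, 'k) kq set"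

definition quot_algebra ::
  "('v, 'e) pre_digraph \<Rightarrow> ('v, 'e, 'k::field) kq set \<Rightarrow> ('v, 'e, 'k) qa ring" where
  "quot_algebra Q I = path_algebra Q Quot I"

definition proj ::
  "('v, 'e) pre_digraph \<Rightarrow> ('v, 'e, 'k::field) kq set \<Rightarrow> ('v, 'e, 'k) kq \<Rightarrow> ('v, 'e, 'k) qa" where
  "proj Q I x = I +>\<^bsub>path_algebra Q\<^esub> x"

definition scal ::
  "('v, 'e) pre_digraph \<Rightarrow> ('v, 'e, 'k::field) kq set \<Rightarrow> 'k \<Rightarrow> ('v, 'e, 'k) qa" where
  "scal Q I c = proj Q I (pscale c \<one>\<^bsub>path_algebra Q\<^esub>)"

text \<open>Linear independence of the family \<open>(\<pi>(p))\<close>, \<open>p \<in> X\<close>, over the base field.\<close>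

definition proj_lin_indep ::
  "('v, 'e) pre_digraph \<Rightarrow> ('v, 'e, 'k::field) kq set \<Rightarrow> ('v, 'e) qpath set \<Rightarrow> bool" where
  "proj_lin_indep Q I X \<longleftrightarrow> (\<forall>F c. finite F \<longrightarrow> F \<subseteq> X \<longrightarrow>
     (\<Oplus>\<^bsub>quot_algebra Q I\<^esub> p \<in> F. scal Q I (c p) \<otimes>\<^bsub>quot_algebra Q I\<^esub> proj Q I (bas p))
       = \<zero>\<^bsub>quot_algebra Q I\<^esub> \<longrightarrow>
     (\<forall>p \<in> F. c p = 0))"

section \<open>Reduction systems\<close>

type_synonym ('v, 'e, 'k) redsys = "(('v, 'e) qpath \<times> ('v, 'e, 'k) kq) set"

text \<open>
  In an indexed family the condition that \<open>s\<^sub>i\<close> does not divide \<open>s\<^sub>j\<close> for \<open>i \<noteq> j\<close> makes the \<open>s\<^sub>i\<close> pairwise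
  distinct, so nothing is lost by using a set of pairs.
\<close>

definition reduction_system :: "('v, 'e) pre_digraph \<Rightarrow> ('v, 'e, 'k::field) redsys \<Rightarrow> bool" where
  "reduction_system Q R \<longleftrightarrow>
     (\<forall>(s, f) \<in> R. s \<in> qpaths Q \<and> f \<in> carrier (path_algebra Q) \<and>
        (\<forall>p \<in> Poly_Mapping.keys f. psrc p = psrc s \<and> ptgt p = ptgt s) \<and> f \<noteq> bas s) \<and>
     (\<forall>(s, f) \<in> R. \<forall>(s', f') \<in> R. (s, f) \<noteq> (s', f') \<longrightarrow> \<not> path_divides Q s s')"

definition basic_reduction ::
  "('v, 'e) qpath \<Rightarrow> ('v, 'e) qpath \<Rightarrow> ('v, 'e, 'k::field) kq \<Rightarrow> ('v, 'e) qpath \<Rightarrow>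
   ('v, 'e, 'k) kq \<Rightarrow> ('v, 'e, 'k) kq" where
  "basic_reduction a s f c =
     lin_ext (\<lambda>q. if q = pcomp a (pcomp s c) then kq_mult (bas a) (kq_mult f (bas c)) else bas q)"

definition basic_reductions ::
  "('v, 'e) pre_digraph \<Rightarrow> ('v, 'e, 'k::field) redsys \<Rightarrow>
   (('v, 'e, 'k) kq \<Rightarrow> ('v, 'e, 'k) kq) set" where
  "basic_reductions Q R = {basic_reduction a s f c | a s f c.
     (s, f) \<in> R \<and> a \<in> qpaths Q \<and> c \<in> qpaths Q \<and> composable a s \<and> composable s c}"

definition reductions ::
  "('v, 'e) pre_digraph \<Rightarrow> ('v, 'e, 'k::field) redsys \<Rightarrow>
   (('v, 'e, 'k) kq \<Rightarrow> ('v, 'e, 'k) kq) set" where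
  "reductions Q R = {foldr (\<circ>) rs id | rs. set rs \<subseteq> basic_reductions Q R}"

definition irred ::
  "('v, 'e) pre_digraph \<Rightarrow> ('v, 'e, 'k::field) redsys \<Rightarrow> ('v, 'e, 'k) kq \<Rightarrow> bool" where
  "irred Q R x \<longleftrightarrow> (\<forall>r \<in> basic_reductions Q R. r x = x)"

abbreviation irred_path ::
  "('v, 'e) pre_digraph \<Rightarrow> ('v, 'e, 'k::field) redsys \<Rightarrow> ('v, 'e) qpath \<Rightarrow> bool" where
  "irred_path Q R p \<equiv> irred Q R (bas p)"

definition reduction_finite ::
  "('v, 'e) pre_digraph \<Rightarrow> ('v, 'e, 'k::field) redsys \<Rightarrow> ('v, 'e) qpath \<Rightarrow> bool" where
  "reduction_finite Q R p \<longleftrightarrow>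
     (\<forall>r. (\<forall>i::nat. r i \<in> basic_reductions Q R) \<longrightarrow>
        (\<exists>m. \<forall>n \<ge> m. fold r [0..<n] (bas p) = fold r [0..<m] (bas p)))"

definition reduction_unique ::
  "('v, 'e) pre_digraph \<Rightarrow> ('v, 'e, 'k::field) redsys \<Rightarrow> ('v, 'e) qpath \<Rightarrow> bool" where
  "reduction_unique Q R p \<longleftrightarrow> reduction_finite Q R p \<and>
     (\<forall>r \<in> reductions Q R. \<forall>r' \<in> reductions Q R.
        irred Q R (r (bas p)) \<longrightarrow> irred Q R (r' (bas p)) \<longrightarrow> r (bas p) = r' (bas p))"

definition lozenge ::
  "('v, 'e) pre_digraph \<Rightarrow> ('v, 'e, 'k::field) redsys \<Rightarrow> ('v, 'e, 'k) kq set \<Rightarrow> bool" where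
  "lozenge Q R I \<longleftrightarrow>
     I = Idl\<^bsub>path_algebra Q\<^esub> {bas s - f | s f. (s, f) \<in> R} \<and>
     (\<forall>p \<in> qpaths Q. reduction_unique Q R p) \<and>
     (\<forall>(s, f) \<in> R. irred Q R f)"

definition irred_paths ::
  "('v, 'e) pre_digraph \<Rightarrow> ('v, 'e, 'k::field) redsys \<Rightarrow> ('v, 'e) qpath set" where
  "irred_paths Q R = {p \<in> qpaths Q. irred_path Q R p}"

section \<open>Ambiguities\<close>

text \<open>
  \<open>us\<close> is the list \<open>u\<^sub>0, \<dots>, u\<^sub>n\<close> of the left factorization of \<open>p\<close>; in a right factorization \<open>vs\<close> is the list
  \<open>v\<^sub>0, \<dots>, v\<^sub>n\<close>, the path itself being \<open>v\<^sub>n \<cdots> v\<^sub>0\<close>.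
\<close>

definition left_factorization ::
  "('v, 'e) pre_digraph \<Rightarrow> ('v, 'e, 'k::field) redsys \<Rightarrow> nat \<Rightarrow> ('v, 'e) qpath \<Rightarrow>
   ('v, 'e) qpath list \<Rightarrow> bool" where
  "left_factorization Q R n p us \<longleftrightarrow>
     length us = Suc n \<and> us ! 0 \<in> qpaths_of_length Q 1 \<and>
     (\<forall>i \<in> {1..n}. us ! i \<in> irred_paths Q R) \<and>
     (\<forall>i < n. composable (us ! i) (us ! Suc i)) \<and>
     p = pprod us \<and>
     (\<forall>i < n. \<not> irred_path Q R (pcomp (us ! i) (us ! Suc i)) \<and>
        (\<forall>d \<in> qpaths Q. left_divisor Q d (us ! Suc i) \<and> d \<noteq> us ! Suc i \<longrightarrow>
           irred_path Q R (pcomp (us ! i) d)))"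

definition right_factorization ::
  "('v, 'e) pre_digraph \<Rightarrow> ('v, 'e, 'k::field) redsys \<Rightarrow> nat \<Rightarrow> ('v, 'e) qpath \<Rightarrow>
   ('v, 'e) qpath list \<Rightarrow> bool" where
  "right_factorization Q R n p vs \<longleftrightarrow>
     length vs = Suc n \<and> vs ! 0 \<in> qpaths_of_length Q 1 \<and>
     (\<forall>i \<in> {1..n}. vs ! i \<in> irred_paths Q R) \<and>
     (\<forall>i < n. composable (vs ! Suc i) (vs ! i)) \<and>
     p = pprod (rev vs) \<and>
     (\<forall>i < n. \<not> irred_path Q R (pcomp (vs ! Suc i) (vs ! i)) \<and>
        (\<forall>d \<in> qpaths Q. right_divisor Q d (vs ! Suc i) \<and> d \<noteq> vs ! Suc i \<longrightarrow>
           irred_path Q R (pcomp d (vs ! i))))"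

definition ambig ::
  "('v, 'e) pre_digraph \<Rightarrow> ('v, 'e, 'k::field) redsys \<Rightarrow> int \<Rightarrow> ('v, 'e) qpath set" where
  "ambig Q R n =
     (if n < - 1 then {}
      else if n = - 1 then qpaths_of_length Q 0
      else if n = 0 then qpaths_of_length Q 1
      else if n = 1 then fst ` R
      else {p \<in> qpaths Q. \<exists>us. left_factorization Q R (nat n) p us})"

section \<open>Bimodules and the tensor products over \<open>E\<close>\<close>

record ('a, 'm) bimodule = "('a, 'm) module" +
  rsmult :: "'m \<Rightarrow> 'a \<Rightarrow> 'm"

definition bimod_hom ::
  "'a ring \<Rightarrow> ('a, 'm) bimodule \<Rightarrow> ('a, 'n) bimodule \<Rightarrow> ('m \<Rightarrow> 'n) set" where
  "bimod_hom A M N = {f. (\<forall>x \<in> carrier M. f x \<in> carrier N) \<and>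
     (\<forall>x \<in> carrier M. \<forall>y \<in> carrier M. f (x \<oplus>\<^bsub>M\<^esub> y) = f x \<oplus>\<^bsub>N\<^esub> f y) \<and>
     (\<forall>a \<in> carrier A. \<forall>x \<in> carrier M.
        f (a \<odot>\<^bsub>M\<^esub> x) = a \<odot>\<^bsub>N\<^esub> f x \<and> f (rsmult M x a) = rsmult N (f x) a)}"

definition regular_bimod :: "'a ring \<Rightarrow> ('a, 'a) bimodule" where
  "regular_bimod A =
     \<lparr>carrier = carrier A, mult = undefined, one = undefined, zero = \<zero>\<^bsub>A\<^esub>, add = add A,
      smult = mult A, rsmult = mult A\<rparr>"

text \<open>
  For a set \<open>X\<close> of paths, \<open>A \<otimes>\<^sub>E kX \<otimes>\<^sub>E A\<close> is the vector space freely generated by all triples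
  \<open>(x, w, y)\<close> with \<open>x, y \<in> A\<close> and \<open>w \<in> kX\<close>, modulo the relations making the triple multilinear over the
  field and balanced over \<open>E = kQ\<^sub>0\<close>, which acts on \<open>A\<close> through the projection and on \<open>kX\<close> by
  multiplication in the path algebra.
\<close>

type_synonym ('v, 'e, 'k) ftens =
  "(('v, 'e, 'k) qa \<times> ('v, 'e, 'k) kq \<times> ('v, 'e, 'k) qa) \<Rightarrow>\<^sub>0 'k"

type_synonym ('v, 'e, 'k) tens = "('v, 'e, 'k) ftens set"

definition tensor_free ::
  "('v, 'e) pre_digraph \<Rightarrow> ('v, 'e, 'k::field) kq set \<Rightarrow> ('v, 'e) qpath set \<Rightarrow>
   ('v, 'e, 'k) ftens ring" where
  "tensor_free Q I X =
     \<lparr>carrier = kspace (carrier (quot_algebra Q I) \<times> kspace X \<times> carrier (quot_algebra Q I)),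
      mult = undefined, one = undefined, zero = 0, add = (+)\<rparr>"

definition tensor_rels ::
  "('v, 'e) pre_digraph \<Rightarrow> ('v, 'e, 'k::field) kq set \<Rightarrow> ('v, 'e) qpath set \<Rightarrow>
   ('v, 'e, 'k) ftens set" where
  "tensor_rels Q I X =
    (let A = quot_algebra Q I; CA = carrier A; W = kspace X; E = kspace (qpaths_of_length Q 0);
         \<pi> = proj Q I; t = (\<lambda>x w y. bas (x, w, y))
     in module.span pscale
      ( {t (x \<oplus>\<^bsub>A\<^esub> x') w y - t x w y - t x' w y | x x' w y. x \<in> CA \<and> x' \<in> CA \<and> w \<in> W \<and> y \<in> CA}
      \<union> {t x (w + w') y - t x w y - t x w' y | x w w' y. x \<in> CA \<and> w \<in> W \<and> w' \<in> W \<and> y \<in> CA}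
      \<union> {t x w (y \<oplus>\<^bsub>A\<^esub> y') - t x w y - t x w y' | x w y y'. x \<in> CA \<and> w \<in> W \<and> y \<in> CA \<and> y' \<in> CA}
      \<union> {t (scal Q I c \<otimes>\<^bsub>A\<^esub> x) w y - pscale c (t x w y) | c x w y. x \<in> CA \<and> w \<in> W \<and> y \<in> CA}
      \<union> {t x (pscale c w) y - pscale c (t x w y) | c x w y. x \<in> CA \<and> w \<in> W \<and> y \<in> CA}
      \<union> {t x w (scal Q I c \<otimes>\<^bsub>A\<^esub> y) - pscale c (t x w y) | c x w y. x \<in> CA \<and> w \<in> W \<and> y \<in> CA}
      \<union> {t (x \<otimes>\<^bsub>A\<^esub> \<pi> e) w y - t x (kq_mult e w) y | x e w y. x \<in> CA \<and> e \<in> E \<and> w \<in> W \<and> y \<in> CA}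
      \<union> {t x (kq_mult w e) y - t x w (\<pi> e \<otimes>\<^bsub>A\<^esub> y) | x e w y. x \<in> CA \<and> e \<in> E \<and> w \<in> W \<and> y \<in> CA}))"

definition tensor_class ::
  "('v, 'e) pre_digraph \<Rightarrow> ('v, 'e, 'k::field) kq set \<Rightarrow> ('v, 'e) qpath set \<Rightarrow>
   ('v, 'e, 'k) ftens \<Rightarrow> ('v, 'e, 'k) tens" where
  "tensor_class Q I X v = tensor_rels Q I X +>\<^bsub>tensor_free Q I X\<^esub> v"

text \<open>The elementary tensor \<open>x \<otimes> w \<otimes> y\<close>.\<close>

definition ten ::
  "('v, 'e) pre_digraph \<Rightarrow> ('v, 'e, 'k::field) kq set \<Rightarrow> ('v, 'e) qpath set \<Rightarrow>
   ('v, 'e, 'k) qa \<Rightarrow> ('v, 'e, 'k) kq \<Rightarrow> ('v, 'e, 'k) qa \<Rightarrow> ('v, 'e, 'k) tens" where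
  "ten Q I X x w y = tensor_class Q I X (bas (x, w, y))"

definition tensor_bimod ::
  "('v, 'e) pre_digraph \<Rightarrow> ('v, 'e, 'k::field) kq set \<Rightarrow> ('v, 'e) qpath set \<Rightarrow>
   (('v, 'e, 'k) qa, ('v, 'e, 'k) tens) bimodule" where
  "tensor_bimod Q I X =
     \<lparr>carrier = a_rcosets\<^bsub>tensor_free Q I X\<^esub> (tensor_rels Q I X),
      mult = undefined, one = undefined,
      zero = tensor_rels Q I X, add = set_add (tensor_free Q I X),
      smult = (\<lambda>a t. \<Union>v \<in> t. tensor_class Q I X
                 (lin_ext (\<lambda>(x, w, y). bas (a \<otimes>\<^bsub>quot_algebra Q I\<^esub> x, w, y)) v)),
      rsmult = (\<lambda>t a. \<Union>v \<in> t. tensor_class Q I X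
                 (lin_ext (\<lambda>(x, w, y). bas (x, w, y \<otimes>\<^bsub>quot_algebra Q I\<^esub> a)) v))\<rparr>"

text \<open>
  The bimodule map \<open>A \<otimes>\<^sub>E kX \<otimes>\<^sub>E A \<rightarrow> M\<close> with \<open>1 \<otimes> q \<otimes> 1 \<mapsto> g q\<close> for \<open>q \<in> X\<close>. It is computed on an
  arbitrary representative of the tensor, which is immaterial if \<open>\<pi>(e) g(q) = g(q) = g(q) \<pi>(e')\<close> for
  the source \<open>e\<close> and the target \<open>e'\<close> of \<open>q\<close>.
\<close>

definition bimod_ext ::
  "('v, 'e) pre_digraph \<Rightarrow> ('v, 'e, 'k::field) kq set \<Rightarrow> (('v, 'e, 'k) qa, 'm) bimodule \<Rightarrow>
   (('v, 'e) qpath \<Rightarrow> 'm) \<Rightarrow> ('v, 'e, 'k) tens \<Rightarrow> 'm" where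
  "bimod_ext Q I M g t =
     (let v = (SOME v. v \<in> t) in
      \<Oplus>\<^bsub>M\<^esub> z \<in> Poly_Mapping.keys v. (case z of (x, w, y) \<Rightarrow>
        (\<Oplus>\<^bsub>M\<^esub> q \<in> Poly_Mapping.keys w.
           scal Q I (Poly_Mapping.lookup v z * Poly_Mapping.lookup w q) \<odot>\<^bsub>M\<^esub>
             rsmult M (x \<odot>\<^bsub>M\<^esub> g q) y)))"

definition kspan ::
  "('v, 'e) pre_digraph \<Rightarrow> ('v, 'e, 'k::field) kq set \<Rightarrow> (('v, 'e, 'k) qa, 'm) bimodule \<Rightarrow>
   'm set \<Rightarrow> 'm set" where
  "kspan Q I M Y = {(\<Oplus>\<^bsub>M\<^esub> z \<in> F. scal Q I (c z) \<odot>\<^bsub>M\<^esub> z) | F c. finite F \<and> F \<subseteq> Y}"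

section \<open>The maps \<open>\<delta>\<^sub>n\<close>\<close>

definition res_term ::
  "('v, 'e) pre_digraph \<Rightarrow> ('v, 'e, 'k::field) kq set \<Rightarrow> ('v, 'e, 'k) redsys \<Rightarrow> int \<Rightarrow>
   (('v, 'e, 'k) qa, ('v, 'e, 'k) tens) bimodule" where
  "res_term Q I R n = tensor_bimod Q I (ambig Q R n)"

abbreviation res_ten ::
  "('v, 'e) pre_digraph \<Rightarrow> ('v, 'e, 'k::field) kq set \<Rightarrow> ('v, 'e, 'k) redsys \<Rightarrow> int \<Rightarrow>
   ('v, 'e, 'k) qa \<Rightarrow> ('v, 'e, 'k) kq \<Rightarrow> ('v, 'e, 'k) qa \<Rightarrow> ('v, 'e, 'k) tens" where
  "res_ten Q I R n \<equiv> ten Q I (ambig Q R n)"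

text \<open>
  The bimodule \<open>A \<otimes>\<^sub>E A\<close> is represented by \<open>A \<otimes>\<^sub>E kQ\<^sub>0 \<otimes>\<^sub>E A\<close>, where \<open>x \<otimes> y\<close> corresponds to \<open>x \<otimes> 1 \<otimes> y\<close>
  for the unit \<open>1\<close> of \<open>kQ\<^sub>0\<close>, which is that of the path algebra. Hence multiplication is the
  bimodule map given by \<open>1 \<otimes> e \<otimes> 1 \<mapsto> \<pi>(e)\<close>.
\<close>

definition delta_aug ::
  "('v, 'e) pre_digraph \<Rightarrow> ('v, 'e, 'k::field) kq set \<Rightarrow> ('v, 'e, 'k) tens \<Rightarrow>
   ('v, 'e, 'k) qa" where
  "delta_aug Q I = bimod_ext Q I (regular_bimod (quot_algebra Q I)) (\<lambda>e. proj Q I (bas e))"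

definition delta_gen ::
  "('v, 'e) pre_digraph \<Rightarrow> ('v, 'e, 'k::field) kq set \<Rightarrow> ('v, 'e, 'k) redsys \<Rightarrow> int \<Rightarrow>
   ('v, 'e) qpath \<Rightarrow> ('v, 'e, 'k) tens" where
  "delta_gen Q I R n q =
    (let T = res_term Q I R (n - 1); t = res_ten Q I R (n - 1); \<pi> = (\<lambda>p. proj Q I (bas p));
         one_A = \<one>\<^bsub>quot_algebra Q I\<^esub>; one_E = \<one>\<^bsub>path_algebra Q\<^esub>
     in if n = 0 then
          t (\<pi> q) one_E one_A \<ominus>\<^bsub>T\<^esub> t one_A one_E (\<pi> q)
        else if even n then
          (let m = nat n;
               us = (THE us. left_factorization Q R m q us);
               vs = (THE vs. right_factorization Q R m q vs)
           in t (\<pi> (vs ! m)) (bas (pprod (rev (take m vs)))) one_A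
                \<ominus>\<^bsub>T\<^esub> t one_A (bas (pprod (take m us))) (\<pi> (us ! m)))
        else
          (\<Oplus>\<^bsub>T\<^esub> z \<in> {(a, p, c). a \<in> qpaths Q \<and> p \<in> ambig Q R (n - 1) \<and> c \<in> qpaths Q \<and>
               composable a p \<and> composable p c \<and> pcomp a (pcomp p c) = q}.
             (case z of (a, p, c) \<Rightarrow> t (\<pi> a) (bas p) (\<pi> c))))"

definition delta ::
  "('v, 'e) pre_digraph \<Rightarrow> ('v, 'e, 'k::field) kq set \<Rightarrow> ('v, 'e, 'k) redsys \<Rightarrow> int \<Rightarrow>
   ('v, 'e, 'k) tens \<Rightarrow> ('v, 'e, 'k) tens" where
  "delta Q I R n = bimod_ext Q I (res_term Q I R (n - 1)) (delta_gen Q I R n)"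

section \<open>The order on scalar multiples of paths\<close>

text \<open>\<open>preceq\<close> lives on the set \<^term>\<open>spaths Q\<close> of all \<open>\<lambda>p\<close> with \<open>\<lambda> \<noteq> 0\<close>, together with 0.\<close>

definition spaths :: "('v, 'e) pre_digraph \<Rightarrow> ('v, 'e, 'k::field) kq set" where
  "spaths Q = {Poly_Mapping.single p c | p c. c \<noteq> 0 \<and> p \<in> qpaths Q} \<union> {0}"

inductive preceq ::
  "('v, 'e) pre_digraph \<Rightarrow> ('v, 'e, 'k::field) redsys \<Rightarrow> ('v, 'e, 'k) kq \<Rightarrow>
   ('v, 'e, 'k) kq \<Rightarrow> bool"
  for Q R where
  refl: "x \<in> spaths Q \<Longrightarrow> preceq Q R x x"
| trans: "preceq Q R x y \<Longrightarrow> preceq Q R y z \<Longrightarrow> preceq Q R x z"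
| red: "c \<noteq> 0 \<Longrightarrow> d \<noteq> 0 \<Longrightarrow> p \<in> qpaths Q \<Longrightarrow> q \<in> qpaths Q \<Longrightarrow> r \<in> reductions Q R \<Longrightarrow>
    x \<in> carrier (path_algebra Q) \<Longrightarrow> p \<notin> Poly_Mapping.keys x \<Longrightarrow>
    r (Poly_Mapping.single q d) = Poly_Mapping.single p c + x \<Longrightarrow>
    preceq Q R (Poly_Mapping.single p c) (Poly_Mapping.single q d)"
| zero: "x \<in> spaths Q \<Longrightarrow> preceq Q R 0 x"

definition prec ::
  "('v, 'e) pre_digraph \<Rightarrow> ('v, 'e, 'k::field) redsys \<Rightarrow> ('v, 'e, 'k) kq \<Rightarrow>
   ('v, 'e, 'k) kq \<Rightarrow> bool" where
  "prec Q R x y \<longleftrightarrow> preceq Q R x y \<and> x \<noteq> y"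

text \<open>
  The set of all \<open>\<lambda>\<pi>(b) \<otimes> p \<otimes> \<pi>(b')\<close> with \<open>\<lambda>bpb' \<prec> x\<close>, the product being taken in the path algebra.
  If \<open>\<lambda>bpb' = 0\<close> because \<open>\<lambda> = 0\<close> or the paths do not compose, then the tensor is 0 as well.
\<close>

definition Lbar ::
  "('v, 'e) pre_digraph \<Rightarrow> ('v, 'e, 'k::field) kq set \<Rightarrow> ('v, 'e, 'k) redsys \<Rightarrow> int \<Rightarrow>
   ('v, 'e, 'k) kq \<Rightarrow> ('v, 'e, 'k) tens set" where
  "Lbar Q I R n x =
     {scal Q I c \<odot>\<^bsub>res_term Q I R n\<^esub>
        res_ten Q I R n (proj Q I (bas b)) (bas p) (proj Q I (bas b')) | c b p b'.
      b \<in> irred_paths Q R \<and> b' \<in> irred_paths Q R \<and> p \<in> ambig Q R n \<and>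
      prec Q R (pscale c (kq_mult (bas b) (kq_mult (bas p) (bas b')))) x}"

end

theory Submission
  imports Defs "HOL-Library.Product_Lexorder"
begin

text \<open>
  By reduction-uniqueness the irreducible paths \<open>\<B>\<close> give a basis of \<open>A\<close>, with the normal form \<open>N\<close> as
  coordinates, so that \<open>A \<otimes>\<^sub>E k\<A>\<^sub>n \<otimes>\<^sub>E A\<close> has the basis of all triples \<open>(b, p, b')\<close> with \<open>b, b' \<in> \<B>\<close>,
  \<open>p \<in> \<A>\<^sub>n\<close> and \<open>b p b' \<noteq> 0\<close>. The relation that \<open>p\<close> occurs in a one-step reduction of \<open>q\<close>
  is well-founded and finitely branching; let \<open>\<rho>(w)\<close> be the number of paths strictly below \<open>w\<close>, and rank triples
  lexicographically by \<open>\<rho>(b p b')\<close> and the length of \<open>p b'\<close>.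

  If \<open>u\<^sub>0, \<dots>, u\<^sub>n\<close> is the left factorization of \<open>q\<close>, then \<open>d\<^sub>n\<close> maps \<open>(b, q, b')\<close> to
  \<open>\<plusminus> (b, u\<^sub>0 \<cdots> u\<^sub>n\<^sub>-\<^sub>1, u\<^sub>n b')\<close> plus terms of smaller rank if \<open>u\<^sub>n b'\<close> is irreducible, and to terms of
  smaller rank otherwise; the correction \<open>d\<^sub>n - \<delta>\<^sub>n\<close> only contributes terms with smaller \<open>\<rho>\<close>. If \<open>u\<^sub>n b'\<close> is
  reducible, then the shortest prefix \<open>u\<^sub>n\<^sub>+\<^sub>1\<close> of \<open>b'\<close> with \<open>u\<^sub>n u\<^sub>n\<^sub>+\<^sub>1\<close> reducible makes \<open>(b, q, b')\<close> the
  leading term of a basis element in degree \<open>n + 1\<close>. Thus the leading terms pair off the bases of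
  adjacent degrees, and exactness follows by induction on the rank.
\<close>

section \<open>Finitely supported functions as vector spaces\<close>

text \<open>Reduction-finiteness only concerns sequences of reductions applied to one element, where
  cancellation of coefficients might hide an endless descent of paths; well-foundedness therefore
  needs an argument of its own. Multiplication is compatible with \<open>step\<close> but not
  visibly with the count \<open>rho\<close>, so all estimates are made for \<open>step\<close> and
  turned into numbers last. A second rank component is unavoidable, since before normalization every
  term of \<delta> applied to \<open>b q b'\<close> spells the same word. The terms other than the
  leading one have pushed arrows into the left factor, and this is what the length of
  \<open>p b'\<close> measures. The word has to come first in the lexicographic order because the
  corrections may have any shape as long as the word drops. In even degrees \<delta> involves right
  factorizations while ambiguities are defined from the left, so the agreement of the two notions
  has to be proved; this happens on words, where uniqueness is a statement about shortest prefixes.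
  Tensors are classes in a huge free space. A basis is available only once the relations are known
  to be the kernel of the coordinate map. No contracting homotopy is constructed.\<close>

abbreviation "keys \<equiv> Poly_Mapping.keys"
abbreviation "lookup \<equiv> Poly_Mapping.lookup"

lemma lookup_pscale [simp]: "lookup (pscale c x) p = c * lookup x p"
  by (simp add: pscale_def Poly_Mapping.map.rep_eq when_def)

lemma lookup_bas: "lookup (bas p) q = (if p = q then 1 else 0)"
  by (simp add: bas_def lookup_single when_def)

lemma keys_bas [simp]: "keys (bas p :: 'x \<Rightarrow>\<^sub>0 'k::field) = {p}"
  by (simp add: bas_def)

lemma bas_eq_iff [simp]: "(bas p :: 'x \<Rightarrow>\<^sub>0 'k::field) = bas q \<longleftrightarrow> p = q"
  by (metis keys_bas singleton_inject)

lemma bas_neq_0 [simp]: "(bas p :: 'x \<Rightarrow>\<^sub>0 'k::field) \<noteq> 0"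
  by (metis keys_bas keys_zero insert_not_empty)

lemma pscale_add_right: "pscale c (x + y) = pscale c x + pscale c y"
  by (rule poly_mapping_eqI) (simp add: lookup_add algebra_simps)

lemma pscale_add_left: "pscale (c + d) x = pscale c x + pscale d x"
  by (rule poly_mapping_eqI) (simp add: lookup_add algebra_simps)

lemma pscale_pscale [simp]: "pscale c (pscale d x) = pscale (c * d) x"
  by (rule poly_mapping_eqI) (simp add: algebra_simps)

lemma pscale_simps [simp]:
  "pscale 1 x = x" "pscale 0 x = 0" "pscale c 0 = 0" "pscale (- 1) x = - x"
  by (rule poly_mapping_eqI, simp)+

lemma pscale_diff: "pscale c (x - y) = pscale c x - pscale c y"
  by (rule poly_mapping_eqI) (simp add: lookup_minus algebra_simps)

lemma pscale_eq_0 [simp]: "pscale c x = 0 \<longleftrightarrow> c = 0 \<or> x = (0 :: 'x \<Rightarrow>\<^sub>0 'k::field)"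
proof
  assume h: "pscale c x = 0"
  show "c = 0 \<or> x = 0"
  proof (cases "c = 0")
    case False
    have "lookup x p = 0" for p
      using h False lookup_pscale[of c x p] by simp
    then show ?thesis by (auto intro: poly_mapping_eqI)
  qed simp
qed auto

lemma pscale_minus [simp]: "pscale c (- x) = - pscale c x"
  by (rule poly_mapping_eqI) simp

lemma pscale_sum: "pscale c (sum f F) = (\<Sum>z\<in>F. pscale c (f z))"
  by (rule poly_mapping_eqI) (simp add: lookup_sum sum_distrib_left)

lemma single_eq_pscale: "Poly_Mapping.single p c = pscale c (bas p)"
  by (rule poly_mapping_eqI) (simp add: lookup_bas lookup_single when_def)

lemma keys_pscale: "keys (pscale c x) = (if c = 0 then {} else keys x)"
  by (auto simp: in_keys_iff)

lemma vector_space_pscale: "vector_space (pscale :: 'k::field \<Rightarrow> ('x \<Rightarrow>\<^sub>0 'k) \<Rightarrow> _)"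
  by unfold_locales (simp_all add: pscale_add_left pscale_add_right)

lemma lin_ext_superset:
  assumes "finite F" "keys x \<subseteq> F"
  shows "lin_ext g x = (\<Sum>p\<in>F. pscale (lookup x p) (g p))"
  unfolding lin_ext_def
  by (rule sum.mono_neutral_left[OF assms]) (auto simp: in_keys_iff)

lemma lin_ext_add: "lin_ext g (x + y) = lin_ext g x + lin_ext g y"
proof -
  let ?F = "keys x \<union> keys y"
  have "keys (x + y) \<subseteq> ?F" by (rule keys_add)
  then have "lin_ext g (x + y) = (\<Sum>p\<in>?F. pscale (lookup (x + y) p) (g p))"
    by (intro lin_ext_superset) auto
  also have "\<dots> = (\<Sum>p\<in>?F. pscale (lookup x p) (g p))
      + (\<Sum>p\<in>?F. pscale (lookup y p) (g p))"
    by (simp add: lookup_add pscale_add_left sum.distrib)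
  also have "\<dots> = lin_ext g x + lin_ext g y"
    by (subst (1 2) lin_ext_superset[symmetric]) auto
  finally show ?thesis .
qed

lemma lin_ext_0 [simp]: "lin_ext g 0 = 0"
  by (simp add: lin_ext_def)

lemma lin_ext_pscale: "lin_ext g (pscale c x) = pscale c (lin_ext g x)"
  by (cases "c = 0") (simp_all add: lin_ext_def keys_pscale pscale_sum)

lemma lin_ext_bas [simp]: "lin_ext g (bas p) = g p"
  by (simp add: lin_ext_def lookup_bas)

section \<open>Linear maps between spaces of finitely supported functions\<close>

definition klin :: "(('x \<Rightarrow>\<^sub>0 'k::field) \<Rightarrow> ('y \<Rightarrow>\<^sub>0 'k)) \<Rightarrow> bool" where
  "klin F \<longleftrightarrow> (\<forall>x y. F (x + y) = F x + F y) \<and> (\<forall>c x. F (pscale c x) = pscale c (F x))"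

lemma klinI: "(\<And>x y. F (x + y) = F x + F y) \<Longrightarrow> (\<And>c x. F (pscale c x) = pscale c (F x)) \<Longrightarrow> klin F"
  by (simp add: klin_def)

lemma klin_add: "klin F \<Longrightarrow> F (x + y) = F x + F y"
  and klin_pscale: "klin F \<Longrightarrow> F (pscale c x) = pscale c (F x)"
  by (simp_all add: klin_def)

lemma klin_0: "klin F \<Longrightarrow> F 0 = 0"
  by (metis klin_pscale pscale_simps(2))

lemma klin_uminus: "klin F \<Longrightarrow> F (- x) = - F x"
  by (metis klin_pscale pscale_simps(4))

lemma klin_diff: "klin F \<Longrightarrow> F (x - y) = F x - F y"
  using klin_add[of F x "- y"] klin_uminus[of F y] by simp

lemma klin_sum: "klin F \<Longrightarrow> F (sum f A) = (\<Sum>z\<in>A. F (f z))"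
  by (induction A rule: infinite_finite_induct) (auto simp: klin_0 klin_add)

lemma klin_lin_ext [simp, intro]: "klin (lin_ext g)"
  by (rule klinI) (simp_all add: lin_ext_add lin_ext_pscale)

lemma klin_id [simp, intro]: "klin (\<lambda>x. x)"
  by (rule klinI) simp_all

lemma klin_compose: "klin F \<Longrightarrow> klin G \<Longrightarrow> klin (\<lambda>x. F (G x))"
  by (auto simp: klin_def)

lemma lin_ext_bas_id [simp]: "lin_ext bas x = x"
proof (rule poly_mapping_eqI)
  fix q
  have "lookup (lin_ext bas x) q
      = (\<Sum>p\<in>keys x. if p = q then lookup x p else 0)"
    unfolding lin_ext_def lookup_sum by (rule sum.cong) (auto simp: lookup_bas)
  also have "\<dots> = lookup x q"
    by (auto simp: in_keys_iff)
  finally show "lookup (lin_ext bas x) q = lookup x q" .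
qed

lemma klin_eq_lin_ext:
  assumes "klin F"
  shows "F x = lin_ext (\<lambda>p. F (bas p)) x"
proof -
  have "F x = F (lin_ext bas x)" by simp
  also have "\<dots> = lin_ext (\<lambda>p. F (bas p)) x"
    unfolding lin_ext_def by (simp add: klin_sum[OF assms] klin_pscale[OF assms])
  finally show ?thesis .
qed

lemma lin_ext_cong: "(\<And>p. p \<in> keys x \<Longrightarrow> g p = h p) \<Longrightarrow> lin_ext g x = lin_ext h x"
  by (simp add: lin_ext_def)

text \<open>Agreement is asked on the support of \<open>x\<close> only, because most identities
  below hold for genuine paths and not for arbitrary values of type \<open>qpath\<close>.\<close>

lemma klin_eqI:
  assumes "klin F" "klin G" "\<And>p. p \<in> keys x \<Longrightarrow> F (bas p) = G (bas p)"
  shows "F x = G x"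
  using klin_eq_lin_ext[OF assms(1), of x] klin_eq_lin_ext[OF assms(2), of x]
    lin_ext_cong[OF assms(3)] by simp

lemma klin_lin_ext_comp: "klin F \<Longrightarrow> F (lin_ext g x) = lin_ext (\<lambda>p. F (g p)) x"
  by (simp add: lin_ext_def klin_sum klin_pscale)

lemma lin_ext_fun_add: "lin_ext (\<lambda>p. g p + h p) x = lin_ext g x + lin_ext h x"
  by (simp add: lin_ext_def pscale_add_right sum.distrib)

lemma lin_ext_fun_pscale: "lin_ext (\<lambda>p. pscale c (g p)) x = pscale c (lin_ext g x)"
  by (simp add: lin_ext_def pscale_sum mult.commute)

lemma klin_lin_ext_fun:
  assumes "\<And>p. klin (\<lambda>y. g y p)"
  shows "klin (\<lambda>y. lin_ext (g y) x)"
  by (rule klinI)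
    (simp_all add: lin_ext_def klin_add[OF assms] klin_pscale[OF assms] pscale_add_right
      sum.distrib pscale_sum mult.commute)

lemma keys_lin_ext:
  "keys (lin_ext g x) \<subseteq> (\<Union>p\<in>keys x. keys (g p))"
proof
  fix q assume "q \<in> keys (lin_ext g x)"
  then have "(\<Sum>p\<in>keys x. lookup x p * lookup (g p) q) \<noteq> 0"
    by (simp add: lin_ext_def in_keys_iff lookup_sum)
  then obtain p where "p \<in> keys x" "lookup (g p) q \<noteq> 0"
    by (metis (no_types, lifting) mult_zero_right sum.neutral)
  then show "q \<in> (\<Union>p\<in>keys x. keys (g p))"
    by (auto simp: in_keys_iff)
qed

lemma keys_klin:
  assumes "klin F"
  shows "keys (F x) \<subseteq> (\<Union>p\<in>keys x. keys (F (bas p)))"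
  using keys_lin_ext[of "\<lambda>p. F (bas p)" x] klin_eq_lin_ext[OF assms, of x] by simp

lemma lookup_lin_ext:
  "lookup (lin_ext g x) q
    = (\<Sum>p\<in>keys x. lookup x p * lookup (g p) q)"
  by (simp add: lin_ext_def lookup_sum)

lemma keys_minus: "keys (x - y :: 'x \<Rightarrow>\<^sub>0 'k::field) \<subseteq> keys x \<union> keys y"
  by (auto simp: in_keys_iff lookup_minus)

lemma keys_sum_subset:
  "keys (sum f A :: 'x \<Rightarrow>\<^sub>0 'k::field) \<subseteq> (\<Union>z\<in>A. keys (f z))"
proof
  fix q assume "q \<in> keys (sum f A)"
  then have "(\<Sum>z\<in>A. lookup (f z) q) \<noteq> 0" by (simp add: in_keys_iff lookup_sum)
  then show "q \<in> (\<Union>z\<in>A. keys (f z))"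
    by (meson UN_I in_keys_iff sum.neutral)
qed

lemma kspace_0 [simp]: "0 \<in> kspace X"
  and kspace_add: "x \<in> kspace X \<Longrightarrow> y \<in> kspace X \<Longrightarrow> x + y \<in> kspace X"
  and kspace_diff: "x \<in> kspace X \<Longrightarrow> y \<in> kspace X \<Longrightarrow> x - y \<in> kspace X"
  and kspace_uminus: "x \<in> kspace X \<Longrightarrow> - x \<in> kspace X"
  and kspace_pscale: "x \<in> kspace X \<Longrightarrow> pscale c x \<in> kspace X"
  and kspace_bas [simp]: "bas p \<in> kspace X \<longleftrightarrow> p \<in> X"
  using keys_add[of x y] keys_minus[of x y] by (auto simp: kspace_def keys_pscale)

lemma kspace_sum: "(\<And>z. z \<in> A \<Longrightarrow> f z \<in> kspace X) \<Longrightarrow> sum f A \<in> kspace X"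
  by (induction A rule: infinite_finite_induct) (auto intro: kspace_add)

lemma kspace_lin_ext:
  assumes "x \<in> kspace X" "\<And>p. p \<in> X \<Longrightarrow> g p \<in> kspace Y"
  shows "lin_ext g x \<in> kspace Y"
  using keys_lin_ext[of g x] assms unfolding kspace_def by blast

lemma kspace_induct [consumes 1, case_names zero step]:
  assumes "x \<in> kspace X" "P 0"
    and "\<And>p c y. p \<in> X \<Longrightarrow> y \<in> kspace X \<Longrightarrow> P y \<Longrightarrow> P (pscale c (bas p) + y)"
  shows "P x"
proof -
  have "x = (\<Sum>p\<in>keys x. pscale (lookup x p) (bas p))"
    using lin_ext_bas_id[of x] by (simp add: lin_ext_def)
  moreover have "P (\<Sum>p\<in>F. pscale (lookup x p) (bas p))" if "finite F" "F \<subseteq> X" for F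
    using that
  proof (induction F)
    case (insert p F)
    have "(\<Sum>p\<in>F. pscale (lookup x p) (bas p)) \<in> kspace X"
      using insert.prems by (intro kspace_sum kspace_pscale) auto
    then show ?case using insert assms(3) by simp
  qed (simp add: assms(2))
  ultimately show ?thesis using assms(1) by (metis finite_keys kspace_def mem_Collect_eq)
qed

section \<open>Exactness from leading terms\<close>

text \<open>
  \<open>M\<close> is the part of the basis on which the leading term of \<open>D\<^sub>1\<close> does not vanish. A cycle has no
  such element in its top rank, since the images \<open>\<mu> t\<close> are distinct; the remaining elements of top
  rank are removed by subtracting boundaries.
\<close>

lemma exact_of_leading_terms:
  fixes D1 :: "('y \<Rightarrow>\<^sub>0 'k::field) \<Rightarrow> ('x \<Rightarrow>\<^sub>0 'k)" and D2 :: "('z \<Rightarrow>\<^sub>0 'k) \<Rightarrow> ('y \<Rightarrow>\<^sub>0 'k)"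
    and rk1 :: "'y \<Rightarrow> 'r::wellorder" and rk0 :: "'x \<Rightarrow> 'r"
  assumes lin1: "klin D1" and lin2: "klin D2"
    and complex: "\<And>y. y \<in> kspace T2 \<Longrightarrow> D1 (D2 y) = 0"
    and inj: "inj_on \<mu> M"
    and lead: "\<And>t. t \<in> T1 \<Longrightarrow> t \<in> M \<Longrightarrow> rk0 (\<mu> t) = rk1 t \<and> (\<exists>\<epsilon>. \<epsilon> \<noteq> 0 \<and>
        (\<forall>u \<in> keys (D1 (bas t) - pscale \<epsilon> (bas (\<mu> t))). rk0 u < rk1 t))"
    and low: "\<And>t. t \<in> T1 \<Longrightarrow> t \<notin> M \<Longrightarrow> \<forall>u \<in> keys (D1 (bas t)). rk0 u < rk1 t"
    and lift: "\<And>t. t \<in> T1 \<Longrightarrow> t \<notin> M \<Longrightarrow> \<exists>z\<in>T2. \<exists>\<epsilon>. \<epsilon> \<noteq> 0 \<and>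
        (\<forall>u \<in> keys (D2 (bas z) - pscale \<epsilon> (bas t)). u \<in> T1 \<and> rk1 u < rk1 t)"
    and x: "x \<in> kspace T1" "D1 x = 0"
  shows "\<exists>y\<in>kspace T2. D2 y = x"
proof -
  \<comment> \<open>The induction runs over an upper bound \<open>m\<close> of the ranks and not
    over the top rank itself, which a zero cycle would not have.\<close>
  have "\<exists>y\<in>kspace T2. D2 y = x"
    if "x \<in> kspace T1" "D1 x = 0" "\<forall>t\<in>keys x. rk1 t \<le> m" for m x
    using that
  proof (induction m arbitrary: x rule: less_induct)
    case (less m)
    note x = less.prems
    define L where "L = {t \<in> keys x. rk1 t = m}"
    have finL: "finite L" by (simp add: L_def)
    have LT: "L \<subseteq> T1" using x(1) by (auto simp: L_def kspace_def)
    have notM: "t \<notin> M" if t: "t \<in> L" for t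
    proof
      assume tM: "t \<in> M"
      have tT: "t \<in> T1" using t LT by auto
      obtain e where e: "e \<noteq> 0" "rk0 (\<mu> t) = m"
        "\<forall>u \<in> keys (D1 (bas t) - pscale e (bas (\<mu> t))). rk0 u < m"
        using lead[OF tT tM] t by (auto simp: L_def)
      \<comment> \<open>Since \<open>\<mu> t\<close> has rank \<open>m\<close> and \<open>s\<close>
        at most rank \<open>m\<close>, there are two ways for \<open>s\<close> to contribute:
        through its leading term, excluded by injectivity of \<open>\<mu>\<close>, or through a
        lower term, excluded by strictness.\<close>
      have other: "lookup (D1 (bas s)) (\<mu> t) = 0"
        if s: "s \<in> keys x" "s \<noteq> t" for s
      proof -
        have sT: "s \<in> T1" using s x(1) by (auto simp: kspace_def)
        have sm: "rk1 s \<le> m" using s x(3) by auto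
        show ?thesis
        proof (cases "s \<in> M")
          case True
          obtain d where d: "rk0 (\<mu> s) = rk1 s"
            "\<forall>u \<in> keys (D1 (bas s) - pscale d (bas (\<mu> s))). rk0 u < rk1 s"
            using lead[OF sT True] by auto
          have "\<mu> s \<noteq> \<mu> t" using inj True tM s(2) by (auto simp: inj_on_def)
          moreover have "\<mu> t \<notin> keys (D1 (bas s) - pscale d (bas (\<mu> s)))"
            using d(2) e(2) sm by auto
          ultimately show ?thesis
            by (simp add: in_keys_iff lookup_minus lookup_bas)
        next
          case False
          then show ?thesis using low[OF sT False] e(2) sm by (force simp: in_keys_iff)
        qed
      qed
      have tt: "lookup (D1 (bas t)) (\<mu> t) = e"
      proof -
        have "\<mu> t \<notin> keys (D1 (bas t) - pscale e (bas (\<mu> t)))"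
          using e(2,3) by auto
        then show ?thesis by (simp add: in_keys_iff lookup_minus lookup_bas)
      qed
      have tx: "t \<in> keys x" using t by (simp add: L_def)
      have "0 = lookup (D1 x) (\<mu> t)" using x(2) by simp
      also have "\<dots> = (\<Sum>s\<in>keys x. lookup x s * lookup (D1 (bas s)) (\<mu> t))"
        by (subst klin_eq_lin_ext[OF lin1]) (simp add: lookup_lin_ext)
      also have "\<dots> = (\<Sum>s\<in>{t}. lookup x s * lookup (D1 (bas s)) (\<mu> t))"
        using tx other by (intro sum.mono_neutral_right) auto
      also have "\<dots> = lookup x t * e" using tt by simp
      finally show False using e(1) tx by (simp add: in_keys_iff)
    qed
    have "\<forall>t\<in>L. \<exists>z. z \<in> T2 \<and> (\<exists>\<epsilon>. \<epsilon> \<noteq> 0 \<and>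
        (\<forall>u \<in> keys (D2 (bas z) - pscale \<epsilon> (bas t)). u \<in> T1 \<and> rk1 u < rk1 t))"
      using lift notM LT by blast
    then obtain z where z: "\<And>t. t \<in> L \<Longrightarrow> z t \<in> T2" "\<forall>t\<in>L. \<exists>\<epsilon>. \<epsilon> \<noteq> 0 \<and>
        (\<forall>u \<in> keys (D2 (bas (z t)) - pscale \<epsilon> (bas t)). u \<in> T1 \<and> rk1 u < rk1 t)"
      by metis
    then obtain \<epsilon> where eps: "\<And>t. t \<in> L \<Longrightarrow> \<epsilon> t \<noteq> 0"
      "\<And>t u. t \<in> L \<Longrightarrow> u \<in> keys (D2 (bas (z t)) - pscale (\<epsilon> t) (bas t)) \<Longrightarrow> u \<in> T1 \<and> rk1 u < m"
      by (metis (mono_tags, lifting) L_def mem_Collect_eq)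
    \<comment> \<open>The coefficients are chosen so that the leading terms of \<open>D2 y\<close>
      reproduce the top part of \<open>x\<close>. What remains of \<open>x - D2 y\<close> is
      \<open>x0\<close>, that is \<open>x\<close> without its top part, minus the lower terms
      \<open>w\<close> of \<open>D2 y\<close>.\<close>
    define y where "y = (\<Sum>t\<in>L. pscale (lookup x t / \<epsilon> t) (bas (z t)))"
    have yT: "y \<in> kspace T2" unfolding y_def using z(1) by (intro kspace_sum kspace_pscale) auto
    define w where "w = (\<Sum>t\<in>L. pscale (lookup x t / \<epsilon> t) (D2 (bas (z t)) - pscale (\<epsilon> t) (bas t)))"
    define x0 where "x0 = x - (\<Sum>t\<in>L. pscale (lookup x t) (bas t))"
    have "D2 y = w + (\<Sum>t\<in>L. pscale (lookup x t) (bas t))"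
      unfolding y_def w_def klin_sum[OF lin2] klin_pscale[OF lin2] sum.distrib[symmetric]
      by (rule sum.cong) (auto simp: pscale_diff eps(1))
    then have xy: "x - D2 y = x0 - w" by (simp add: x0_def)
    have wk: "u \<in> T1 \<and> rk1 u < m" if "u \<in> keys w" for u
    proof -
      obtain t where "t \<in> L" "u \<in> keys (pscale (lookup x t / \<epsilon> t) (D2 (bas (z t)) - pscale (\<epsilon> t) (bas t)))"
        using \<open>u \<in> keys w\<close> unfolding w_def using keys_sum_subset by fastforce
      then show ?thesis using eps(2) by (auto simp: keys_pscale split: if_splits)
    qed
    have x0k: "u \<in> T1 \<and> rk1 u < m" if u: "u \<in> keys x0" for u
    proof -
      have l: "lookup x0 u = lookup x u - (if u \<in> L then lookup x u else 0)"
        using finL by (simp add: x0_def lookup_minus lookup_sum lookup_bas if_distrib cong: if_cong)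
      have "u \<notin> L" "u \<in> keys x" using u l by (auto simp: in_keys_iff split: if_splits)
      then show ?thesis using x(1,3) by (auto simp: L_def kspace_def order.not_eq_order_implies_strict)
    qed
    have k: "u \<in> T1 \<and> rk1 u < m" if "u \<in> keys (x - D2 y)" for u
      using that keys_minus[of x0 w] wk x0k unfolding xy by blast
    have inT: "x - D2 y \<in> kspace T1" using k by (auto simp: kspace_def)
    have ker: "D1 (x - D2 y) = 0" using x(2) complex[OF yT] by (simp add: klin_diff[OF lin1])
    have "\<exists>y'\<in>kspace T2. D2 y' = x - D2 y"
    proof (cases "x - D2 y = 0")
      case True
      then show ?thesis by (metis kspace_0 klin_0[OF lin2])
    next
      case False
      define m' where "m' = Max (rk1 ` keys (x - D2 y))"
      have ne: "keys (x - D2 y) \<noteq> {}" using False by (metis lookup_zero poly_mapping_eqI in_keys_iff ex_in_conv)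
      have "m' \<in> rk1 ` keys (x - D2 y)" unfolding m'_def using ne by (intro Max_in) auto
      then have "m' < m" using k by auto
      moreover have "\<forall>t\<in>keys (x - D2 y). rk1 t \<le> m'" by (simp add: m'_def)
      ultimately show ?thesis using less.IH[OF _ inT ker] by blast
    qed
    then obtain y' where "y' \<in> kspace T2" "D2 y' = x - D2 y" by blast
    then have "y' + y \<in> kspace T2" "D2 (y' + y) = x" using yT by (auto intro: kspace_add simp: klin_add[OF lin2])
    then show ?case by blast
  qed
  from this[OF x, of "Max (rk1 ` keys x)"] show ?thesis by simp
qed

section \<open>Greedy factorizations of words\<close>

definition wred :: "'e list set \<Rightarrow> 'e list \<Rightarrow> bool" where
  "wred S w \<longleftrightarrow> (\<exists>s\<in>S. \<exists>a c. w = a @ s @ c)"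

lemma wred_append: "wred S w \<Longrightarrow> wred S (x @ w @ y)"
  unfolding wred_def by (metis append.assoc)

lemma wred_appendL: "wred S w \<Longrightarrow> wred S (x @ w)"
  using wred_append[of S w x "[]"] by simp

lemma wred_appendR: "wred S w \<Longrightarrow> wred S (w @ y)"
  using wred_append[of S w "[]" y] by simp

lemma wred_rev: "wred (rev ` S) (rev w) \<longleftrightarrow> wred S w"
proof -
  have *: "wred (rev ` S) (rev w)" if "wred S w" for w :: "'a list" and S
    using that unfolding wred_def by (metis append.assoc image_eqI rev_append)
  show ?thesis using *[of S w] *[of "rev ` S" "rev w"] by (auto simp: image_image)
qed

text \<open>Irreducibility of the product with every proper prefix of the next factor reduces to the
  longest one, \<open>butlast\<close>, because reducibility passes to longer words.\<close>

definition lfac :: "'e list set \<Rightarrow> 'e list list \<Rightarrow> bool" where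
  "lfac S us \<longleftrightarrow> us \<noteq> [] \<and> length (us ! 0) = 1 \<and>
     (\<forall>i. Suc i < length us \<longrightarrow> \<not> wred S (us ! Suc i) \<and> wred S (us ! i @ us ! Suc i) \<and>
        \<not> wred S (us ! i @ butlast (us ! Suc i)))"

definition rfac :: "'e list set \<Rightarrow> 'e list list \<Rightarrow> bool" where
  "rfac S vs \<longleftrightarrow> vs \<noteq> [] \<and> length (vs ! 0) = 1 \<and>
     (\<forall>i. Suc i < length vs \<longrightarrow> \<not> wred S (vs ! Suc i) \<and> wred S (vs ! Suc i @ vs ! i) \<and>
        \<not> wred S (tl (vs ! Suc i) @ vs ! i))"

text \<open>Reversing all words, those of \<open>S\<close> included, exchanges prefixes and
  suffixes. Every fact about right factorizations is obtained from its left counterpart in this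
  way.\<close>

lemma rfac_iff_lfac_rev: "rfac S vs \<longleftrightarrow> lfac (rev ` S) (map rev vs)"
proof -
  have "wred (rev ` S) (rev x @ butlast (rev y)) \<longleftrightarrow> wred S (tl y @ x)"
    "wred (rev ` S) (rev x @ rev y) \<longleftrightarrow> wred S (y @ x)" for x y
    using wred_rev[of S "tl y @ x"] wred_rev[of S "y @ x"] by (simp_all add: butlast_rev)
  then show ?thesis unfolding lfac_def rfac_def by (auto simp: wred_rev)
qed

lemma lfac_iff_rfac_rev: "lfac S us \<longleftrightarrow> rfac (rev ` S) (map rev us)"
  by (simp add: rfac_iff_lfac_rev image_image comp_def)

text \<open>The definition imposes irreducibility on the later factors only; the first one is a
  single letter and hence too short to contain an element of \<open>S\<close>.\<close>

lemma lfac_not_wred: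
  assumes "lfac S us" "\<And>s. s \<in> S \<Longrightarrow> 2 \<le> length s" "i < length us"
  shows "\<not> wred S (us ! i)"
proof (cases i)
  case 0
  show ?thesis
  proof
    assume "wred S (us ! i)"
    then obtain s a c where "s \<in> S" "us ! 0 = a @ s @ c" using 0 by (auto simp: wred_def)
    then have "length s \<le> 1" using assms(1) by (metis lfac_def length_append le_add1 le_add2 le_trans)
    then show False using assms(2)[OF \<open>s \<in> S\<close>] by simp
  qed
next
  case (Suc j)
  then show ?thesis using assms by (auto simp: lfac_def)
qed

lemma lfac_nonempty:
  assumes "lfac S us" "\<And>s. s \<in> S \<Longrightarrow> 2 \<le> length s" "i < length us"
  shows "us ! i \<noteq> []"
proof (cases i)
  case 0
  then show ?thesis using assms(1) by (auto simp: lfac_def)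
next
  case (Suc j)
  have "wred S (us ! j @ us ! Suc j)" "\<not> wred S (us ! j)"
    using assms lfac_not_wred[OF assms(1,2), of j] Suc by (auto simp: lfac_def)
  then show ?thesis using Suc by auto
qed

lemma lfac_take:
  assumes "lfac S us" "0 < k"
  shows "lfac S (take k us)"
  using assms by (auto simp: lfac_def)

lemma rfac_take:
  assumes "rfac S vs" "0 < k"
  shows "rfac S (take k vs)"
  using assms by (auto simp: rfac_def)

text \<open>Two candidates for the next factor are prefixes of one word, so one extends the other.
  If the extension were proper, the shorter candidate would already create a factor in
  \<open>S\<close> within the \<open>butlast\<close> of the longer one, against minimality. The
  tails \<open>x\<close> and \<open>y\<close> make it possible to compare factorizations of
  different lengths.\<close>

lemma lfac_prefix_unique:
  assumes S: "\<And>s. s \<in> S \<Longrightarrow> 2 \<le> length s"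
    and fac: "lfac S us" "lfac S us'"
    and eq: "concat us @ x = concat us' @ y"
    and n: "n \<le> length us" "n \<le> length us'"
  shows "take n us = take n us'"
  using n
proof (induction n)
  case (Suc n)
  have IH: "take n us = take n us'" using Suc by simp
  have split: "concat vs = concat (take n vs) @ vs ! n @ concat (drop (Suc n) vs)"
    if "n < length vs" for vs :: "'a list list"
    using that by (metis Cons_nth_drop_Suc append_take_drop_id concat.simps(2) concat_append)
  have "us ! n @ concat (drop (Suc n) us) @ x = us' ! n @ concat (drop (Suc n) us') @ y"
    using eq split[of us] split[of us'] Suc.prems IH by simp
  then obtain z where z: "us ! n = us' ! n @ z \<or> us' ! n = us ! n @ z"
    by (metis append_eq_append_conv2)
  have "z = []"
  proof (cases n)
    case 0
    then show ?thesis using z fac by (auto simp: lfac_def)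
  next
    case (Suc m)
    have m: "us ! m = us' ! m" using IH Suc by (metis lessI nth_take)
    have l: "Suc m < length us" "Suc m < length us'" using Suc Suc.prems by auto
    have w: "wred S (us ! m @ us ! n)" "wred S (us ! m @ us' ! n)"
      "\<not> wred S (us ! m @ butlast (us ! n))" "\<not> wred S (us ! m @ butlast (us' ! n))"
      using fac l Suc m by (auto simp: lfac_def)
    show ?thesis
    proof (rule ccontr)
      assume "z \<noteq> []"
      then have "butlast (v @ z) = v @ butlast z" for v by (simp add: butlast_append)
      then show False using z w wred_appendR[of S "us ! m @ us ! n" "butlast z"]
          wred_appendR[of S "us ! m @ us' ! n" "butlast z"] by auto
    qed
  qed
  then have "us ! n = us' ! n" using z by auto
  then show ?case using IH Suc.prems by (simp add: take_Suc_conv_app_nth)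
qed simp

lemma lfac_unique:
  assumes S: "\<And>s. s \<in> S \<Longrightarrow> 2 \<le> length s"
    and fac: "lfac S us" "lfac S us'" "concat us = concat us'" "length us = length us'"
  shows "us = us'"
  using lfac_prefix_unique[OF S fac(1,2), of "[]" "[]" "length us"] fac by simp

lemma rfac_unique:
  assumes S: "\<And>s. s \<in> S \<Longrightarrow> 2 \<le> length s"
    and fac: "rfac S vs" "rfac S vs'" "concat (rev vs) = concat (rev vs')" "length vs = length vs'"
  shows "vs = vs'"
proof -
  have "concat (map rev vs) = rev (concat (rev vs))" for vs :: "'a list list"
    by (simp add: rev_concat rev_map)
  then have "map rev vs = map rev vs'"
    using S fac by (intro lfac_unique[of "rev ` S"]) (auto simp: rfac_iff_lfac_rev)
  then show ?thesis by (metis inj_map_eq_map injI rev_rev_ident)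
qed

text \<open>Take the shortest prefix of \<open>c\<close> whose product with the last factor is
  reducible. It exists since \<open>c\<close> itself qualifies, and it is nonempty since the last
  factor alone is irreducible.\<close>

lemma lfac_extend:
  assumes S: "\<And>s. s \<in> S \<Longrightarrow> 2 \<le> length s"
    and us: "lfac S us" and c: "\<not> wred S c" "wred S (last us @ c)"
  shows "\<exists>u c'. c = u @ c' \<and> lfac S (us @ [u])"
proof -
  define k where "k = (LEAST k. wred S (last us @ take k c))"
  have ex: "wred S (last us @ take (length c) c)" using c by simp
  have k: "wred S (last us @ take k c)" unfolding k_def by (rule LeastI[of "\<lambda>k. wred S (last us @ take k c)", OF ex])
  have min: "\<not> wred S (last us @ take j c)" if "j < k" for j
    using that unfolding k_def by (rule not_less_Least)
  have kl: "k \<le> length c" unfolding k_def by (rule Least_le[of "\<lambda>k. wred S (last us @ take k c)", OF ex])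
  have ne: "us \<noteq> []" using us by (simp add: lfac_def)
  then have lst: "last us = us ! (length us - 1)" by (simp add: last_conv_nth)
  have "\<not> wred S (last us)" using lfac_not_wred[OF us S] ne by (simp add: lst)
  then have k0: "k \<noteq> 0" using k by (metis append_Nil2 take0)
  have bl: "butlast (take k c) = take (k - 1) c" using kl by (simp add: butlast_take)
  have irr: "\<not> wred S (take k c)" using c(1) wred_appendR[of S "take k c" "drop k c"] by auto
  have "lfac S (us @ [take k c])"
    unfolding lfac_def
  proof (intro conjI allI impI)
    fix i assume i: "Suc i < length (us @ [take k c])"
    have "\<not> wred S ((us @ [take k c]) ! Suc i) \<and>
      wred S ((us @ [take k c]) ! i @ (us @ [take k c]) ! Suc i) \<and>
      \<not> wred S ((us @ [take k c]) ! i @ butlast ((us @ [take k c]) ! Suc i))"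
    proof (cases "Suc i < length us")
      case True
      then show ?thesis using us by (simp add: lfac_def nth_append)
    next
      case False
      then have si: "length us = Suc i" using i by simp
      then have "(us @ [take k c]) ! Suc i = take k c" "(us @ [take k c]) ! i = last us"
        using lst by (auto simp: nth_append)
      then show ?thesis using irr k min[of "k - 1"] k0 bl by simp
    qed
    then show "\<not> wred S ((us @ [take k c]) ! Suc i)"
      "wred S ((us @ [take k c]) ! i @ (us @ [take k c]) ! Suc i)"
      "\<not> wred S ((us @ [take k c]) ! i @ butlast ((us @ [take k c]) ! Suc i))" by blast+
  qed (use us ne in \<open>auto simp: lfac_def nth_append\<close>)
  then show ?thesis by (metis append_take_drop_id)
qed

text \<open>Cut points of the right factorization, counted from the right end. The product of two
  neighbouring factors spans two gaps between cuts, so each cut is governed by the one two places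
  earlier: it is the rightmost start of a reducible piece ending there. The first two values split
  off the last letter.\<close>

fun rcut :: "(nat \<Rightarrow> nat \<Rightarrow> bool) \<Rightarrow> nat \<Rightarrow> nat \<Rightarrow> nat" where
  "rcut red L 0 = L"
| "rcut red L (Suc 0) = L - 1"
| "rcut red L (Suc (Suc k)) = (GREATEST x. x \<le> L \<and> red x (rcut red L k))"

text \<open>
  A greedy left factorization with cut points \<open>c\<close> and the greedy right factorization with cut points
  \<open>d\<close> (numbered from the right) interleave: \<open>c (n + 1 - k) \<le> d k < c (n + 2 - k)\<close>.
\<close>

lemma greedy_cuts_interleave:
  fixes red :: "nat \<Rightarrow> nat \<Rightarrow> bool" and c :: "nat \<Rightarrow> nat"
  assumes mono: "\<And>i j i' j'. red i j \<Longrightarrow> i' \<le> i \<Longrightarrow> j \<le> j' \<Longrightarrow> red i' j'"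
    and c: "c 0 = 0" "c 1 = 1" "c (n + 1) = L" "\<And>k. k \<le> n \<Longrightarrow> c k < c (k + 1)"
    and red: "\<And>k. k < n \<Longrightarrow> red (c k) (c (k + 2))"
    and min: "\<And>k. k < n \<Longrightarrow> \<not> red (c k) (c (k + 2) - 1)"
    and irr: "\<And>k. 1 \<le> k \<Longrightarrow> k \<le> n \<Longrightarrow> \<not> red (c k) (c (k + 1))"
  shows "\<exists>d. d 0 = L \<and> d 1 = L - 1 \<and> d (n + 1) = 0 \<and> (\<forall>k\<le>n. d (k + 1) < d k) \<and>
    (\<forall>k<n. red (d (k + 2)) (d k) \<and> \<not> red (d (k + 2) + 1) (d k)) \<and>
    (\<forall>k. 1 \<le> k \<and> k \<le> n \<longrightarrow> \<not> red (d (k + 1)) (d k))"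
proof -
  let ?d = "rcut red L"
  have le_pred: "x \<le> y - 1" if "x < y" for x y :: nat using that by simp
  have cL: "k \<le> n + 1 \<Longrightarrow> c k \<le> L" for k
  proof (induction "n + 1 - k" arbitrary: k)
    case (Suc m)
    then have "c (k + 1) \<le> L" "c k < c (k + 1)" using c(4)[of k] by auto
    then show ?case by simp
  qed (use c in auto)
  have L1: "1 \<le> L" using cL[of 1] c(2) by simp
  \<comment> \<open>One greedy step from the right. By \<open>ex\<close> some reducible piece starts
    at \<open>c (n - k - 1)\<close>, which bounds the new cut from below; by \<open>nx\<close> none
    starts at \<open>c (n - k)\<close>, which bounds it strictly from above.\<close>
  have step: "c (n - k - 1) \<le> ?d (k + 2) \<and> ?d (k + 2) < c (n - k) \<and>
      red (?d (k + 2)) (?d k) \<and> \<not> red (?d (k + 2) + 1) (?d k)"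
    if k: "k < n" and ex: "red (c (n - k - 1)) (?d k)" and nx: "\<not> red (c (n - k)) (?d k)" for k
  proof -
    let ?P = "\<lambda>x. x \<le> L \<and> red x (?d k)"
    have P: "?P (c (n - k - 1))" using ex cL[of "n - k - 1"] by simp
    have g: "?P (?d (k + 2))" using GreatestI_nat[of ?P _ L, OF P] by simp
    have le: "x \<le> ?d (k + 2)" if "?P x" for x using Greatest_le_nat[of ?P x L] that by simp
    have lt: "?d (k + 2) < c (n - k)"
      using nx g mono[of "?d (k + 2)" "?d k" "c (n - k)" "?d k"] by (metis le_refl not_less)
    have "\<not> red (?d (k + 2) + 1) (?d k)"
    proof
      assume "red (?d (k + 2) + 1) (?d k)"
      moreover have "?d (k + 2) + 1 \<le> L" using lt cL[of "n - k"] k by linarith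
      ultimately show False using le[of "?d (k + 2) + 1"] by simp
    qed
    then show ?thesis using g lt le[OF P] by blast
  qed
  \<comment> \<open>Since a cut depends on the one two places earlier, 1 and 2 are both base cases.
    From there on, reducibility of a product of neighbouring left factors gives the lower bound and
    minimality of a left factor the upper bound.\<close>
  have inter: "c (n + 1 - k) \<le> ?d k \<and> ?d k < c (n + 2 - k)" if "1 \<le> k" "k \<le> n + 1" for k
    using that
  proof (induction k rule: less_induct)
    case (less k)
    have "k = 1 \<or> k = 2 \<or> (\<exists>j. k = j + 2 \<and> 1 \<le> j)" using less.prems by presburger
    then consider "k = 1" | "k = 2" | j where "k = j + 2" "1 \<le> j"
      by blast
    then show ?case
    proof cases
      case 1
      then show ?thesis using c(3) c(4)[of n] L1 by auto
    next
      case 2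
      then have n1: "0 < n" using less.prems by simp
      have "red (c (n - 0 - 1)) (?d 0)" "\<not> red (c (n - 0)) (?d 0)"
        using red[of "n - 1"] irr[of n] n1 c(3) by (auto simp: numeral_2_eq_2)
      from step[OF n1 this] show ?thesis using 2 n1 by (auto simp: numeral_2_eq_2)
    next
      case 3
      have j: "j < n" using 3 less.prems by simp
      have IH: "c (n + 1 - j) \<le> ?d j" "?d j < c (n + 2 - j)" using less.IH[of j] 3 less.prems by auto
      have "n - j - 1 + 2 = n + 1 - j" using j by simp
      then have "red (c (n - j - 1)) (c (n + 1 - j))" using red[of "n - j - 1"] j by simp
      then have 1: "red (c (n - j - 1)) (?d j)" by (rule mono[OF _ le_refl IH(1)])
      have "\<not> red (c (n - j)) (c (n + 2 - j) - 1)" using min[of "n - j"] j 3 by (simp add: Suc_diff_le)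
      moreover have "?d j \<le> c (n + 2 - j) - 1" by (rule le_pred[OF IH(2)])
      ultimately have 2: "\<not> red (c (n - j)) (?d j)" using mono le_refl by blast
      from step[OF j 1 2] show ?thesis using 3 by (simp add: numeral_2_eq_2)
    qed
  qed
  \<comment> \<open>These are the premises of \<open>step\<close> for every \<open>k\<close>. At 0
    the interleaving bounds say nothing, and the irreducibility of the last left factor replaces
    them.\<close>
  have bounds: "red (c (n - k - 1)) (?d k) \<and> \<not> red (c (n - k)) (?d k)" if k: "k < n" for k
  proof (cases "k = 0")
    case True
    then show ?thesis using red[of "n - 1"] irr[of n] k c(3) by (auto simp: numeral_2_eq_2)
  next
    case False
    have "c (n + 1 - k) \<le> ?d k" "?d k < c (n + 2 - k)" using inter[of k] False k by auto
    moreover have "n - k - 1 + 2 = n + 1 - k" using k by simp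
    then have "red (c (n - k - 1)) (c (n + 1 - k))" using red[of "n - k - 1"] k by simp
    moreover have "\<not> red (c (n - k)) (c (n + 2 - k) - 1)" using min[of "n - k"] k False by (simp add: Suc_diff_le)
    ultimately show ?thesis using mono le_refl le_pred by metis
  qed
  have irr': "\<not> red (?d (k + 1)) (?d k)" if k: "1 \<le> k" "k \<le> n" for k
  proof -
    have "c (n - k) \<le> ?d (k + 1)" using inter[of "k + 1"] k by simp
    moreover have "?d k < c (n + 2 - k)" using inter[of k] k by simp
    moreover have "\<not> red (c (n - k)) (c (n + 2 - k) - 1)" using min[of "n - k"] k by (simp add: Suc_diff_le)
    ultimately show ?thesis using mono le_pred by metis
  qed
  have dec: "?d (k + 1) < ?d k" if "k \<le> n" for k
  proof (cases "k = 0")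
    case True
    then show ?thesis using L1 by simp
  next
    case False
    have "?d (k + 1) < c (n + 1 - k)" using inter[of "k + 1"] that by simp
    also have "\<dots> \<le> ?d k" using inter[of k] that False by simp
    finally show ?thesis .
  qed
  have "?d (n + 1) = 0" using inter[of "n + 1"] c by simp
  moreover have "\<forall>k<n. red (?d (k + 2)) (?d k) \<and> \<not> red (?d (k + 2) + 1) (?d k)"
    using step bounds by blast
  ultimately show ?thesis using irr' dec by (intro exI[of _ ?d]) auto
qed

section \<open>Passing between left and right factorizations of a word\<close>

definition subword :: "'e list \<Rightarrow> nat \<Rightarrow> nat \<Rightarrow> 'e list" where
  "subword w i j = take (j - i) (drop i w)"

lemma subword_append: "i \<le> j \<Longrightarrow> j \<le> k \<Longrightarrow> subword w i j @ subword w j k = subword w i k"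
proof -
  assume "i \<le> j" "j \<le> k"
  then have "take (k - i) (drop i w) = take (j - i) (drop i w) @ take (k - j) (drop (j - i) (drop i w))"
    by (metis take_add add.commute le_add_diff_inverse2 Nat.add_diff_assoc2)
  then show ?thesis using \<open>i \<le> j\<close> by (simp add: subword_def)
qed

text \<open>The cut points of \<open>us\<close> satisfy the hypotheses of
  \<open>greedy_cuts_interleave\<close> when \<open>red i j\<close> means that the letters between
  positions \<open>i\<close> and \<open>j\<close> form a reducible word. The cut points
  \<open>d\<close> found there delimit the right factorization, with equally many factors.\<close>

lemma lfac_imp_rfac:
  assumes S: "\<And>s. s \<in> S \<Longrightarrow> 2 \<le> length s" and us: "lfac S us"
  shows "\<exists>vs. rfac S vs \<and> length vs = length us \<and> concat (rev vs) = concat us"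
proof -
  define w where "w = concat us"
  define n where "n = length us - 1"
  have lu: "length us = n + 1" using us by (cases us) (auto simp: lfac_def n_def)
  define c where "c k = length (concat (take k us))" for k
  define L where "L = length w"
  have split: "w = concat (take k us) @ us ! k @ concat (drop (k + 1) us)" if "k \<le> n" for k
    using that lu unfolding w_def
    by (metis Cons_nth_drop_Suc Suc_eq_plus1 append_take_drop_id concat.simps(2) concat_append le_imp_less_Suc)
  have cS: "c (k + 1) = c k + length (us ! k)" if "k \<le> n" for k
    using that lu by (simp add: c_def take_Suc_conv_app_nth)
  have s1: "subword w (c k) (c (k + 1)) = us ! k" if "k \<le> n" for k
    unfolding subword_def using split[OF that] cS[OF that] by (simp add: c_def)
  have s2: "subword w (c k) (c (k + 2)) = us ! k @ us ! (k + 1)" if "k < n" for k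
    using s1[of k] s1[of "k + 1"] cS[of k] cS[of "k + 1"] that
      subword_append[of "c k" "c (k + 1)" "c (k + 2)" w] by (simp add: numeral_2_eq_2)
  have pos: "0 < length (us ! k)" if "k \<le> n" for k
    using lfac_nonempty[OF us S] that lu by auto
  have s3: "subword w (c k) (c (k + 2) - 1) = us ! k @ butlast (us ! (k + 1))" if "k < n" for k
  proof -
    have "butlast (subword w (c k) (c (k + 2))) = us ! k @ butlast (us ! (k + 1))"
      unfolding s2[OF that] using pos[of "k + 1"] that by (simp add: butlast_append)
    moreover have "c (k + 2) \<le> L"
    proof -
      have "c (k + 2) = length (concat (take (k + 2) us))" by (simp add: c_def)
      also have "\<dots> \<le> length (concat (take (k + 2) us) @ concat (drop (k + 2) us))" by simp
      also have "\<dots> = L" unfolding L_def w_def by (metis append_take_drop_id concat_append)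
      finally show ?thesis .
    qed
    then have "butlast (subword w (c k) (c (k + 2))) = subword w (c k) (c (k + 2) - 1)"
      unfolding subword_def L_def by (subst butlast_take) auto
    ultimately show ?thesis by simp
  qed
  let ?red = "\<lambda>i j. wred S (subword w i j)"
  have mono: "?red i' j'" if "?red i j" "i' \<le> i" "j \<le> j'" for i j i' j'
  proof (cases "i \<le> j")
    case True
    then have "subword w i' j' = subword w i' i @ subword w i j @ subword w j j'"
      using that by (simp add: subword_append)
    then show ?thesis using wred_append that(1) by metis
  next
    case False
    \<comment> \<open>An inverted interval yields the empty word; were it reducible, every word
      would be, so monotonicity holds in this case as well.\<close>
    then have "wred S []" using that(1) by (simp add: subword_def)
    then show ?thesis using wred_appendL[of S "[]"] by simp
  qed
  have c0: "c 0 = 0" by (simp add: c_def)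
  have c1: "c 1 = 1" using cS[of 0] us c0 by (simp add: lfac_def)
  have cn: "c (n + 1) = L" using lu by (simp add: c_def L_def w_def)
  have cinc: "c k < c (k + 1)" if "k \<le> n" for k using cS[OF that] pos[OF that] by simp
  have cred: "?red (c k) (c (k + 2))" and cmin: "\<not> ?red (c k) (c (k + 2) - 1)" if "k < n" for k
    using us lu that unfolding s2[OF that] s3[OF that] by (auto simp: lfac_def)
  have cirr: "\<not> ?red (c k) (c (k + 1))" if "1 \<le> k" "k \<le> n" for k
    unfolding s1[OF that(2)] using lfac_not_wred[OF us S, of k] that lu by simp
  have "\<exists>d. d 0 = L \<and> d 1 = L - 1 \<and> d (n + 1) = 0 \<and> (\<forall>k\<le>n. d (k + 1) < d k) \<and>
    (\<forall>k<n. ?red (d (k + 2)) (d k) \<and> \<not> ?red (d (k + 2) + 1) (d k)) \<and>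
    (\<forall>k. 1 \<le> k \<and> k \<le> n \<longrightarrow> \<not> ?red (d (k + 1)) (d k))"
    by (rule greedy_cuts_interleave[where red = ?red and c = c])
      (fact mono c0 c1 cn cinc cred cmin cirr)+
  then obtain d where d: "d 0 = L" "d 1 = L - 1" "d (n + 1) = 0" "\<forall>k\<le>n. d (k + 1) < d k"
    "\<forall>k<n. ?red (d (k + 2)) (d k) \<and> \<not> ?red (d (k + 2) + 1) (d k)"
    "\<forall>k. 1 \<le> k \<and> k \<le> n \<longrightarrow> \<not> ?red (d (k + 1)) (d k)"
    by blast
  define vs where "vs = map (\<lambda>k. subword w (d (k + 1)) (d k)) [0..<n + 1]"
  have lv: "length vs = n + 1" by (simp add: vs_def)
  have v: "vs ! k = subword w (d (k + 1)) (d k)" if "k \<le> n" for k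
    using that unfolding vs_def by (metis (no_types, lifting) add.left_neutral diff_zero le_imp_less_Suc length_upt nth_map nth_upt Suc_eq_plus1)
  have dL: "d k \<le> L" if "k \<le> n + 1" for k using that
  proof (induction k)
    case (Suc k)
    then have "d (k + 1) < d k" using d(4) by simp
    then show ?case using Suc by simp
  qed (simp add: d(1))
  have "rfac S vs"
    unfolding rfac_def
  proof (intro conjI allI impI)
    show "vs \<noteq> []" using lv by auto
    have "d 1 < d 0" using d(4) by (metis Suc_eq_plus1 le0 One_nat_def)
    then show "length (vs ! 0) = 1" using v[of 0] d(1,2) by (simp add: subword_def L_def)
    fix i assume "Suc i < length vs"
    then have i: "i < n" using lv by simp
    have t: "tl (vs ! Suc i) = subword w (d (i + 2) + 1) (d (i + 1))"
      unfolding v[OF Suc_leI[OF i]] subword_def tl_take by (simp add: tl_drop drop_Suc)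
    have lt: "d (i + 2) < d (i + 1)" "d (i + 1) < d i"
      using d(4) i by (metis Suc_eq_plus1 Suc_leI add_2_eq_Suc', simp)
    show "\<not> wred S (vs ! Suc i)" using d(6) i v[of "Suc i"] by simp
    have e1: "vs ! Suc i @ vs ! i = subword w (d (i + 2)) (d i)"
      using v[of "Suc i"] v[of i] i lt subword_append[of "d (i + 2)" "d (i + 1)" "d i" w] by simp
    show "wred S (vs ! Suc i @ vs ! i)" unfolding e1 using d(5) i by simp
    have e2: "tl (vs ! Suc i) @ vs ! i = subword w (d (i + 2) + 1) (d i)"
      unfolding t using v[of i] i lt subword_append[of "d (i + 2) + 1" "d (i + 1)" "d i" w] by simp
    show "\<not> wred S (tl (vs ! Suc i) @ vs ! i)" unfolding e2 using d(5) i by simp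
  qed
  moreover have "concat (rev (take m vs)) = subword w (d m) L" if "m \<le> n + 1" for m
    using that
  proof (induction m)
    case 0
    then show ?case by (simp add: subword_def d(1))
  next
    case (Suc m)
    have "take (Suc m) vs = take m vs @ [vs ! m]" using Suc.prems lv by (simp add: take_Suc_conv_app_nth)
    then show ?case using Suc v[of m] d(4) dL[of m]
        subword_append[of "d (m + 1)" "d m" L w] by (simp add: less_imp_le)
  qed
  from this[of "n + 1"] have "concat (rev vs) = w" using lv d(3) by (simp add: subword_def L_def)
  ultimately show ?thesis using lv lu w_def by auto
qed

text \<open>The converse comes from the same construction applied to the reversed words.\<close>

lemma rfac_imp_lfac:
  assumes S: "\<And>s. s \<in> S \<Longrightarrow> 2 \<le> length s" and vs: "rfac S vs"
  shows "\<exists>us. lfac S us \<and> length us = length vs \<and> concat us = concat (rev vs)"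
proof -
  have "lfac (rev ` S) (map rev vs)" using vs by (simp add: rfac_iff_lfac_rev)
  moreover have "2 \<le> length s" if "s \<in> rev ` S" for s using S that by auto
  ultimately have "\<exists>us. rfac (rev ` S) us \<and> length us = length (map rev vs) \<and>
      concat (rev us) = concat (map rev vs)"
    by (intro lfac_imp_rfac) blast+
  then obtain us where us: "rfac (rev ` S) us" "length us = length vs"
    "concat (rev us) = concat (map rev vs)" by auto
  have "rfac (rev ` S) (map rev (map rev us))" using us(1) by (simp add: comp_def)
  then have "lfac S (map rev us)" unfolding lfac_iff_rfac_rev .
  moreover have "concat (map rev us) = rev (concat (rev us))" by (simp add: rev_concat rev_map)
  then have "concat (map rev us) = concat (rev vs)" unfolding us(3) by (simp add: rev_concat rev_map comp_def)
  ultimately show ?thesis using us(2) by (intro exI[of _ "map rev us"]) simp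
qed

lemma keys_lin_ext_inj:
  assumes "inj_on g (keys x)"
  shows "keys (lin_ext (\<lambda>p. bas (g p)) x) = g ` keys x"
    and "p \<in> keys x \<Longrightarrow>
      lookup (lin_ext (\<lambda>p. bas (g p)) x) (g p) = lookup x p"
proof -
  show *: "lookup (lin_ext (\<lambda>p. bas (g p)) x) (g p) = lookup x p"
    if p: "p \<in> keys x" for p
  proof -
    have "lookup (lin_ext (\<lambda>p. bas (g p)) x) (g p)
        = (\<Sum>q\<in>keys x. if q = p then lookup x q else 0)"
      unfolding lookup_lin_ext using assms p by (intro sum.cong) (auto simp: lookup_bas inj_on_def)
    then show ?thesis using p by simp
  qed
  show "keys (lin_ext (\<lambda>p. bas (g p)) x) = g ` keys x"
    using keys_lin_ext[of "\<lambda>p. bas (g p)" x] * by (auto simp: in_keys_iff)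
qed

lemma klin_kq_mult_left [intro]: "klin (\<lambda>x. kq_mult x y)"
  unfolding kq_mult_def by simp

lemma klin_kq_mult_right [intro]: "klin (\<lambda>y. kq_mult x y)"
  unfolding kq_mult_def by (rule klin_lin_ext_fun) simp

lemma kq_mult_bas [simp]: "kq_mult (bas p) (bas q) = (if composable p q then bas (pcomp p q) else 0)"
  by (simp add: kq_mult_def)

section \<open>Paths and reducibility\<close>

lemma pcomp_simps [simp]:
  "psrc (pcomp p q) = psrc p" "ptgt (pcomp p q) = ptgt q" "parr (pcomp p q) = parr p @ parr q"
  by (simp_all add: pcomp_def psrc_def ptgt_def parr_def)

lemma path_tuple_simps [simp]: "psrc (u, es, v) = u" "parr (u, es, v) = es" "ptgt (u, es, v) = v"
  by (simp_all add: psrc_def ptgt_def parr_def)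

lemma path_eqI: "psrc p = psrc q \<Longrightarrow> parr p = parr q \<Longrightarrow> ptgt p = ptgt q \<Longrightarrow> p = q"
  by (cases p; cases q) simp

lemma pcomp_assoc: "pcomp (pcomp p q) r = pcomp p (pcomp q r)"
  by (rule path_eqI) simp_all

lemma composable_pcomp [simp]:
  "composable (pcomp p q) r \<longleftrightarrow> composable q r" "composable r (pcomp p q) \<longleftrightarrow> composable r p"
  by (simp_all add: composable_def)

lemma pprod_simps:
  assumes "us \<noteq> []"
  shows "parr (pprod us) = concat (map parr us)" "psrc (pprod us) = psrc (hd us)"
    "ptgt (pprod us) = ptgt (last us)"
proof -
  have "parr (pprod us) = concat (map parr us) \<and> psrc (pprod us) = psrc (hd us)
      \<and> ptgt (pprod us) = ptgt (last us)"
    using assms by (induction us rule: pprod.induct) auto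
  then show "parr (pprod us) = concat (map parr us)" "psrc (pprod us) = psrc (hd us)"
    "ptgt (pprod us) = ptgt (last us)" by auto
qed

text \<open>Paths are triples, but quantified paths should not be split into their components.\<close>

declare split_paired_All [simp del] split_paired_Ex [simp del]

locale quiver_redsys = wf_digraph Q for Q :: "('v, 'e) pre_digraph" +
  fixes R :: "('v, 'e, 'k::field) redsys"
  assumes fin_verts: "finite (verts Q)"
    and redsys: "reduction_system Q R"
    and length_S: "fst ` R \<subseteq> (\<Union>i\<in>{2..}. qpaths_of_length Q i)"
begin

abbreviation "PQ \<equiv> qpaths Q"
abbreviation "B \<equiv> irred_paths Q R"
definition "SW = parr ` fst ` R"

lemma qpath_iff: "p \<in> PQ \<longleftrightarrow> awalk (psrc p) (parr p) (ptgt p)"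
  by (cases p) (simp add: qpaths_def)

lemma pcomp_qpath: "p \<in> PQ \<Longrightarrow> q \<in> PQ \<Longrightarrow> composable p q \<Longrightarrow> pcomp p q \<in> PQ"
  unfolding qpath_iff by (simp add: composable_def awalk_appendI del: awalk_append_iff)

lemma split_qpath:
  assumes "p \<in> PQ" "parr p = x @ y"
  obtains a b where "a \<in> PQ" "b \<in> PQ" "composable a b" "p = pcomp a b" "parr a = x" "parr b = y"
proof -
  let ?m = "awlast (psrc p) x"
  have "awalk (psrc p) x ?m" "awalk ?m y (ptgt p)" using assms by (simp_all add: qpath_iff)
  then show ?thesis
    using assms(2) by (intro that[of "(psrc p, x, ?m)" "(?m, y, ptgt p)"])
      (auto simp: qpath_iff composable_def intro: path_eqI)
qed

lemma qpath_eqI_src: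
  assumes "p \<in> PQ" "q \<in> PQ" "psrc p = psrc q" "parr p = parr q"
  shows "p = q"
proof -
  have "ptgt p = ptgt q"
    using assms unfolding qpath_iff by (metis awalkE awlast_if_cas)
  then show ?thesis using assms by (intro path_eqI)
qed

lemma qpath_src_tgt:
  assumes "p \<in> PQ" "parr p \<noteq> []"
  shows "psrc p = tail Q (hd (parr p))" "ptgt p = head Q (last (parr p))"
proof -
  have w: "awalk (psrc p) (parr p) (ptgt p)" using assms by (simp add: qpath_iff)
  show "psrc p = tail Q (hd (parr p))" using w assms(2) by (cases "parr p") (auto simp: awalk_def)
  have "ptgt p = awlast (psrc p) (parr p)" using w by (metis awalkE awlast_if_cas)
  then show "ptgt p = head Q (last (parr p))" using assms(2) by (simp add: awalk_verts_conv)
qed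

text \<open>The arrows of a nonempty word fix both ends, so nontrivial paths can be handled as
  words. On the empty word \<open>hd\<close> and \<open>last\<close> are unspecified, hence the
  nonemptiness conditions wherever paths are rebuilt with this function.\<close>

definition "mkp es = (tail Q (hd es), es, head Q (last es))"

lemma parr_mkp [simp]: "parr (mkp es) = es" by (simp add: mkp_def)

lemma qpath_eq_mkp: "p \<in> PQ \<Longrightarrow> parr p \<noteq> [] \<Longrightarrow> p = mkp (parr p)"
  by (intro path_eqI) (auto simp: mkp_def qpath_src_tgt)

lemma qpath_eqI:
  assumes "p \<in> PQ" "q \<in> PQ" "parr p = parr q" "parr p \<noteq> []"
  shows "p = q"
  using assms qpath_eq_mkp by metis

lemma triv_qpath: "p \<in> PQ \<Longrightarrow> parr p = [] \<Longrightarrow> psrc p = ptgt p \<and> psrc p \<in> verts Q"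
  by (auto simp: qpath_iff awalk_Nil_iff)

lemma triv_in: "v \<in> verts Q \<Longrightarrow> (v, [], v) \<in> PQ"
  by (simp add: qpath_iff awalk_Nil_iff)

lemma qpath_verts: "p \<in> PQ \<Longrightarrow> psrc p \<in> verts Q \<and> ptgt p \<in> verts Q"
  unfolding qpath_iff by (auto simp: awalk_last_in_verts awalk_def)

lemma triv_src: "p \<in> PQ \<Longrightarrow> (psrc p, [], psrc p) \<in> PQ"
  and triv_tgt: "p \<in> PQ \<Longrightarrow> (ptgt p, [], ptgt p) \<in> PQ"
  using qpath_verts[of p] triv_in by blast+

lemma pcomp_triv:
  "composable p q \<Longrightarrow> q \<in> PQ \<Longrightarrow> parr q = [] \<Longrightarrow> pcomp p q = p"
  "composable q p \<Longrightarrow> q \<in> PQ \<Longrightarrow> parr q = [] \<Longrightarrow> pcomp q p = p"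
  by (auto intro!: path_eqI simp: composable_def dest: triv_qpath)

lemma redsysD:
  assumes "(s, f) \<in> R"
  shows "s \<in> PQ" "f \<in> kspace PQ" "f \<noteq> bas s" "2 \<le> length (parr s)"
    and "\<And>p. p \<in> keys f \<Longrightarrow> p \<in> PQ \<and> psrc p = psrc s \<and> ptgt p = ptgt s"
proof -
  have *: "s \<in> PQ \<and> f \<in> kspace PQ \<and>
      (\<forall>p \<in> keys f. psrc p = psrc s \<and> ptgt p = ptgt s) \<and> f \<noteq> bas s"
    using redsys assms unfolding reduction_system_def path_algebra_def by fastforce
  then show "s \<in> PQ" "f \<in> kspace PQ" "f \<noteq> bas s" by blast+
  show "p \<in> PQ \<and> psrc p = psrc s \<and> ptgt p = ptgt s" if "p \<in> keys f" for p
    using * that unfolding kspace_def by blast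
  have "s \<in> fst ` R" using assms by (metis fst_conv imageI)
  then have "s \<in> (\<Union>i\<in>{2..}. qpaths_of_length Q i)" using length_S by blast
  then show "2 \<le> length (parr s)" by (auto simp: qpaths_of_length_def)
qed

lemma redsys_antichain:
  assumes "(s, f) \<in> R" "(s', f') \<in> R" "a \<in> PQ" "c \<in> PQ" "composable a s" "composable s c"
    "s' = pcomp a (pcomp s c)"
  shows "s = s' \<and> f = f'"
proof -
  have "path_divides Q s s'" unfolding path_divides_def using assms(3-7) by blast
  moreover have *: "\<forall>(s, f) \<in> R. \<forall>(s', f') \<in> R. (s, f) \<noteq> (s', f') \<longrightarrow> \<not> path_divides Q s s'"
    using redsys unfolding reduction_system_def by (rule conjunct2)
  have "(s, f) \<noteq> (s', f') \<longrightarrow> \<not> path_divides Q s s'"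
    using bspec[OF case_prodD[OF bspec[OF * assms(1)]] assms(2)] by (rule case_prodD)
  ultimately show ?thesis by blast
qed

lemma redsys_unique: "(s, f) \<in> R \<Longrightarrow> (s, f') \<in> R \<Longrightarrow> f = f'"
proof -
  assume a: "(s, f) \<in> R" "(s, f') \<in> R"
  let ?a = "(psrc s, [], psrc s)" and ?c = "(ptgt s, [], ptgt s)"
  have v: "psrc s \<in> verts Q" "ptgt s \<in> verts Q" using redsysD(1)[OF a(1)] qpath_verts by auto
  then have "?a \<in> PQ" "?c \<in> PQ" by (auto intro: triv_in)
  moreover have "s = pcomp ?a (pcomp s ?c)" by (rule path_eqI) simp_all
  ultimately show "f = f'" using redsys_antichain[OF a, of ?a ?c] by (simp add: composable_def)
qed

lemma SW_length: "s \<in> SW \<Longrightarrow> 2 \<le> length s"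
  using redsysD(4) by (auto simp: SW_def)

definition is_asc :: "('v, 'e) qpath \<Rightarrow> ('v, 'e) qpath \<Rightarrow> ('v, 'e, 'k) kq \<Rightarrow> ('v, 'e) qpath \<Rightarrow> bool" where
  "is_asc a s f c \<longleftrightarrow> (s, f) \<in> R \<and> a \<in> PQ \<and> c \<in> PQ \<and> composable a s \<and> composable s c"

text \<open>An occurrence of the word of \<open>s\<close> inside the word of \<open>p\<close> is an
  occurrence of the path \<open>s\<close>: it has at least two arrows, so its ends are
  forced.\<close>

lemma wred_iff: "p \<in> PQ \<Longrightarrow> wred SW (parr p) \<longleftrightarrow> (\<exists>a s f c. is_asc a s f c \<and> p = pcomp a (pcomp s c))"
proof
  assume p: "p \<in> PQ" "wred SW (parr p)"
  then obtain s f x y where s: "(s, f) \<in> R" "parr p = x @ parr s @ y"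
    by (auto simp: wred_def SW_def)
  obtain a b where ab: "a \<in> PQ" "b \<in> PQ" "composable a b" "p = pcomp a b" "parr b = parr s @ y"
    using split_qpath[OF p(1) s(2)] by metis
  obtain m c where mc: "m \<in> PQ" "c \<in> PQ" "composable m c" "b = pcomp m c" "parr m = parr s"
    using split_qpath[OF ab(2,5)] by metis
  have "m = s" using redsysD(1,4)[OF s(1)] mc by (intro qpath_eqI) auto
  then show "\<exists>a s f c. is_asc a s f c \<and> p = pcomp a (pcomp s c)"
    using s ab mc unfolding is_asc_def by (metis composable_pcomp(2))
next
  assume "p \<in> PQ" "\<exists>a s f c. is_asc a s f c \<and> p = pcomp a (pcomp s c)"
  then show "wred SW (parr p)" unfolding wred_def SW_def is_asc_def by force
qed

lemma is_asc_path: "is_asc a s f c \<Longrightarrow> pcomp a (pcomp s c) \<in> PQ"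
  unfolding is_asc_def by (auto intro!: pcomp_qpath dest: redsysD(1))

text \<open>Since \<open>f\<close> is parallel to \<open>s\<close>, the product of \<open>a\<close>,
  \<open>c\<close> and any path in the support of \<open>f\<close> is nonzero.\<close>

lemma sandwich_eq:
  assumes "is_asc a s f c"
  shows "kq_mult (bas a) (kq_mult f (bas c)) = lin_ext (\<lambda>q. bas (pcomp a (pcomp q c))) f"
proof (rule klin_eqI[where F = "\<lambda>f. kq_mult (bas a) (kq_mult f (bas c))"])
  show "klin (\<lambda>f. kq_mult (bas a) (kq_mult f (bas c)))"
    by (rule klin_compose[OF klin_kq_mult_right klin_kq_mult_left])
  fix q assume "q \<in> keys f"
  then have "psrc q = psrc s" "ptgt q = ptgt s" using assms redsysD(5) unfolding is_asc_def by blast+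
  then show "kq_mult (bas a) (kq_mult (bas q) (bas c)) = lin_ext (\<lambda>q. bas (pcomp a (pcomp q c))) (bas q)"
    using assms by (simp add: is_asc_def composable_def)
qed simp

lemma sandwich_inj:
  assumes "is_asc a s f c"
  shows "inj_on (\<lambda>q. pcomp a (pcomp q c)) (insert s (keys f))"
proof (rule inj_onI)
  fix p q assume pq: "p \<in> insert s (keys f)" "q \<in> insert s (keys f)"
    "pcomp a (pcomp p c) = pcomp a (pcomp q c)"
  have "parr p = parr q" using arg_cong[OF pq(3), of parr] by simp
  moreover have "psrc q = psrc s \<and> ptgt q = ptgt s" if "q \<in> insert s (keys f)" for q
    using that redsysD(5)[of s f] assms unfolding is_asc_def by blast
  from this[OF pq(1)] this[OF pq(2)] have "psrc p = psrc q \<and> ptgt p = ptgt q" by simp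
  ultimately show "p = q" by (intro path_eqI) auto
qed

lemma keys_sandwich:
  assumes "is_asc a s f c"
  shows "keys (kq_mult (bas a) (kq_mult f (bas c)))
    = (\<lambda>q. pcomp a (pcomp q c)) ` keys f"
  unfolding sandwich_eq[OF assms]
  by (rule keys_lin_ext_inj(1)) (rule inj_on_subset[OF sandwich_inj[OF assms]], blast)

text \<open>If \<open>a f c\<close> were the path \<open>a s c\<close>, the injectivity of
  multiplication by \<open>a\<close> and \<open>c\<close> would make \<open>f\<close> equal to
  \<open>s\<close>, which a reduction system forbids. So every basic reduction really moves the path
  it acts on.\<close>

lemma sandwich_neq:
  assumes "is_asc a s f c"
  shows "kq_mult (bas a) (kq_mult f (bas c)) \<noteq> bas (pcomp a (pcomp s c))"
proof
  assume h: "kq_mult (bas a) (kq_mult f (bas c)) = bas (pcomp a (pcomp s c))"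
  let ?g = "\<lambda>q. pcomp a (pcomp q c)"
  have inj: "inj_on ?g (insert s (keys f))" by (rule sandwich_inj[OF assms])
  then have inj': "inj_on ?g (keys f)" by (rule inj_on_subset) blast
  have "?g ` keys f = {?g s}" using h keys_sandwich[OF assms] by simp
  then have k: "keys f = {s}"
    using inj by (smt (verit) image_empty image_insert inj_on_image_eq_iff insert_iff singletonD subsetI subset_insertI)
  then have "lookup f s = 1"
    using keys_lin_ext_inj(2)[OF inj', of s] h sandwich_eq[OF assms] by (simp add: lookup_bas)
  then have "f = bas s" using k by (intro poly_mapping_eqI) (auto simp: lookup_bas in_keys_iff)
  then show False using redsysD(3) assms unfolding is_asc_def by blast
qed

lemma basic_reductions_iff:
  "r \<in> basic_reductions Q R \<longleftrightarrow> (\<exists>a s f c. is_asc a s f c \<and> r = basic_reduction a s f c)"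
  unfolding basic_reductions_def is_asc_def mem_Collect_eq by blast

lemma basic_reductionI: "is_asc a s f c \<Longrightarrow> basic_reduction a s f c \<in> basic_reductions Q R"
  unfolding basic_reductions_iff by blast

lemma klin_basic_reduction [simp, intro]: "klin (basic_reduction a s f c)"
  by (simp add: basic_reduction_def)

lemma basic_reduction_bas:
  "basic_reduction a s f c (bas q) =
    (if q = pcomp a (pcomp s c) then kq_mult (bas a) (kq_mult f (bas c)) else bas q)"
  by (simp add: basic_reduction_def)

lemma basic_reduction_eq:
  "basic_reduction a s f c x = x + pscale (lookup x (pcomp a (pcomp s c)))
     (kq_mult (bas a) (kq_mult f (bas c)) - bas (pcomp a (pcomp s c)))"
proof -
  let ?G = "\<lambda>x. x + pscale (lookup x (pcomp a (pcomp s c)))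
     (kq_mult (bas a) (kq_mult f (bas c)) - bas (pcomp a (pcomp s c)))"
  have "klin ?G" by (rule klinI) (simp_all add: lookup_add pscale_add_left pscale_add_right)
  then show ?thesis
    by (rule klin_eqI[OF klin_basic_reduction]) (auto simp: basic_reduction_bas lookup_bas)
qed

text \<open>A basic reduction adds a multiple of one nonzero vector, and the multiple is the
  coefficient of the path being reduced. So a reducible path in the support cannot be hidden by
  cancellation.\<close>

lemma irred_iff:
  assumes "x \<in> kspace PQ"
  shows "irred Q R x \<longleftrightarrow> (\<forall>p\<in>keys x. \<not> wred SW (parr p))"
proof
  assume irr: "irred Q R x"
  show "\<forall>p\<in>keys x. \<not> wred SW (parr p)"
  proof (intro ballI notI)
    fix p assume p: "p \<in> keys x" "wred SW (parr p)"
    have "p \<in> PQ" using p(1) assms unfolding kspace_def by blast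
    then obtain a s f c where asc: "is_asc a s f c" "p = pcomp a (pcomp s c)"
      using wred_iff p(2) by blast
    have "basic_reduction a s f c x = x"
      by (rule bspec[OF irr[unfolded irred_def] basic_reductionI[OF asc(1)]])
    then have "kq_mult (bas a) (kq_mult f (bas c)) = bas p"
      using p(1) unfolding basic_reduction_eq asc(2)[symmetric] by (simp add: in_keys_iff)
    then show False using sandwich_neq[OF asc(1)] asc(2) by simp
  qed
next
  assume h: "\<forall>p\<in>keys x. \<not> wred SW (parr p)"
  show "irred Q R x"
    unfolding irred_def basic_reductions_iff
  proof (intro ballI, unfold basic_reductions_iff, elim exE conjE)
    fix r a s f c assume asc: "is_asc a s f c" and r: "r = basic_reduction a s f c"
    from asc have "wred SW (parr (pcomp a (pcomp s c)))" using wred_iff[OF is_asc_path] by blast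
    then have "lookup x (pcomp a (pcomp s c)) = 0" using h by (metis in_keys_iff)
    then show "r x = x" by (simp add: basic_reduction_eq r)
  qed
qed

lemma irred_path_iff: "p \<in> PQ \<Longrightarrow> irred_path Q R p \<longleftrightarrow> \<not> wred SW (parr p)"
  by (subst irred_iff) auto

lemma B_iff: "p \<in> B \<longleftrightarrow> p \<in> PQ \<and> \<not> wred SW (parr p)"
  by (auto simp: irred_paths_def irred_path_iff)

lemma not_wred_short: "length w < 2 \<Longrightarrow> \<not> wred SW w"
  using SW_length by (fastforce simp: wred_def)

lemma B_right: "pcomp p q \<in> B \<Longrightarrow> q \<in> PQ \<Longrightarrow> q \<in> B"
  by (auto simp: B_iff dest: wred_appendL)

section \<open>Ambiguities as words\<close>

text \<open>Cuts a path at prescribed words. Nonempty pieces are recovered from their arrows alone,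
  which is why word factorizations lift uniquely to paths.\<close>

lemma split_qpath_list:
  assumes "p \<in> PQ" "concat ws = parr p" "\<forall>w\<in>set ws. w \<noteq> []" "ws \<noteq> []"
  shows "set (map mkp ws) \<subseteq> PQ \<and> successively composable (map mkp ws) \<and> pprod (map mkp ws) = p"
  using assms
proof (induction ws arbitrary: p rule: induct_list012)
  case (2 w)
  then show ?case using qpath_eq_mkp[of p] by simp
next
  case (3 w w' ws)
  obtain a b where ab: "a \<in> PQ" "b \<in> PQ" "composable a b" "p = pcomp a b" "parr a = w"
    "parr b = concat (w' # ws)"
    using split_qpath[of p w "concat (w' # ws)"] 3 by (metis concat.simps(2))
  have IH: "set (map mkp (w' # ws)) \<subseteq> PQ" "successively composable (map mkp (w' # ws))"
    "pprod (map mkp (w' # ws)) = b"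
    using "3.IH"(2)[of b] ab "3.prems" by auto
  have "a = mkp w" using ab "3.prems" qpath_eq_mkp[of a] by auto
  moreover have "composable a (mkp w')"
    using ab(3) pprod_simps(2)[of "map mkp (w' # ws)"] IH(3) by (simp add: composable_def)
  ultimately show ?case using IH ab by simp
qed simp

text \<open>The longest proper left divisor decides, as reducibility passes to longer words. For
  trivial \<open>v\<close> the right side degenerates to the irreducibility of \<open>u\<close>,
  which is assumed.\<close>

lemma left_divisor_iff:
  assumes "u \<in> PQ" "v \<in> PQ" "composable u v" "\<not> wred SW (parr u)"
  shows "(\<forall>d \<in> PQ. left_divisor Q d v \<and> d \<noteq> v \<longrightarrow> irred_path Q R (pcomp u d)) \<longleftrightarrow>
    \<not> wred SW (parr u @ butlast (parr v))" (is "?L \<longleftrightarrow> ?R")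
proof
  assume L: ?L
  show ?R
  proof (cases "parr v = []")
    case False
    obtain d b where d: "d \<in> PQ" "b \<in> PQ" "composable d b" "v = pcomp d b" "parr d = butlast (parr v)"
      "parr b = [last (parr v)]"
      using split_qpath[OF assms(2), of "butlast (parr v)" "[last (parr v)]"] False by (metis append_butlast_last_id)
    let ?a = "(psrc d, [], psrc d)"
    have a: "?a \<in> PQ" by (rule triv_src[OF d(1)])
    have "left_divisor Q d v"
      unfolding left_divisor_def qpaths_of_length_def
    proof (rule bexI[of _ ?a], rule bexI[of _ b], intro conjI)
      show "v = pcomp ?a (pcomp d b)" unfolding d(4) by (rule path_eqI) simp_all
      show "composable ?a d" by (simp add: composable_def)
    qed (use a d(1,2,3) in simp_all)
    moreover have "d \<noteq> v" using arg_cong[OF d(4), of parr] d(6) by auto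
    ultimately have "irred_path Q R (pcomp u d)" using L d(1) by blast
    moreover have "composable u d" using assms(3) d(4) by simp
    then have "pcomp u d \<in> PQ" using assms(1) d(1) by (intro pcomp_qpath)
    ultimately show ?thesis using d(5) by (simp add: irred_path_iff)
  qed (use assms(4) in simp)
next
  assume R: ?R
  show ?L
  proof (intro ballI impI)
    fix d assume d: "d \<in> PQ" "left_divisor Q d v \<and> d \<noteq> v"
    then obtain a b where ab: "a \<in> PQ" "parr a = []" "b \<in> PQ" "composable a d" "composable d b"
      "v = pcomp a (pcomp d b)" by (auto simp: left_divisor_def qpaths_of_length_def)
    then have v: "v = pcomp d b" using pcomp_triv(2)[of a "pcomp d b"] by simp
    have "parr b \<noteq> []" using d v pcomp_triv(1)[of d b] ab by auto
    then have "butlast (parr v) = parr d @ butlast (parr b)" using v by (simp add: butlast_append)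
    then have "\<not> wred SW (parr u @ parr d)" using R wred_appendR[of SW "parr u @ parr d" "butlast (parr b)"] by auto
    moreover have "pcomp u d \<in> PQ" using assms d v by (intro pcomp_qpath) auto
    ultimately show "irred_path Q R (pcomp u d)" by (simp add: irred_path_iff)
  qed
qed

lemma right_divisor_iff:
  assumes "u \<in> PQ" "v \<in> PQ" "composable v u" "\<not> wred SW (parr u)"
  shows "(\<forall>d \<in> PQ. right_divisor Q d v \<and> d \<noteq> v \<longrightarrow> irred_path Q R (pcomp d u)) \<longleftrightarrow>
    \<not> wred SW (tl (parr v) @ parr u)" (is "?L \<longleftrightarrow> ?R")
proof
  assume L: ?L
  show ?R
  proof (cases "parr v = []")
    case False
    obtain b d where d: "d \<in> PQ" "b \<in> PQ" "composable b d" "v = pcomp b d" "parr d = tl (parr v)"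
      "parr b = [hd (parr v)]"
      using split_qpath[OF assms(2), of "[hd (parr v)]" "tl (parr v)"] False by (metis append_Cons append_Nil list.collapse)
    let ?a = "(ptgt d, [], ptgt d)"
    have a: "?a \<in> PQ" by (rule triv_tgt[OF d(1)])
    have "right_divisor Q d v"
      unfolding right_divisor_def qpaths_of_length_def
    proof (rule bexI[of _ b], rule bexI[of _ ?a], intro conjI)
      show "v = pcomp b (pcomp d ?a)" unfolding d(4) by (rule path_eqI) simp_all
      show "composable d ?a" by (simp add: composable_def)
    qed (use a d(1,2,3) in simp_all)
    moreover have "d \<noteq> v" using arg_cong[OF d(4), of parr] d(6) by auto
    ultimately have "irred_path Q R (pcomp d u)" using L d(1) by blast
    moreover have "composable d u" using assms(3) d(4) by simp
    then have "pcomp d u \<in> PQ" using assms(1) d(1) by (intro pcomp_qpath)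
    ultimately show ?thesis using d(5) by (simp add: irred_path_iff)
  qed (use assms(4) in simp)
next
  assume R: ?R
  show ?L
  proof (intro ballI impI)
    fix d assume d: "d \<in> PQ" "right_divisor Q d v \<and> d \<noteq> v"
    then obtain a b where ab: "b \<in> PQ" "parr b = []" "a \<in> PQ" "composable a d" "composable d b"
      "v = pcomp a (pcomp d b)" by (auto simp: right_divisor_def qpaths_of_length_def)
    then have v: "v = pcomp a d" using pcomp_triv(1)[of d b] by simp
    have "parr a \<noteq> []" using d v pcomp_triv(2)[of a d] ab by auto
    then have "tl (parr v) = tl (parr a) @ parr d" using v by simp
    then have "\<not> wred SW (parr d @ parr u)" using R wred_appendL[of SW "parr d @ parr u" "tl (parr a)"] by auto
    moreover have "composable d u" using assms(3) v by simp
    then have "pcomp d u \<in> PQ" using assms d by (intro pcomp_qpath) auto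
    ultimately show "irred_path Q R (pcomp d u)" by (simp add: irred_path_iff)
  qed
qed

text \<open>A left factorization stored as words. It makes sense for \<open>n = 0\<close> and
  \<open>n = 1\<close> too, where \<open>ambig\<close> has clauses of its own, and so allows one
  treatment of all degrees from 0 on.\<close>

definition pfac :: "nat \<Rightarrow> ('v, 'e) qpath \<Rightarrow> 'e list list \<Rightarrow> bool" where
  "pfac n p ws \<longleftrightarrow> p \<in> PQ \<and> lfac SW ws \<and> length ws = Suc n \<and> concat ws = parr p"

lemma pfac_nonempty: "pfac n p ws \<Longrightarrow> w \<in> set ws \<Longrightarrow> w \<noteq> []"
  unfolding pfac_def using lfac_nonempty[OF _ SW_length] by (metis in_set_conv_nth)

text \<open>The second conjunct records that the factors are rebuilt from their words; through it,
  uniqueness on words becomes uniqueness on paths.\<close>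

lemma left_factorization_iff:
  "left_factorization Q R n p us \<longleftrightarrow> pfac n p (map parr us) \<and> us = map mkp (map parr us)"
proof
  assume h: "left_factorization Q R n p us"
  then have l: "length us = Suc n" and comp: "\<forall>i<n. composable (us ! i) (us ! Suc i)"
    and p: "p = pprod us" and u0: "us ! 0 \<in> PQ" "length (parr (us ! 0)) = 1"
    and uB: "\<forall>i\<in>{1..n}. us ! i \<in> B"
    by (auto simp: left_factorization_def qpaths_of_length_def)
  have PQ: "us ! i \<in> PQ \<and> \<not> wred SW (parr (us ! i))" if "i \<le> n" for i
  proof (cases "i = 0")
    case True
    then show ?thesis using u0 not_wred_short[of "parr (us ! 0)"] by simp
  next
    case False
    then have "us ! i \<in> B" using uB that by simp
    then show ?thesis unfolding B_iff .
  qed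
  have lf: "lfac SW (map parr us)"
    unfolding lfac_def
  proof (intro conjI allI impI)
    show "map parr us \<noteq> []" "length (map parr us ! 0) = 1" using l u0 by auto
    fix i assume "Suc i < length (map parr us)"
    then have i: "i < n" using l by simp
    have c: "pcomp (us ! i) (us ! Suc i) \<in> PQ" using PQ[of i] PQ[of "Suc i"] comp i by (intro pcomp_qpath) auto
    show "\<not> wred SW (map parr us ! Suc i)" using PQ[of "Suc i"] i l by simp
    show "wred SW (map parr us ! i @ map parr us ! Suc i)"
      using h irred_path_iff[OF c] i l unfolding left_factorization_def by simp
    show "\<not> wred SW (map parr us ! i @ butlast (map parr us ! Suc i))"
      using h left_divisor_iff[of "us ! i" "us ! Suc i"] PQ[of i] PQ[of "Suc i"] comp i l
      unfolding left_factorization_def by simp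
  qed
  have ne: "us \<noteq> []" using l by auto
  have sub: "set us \<subseteq> PQ" using PQ l by (metis in_set_conv_nth less_Suc_eq_le subsetI)
  have "p \<in> PQ"
  proof -
    have "pprod us \<in> PQ" if "us \<noteq> []" "set us \<subseteq> PQ" "successively composable us" for us
      using that
    proof (induction us rule: pprod.induct)
      case (3 u v us)
      then have "composable u (pprod (v # us))" by (simp add: composable_def pprod_simps(2))
      then show ?case using 3 by (simp add: pcomp_qpath)
    qed auto
    moreover have "successively composable us" using comp l by (simp add: successively_conv_nth)
    ultimately show ?thesis using p ne sub by blast
  qed
  moreover have "us = map mkp (map parr us)"
  proof (rule nth_equalityI)
    fix i assume i: "i < length us"
    have "parr (us ! i) \<noteq> []" using lfac_nonempty[OF lf SW_length, of i] i by simp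
    then show "us ! i = map mkp (map parr us) ! i" using qpath_eq_mkp[of "us ! i"] PQ[of i] i l by simp
  qed simp
  ultimately show "pfac n p (map parr us) \<and> us = map mkp (map parr us)"
    using lf l pprod_simps(1)[OF ne] p by (simp add: pfac_def)
next
  assume "pfac n p (map parr us) \<and> us = map mkp (map parr us)"
  then have p: "p \<in> PQ" and lf: "lfac SW (map parr us)" and l: "length us = Suc n"
    and cc: "concat (map parr us) = parr p" and us: "us = map mkp (map parr us)"
    and h: "pfac n p (map parr us)"
    unfolding pfac_def by simp_all
  have ne: "\<forall>w\<in>set (map parr us). w \<noteq> []" using pfac_nonempty[OF h] by blast
  have "map parr us \<noteq> []" using l by auto
  from split_qpath_list[OF p cc ne this, folded us]
  have sub: "set us \<subseteq> PQ" and succ: "successively composable us" and pp: "pprod us = p"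
    by blast+
  have PQ: "us ! i \<in> PQ" "\<not> wred SW (parr (us ! i))" if "i \<le> n" for i
    using sub that l lfac_not_wred[OF lf SW_length, of i] by (auto simp: subset_iff)
  have comp: "composable (us ! i) (us ! Suc i)" if "i < n" for i
    using succ that l by (simp add: successively_conv_nth)
  have wr: "wred SW (parr (us ! i) @ parr (us ! Suc i)) \<and> \<not> wred SW (parr (us ! i) @ butlast (parr (us ! Suc i)))"
    if "i < n" for i using lf l that by (simp add: lfac_def)
  show "left_factorization Q R n p us"
    unfolding left_factorization_def
  proof (intro conjI ballI allI impI)
    show "us ! 0 \<in> qpaths_of_length Q 1" using lf l PQ(1)[of 0] by (auto simp: lfac_def qpaths_of_length_def)
    fix i assume i: "i < n"
    have c: "pcomp (us ! i) (us ! Suc i) \<in> PQ" using PQ[of i] PQ[of "Suc i"] comp i by (intro pcomp_qpath) auto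
    show "\<not> irred_path Q R (pcomp (us ! i) (us ! Suc i))" using irred_path_iff[OF c] wr[OF i] by simp
    show "irred_path Q R (pcomp (us ! i) d)" if "d \<in> PQ" "left_divisor Q d (us ! Suc i) \<and> d \<noteq> us ! Suc i" for d
      using left_divisor_iff[of "us ! i" "us ! Suc i"] PQ[of i] PQ[of "Suc i"] comp i wr[OF i] that by simp
  qed (use l pp comp PQ in \<open>auto simp: B_iff\<close>)
qed

lemma right_factorization_iff:
  "right_factorization Q R n p vs \<longleftrightarrow> p \<in> PQ \<and> rfac SW (map parr vs) \<and> length vs = Suc n \<and>
     concat (rev (map parr vs)) = parr p \<and> vs = map mkp (map parr vs)"
proof
  assume h: "right_factorization Q R n p vs"
  then have l: "length vs = Suc n" and comp: "\<forall>i<n. composable (vs ! Suc i) (vs ! i)"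
    and p: "p = pprod (rev vs)" and u0: "vs ! 0 \<in> PQ" "length (parr (vs ! 0)) = 1"
    and uB: "\<forall>i\<in>{1..n}. vs ! i \<in> B"
    by (auto simp: right_factorization_def qpaths_of_length_def)
  have PQ: "vs ! i \<in> PQ \<and> \<not> wred SW (parr (vs ! i))" if "i \<le> n" for i
  proof (cases "i = 0")
    case True
    then show ?thesis using u0 not_wred_short[of "parr (vs ! 0)"] by simp
  next
    case False
    then have "vs ! i \<in> B" using uB that by simp
    then show ?thesis unfolding B_iff .
  qed
  have rf: "rfac SW (map parr vs)"
    unfolding rfac_def
  proof (intro conjI allI impI)
    show "map parr vs \<noteq> []" "length (map parr vs ! 0) = 1" using l u0 by auto
    fix i assume "Suc i < length (map parr vs)"
    then have i: "i < n" using l by simp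
    have c: "pcomp (vs ! Suc i) (vs ! i) \<in> PQ" using PQ[of i] PQ[of "Suc i"] comp i by (intro pcomp_qpath) auto
    show "\<not> wred SW (map parr vs ! Suc i)" using PQ[of "Suc i"] i l by simp
    show "wred SW (map parr vs ! Suc i @ map parr vs ! i)"
      using h irred_path_iff[OF c] i l unfolding right_factorization_def by simp
    show "\<not> wred SW (tl (map parr vs ! Suc i) @ map parr vs ! i)"
      using h right_divisor_iff[of "vs ! i" "vs ! Suc i"] PQ[of i] PQ[of "Suc i"] comp i l
      unfolding right_factorization_def by simp
  qed
  have ne: "rev vs \<noteq> []" using l by auto
  have sub: "set vs \<subseteq> PQ" using PQ l by (metis in_set_conv_nth less_Suc_eq_le subsetI)
  have "p \<in> PQ"
  proof -
    have "pprod us \<in> PQ" if "us \<noteq> []" "set us \<subseteq> PQ" "successively composable us" for us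
      using that
    proof (induction us rule: pprod.induct)
      case (3 u v us)
      then have "composable u (pprod (v # us))" by (simp add: composable_def pprod_simps(2))
      then show ?case using 3 by (simp add: pcomp_qpath)
    qed auto
    moreover have "successively composable (rev vs)"
      unfolding successively_rev using comp l by (simp add: successively_conv_nth)
    ultimately show ?thesis using p ne sub by (metis set_rev)
  qed
  moreover have "vs = map mkp (map parr vs)"
  proof (rule nth_equalityI)
    fix i assume i: "i < length vs"
    have "lfac (rev ` SW) (map rev (map parr vs))" using rf by (simp only: rfac_iff_lfac_rev)
    then have "map rev (map parr vs) ! i \<noteq> []" using i by (intro lfac_nonempty) (auto dest: SW_length)
    then have "parr (vs ! i) \<noteq> []" using i by simp
    then show "vs ! i = map mkp (map parr vs) ! i" using qpath_eq_mkp[of "vs ! i"] PQ[of i] i l by simp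
  qed simp
  ultimately show "p \<in> PQ \<and> rfac SW (map parr vs) \<and> length vs = Suc n \<and>
     concat (rev (map parr vs)) = parr p \<and> vs = map mkp (map parr vs)"
    using rf l pprod_simps(1)[OF ne] p by (simp add: rev_map)
next
  assume h: "p \<in> PQ \<and> rfac SW (map parr vs) \<and> length vs = Suc n \<and>
     concat (rev (map parr vs)) = parr p \<and> vs = map mkp (map parr vs)"
  then have p: "p \<in> PQ" and rf: "rfac SW (map parr vs)" and l: "length vs = Suc n"
    and cc: "concat (rev (map parr vs)) = parr p" and vs: "vs = map mkp (map parr vs)" by auto
  have lf: "lfac (rev ` SW) (map rev (map parr vs))" using rf by (simp only: rfac_iff_lfac_rev)
  have SWr: "\<And>s. s \<in> rev ` SW \<Longrightarrow> 2 \<le> length s" by (auto dest: SW_length)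
  have ne: "parr (vs ! i) \<noteq> []" "\<not> wred SW (parr (vs ! i))" if "i < length vs" for i
    using lfac_nonempty[OF lf SWr, of i] lfac_not_wred[OF lf SWr, of i] that by (auto simp: wred_rev)
  then have ne': "\<forall>w\<in>set (rev (map parr vs)). w \<noteq> []"
    using ne(1) by (metis in_set_conv_nth length_map nth_map set_rev)
  have "rev (map parr vs) \<noteq> []" using l by auto
  moreover have vs': "map mkp (rev (map parr vs)) = rev vs" using vs by (metis rev_map)
  ultimately have "set (rev vs) \<subseteq> PQ" and succ: "successively composable (rev vs)" and pp: "pprod (rev vs) = p"
    using split_qpath_list[OF p cc ne'] by simp_all
  then have sub: "set vs \<subseteq> PQ" by simp
  have PQ: "vs ! i \<in> PQ" "\<not> wred SW (parr (vs ! i))" if "i \<le> n" for i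
    using sub that l ne(2)[of i] by (auto simp: subset_iff)
  have comp: "composable (vs ! Suc i) (vs ! i)" if "i < n" for i
    using succ[unfolded successively_rev] that l by (simp add: successively_conv_nth)
  have wr: "wred SW (parr (vs ! Suc i) @ parr (vs ! i)) \<and> \<not> wred SW (tl (parr (vs ! Suc i)) @ parr (vs ! i))"
    if "i < n" for i using rf l that by (simp add: rfac_def)
  show "right_factorization Q R n p vs"
    unfolding right_factorization_def
  proof (intro conjI ballI allI impI)
    show "vs ! 0 \<in> qpaths_of_length Q 1" using rf l PQ(1)[of 0] by (auto simp: rfac_def qpaths_of_length_def)
    fix i assume i: "i < n"
    have c: "pcomp (vs ! Suc i) (vs ! i) \<in> PQ" using PQ[of i] PQ[of "Suc i"] comp i by (intro pcomp_qpath) auto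
    show "\<not> irred_path Q R (pcomp (vs ! Suc i) (vs ! i))" using irred_path_iff[OF c] wr[OF i] by simp
    show "irred_path Q R (pcomp d (vs ! i))" if "d \<in> PQ" "right_divisor Q d (vs ! Suc i) \<and> d \<noteq> vs ! Suc i" for d
      using right_divisor_iff[of "vs ! i" "vs ! Suc i"] PQ[of i] PQ[of "Suc i"] comp i wr[OF i] that by simp
  qed (use l pp comp PQ in \<open>auto simp: B_iff\<close>)
qed

section \<open>Ambiguities of all degrees as greedy factorizations\<close>

lemma S_obtain:
  assumes "s \<in> fst ` R"
  obtains f where "(s, f) \<in> R"
proof -
  obtain z where "z \<in> R" "s = fst z" using assms by blast
  then have "(s, snd z) \<in> R" by simp
  then show ?thesis by (rule that)
qed

lemma SW_obtain:
  assumes "w \<in> SW"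
  obtains s f where "(s, f) \<in> R" "w = parr s"
  using assms S_obtain unfolding SW_def by blast

text \<open>An element of \<open>S\<close> occurring inside \<open>s\<close> divides it as a path,
  hence is \<open>s\<close> by the antichain condition; comparing lengths leaves no letters outside
  the occurrence.\<close>

lemma SW_not_wred_proper:
  assumes "s \<in> fst ` R" "parr s = x @ y"
  shows "y \<noteq> [] \<Longrightarrow> \<not> wred SW x" and "x \<noteq> [] \<Longrightarrow> \<not> wred SW y"
proof -
  obtain f where f: "(s, f) \<in> R" by (rule S_obtain[OF assms(1)])
  have s: "s \<in> PQ" by (rule redsysD(1)[OF f])
  have *: "w = [] \<and> w' = []" if hw: "parr s = w @ m @ w'" and hm: "m \<in> SW" for m w w'
  proof -
    obtain t g where t: "(t, g) \<in> R" "m = parr t" by (rule SW_obtain[OF hm])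
    obtain a b where ab: "a \<in> PQ" "b \<in> PQ" "composable a b" "s = pcomp a b" "parr a = w" "parr b = m @ w'"
      by (rule split_qpath[OF s hw])
    obtain m' c where mc: "m' \<in> PQ" "c \<in> PQ" "composable m' c" "b = pcomp m' c" "parr m' = m" "parr c = w'"
      by (rule split_qpath[OF ab(2,6)])
    have "m' = t" using redsysD(1,4)[OF t(1)] mc(1,5) t(2) by (intro qpath_eqI) auto
    then have "t = s" using redsys_antichain[OF t(1) f, of a c] ab mc by simp
    then have "length (parr s) = length m" using t by simp
    then show ?thesis using arg_cong[OF hw, of length] by simp
  qed
  show "\<not> wred SW x" if "y \<noteq> []" unfolding wred_def
    using *[of _ _ "_ @ y"] assms(2) that by (metis append.assoc append_is_Nil_conv)
  show "\<not> wred SW y" if "x \<noteq> []" unfolding wred_def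
    using *[of "x @ _"] assms(2) that by (metis append.assoc append_is_Nil_conv)
qed

text \<open>An element of \<open>S\<close> factors as its first arrow followed by the rest, both
  conditions being about proper pieces of it. Conversely, the element of \<open>S\<close> found
  inside \<open>u @ v\<close> must reach both ends, because \<open>v\<close> and
  \<open>u @ butlast v\<close> are irreducible, so it is the whole word.\<close>

lemma ambig_1_iff: "p \<in> fst ` R \<longleftrightarrow> (\<exists>ws. pfac 1 p ws)"
proof
  assume p: "p \<in> fst ` R"
  then obtain f where f: "(p, f) \<in> R" by (rule S_obtain)
  have PQ: "p \<in> PQ" "2 \<le> length (parr p)" using redsysD[OF f] by auto
  then obtain e es where es: "parr p = e # es" "es \<noteq> []"
    by (metis One_nat_def Suc_1 length_0_conv length_Cons list.exhaust not_less_eq_eq zero_le)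
  have sw: "parr p \<in> SW" using p by (simp add: SW_def)
  have "wred SW (parr p)" unfolding wred_def using sw by (metis append_Nil append_Nil2)
  moreover have "\<not> wred SW es" using SW_not_wred_proper(2)[OF p, of "[e]" es] es by simp
  moreover have "\<not> wred SW (e # butlast es)"
    using SW_not_wred_proper(1)[OF p, of "e # butlast es" "[last es]"] es by simp
  ultimately have "lfac SW [[e], es]" using es by (simp add: lfac_def)
  then show "\<exists>ws. pfac 1 p ws" using PQ es by (intro exI[of _ "[[e], es]"]) (simp add: pfac_def)
next
  assume "\<exists>ws. pfac 1 p ws"
  then obtain ws where ws: "p \<in> PQ" "lfac SW ws" "length ws = 2" "concat ws = parr p" by (auto simp: pfac_def)
  then obtain u v where uv: "ws = [u, v]" by (metis One_nat_def Suc_1 length_0_conv length_Suc_conv)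
  have u1: "length u = 1" and irr: "\<not> wred SW v" "wred SW (u @ v)" "\<not> wred SW (u @ butlast v)"
    using ws(2) unfolding lfac_def uv by auto
  obtain s a c where s: "s \<in> SW" "u @ v = a @ s @ c" using irr(2) by (auto simp: wred_def)
  \<comment> \<open>If letters remained on the right, the element of \<open>S\<close> would already
    lie in \<open>u @ butlast v\<close>.\<close>
  have "c = []"
  proof (rule ccontr)
    assume "c \<noteq> []"
    then have b: "butlast (u @ v) = a @ s @ butlast c" unfolding s(2) by (simp add: butlast_append)
    have "v \<noteq> []" using irr by (auto dest: not_wred_short simp: u1)
    then have "u @ butlast v = a @ s @ butlast c" using b by (simp add: butlast_append)
    then show False using irr(3) s(1) unfolding wred_def by blast
  qed
  moreover have "a = []"
  proof (rule ccontr)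
    assume "a \<noteq> []"
    then have "v = tl a @ s @ c" using s(2) u1 by (metis length_0_conv length_Suc_conv One_nat_def append_Cons append_Nil list.sel(3) tl_append2)
    then show False using irr(1) s(1) unfolding wred_def by blast
  qed
  ultimately have "parr p = s" using ws(4) uv s(2) by simp
  then obtain t f where t: "(t, f) \<in> R" "parr t = parr p" using SW_obtain[OF s(1)] by metis
  then have "t = p" using redsysD(1,4)[OF t(1)] ws(1) by (intro qpath_eqI) auto
  then show "p \<in> fst ` R" using t(1) by (metis fst_conv imageI)
qed

lemma ambig_iff:
  assumes "0 \<le> n"
  shows "p \<in> ambig Q R n \<longleftrightarrow> (\<exists>ws. pfac (nat n) p ws)"
proof -
  consider "n = 0" | "n = 1" | "2 \<le> n" using assms by linarith
  then show ?thesis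
  proof cases
    case 1
    have "pfac 0 p ws \<longleftrightarrow> p \<in> PQ \<and> ws = [parr p] \<and> length (parr p) = 1" for ws
    proof -
      have "ws = [parr p]" if "length ws = 1" "concat ws = parr p"
        using that by (cases ws) auto
      then show ?thesis by (auto simp: pfac_def lfac_def)
    qed
    then show ?thesis using 1 by (simp add: ambig_def qpaths_of_length_def)
  next
    case 2
    then show ?thesis using ambig_1_iff[of p] by (simp add: ambig_def)
  next
    case 3
    have "(\<exists>us. left_factorization Q R (nat n) p us) \<longleftrightarrow> (\<exists>ws. pfac (nat n) p ws)"
    proof
      assume "\<exists>ws. pfac (nat n) p ws"
      then obtain ws where "pfac (nat n) p ws" ..
      then have "left_factorization Q R (nat n) p (map mkp ws)"
        by (simp add: left_factorization_iff comp_def)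
      then show "\<exists>us. left_factorization Q R (nat n) p us" ..
    qed (use left_factorization_iff in blast)
    then show ?thesis using 3 by (auto simp: ambig_def pfac_def)
  qed
qed

lemma ambig_m1_iff: "p \<in> ambig Q R (- 1) \<longleftrightarrow> p \<in> PQ \<and> parr p = []"
  by (simp add: ambig_def qpaths_of_length_def)

lemma ambig_path: "p \<in> ambig Q R n \<Longrightarrow> p \<in> PQ"
proof -
  assume p: "p \<in> ambig Q R n"
  consider "n < -1" | "n = -1" | "0 \<le> n" by linarith
  then show ?thesis
  proof cases
    case 1
    then show ?thesis using p by (simp add: ambig_def)
  next
    case 2
    then show ?thesis using p ambig_m1_iff by simp
  next
    case 3
    then show ?thesis using p by (auto simp: ambig_iff pfac_def)
  qed
qed

text \<open>
  Splits off the last factor \<open>u\<close> of the left factorization of \<open>q\<close>. For \<open>m = 0\<close> this makes \<open>q'\<close> the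
  source of the arrow \<open>q = u\<close>, so that arrows need no separate treatment.
\<close>

definition lsplit :: "int \<Rightarrow> ('v, 'e) qpath \<Rightarrow> ('v, 'e) qpath \<Rightarrow> ('v, 'e) qpath \<Rightarrow> bool" where
  "lsplit m q q' u \<longleftrightarrow> (\<exists>ws. pfac (nat m) q ws \<and> parr u = last ws) \<and>
     q' \<in> PQ \<and> u \<in> PQ \<and> composable q' u \<and> q = pcomp q' u"

lemma pfac_unique: "pfac n p ws \<Longrightarrow> pfac n p ws' \<Longrightarrow> ws = ws'"
  unfolding pfac_def by (intro lfac_unique[OF SW_length]) auto

lemma concat_butlast_last: "ws \<noteq> [] \<Longrightarrow> concat ws = concat (butlast ws) @ last ws"
  by (metis append_butlast_last_id append_Nil2 concat.simps concat_append)

lemma pfac_ne: "pfac n p ws \<Longrightarrow> ws \<noteq> []"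
  by (auto simp: pfac_def)

lemma lsplit_ex:
  assumes "q \<in> ambig Q R m" "0 \<le> m"
  obtains q' u where "lsplit m q q' u"
proof -
  obtain ws where ws: "pfac (nat m) q ws" using assms by (auto simp: ambig_iff)
  have q: "q \<in> PQ" and eq: "parr q = concat (butlast ws) @ last ws"
    using ws concat_butlast_last[OF pfac_ne[OF ws]] by (auto simp: pfac_def)
  obtain a b where "a \<in> PQ" "b \<in> PQ" "composable a b" "q = pcomp a b" "parr b = last ws"
    by (rule split_qpath[OF q eq])
  then show ?thesis using that ws unfolding lsplit_def by blast
qed

text \<open>Dropping the last factor preserves all conditions of a greedy factorization, so
  \<open>q'\<close> is an ambiguity of one degree less; for \<open>m = 0\<close> no factor remains
  and \<open>q'\<close> is a vertex.\<close>

lemma lsplitD: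
  assumes "lsplit m q q' u" "0 \<le> m"
  shows "q \<in> ambig Q R m" "q' \<in> ambig Q R (m - 1)" "u \<in> B" "parr u \<noteq> []" "composable q' u"
    "q = pcomp q' u" "q' \<in> PQ" "u \<in> PQ" "q \<in> PQ"
proof -
  obtain ws where ws: "pfac (nat m) q ws" "parr u = last ws" and q: "q' \<in> PQ" "u \<in> PQ" "composable q' u" "q = pcomp q' u"
    using assms(1) unfolding lsplit_def by blast
  show "composable q' u" "q = pcomp q' u" "q' \<in> PQ" "u \<in> PQ" by fact+
  show "q \<in> PQ" using ws by (simp add: pfac_def)
  show "q \<in> ambig Q R m" using ws assms(2) ambig_iff by blast
  have ne: "ws \<noteq> []" by (rule pfac_ne[OF ws(1)])
  show "parr u \<noteq> []" using pfac_nonempty[OF ws(1)] ne ws(2) by simp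
  have lf: "lfac SW ws" "length ws = Suc (nat m)" using ws(1) by (auto simp: pfac_def)
  have "\<not> wred SW (last ws)" using lfac_not_wred[OF lf(1) SW_length, of "length ws - 1"] ne by (simp add: last_conv_nth)
  then show "u \<in> B" using q(2) ws(2) by (simp add: B_iff)
  have w': "concat (butlast ws) = parr q'"
    using ws q(4) concat_butlast_last[OF ne] by (simp add: pfac_def)
  show "q' \<in> ambig Q R (m - 1)"
  proof (cases "m = 0")
    case True
    then have "butlast ws = []" using lf(2) by (cases ws) auto
    then show ?thesis using True w' q(1) by (simp add: ambig_m1_iff)
  next
    case False
    then have "0 < m" using assms(2) by simp
    then have "lfac SW (butlast ws)" using lfac_take[OF lf(1), of "nat m"] lf(2) by (simp add: butlast_conv_take)
    then have "pfac (nat (m - 1)) q' (butlast ws)" using lf(2) w' q(1) \<open>0 < m\<close> by (simp add: pfac_def nat_diff_distrib)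
    then show ?thesis using ambig_iff[of "m - 1" q'] \<open>0 < m\<close> by auto
  qed
qed

text \<open>The distinctness of leading terms rests on this. Followed by the tails, \<open>q\<close>
  and \<open>q2\<close> spell the same word, and greedy factorizations of the same length that start
  one word coincide.\<close>

lemma lsplit_same_tail:
  assumes "lsplit m q q' u" "lsplit m q2 q' u2" "0 \<le> m" "pcomp u c = pcomp u2 c2"
  shows "u = u2 \<and> q = q2"
proof -
  obtain ws where ws: "pfac (nat m) q ws" "parr u = last ws" using assms(1) unfolding lsplit_def by blast
  obtain vs where vs: "pfac (nat m) q2 vs" "parr u2 = last vs" using assms(2) unfolding lsplit_def by blast
  note D1 = lsplitD[OF assms(1,3)] and D2 = lsplitD[OF assms(2,3)]
  have "parr u @ parr c = parr u2 @ parr c2" using arg_cong[OF assms(4), of parr] by simp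
  then have "concat ws @ parr c = concat vs @ parr c2" using ws vs D1(6) D2(6) by (simp add: pfac_def)
  then have "take (length ws) ws = take (length ws) vs"
    using ws vs unfolding pfac_def by (intro lfac_prefix_unique[OF SW_length]) auto
  then have "ws = vs" using ws vs by (simp add: pfac_def)
  then have eq: "parr u = parr u2" using ws(2) vs(2) by simp
  have "u = u2" by (rule qpath_eqI[OF D1(8) D2(8) eq D1(4)])
  then show ?thesis using D1(6) D2(6) by simp
qed

lemma lsplit_extend:
  assumes "lsplit m q q' u" "0 \<le> m" "c \<in> B" "composable q c" "wred SW (parr u @ parr c)"
  obtains q2 u2 c2 where "lsplit (m + 1) q2 q u2" "c = pcomp u2 c2" "c2 \<in> B" "composable q2 c2" "composable u2 c2"
proof -
  obtain ws where ws: "pfac (nat m) q ws" "parr u = last ws" using assms(1) unfolding lsplit_def by blast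
  have c: "c \<in> PQ" "\<not> wred SW (parr c)" using assms(3) by (auto simp: B_iff)
  have lf: "lfac SW ws" using ws by (simp add: pfac_def)
  obtain v c' where v: "parr c = v @ c'" "lfac SW (ws @ [v])"
    using lfac_extend[OF SW_length lf, of "parr c"] c assms(5) ws(2) by auto
  obtain u2 c2 where uc: "u2 \<in> PQ" "c2 \<in> PQ" "composable u2 c2" "c = pcomp u2 c2" "parr u2 = v" "parr c2 = c'"
    by (rule split_qpath[OF c(1) v(1)])
  have q: "q \<in> PQ" using ws by (simp add: pfac_def)
  have qu: "composable q u2" using assms(4) uc(4) by (simp add: composable_def)
  have "pfac (nat (m + 1)) (pcomp q u2) (ws @ [v])"
    using ws v uc q qu assms(2) by (simp add: pfac_def pcomp_qpath nat_add_distrib)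
  then have "lsplit (m + 1) (pcomp q u2) q u2" unfolding lsplit_def using uc q qu by auto
  moreover have "c2 \<in> B" using assms(3) uc by (metis B_right)
  ultimately show ?thesis using that uc by simp
qed

text \<open>Counterpart of \<open>lsplit_extend\<close> starting from a vertex: the ambiguities of
  degree 0 are arrows, so in place of a reducible product it suffices that \<open>c\<close> has a
  first arrow.\<close>

lemma lsplit_arrow:
  assumes "q \<in> ambig Q R (- 1)" "c \<in> B" "composable q c" "parr c \<noteq> []"
  obtains q2 u2 c2 where "lsplit 0 q2 q u2" "c = pcomp u2 c2" "c2 \<in> B" "composable q2 c2" "composable u2 c2"
proof -
  have q: "q \<in> PQ" "parr q = []" using assms(1) by (auto simp: ambig_m1_iff)
  have c: "c \<in> PQ" using assms(2) by (simp add: B_iff)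
  have hc: "parr c = [hd (parr c)] @ tl (parr c)" using assms(4) by simp
  obtain u2 c2 where uc: "u2 \<in> PQ" "c2 \<in> PQ" "composable u2 c2" "c = pcomp u2 c2" "parr u2 = [hd (parr c)]" "parr c2 = tl (parr c)"
    by (rule split_qpath[OF c hc])
  have qu: "composable q u2" using assms(3) uc(4) by (simp add: composable_def)
  have e: "pcomp q u2 = u2" by (rule pcomp_triv(2)[OF qu q])
  have "pfac 0 u2 [parr u2]" using uc(1,5) by (simp add: pfac_def lfac_def)
  then have "\<exists>ws. pfac (nat 0) u2 ws \<and> parr u2 = last ws" by (intro exI[of _ "[parr u2]"]) simp
  then have l: "lsplit 0 u2 q u2" unfolding lsplit_def using uc(1) q(1) qu e by simp
  have "c2 \<in> B" using assms(2) uc(2) unfolding uc(4) by (rule B_right)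
  then show ?thesis by (rule that[OF l uc(4) _ uc(3) uc(3)])
qed

text \<open>Both \<open>p\<close> and \<open>q'\<close> are prefixes of \<open>q\<close> made of
  equally many greedy factors, hence equal. In odd degrees this leaves a single summand of \<delta>
  whose left coefficient is a vertex.\<close>

lemma lsplit_prefix:
  assumes "lsplit m q q' u" "1 \<le> m" "p \<in> ambig Q R (m - 1)" "q = pcomp p c" "composable p c" "c \<in> PQ"
  shows "p = q' \<and> c = u"
proof -
  obtain ws where ws: "pfac (nat m) q ws" "parr u = last ws" using assms(1) unfolding lsplit_def by blast
  obtain vs where vs: "pfac (nat (m - 1)) p vs" using assms(2,3) ambig_iff[of "m - 1" p] by auto
  have D: "q' \<in> PQ" "u \<in> PQ" "parr u \<noteq> []" "q = pcomp q' u" using lsplitD[OF assms(1)] assms(2) by auto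
  have l: "length vs = nat m" "length ws = Suc (nat m)" using ws vs assms(2) by (auto simp: pfac_def)
  have e: "concat vs @ parr c = concat ws @ []" using ws vs assms(4) by (simp add: pfac_def)
  have lf: "lfac SW vs" "lfac SW ws" using ws vs by (simp_all add: pfac_def)
  have "take (length vs) vs = take (length vs) ws"
    by (rule lfac_prefix_unique[OF SW_length lf e]) (simp_all add: l)
  then have "vs = butlast ws" using l by (simp add: butlast_conv_take)
  then have pq1: "parr p = parr q'"
    using ws vs D(4) concat_butlast_last[OF pfac_ne[OF ws(1)]] by (simp add: pfac_def)
  have "parr p @ parr c = parr q' @ parr u" using assms(4) D(4) by (metis pcomp_simps(3))
  then have pq: "parr p = parr q'" "parr c = parr u" using pq1 by auto
  have "psrc p = psrc q'" using assms(4) D(4) by (metis pcomp_simps(1))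
  then have "p = q'" using qpath_eqI_src[OF ambig_path[OF assms(3)] D(1)] pq by simp
  moreover have "c = u" using qpath_eqI[OF assms(6) D(2)] pq D(3) by simp
  ultimately show ?thesis by simp
qed

text \<open>Uniqueness of the greedy factorization evaluates the definite description occurring in
  \<open>delta_gen\<close>.\<close>

lemma left_factorization_lsplit:
  assumes "lsplit m q q' u" "1 \<le> m"
  shows "left_factorization Q R (nat m) q (THE us. left_factorization Q R (nat m) q us)"
    and "pprod (take (nat m) (THE us. left_factorization Q R (nat m) q us)) = q'"
    and "(THE us. left_factorization Q R (nat m) q us) ! nat m = u"
proof -
  let ?us = "THE us. left_factorization Q R (nat m) q us"
  obtain ws where ws: "pfac (nat m) q ws" "parr u = last ws" using assms(1) unfolding lsplit_def by blast
  have D: "q' \<in> PQ" "u \<in> PQ" "parr u \<noteq> []" "q = pcomp q' u" "q \<in> PQ" "q' \<in> ambig Q R (m - 1)"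
    using lsplitD[OF assms(1)] assms(2) by auto
  have lfm: "left_factorization Q R (nat m) q (map mkp ws)"
    using ws by (simp add: left_factorization_iff comp_def)
  have us: "?us = map mkp ws"
  proof (rule the_equality[where P = "left_factorization Q R (nat m) q", OF lfm])
    fix us assume "left_factorization Q R (nat m) q us"
    then have "pfac (nat m) q (map parr us)" "us = map mkp (map parr us)" by (auto simp only: left_factorization_iff)
    then show "us = map mkp ws" using pfac_unique[OF ws(1)] by metis
  qed
  show "left_factorization Q R (nat m) q ?us" unfolding us by (rule lfm)
  have l: "length ws = Suc (nat m)" using ws by (simp add: pfac_def)
  have lst: "last ws = ws ! nat m" using l by (metis diff_Suc_1 last_conv_nth length_0_conv nat.distinct(1))
  show "?us ! nat m = u" unfolding us using l lst ws(2) qpath_eq_mkp[OF D(2,3)] by simp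
  have "concat (butlast ws) = parr q'"
    using ws D(4) concat_butlast_last[OF pfac_ne[OF ws(1)]] by (simp add: pfac_def)
  moreover have "butlast ws = take (nat m) ws" using l by (simp add: butlast_conv_take)
  moreover have "\<forall>w\<in>set (take (nat m) ws). w \<noteq> []" using pfac_nonempty[OF ws(1)] by (meson in_set_takeD)
  moreover have "take (nat m) ws \<noteq> []" using l assms(2) by auto
  ultimately show "pprod (take (nat m) ?us) = q'"
    unfolding us using split_qpath_list[OF D(1), of "take (nat m) ws"] by (simp add: take_map)
qed

text \<open>Without its leftmost factor, a right factorization is again one, but membership in
  \<open>ambig\<close> asks for a left factorization; \<open>rfac_imp_lfac\<close> supplies
  it.\<close>

lemma right_factorization_split:
  assumes "q \<in> ambig Q R m" "1 \<le> m"
  defines "vs \<equiv> THE vs. right_factorization Q R (nat m) q vs"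
  defines "v \<equiv> vs ! nat m" and "q'' \<equiv> pprod (rev (take (nat m) vs))"
  shows "v \<in> B" "parr v \<noteq> []" "q'' \<in> ambig Q R (m - 1)" "composable v q''" "q = pcomp v q''"
proof -
  obtain ws where ws: "pfac (nat m) q ws" using assms ambig_iff[of m q] by auto
  then have q: "q \<in> PQ" "parr q = concat ws" and l: "lfac SW ws" "length ws = Suc (nat m)" by (auto simp: pfac_def)
  obtain xs where xs: "rfac SW xs" "length xs = Suc (nat m)" "concat (rev xs) = parr q"
    using lfac_imp_rfac[OF SW_length l(1)] q(2) l(2) by auto
  have rfm: "right_factorization Q R (nat m) q (map mkp xs)"
    using xs q(1) by (simp add: right_factorization_iff comp_def)
  have vs: "vs = map mkp xs" unfolding vs_def
  proof (rule the_equality[where P = "right_factorization Q R (nat m) q", OF rfm])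
    fix us assume "right_factorization Q R (nat m) q us"
    then have us: "rfac SW (map parr us)" "length us = Suc (nat m)"
     "concat (rev (map parr us)) = parr q" "us = map mkp (map parr us)" by (auto simp only: right_factorization_iff)
    then have "map parr us = xs" using xs by (intro rfac_unique[OF SW_length]) auto
    then show "us = map mkp xs" using us(4) by metis
  qed
  have xm: "rev xs = xs ! nat m # rev (take (nat m) xs)"
    using xs(2) take_Suc_conv_app_nth[of "nat m" xs] by simp
  have lf: "lfac (rev ` SW) (map rev xs)" using xs(1) by (simp only: rfac_iff_lfac_rev)
  have SWr: "\<And>s. s \<in> rev ` SW \<Longrightarrow> 2 \<le> length s" by (auto dest: SW_length)
  have ne: "xs ! i \<noteq> []" "\<not> wred SW (xs ! i)" if "i < length xs" for i
    using lfac_nonempty[OF lf SWr, of i] lfac_not_wred[OF lf SWr, of i] that by (auto simp: wred_rev)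
  have ne': "\<forall>w\<in>set (rev xs). w \<noteq> []" using ne(1) by (metis in_set_conv_nth set_rev)
  have rxs: "rev xs \<noteq> []" using xs(2) by auto
  have split: "set (map mkp (rev xs)) \<subseteq> PQ" "successively composable (map mkp (rev xs))" "pprod (map mkp (rev xs)) = q"
    using split_qpath_list[OF q(1) xs(3) ne' rxs] by auto
  have v: "v = mkp (xs ! nat m)" unfolding v_def vs using xs(2) by simp
  have vPQ: "v \<in> PQ" unfolding v using split(1) unfolding xm by simp
  then show "v \<in> B" using ne(2)[of "nat m"] xs(2) v by (simp add: B_iff)
  show "parr v \<noteq> []" using ne(1)[of "nat m"] xs(2) v by simp
  let ?ys = "rev (take (nat m) xs)"
  have ys: "?ys \<noteq> []" using xs(2) assms(2) by auto
  have q'': "q'' = pprod (map mkp ?ys)" unfolding q''_def vs by (simp add: take_map rev_map)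
  obtain y ys where yy: "?ys = y # ys" using ys by (cases ?ys) auto
  have "pprod (map mkp (xs ! nat m # ?ys)) = pcomp v q''" unfolding q'' v yy by simp
  then show qv: "q = pcomp v q''" using split(3) xm by simp
  have src: "psrc q'' = psrc (mkp y)" unfolding q'' using pprod_simps(2)[of "map mkp ?ys"] yy by simp
  have "composable v (mkp y)" using split(2) unfolding xm yy v by simp
  then show comp: "composable v q''" using src by (simp add: composable_def)
  have rf: "rfac SW (take (nat m) xs)" using rfac_take[OF xs(1)] assms(2) by simp
  obtain zs where zs: "lfac SW zs" "length zs = length (take (nat m) xs)" "concat zs = concat ?ys"
    using rfac_imp_lfac[OF SW_length rf] by auto
  have pq'': "parr q'' = concat ?ys" unfolding q'' using ys by (simp add: pprod_simps comp_def)
  obtain a b where ab: "a \<in> PQ" "b \<in> PQ" "composable a b" "q = pcomp a b" "parr a = parr v" "parr b = parr q''"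
    using split_qpath[OF q(1), of "parr v" "parr q''"] qv by (metis pcomp_simps(3))
  have "a = v" using ab(1,5) vPQ \<open>parr v \<noteq> []\<close> by (intro qpath_eqI) auto
  then have "b = q''" using ab qv comp
    by (intro path_eqI) (metis composable_def, metis, metis pcomp_simps(2))
  then have "q'' \<in> PQ" using ab by simp
  then have "pfac (nat (m - 1)) q'' zs" using zs pq'' xs(2) assms(2) by (simp add: pfac_def nat_diff_distrib)
  then show "q'' \<in> ambig Q R (m - 1)" using ambig_iff[of "m - 1" q''] assms(2) by auto
qed

end

section \<open>The reduction order\<close>

locale quiver_diamond = quiver_redsys Q R
  for Q :: "('v, 'e) pre_digraph" and R :: "('v, 'e, 'k::field) redsys" +
  fixes I :: "('v, 'e, 'k) kq set"
  assumes ideal_I: "ideal I (path_algebra Q)"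
    and lozenge: "lozenge Q R I"
begin

lemma lozengeD:
  shows "I = Idl\<^bsub>path_algebra Q\<^esub> {bas s - f | s f. (s, f) \<in> R}"
    and "p \<in> PQ \<Longrightarrow> reduction_unique Q R p"
    and "(s, f) \<in> R \<Longrightarrow> irred Q R f"
  using lozenge unfolding lozenge_def by blast+

text \<open>The one-step relation of the overview, with the smaller path as first component, so that
  well-foundedness means the absence of endless reduction.\<close>

definition step :: "(('v, 'e) qpath \<times> ('v, 'e) qpath) set" where
  "step = {(v, w). \<exists>a s f c q. is_asc a s f c \<and> w = pcomp a (pcomp s c) \<and>
     q \<in> keys f \<and> v = pcomp a (pcomp q c)}"

lemma stepI:
  "is_asc a s f c \<Longrightarrow> q \<in> keys f \<Longrightarrow> (pcomp a (pcomp q c), pcomp a (pcomp s c)) \<in> step"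
  unfolding step_def by blast

lemma step_obtain:
  assumes "(v, w) \<in> step"
  obtains a s f c q where "is_asc a s f c" "w = pcomp a (pcomp s c)" "q \<in> keys f"
    "v = pcomp a (pcomp q c)"
  using assms unfolding step_def by blast

lemma is_ascD:
  assumes "is_asc a s f c"
  shows "(s, f) \<in> R" "a \<in> PQ" "c \<in> PQ" "composable a s" "composable s c" "s \<in> PQ"
  using assms redsysD(1) unfolding is_asc_def by blast+

lemma is_asc_key:
  assumes "is_asc a s f c" "q \<in> keys f"
  shows "q \<in> PQ" "psrc q = psrc s" "ptgt q = ptgt s" "composable a q" "composable q c"
    "pcomp a (pcomp q c) \<in> PQ"
proof -
  note D = is_ascD[OF assms(1)]
  show *: "q \<in> PQ" "psrc q = psrc s" "ptgt q = ptgt s" using redsysD(5)[OF D(1) assms(2)] by blast+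
  show **: "composable a q" "composable q c" using D * by (simp_all add: composable_def)
  show "pcomp a (pcomp q c) \<in> PQ" using D * ** by (simp add: pcomp_qpath)
qed

text \<open>\<open>f\<close> is irreducible while \<open>s\<close> is not. As a consequence, a basic
  reduction removes its path completely and no path is one step below itself.\<close>

lemma is_asc_s_notin: "is_asc a s f c \<Longrightarrow> s \<notin> keys f"
proof
  assume a: "is_asc a s f c" and s: "s \<in> keys f"
  note D = is_ascD[OF a]
  have "\<not> wred SW (parr s)"
    using irred_iff[OF redsysD(2)[OF D(1)]] lozengeD(3)[OF D(1)] s by blast
  moreover have "parr s \<in> SW" using D(1) unfolding SW_def by (metis fst_conv imageI)
  then have "wred SW (parr s)" unfolding wred_def by (metis append_Nil append_Nil2)
  ultimately show False by blast
qed

lemma step_paths: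
  assumes "(v, w) \<in> step"
  shows "v \<in> PQ" "w \<in> PQ" "psrc v = psrc w" "ptgt v = ptgt w" "v \<noteq> w"
proof -
  obtain a s f c q where asc: "is_asc a s f c" "w = pcomp a (pcomp s c)" "q \<in> keys f"
    "v = pcomp a (pcomp q c)" by (rule step_obtain[OF assms])
  note D = is_asc_key[OF asc(1,3)]
  show "v \<in> PQ" "w \<in> PQ" "psrc v = psrc w" "ptgt v = ptgt w"
    using D is_asc_path[OF asc(1)] asc by simp_all
  show "v \<noteq> w"
  proof
    assume "v = w"
    then have "q = s" using inj_onD[OF sandwich_inj[OF asc(1)], of q s] asc by blast
    then show False using is_asc_s_notin[OF asc(1)] asc(3) by simp
  qed
qed

lemma step_left:
  assumes "(v, w) \<in> step" "x \<in> PQ" "composable x w"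
  shows "(pcomp x v, pcomp x w) \<in> step"
proof -
  obtain a s f c q where asc: "is_asc a s f c" "w = pcomp a (pcomp s c)" "q \<in> keys f"
    "v = pcomp a (pcomp q c)" by (rule step_obtain[OF assms(1)])
  have "composable x a" using assms(3) asc(2) by (simp add: composable_def)
  then have "is_asc (pcomp x a) s f c" using asc(1) assms(2) unfolding is_asc_def by (simp add: pcomp_qpath)
  from stepI[OF this asc(3)] show ?thesis unfolding asc(2,4) by (simp add: pcomp_assoc)
qed

lemma step_right:
  assumes "(v, w) \<in> step" "x \<in> PQ" "composable w x"
  shows "(pcomp v x, pcomp w x) \<in> step"
proof -
  obtain a s f c q where asc: "is_asc a s f c" "w = pcomp a (pcomp s c)" "q \<in> keys f"
    "v = pcomp a (pcomp q c)" by (rule step_obtain[OF assms(1)])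
  have "composable c x" using assms(3) asc(2) by (simp add: composable_def)
  then have "is_asc a s f (pcomp c x)" using asc(1) assms(2) unfolding is_asc_def by (simp add: pcomp_qpath)
  from stepI[OF this asc(3)] show ?thesis unfolding asc(2,4) by (simp add: pcomp_assoc)
qed

lemma sandwich_0_iff:
  assumes "is_asc a s f c"
  shows "lookup (kq_mult (bas a) (kq_mult f (bas c))) (pcomp a (pcomp s c)) = 0"
proof -
  have "pcomp a (pcomp s c) \<notin> keys (kq_mult (bas a) (kq_mult f (bas c)))"
  proof
    assume "pcomp a (pcomp s c) \<in> keys (kq_mult (bas a) (kq_mult f (bas c)))"
    then obtain q where "q \<in> keys f" "pcomp a (pcomp s c) = pcomp a (pcomp q c)"
      unfolding keys_sandwich[OF assms] by blast
    then show False using step_paths(5)[OF stepI[OF assms]] by metis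
  qed
  then show ?thesis by (simp add: in_keys_iff)
qed

text \<open>
  Call a path bad if an infinite chain of steps starts in it. If every element with a bad path in its
  support has a nontrivial basic reduction keeping a bad path, iterating from a bad path contradicts
  reduction-finiteness. Otherwise some \<open>x\<close> loses all bad paths whichever bad path \<open>q\<close> of its support
  is reduced, so that \<open>x\<^sub>q r\<^sub>q(q) = - \<Sum>\<^sub>p\<^sub>\<noteq>\<^sub>q x\<^sub>p p\<close> modulo good paths, and alternating the reductions of two
  such paths \<open>q\<close>, \<open>q'\<close> leads from \<open>q\<close> back to a multiple of \<open>q\<close> modulo good paths, for ever.
\<close>

lemma wf_step: "wf step"
proof (rule ccontr)
  assume "\<not> wf step"
  then obtain q0 where q0: "q0 \<notin> Wellfounded.acc step" using wf_iff_acc by blast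
  \<comment> \<open>Bad is rendered as not accessible: each bad path then has a bad path one step
    below it, and no infinite chain has to be chosen.\<close>
  let ?bad = "\<lambda>q. q \<notin> Wellfounded.acc step"
  let ?Bad = "\<lambda>x :: ('v, 'e, 'k) kq. \<exists>q\<in>keys x. ?bad q"
  have bad_path: "q \<in> PQ" if "?bad q" for q
    using that by (rule not_acc_down) (rule step_paths(2))
  have never: "\<not> (\<forall>n. fold r [0..<Suc n] (bas q) \<noteq> fold r [0..<n] (bas q))"
    if hq: "q \<in> PQ" and hr: "\<forall>i::nat. r i \<in> basic_reductions Q R" for q r
  proof -
    have "reduction_finite Q R q" using lozengeD(2)[OF hq] unfolding reduction_unique_def by blast
    then obtain m where "\<forall>n\<ge>m. fold r [0..<n] (bas q) = fold r [0..<m] (bas q)"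
      using hr unfolding reduction_finite_def by blast
    then have "fold r [0..<Suc m] (bas q) = fold r [0..<m] (bas q)" by (metis le_SucI order_refl)
    then show ?thesis by blast
  qed
  show False
  proof (cases "\<forall>x. ?Bad x \<longrightarrow> (\<exists>r\<in>basic_reductions Q R. r x \<noteq> x \<and> ?Bad (r x))")
    case True
    define nxt where "nxt x = (SOME r. r \<in> basic_reductions Q R \<and> r x \<noteq> x \<and> ?Bad (r x))" for x
    have nxt: "nxt x \<in> basic_reductions Q R \<and> nxt x x \<noteq> x \<and> ?Bad (nxt x x)" if hx: "?Bad x" for x
    proof -
      have "\<exists>r. r \<in> basic_reductions Q R \<and> r x \<noteq> x \<and> ?Bad (r x)"
        using mp[OF spec[OF True] hx] unfolding Bex_def .
      then show ?thesis unfolding nxt_def by (rule someI_ex)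
    qed
    define X where "X = rec_nat (bas q0) (\<lambda>_ x. nxt x x)"
    have X: "X 0 = bas q0" "X (Suc n) = nxt (X n) (X n)" for n by (simp_all add: X_def)
    have XB: "?Bad (X n)" for n
    proof (induction n)
      case 0
      show ?case using q0 by (simp add: X)
    next
      case (Suc n)
      then show ?case using nxt X(2) by simp
    qed
    define r where "r n = nxt (X n)" for n
    have "fold r [0..<n] (bas q0) = X n" for n by (induction n) (simp_all add: X r_def)
    moreover have "X (Suc n) \<noteq> X n" for n using nxt[OF XB] X(2) by simp
    moreover have "\<forall>n. r n \<in> basic_reductions Q R" using nxt[OF XB] by (simp add: r_def)
    ultimately show False using never[OF bad_path[OF q0]] by metis
  next
    case False
    then obtain x where x: "?Bad x" "\<forall>r\<in>basic_reductions Q R. r x = x \<or> \<not> ?Bad (r x)" by blast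
    \<comment> \<open>Reducing a bad \<open>q\<close> of the support clears all bad coefficients of
      \<open>x\<close>. Read coefficient by coefficient, this determines the reduced form
      \<open>g\<close> of \<open>q\<close> up to good paths. The path \<open>q1\<close> is a bad one
      in \<open>g\<close>; the same equation forces it into the support of \<open>x\<close>, where
      it serves as \<open>q'\<close>.\<close>
    have F: "\<exists>r g q1. r \<in> basic_reductions Q R \<and>
        (\<forall>y. r y = y + pscale (lookup y q) (g - bas q)) \<and>
        (\<forall>p. ?bad p \<longrightarrow> lookup x p
            + lookup x q * (lookup g p - (if q = p then 1 else 0)) = 0) \<and>
        lookup g q = 0 \<and> ?bad q1 \<and> q1 \<noteq> q \<and> lookup g q1 \<noteq> 0"
      if q: "q \<in> keys x" "?bad q" for q
    proof -
      obtain q1 where q1: "(q1, q) \<in> step" "?bad q1" using not_acc_down[OF q(2)] by metis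
      obtain a s f c p where asc: "is_asc a s f c" "q = pcomp a (pcomp s c)" "p \<in> keys f"
        "q1 = pcomp a (pcomp p c)" by (rule step_obtain[OF q1(1)])
      define g where "g = kq_mult (bas a) (kq_mult f (bas c))"
      define r where "r = basic_reduction a s f c"
      have r: "r y = y + pscale (lookup y q) (g - bas q)" for y
        unfolding r_def g_def asc(2) by (rule basic_reduction_eq)
      have rB: "r \<in> basic_reductions Q R" unfolding r_def by (rule basic_reductionI[OF asc(1)])
      have gq: "lookup g q = 0" unfolding g_def asc(2) by (rule sandwich_0_iff[OF asc(1)])
      have "q1 \<in> keys g" unfolding g_def keys_sandwich[OF asc(1)] asc(4) using asc(3) by blast
      then have gq1: "lookup g q1 \<noteq> 0" by (simp add: in_keys_iff)
      have "lookup (r x) q = 0" using gq by (simp add: r lookup_add lookup_minus lookup_bas)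
      then have "r x \<noteq> x" using q(1) by (auto simp: in_keys_iff)
      then have nB: "\<not> ?Bad (r x)" using x(2) rB by blast
      have "lookup x p + lookup x q * (lookup g p - (if q = p then 1 else 0)) = 0"
        if "?bad p" for p
      proof -
        have "lookup (r x) p = 0" using nB that by (metis in_keys_iff)
        then show ?thesis by (simp add: r lookup_add lookup_minus lookup_bas)
      qed
      then show ?thesis using rB r gq gq1 q1(2) step_paths(5)[OF q1(1)] by blast
    qed
    obtain q where q: "q \<in> keys x" "?bad q" using x(1) by blast
    obtain r g q' where r: "r \<in> basic_reductions Q R"
      "\<And>y. r y = y + pscale (lookup y q) (g - bas q)"
      "\<And>p. ?bad p \<Longrightarrow> lookup x p
            + lookup x q * (lookup g p - (if q = p then 1 else 0)) = 0"
      "lookup g q = 0" "?bad q'" "q' \<noteq> q" "lookup g q' \<noteq> 0"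
      using F[OF q] by metis
    have xq: "lookup x q \<noteq> 0" using q(1) by (simp add: in_keys_iff)
    have "lookup x q' \<noteq> 0" using r(3)[OF r(5)] r(6,7) xq by auto
    then have q': "q' \<in> keys x" by (simp add: in_keys_iff)
    obtain r' g' where r': "r' \<in> basic_reductions Q R"
      "\<And>y. r' y = y + pscale (lookup y q') (g' - bas q')"
      "\<And>p. ?bad p \<Longrightarrow> lookup x p
            + lookup x q' * (lookup g' p - (if q' = p then 1 else 0)) = 0"
      "lookup g' q' = 0"
      using F[OF q' r(5)] by metis
    have xq': "lookup x q' \<noteq> 0" using q' by (simp add: in_keys_iff)
    have g: "lookup g p = - lookup x p / lookup x q"
      if "?bad p" "p \<noteq> q" for p
    proof -
      have "lookup x q * lookup g p = - lookup x p"
        using r(3)[OF that(1)] that(2) by (simp add: add_eq_0_iff)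
      then show ?thesis using xq by (simp add: field_simps)
    qed
    have g': "lookup g' p = - lookup x p / lookup x q'"
      if "?bad p" "p \<noteq> q'" for p
    proof -
      have "lookup x q' * lookup g' p = - lookup x p"
        using r'(3)[OF that(1)] that(2) by (simp add: add_eq_0_iff)
      then show ?thesis using xq' by (simp add: field_simps)
    qed
    \<comment> \<open>Two states, up to good paths: a nonzero multiple of \<open>q\<close>, or a
      nonzero multiple of \<open>x\<close> without its \<open>q\<close> term. Reducing
      \<open>q\<close> leads from the first state to the second, reducing \<open>q'\<close> leads
      back.\<close>
    let ?A = "\<lambda>y. \<exists>\<alpha>. \<alpha> \<noteq> 0 \<and> (\<forall>p. ?bad p \<longrightarrow> lookup y p = (if p = q then \<alpha> else 0))"
    let ?B = "\<lambda>y. \<exists>\<beta>. \<beta> \<noteq> 0 \<and> (\<forall>p. ?bad p \<longrightarrow> lookup y p = (if p = q then 0 else \<beta> * lookup x p))"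
    have AB: "?B (r y)" if hy: "?A y" for y
    proof -
      obtain \<alpha> where a: "\<alpha> \<noteq> 0" "\<forall>p. ?bad p \<longrightarrow> lookup y p = (if p = q then \<alpha> else 0)"
        using hy by blast
      have yq: "lookup y q = \<alpha>" using a(2) q(2) by simp
      have "\<forall>p. ?bad p \<longrightarrow> lookup (r y) p
          = (if p = q then 0 else (- \<alpha> / lookup x q) * lookup x p)"
      proof (intro allI impI)
        fix p assume p: "?bad p"
        show "lookup (r y) p
          = (if p = q then 0 else (- \<alpha> / lookup x q) * lookup x p)"
          using a(2) p g[OF p] r(4) by (cases "p = q") (simp_all add: r(2) lookup_add lookup_minus lookup_bas yq)
      qed
      moreover have "- \<alpha> / lookup x q \<noteq> 0" using a(1) xq by simp
      ultimately show ?thesis by blast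
    qed
    have BA: "?A (r' y)" if hy: "?B y" for y
    proof -
      obtain \<beta> where b: "\<beta> \<noteq> 0"
        "\<forall>p. ?bad p \<longrightarrow> lookup y p = (if p = q then 0 else \<beta> * lookup x p)"
        using hy by blast
      have yq': "lookup y q' = \<beta> * lookup x q'" using b(2) r(5,6) by simp
      have "\<forall>p. ?bad p \<longrightarrow> lookup (r' y) p = (if p = q then - \<beta> * lookup x q else 0)"
      proof (intro allI impI)
        fix p assume p: "?bad p"
        show "lookup (r' y) p = (if p = q then - \<beta> * lookup x q else 0)"
        proof (cases "p = q'")
          case True
          then show ?thesis using r'(4) r(6) by (simp add: r'(2) lookup_add lookup_minus lookup_bas yq')
        next
          case False
          then have "q' \<noteq> p" by simp
          then show ?thesis using b(2) p g'[OF p False] xq'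
            by (simp add: r'(2) lookup_add lookup_minus lookup_bas yq')
        qed
      qed
      moreover have "- \<beta> * lookup x q \<noteq> 0" using b(1) xq by simp
      ultimately show ?thesis by blast
    qed
    define rr where "rr i = (if even i then r else r')" for i :: nat
    have AorB: "if even n then ?A (fold rr [0..<n] (bas q)) else ?B (fold rr [0..<n] (bas q))" for n
    proof (induction n)
      case 0
      show ?case using q(2) by (auto intro!: exI[of _ 1] simp: lookup_bas)
    next
      case (Suc n)
      have e: "fold rr [0..<Suc n] (bas q) = rr n (fold rr [0..<n] (bas q))" by simp
      show ?case unfolding e using Suc AB BA by (cases "even n") (simp_all add: rr_def)
    qed
    \<comment> \<open>The coefficient of \<open>q\<close> is nonzero in one state and zero in the
      other, so no step of the alternating sequence is idle.\<close>
    have nAB: "\<not> (?A y \<and> ?B y)" for y using q(2) by auto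
    have "fold rr [0..<Suc n] (bas q) \<noteq> fold rr [0..<n] (bas q)" for n
    proof
      assume e: "fold rr [0..<Suc n] (bas q) = fold rr [0..<n] (bas q)"
      let ?z = "fold rr [0..<n] (bas q)"
      have "if even n then ?A ?z else ?B ?z" by (rule AorB)
      moreover have "if even (Suc n) then ?A ?z else ?B ?z" using AorB[of "Suc n"] unfolding e .
      ultimately have "?A ?z \<and> ?B ?z"
        by (cases "even n") (simp_all only: even_Suc if_True if_False simp_thms)
      with nAB show False by (rule notE)
    qed
    moreover have "\<forall>i. rr i \<in> basic_reductions Q R" using r(1) r'(1) by (simp add: rr_def)
    ultimately show False using never[OF bad_path[OF q(2)]] by metis
  qed
qed

section \<open>Counting the paths below a given path\<close>

definition decomps :: "('v, 'e) qpath \<Rightarrow> (('v, 'e) qpath \<times> ('v, 'e) qpath \<times> ('v, 'e) qpath) set" where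
  "decomps w = {(a, p, c). a \<in> PQ \<and> p \<in> PQ \<and> c \<in> PQ \<and> composable a p \<and> composable p c \<and>
     w = pcomp a (pcomp p c)}"

text \<open>The lengths of the two left pieces determine the decomposition, because the source of
  the path is fixed and each piece begins where the previous one ends.\<close>

lemma finite_decomps: "finite (decomps w)"
proof -
  let ?g = "\<lambda>(a, p, c). (length (parr a), length (parr p))"
  have "inj_on ?g (decomps w)"
  proof (rule inj_onI)
    fix z z' assume z: "z \<in> decomps w" "z' \<in> decomps w" "?g z = ?g z'"
    obtain a p c where zz: "z = (a, p, c)" by (rule prod_cases3)
    obtain a' p' c' where zz': "z' = (a', p', c')" by (rule prod_cases3)
    have d: "a \<in> PQ" "p \<in> PQ" "c \<in> PQ" "composable a p" "composable p c" "w = pcomp a (pcomp p c)"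
      using z(1) unfolding zz decomps_def by simp_all
    have d': "a' \<in> PQ" "p' \<in> PQ" "c' \<in> PQ" "composable a' p'" "composable p' c'" "w = pcomp a' (pcomp p' c')"
      using z(2) unfolding zz' decomps_def by simp_all
    have l: "length (parr a) = length (parr a')" "length (parr p) = length (parr p')"
      using z(3) unfolding zz zz' by simp_all
    have e: "pcomp a (pcomp p c) = pcomp a' (pcomp p' c')" using d(6) d'(6) by simp
    have eq: "parr a = parr a'" "parr p = parr p'" "parr c = parr c'"
      using arg_cong[OF e, of parr] l by simp_all
    have a: "a = a'" by (rule qpath_eqI_src[OF d(1) d'(1) _ eq(1)]) (use arg_cong[OF e, of psrc] in simp)
    have p: "p = p'" by (rule qpath_eqI_src[OF d(2) d'(2) _ eq(2)]) (use d(4) d'(4) a in \<open>simp add: composable_def\<close>)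
    have "c = c'" by (rule qpath_eqI_src[OF d(3) d'(3) _ eq(3)]) (use d(5) d'(5) p in \<open>simp add: composable_def\<close>)
    then show "z = z'" using zz zz' a p by simp
  qed
  moreover have "?g ` decomps w \<subseteq> {..length (parr w)} \<times> {..length (parr w)}"
    unfolding decomps_def by fastforce
  then have "finite (?g ` decomps w)" by (rule finite_subset) simp
  ultimately show ?thesis by (rule finite_imageD[rotated])
qed

text \<open>A path has finitely many occurrences of elements of \<open>S\<close>, each
  \<open>s\<close> has one \<open>f\<close>, and \<open>f\<close> has finite support.\<close>

lemma finite_step: "finite {v. (v, w) \<in> step}"
proof -
  have "{v. (v, w) \<in> step} \<subseteq> (\<Union>z\<in>decomps w. case z of (a, s, c) \<Rightarrow>
      (\<Union>f\<in>{f. (s, f) \<in> R}. (\<lambda>q. pcomp a (pcomp q c)) ` keys f))"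
  proof
    fix v assume "v \<in> {v. (v, w) \<in> step}"
    then have "(v, w) \<in> step" by simp
    then obtain a s f c q where asc: "is_asc a s f c" "w = pcomp a (pcomp s c)" "q \<in> keys f"
      "v = pcomp a (pcomp q c)" by (rule step_obtain)
    have "(a, s, c) \<in> decomps w" unfolding decomps_def using is_ascD[OF asc(1)] asc(2) by simp
    moreover have "v \<in> (case (a, s, c) of (a, s, c) \<Rightarrow>
      (\<Union>f\<in>{f. (s, f) \<in> R}. (\<lambda>q. pcomp a (pcomp q c)) ` keys f))"
      using is_ascD(1)[OF asc(1)] asc(3,4) by auto
    ultimately show "v \<in> (\<Union>z\<in>decomps w. case z of (a, s, c) \<Rightarrow>
      (\<Union>f\<in>{f. (s, f) \<in> R}. (\<lambda>q. pcomp a (pcomp q c)) ` keys f))" by (rule UN_I)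
  qed
  moreover have "finite {f. (s, f) \<in> R}" for s
  proof (cases "\<exists>f. (s, f) \<in> R")
    case True
    then obtain f where "(s, f) \<in> R" by blast
    then have "{f. (s, f) \<in> R} \<subseteq> {f}" using redsys_unique by blast
    then show ?thesis by (rule finite_subset) simp
  qed simp
  then have "finite (\<Union>z\<in>decomps w. case z of (a, s, c) \<Rightarrow>
      (\<Union>f\<in>{f. (s, f) \<in> R}. (\<lambda>q. pcomp a (pcomp q c)) ` keys f))"
    using finite_decomps[of w] by (intro finite_UN_I) (simp_all split: prod.split)
  ultimately show ?thesis by (rule finite_subset)
qed

text \<open>Konig's argument as a well-founded induction. It makes \<open>rho\<close> an honest
  count, whereas \<open>card\<close> would return 0 on an infinite set.\<close>

lemma finite_down: "finite {v. (v, w) \<in> step\<^sup>+}"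
proof (induction w rule: wf_induct_rule[OF wf_step])
  case (1 w)
  have "{v. (v, w) \<in> step\<^sup>+} \<subseteq> (\<Union>u\<in>{u. (u, w) \<in> step}. insert u {v. (v, u) \<in> step\<^sup>+})"
    by (auto elim: tranclE)
  moreover have "finite \<dots>" using finite_step 1 by simp
  ultimately show ?case by (rule finite_subset)
qed

definition rho :: "('v, 'e) qpath \<Rightarrow> nat" where "rho w = card {v. (v, w) \<in> step\<^sup>+}"

text \<open>The inclusion of down-sets is strict because \<open>v\<close> lies below
  \<open>w\<close> but, by well-foundedness, not below itself.\<close>

lemma rho_less: "(v, w) \<in> step\<^sup>+ \<Longrightarrow> rho v < rho w"
proof -
  assume vw: "(v, w) \<in> step\<^sup>+"
  have nv: "(v, v) \<notin> step\<^sup>+" by (rule wf_not_refl[OF wf_trancl[OF wf_step]])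
  have "{u. (u, v) \<in> step\<^sup>+} \<subseteq> {u. (u, w) \<in> step\<^sup>+}"
    by (rule subsetI, unfold mem_Collect_eq) (rule trancl_trans[OF _ vw])
  moreover have "v \<in> {u. (u, w) \<in> step\<^sup>+}" "v \<notin> {u. (u, v) \<in> step\<^sup>+}" using vw nv by simp_all
  ultimately have "{u. (u, v) \<in> step\<^sup>+} \<subset> {u. (u, w) \<in> step\<^sup>+}" by (metis psubsetI)
  then show ?thesis unfolding rho_def by (rule psubset_card_mono[OF finite_down])
qed

lemma step_rtrancl_paths:
  assumes "(v, w) \<in> step\<^sup>*" "w \<in> PQ"
  shows "v \<in> PQ" "psrc v = psrc w" "ptgt v = ptgt w"
proof -
  have "v \<in> PQ \<and> psrc v = psrc w \<and> ptgt v = ptgt w"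
    using assms by (induction rule: converse_rtrancl_induct) (simp_all add: step_paths)
  then show "v \<in> PQ" "psrc v = psrc w" "ptgt v = ptgt w" by blast+
qed

lemma step_rtrancl_left:
  assumes "(v, w) \<in> step\<^sup>*" "w \<in> PQ" "x \<in> PQ" "composable x w"
  shows "(pcomp x v, pcomp x w) \<in> step\<^sup>*"
  using assms
proof (induction rule: converse_rtrancl_induct)
  case (step y z)
  have "composable x z" using step_rtrancl_paths(2)[OF step(2,4)] step(6) by (simp add: composable_def)
  then have "(pcomp x y, pcomp x z) \<in> local.step" by (rule step_left[OF step(1,5)])
  then show ?case using step.IH[OF step(4-6)] by (rule converse_rtrancl_into_rtrancl)
qed simp

lemma step_rtrancl_right:
  assumes "(v, w) \<in> step\<^sup>*" "w \<in> PQ" "x \<in> PQ" "composable w x"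
  shows "(pcomp v x, pcomp w x) \<in> step\<^sup>*"
  using assms
proof (induction rule: converse_rtrancl_induct)
  case (step y z)
  have "composable z x" using step_rtrancl_paths(3)[OF step(2,4)] step(6) by (simp add: composable_def)
  then have "(pcomp y x, pcomp z x) \<in> local.step" by (rule step_right[OF step(1,5)])
  then show ?case using step.IH[OF step(4-6)] by (rule converse_rtrancl_into_rtrancl)
qed simp

lemma step_trancl_left:
  assumes "(v, w) \<in> step\<^sup>+" "w \<in> PQ" "x \<in> PQ" "composable x w"
  shows "(pcomp x v, pcomp x w) \<in> step\<^sup>+"
proof -
  obtain u where u: "(v, u) \<in> step\<^sup>*" "(u, w) \<in> step" using assms(1) by (metis tranclD2)
  have "composable x u" using step_paths(3)[OF u(2)] assms(4) by (simp add: composable_def)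
  from step_rtrancl_left[OF u(1) step_paths(1)[OF u(2)] assms(3) this] step_left[OF u(2) assms(3,4)]
  show ?thesis by (rule rtrancl_into_trancl1)
qed

lemma step_trancl_right:
  assumes "(v, w) \<in> step\<^sup>+" "w \<in> PQ" "x \<in> PQ" "composable w x"
  shows "(pcomp v x, pcomp w x) \<in> step\<^sup>+"
proof -
  obtain u where u: "(v, u) \<in> step\<^sup>*" "(u, w) \<in> step" using assms(1) by (metis tranclD2)
  have "composable u x" using step_paths(4)[OF u(2)] assms(4) by (simp add: composable_def)
  from step_rtrancl_right[OF u(1) step_paths(1)[OF u(2)] assms(3) this] step_right[OF u(2) assms(3,4)]
  show ?thesis by (rule rtrancl_into_trancl1)
qed

section \<open>Composite reductions and the order on scalar multiples of paths\<close>

lemma reductions_id: "id \<in> reductions Q R"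
  unfolding reductions_def by (intro CollectI exI[of _ "[]"]) simp

lemma reductions_basic: "r \<in> basic_reductions Q R \<Longrightarrow> r \<in> reductions Q R"
  unfolding reductions_def by (intro CollectI exI[of _ "[r]"]) simp

lemma foldr_comp_append: "foldr (\<circ>) (xs @ ys) id = foldr (\<circ>) xs id \<circ> foldr (\<circ>) ys id"
  by (induction xs) (simp_all add: comp_assoc)

lemma reductions_comp:
  assumes "r \<in> reductions Q R" "r' \<in> reductions Q R"
  shows "r \<circ> r' \<in> reductions Q R"
proof -
  obtain xs where xs: "set xs \<subseteq> basic_reductions Q R" "r = foldr (\<circ>) xs id" using assms(1) unfolding reductions_def by blast
  obtain ys where ys: "set ys \<subseteq> basic_reductions Q R" "r' = foldr (\<circ>) ys id" using assms(2) unfolding reductions_def by blast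
  have "r \<circ> r' = foldr (\<circ>) (xs @ ys) id" unfolding xs(2) ys(2) by (rule foldr_comp_append[symmetric])
  moreover have "set (xs @ ys) \<subseteq> basic_reductions Q R" using xs(1) ys(1) by simp
  ultimately show ?thesis unfolding reductions_def by blast
qed

lemma reductions_induct [consumes 1, case_names id comp]:
  assumes "r \<in> reductions Q R" "P id"
    and "\<And>b r. b \<in> basic_reductions Q R \<Longrightarrow> r \<in> reductions Q R \<Longrightarrow> P r \<Longrightarrow> P (b \<circ> r)"
  shows "P r"
proof -
  obtain xs where xs: "set xs \<subseteq> basic_reductions Q R" "r = foldr (\<circ>) xs id" using assms(1) unfolding reductions_def by blast
  have "P (foldr (\<circ>) xs id)" using xs(1)
  proof (induction xs)
    case Nil
    have "foldr (\<circ>) [] id = (id :: ('v, 'e, 'k) kq \<Rightarrow> _)" by simp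
    then show ?case using assms(2) by (simp only:)
  next
    case (Cons b xs)
    have b: "b \<in> basic_reductions Q R" and sub: "set xs \<subseteq> basic_reductions Q R" using Cons.prems by simp_all
    have "foldr (\<circ>) xs id \<in> reductions Q R" unfolding reductions_def using sub by blast
    then have "P (b \<circ> foldr (\<circ>) xs id)" by (rule assms(3)[OF b _ Cons.IH[OF sub]])
    moreover have "foldr (\<circ>) (b # xs) id = b \<circ> foldr (\<circ>) xs id" by simp
    ultimately show ?case by (simp only:)
  qed
  then show ?thesis unfolding xs(2) .
qed

lemma basic_obtain:
  assumes "r \<in> basic_reductions Q R"
  obtains a s f c where "is_asc a s f c" "r = basic_reduction a s f c"
  using assms unfolding basic_reductions_iff by blast

lemma klin_basic: "r \<in> basic_reductions Q R \<Longrightarrow> klin r"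
  using klin_basic_reduction by (metis basic_obtain)

lemma klin_reduction: "r \<in> reductions Q R \<Longrightarrow> klin r"
proof (induction rule: reductions_induct)
  case id
  show ?case unfolding id_def by simp
next
  case (comp b r)
  show ?case unfolding comp_def by (rule klin_compose[OF klin_basic[OF comp(1)] comp(3)])
qed

lemma basic_bas:
  assumes "r \<in> basic_reductions Q R" "p \<in> PQ"
  shows "r (bas p) = bas p \<or> (\<forall>q\<in>keys (r (bas p)). (q, p) \<in> step)"
proof -
  obtain a s f c where r: "is_asc a s f c" "r = basic_reduction a s f c" by (rule basic_obtain[OF assms(1)])
  show ?thesis
  proof (cases "p = pcomp a (pcomp s c)")
    case True
    have "\<forall>q\<in>keys (r (bas p)). (q, p) \<in> step"
    proof
      fix q assume "q \<in> keys (r (bas p))"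
      then have "q \<in> (\<lambda>q. pcomp a (pcomp q c)) ` keys f"
        unfolding r(2) basic_reduction_bas using True keys_sandwich[OF r(1)] by simp
      then obtain q' where "q' \<in> keys f" "q = pcomp a (pcomp q' c)" by (rule imageE)
      then show "(q, p) \<in> step" using stepI[OF r(1)] True by simp
    qed
    then show ?thesis ..
  next
    case False
    then show ?thesis unfolding r(2) basic_reduction_bas by simp
  qed
qed

lemma keys_basic:
  assumes "r \<in> basic_reductions Q R" "x \<in> kspace PQ" "q \<in> keys (r x)"
  shows "q \<in> keys x \<or> (\<exists>p\<in>keys x. (q, p) \<in> step)"
proof -
  obtain p where p: "p \<in> keys x" "q \<in> keys (r (bas p))"
    using subsetD[OF keys_klin[OF klin_basic[OF assms(1)]] assms(3)] by (rule UN_E)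
  have pP: "p \<in> PQ" using p(1) assms(2) unfolding kspace_def by (metis mem_Collect_eq subsetD)
  from basic_bas[OF assms(1) pP] show ?thesis
  proof
    assume "r (bas p) = bas p"
    then have "q = p" using p(2) by simp
    then show ?thesis using p(1) by simp
  next
    assume "\<forall>q\<in>keys (r (bas p)). (q, p) \<in> step"
    then have "(q, p) \<in> step" using p(2) by (rule bspec)
    then show ?thesis using p(1) by metis
  qed
qed

lemma kspace_key: "x \<in> kspace X \<Longrightarrow> p \<in> keys x \<Longrightarrow> p \<in> X"
  unfolding kspace_def by (metis mem_Collect_eq subsetD)

lemma kspaceI: "(\<And>p. p \<in> keys x \<Longrightarrow> p \<in> X) \<Longrightarrow> x \<in> kspace X"
  unfolding kspace_def by (metis mem_Collect_eq subsetI)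

lemma basic_kspace: "r \<in> basic_reductions Q R \<Longrightarrow> x \<in> kspace PQ \<Longrightarrow> r x \<in> kspace PQ"
  using keys_basic step_paths(1) kspace_key by (metis kspaceI)

lemma reduction_kspace: "r \<in> reductions Q R \<Longrightarrow> x \<in> kspace PQ \<Longrightarrow> r x \<in> kspace PQ"
  by (induction rule: reductions_induct) (simp_all add: basic_kspace)

lemma irred_fixed: "r \<in> reductions Q R \<Longrightarrow> irred Q R x \<Longrightarrow> r x = x"
proof (induction rule: reductions_induct)
  case (comp b r)
  have "b x = x" by (rule bspec[OF comp(4)[unfolded irred_def] comp(1)])
  then show ?case using comp by simp
qed simp

text \<open>Once a reduction hits \<open>q\<close>, everything left lies strictly below it. So the
  coefficient of \<open>q\<close> is either untouched or gone, and never rescaled.\<close>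

lemma reduction_single:
  assumes "r \<in> reductions Q R" "q \<in> PQ"
  shows "r (pscale d (bas q)) = pscale d (bas q) \<or>
    (\<forall>p\<in>keys (r (pscale d (bas q))). (p, q) \<in> step\<^sup>+)"
  using assms(1)
proof (induction rule: reductions_induct)
  case id
  show ?case by simp
next
  case (comp b r)
  let ?x = "pscale d (bas q) :: ('v, 'e, 'k) kq"
  have x: "?x \<in> kspace PQ" using assms(2) by (simp add: kspace_pscale)
  from comp(3) show ?case
  proof
    assume e: "r ?x = ?x"
    have "b ?x = pscale d (b (bas q))" by (rule klin_pscale[OF klin_basic[OF comp(1)]])
    moreover from basic_bas[OF comp(1) assms(2)]
    have "b (bas q) = bas q \<or> (\<forall>p\<in>keys (pscale d (b (bas q))). (p, q) \<in> step\<^sup>+)"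
      by (auto simp: keys_pscale)
    ultimately show ?thesis using e by auto
  next
    assume l: "\<forall>p\<in>keys (r ?x). (p, q) \<in> step\<^sup>+"
    have "(p, q) \<in> step\<^sup>+" if p: "p \<in> keys (b (r ?x))" for p
    proof -
      from keys_basic[OF comp(1) reduction_kspace[OF comp(2) x] p]
      show ?thesis using l by (metis trancl_into_trancl2)
    qed
    then show ?thesis by simp
  qed
qed

text \<open>The strict order excludes only equality of scalar multiples, so different multiples of
  one path must be shown to be incomparable. This follows from \<open>reduction_single\<close>: a
  path that has been reduced does not reappear with another coefficient.\<close>

lemma prec_step:
  fixes c :: 'k
  assumes "prec Q R (Poly_Mapping.single p c) (bas q)" "c \<noteq> 0"
  shows "(p, q) \<in> step\<^sup>+"
proof -
  \<comment> \<open>The invariant of the inductive order: related nonzero elements are multiples of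
    paths that are strictly ordered by \<open>step\<close>, or they are equal with the scalar
    included.\<close>
  define P where "P x y \<longleftrightarrow> x = 0 \<or> (\<exists>p c q d. x = pscale c (bas p) \<and> y = pscale d (bas q) \<and> c \<noteq> 0 \<and> d \<noteq> 0 \<and>
      ((p, q) \<in> step\<^sup>+ \<or> x = y))" for x y :: "('v, 'e, 'k) kq"
  have inj: "p = q \<and> c = d" if "pscale c (bas p) = pscale d (bas q)" "c \<noteq> 0"
    for p q :: "('v, 'e) qpath" and c d :: 'k
  proof -
    have "c = lookup (pscale d (bas q)) p" using arg_cong[OF that(1), of "\<lambda>x. lookup x p"]
      by (simp add: lookup_bas)
    then show ?thesis using that(2) by (simp add: lookup_bas split: if_splits)
  qed
  have P: "P x y" if "preceq Q R x y" for x y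
    using that
  proof (induction rule: preceq.induct)
    case (refl x)
    then show ?case unfolding spaths_def P_def single_eq_pscale by blast
  next
    case (trans x y z)
    show ?case
    proof (cases "x = 0")
      case False
      obtain p c q d where xy: "x = pscale c (bas p)" "y = pscale d (bas q)" "c \<noteq> 0" "d \<noteq> 0" "(p, q) \<in> step\<^sup>+ \<or> x = y"
        using trans(3) False unfolding P_def by metis
      have "y \<noteq> 0" using xy by simp
      then obtain p' c' q' d' where yz: "y = pscale c' (bas p')" "z = pscale d' (bas q')" "c' \<noteq> 0" "d' \<noteq> 0" "(p', q') \<in> step\<^sup>+ \<or> y = z"
        using trans(4) unfolding P_def by metis
      have e: "q = p'" "d = c'" using inj[of d q c' p'] xy yz by simp_all
      show ?thesis
      proof (cases "x = y \<or> y = z")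
        case True
        then show ?thesis using trans(3,4) by auto
      next
        case neq: False
        then have "(p, q') \<in> step\<^sup>+" using xy(5) yz(5) e by (metis trancl_trans)
        then show ?thesis unfolding P_def using xy yz by blast
      qed
    qed (simp add: P_def)
  next
    case (red c d p q r x)
    let ?s = "pscale d (bas q) :: ('v, 'e, 'k) kq"
    have e: "r ?s = pscale c (bas p) + x" using red.hyps(8) by (simp add: single_eq_pscale)
    have lp: "lookup (r ?s) p = c" using red.hyps(7) by (simp add: e lookup_add lookup_bas in_keys_iff)
    then have pk: "p \<in> keys (r ?s)" using red.hyps(1) by (simp add: in_keys_iff)
    from reduction_single[OF red.hyps(5,4), of d] show ?case
    proof
      assume "r ?s = ?s"
      then have "p = q" "c = d" using lp red.hyps(1) by (simp_all add: lookup_bas split: if_splits)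
      then show ?thesis unfolding P_def single_eq_pscale using red.hyps(1) by blast
    next
      assume "\<forall>p\<in>keys (r ?s). (p, q) \<in> step\<^sup>+"
      then have "(p, q) \<in> step\<^sup>+" using pk by (rule bspec)
      then show ?thesis unfolding P_def single_eq_pscale using red.hyps(1,2) by blast
    qed
  next
    case (zero x)
    then show ?case by (simp add: P_def)
  qed
  have "preceq Q R (pscale c (bas p)) (bas q)" and ne: "pscale c (bas p) \<noteq> bas q"
    using assms(1) by (simp_all add: prec_def single_eq_pscale)
  then have "P (pscale c (bas p)) (bas q)" using P by simp
  moreover have "pscale c (bas p :: ('v, 'e, 'k) kq) \<noteq> 0" using assms(2) by simp
  ultimately obtain p' c' q' d' where h: "pscale c (bas p) = pscale c' (bas p' :: ('v, 'e, 'k) kq)"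
    "bas q = pscale d' (bas q' :: ('v, 'e, 'k) kq)" "c' \<noteq> 0" "d' \<noteq> 0" "(p', q') \<in> step\<^sup>+"
    using ne unfolding P_def by metis
  have "p = p'" using inj[OF h(1) assms(2)] by simp
  moreover have "q = q'" using inj[of 1 q d' q'] h(2) by simp
  ultimately show ?thesis using h(5) by simp
qed

section \<open>Normal forms\<close>

text \<open>Reducing one path may enlarge the support by other reducible ones, but only with smaller
  \<open>rho\<close>. Hence the outer induction bounds \<open>rho\<close> on the reducible paths and
  the inner one counts those at the largest permitted value.\<close>

lemma ex_irreducible_reduction:
  assumes "x \<in> kspace PQ"
  shows "\<exists>r\<in>reductions Q R. irred Q R (r x)"
proof -
  have "\<exists>r\<in>reductions Q R. irred Q R (r x)"
    if "x \<in> kspace PQ" "\<forall>p\<in>keys x. wred SW (parr p) \<longrightarrow> rho p < m" for x m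
    using that
  proof (induction m arbitrary: x)
    case 0
    then have "irred Q R x" by (simp add: irred_iff)
    then show ?case using reductions_id by (metis id_apply)
  next
    case (Suc m)
    \<comment> \<open>Reducing one path of this set deletes it and adds none, since all new paths
      have \<open>rho\<close> below \<open>m\<close>.\<close>
    let ?K = "\<lambda>x :: ('v, 'e, 'k) kq. {p \<in> keys x. wred SW (parr p) \<and> rho p = m}"
    from Suc.prems show ?case
    proof (induction "card (?K x)" arbitrary: x rule: less_induct)
      case less
      show ?case
      proof (cases "?K x = {}")
        case True
        then have "\<forall>p\<in>keys x. wred SW (parr p) \<longrightarrow> rho p < m"
          using less.prems(2) by (metis (mono_tags, lifting) empty_iff less_SucE mem_Collect_eq)
        then show ?thesis using Suc.IH less.prems(1) by metis
      next
        case False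
        then obtain p where p: "p \<in> keys x" "wred SW (parr p)" "rho p = m" by blast
        obtain a s f c where asc: "is_asc a s f c" "p = pcomp a (pcomp s c)"
          using wred_iff[OF kspace_key[OF less.prems(1) p(1)]] p(2) by metis
        define r where "r = basic_reduction a s f c"
        have rB: "r \<in> basic_reductions Q R" unfolding r_def by (rule basic_reductionI[OF asc(1)])
        define g where "g = kq_mult (bas a) (kq_mult f (bas c))"
        have rx: "r x = x + pscale (lookup x p) (g - bas p)"
          unfolding r_def g_def asc(2) by (rule basic_reduction_eq)
        have gp: "lookup g p = 0" unfolding g_def asc(2) by (rule sandwich_0_iff[OF asc(1)])
        have rxp: "lookup (r x) p = 0" using gp by (simp add: rx lookup_add lookup_minus lookup_bas)
        have gk: "rho q < m" if "q \<in> keys g" for q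
        proof -
          have "q \<in> (\<lambda>q. pcomp a (pcomp q c)) ` keys f"
            using that unfolding g_def keys_sandwich[OF asc(1)] .
          then obtain q' where "q' \<in> keys f" "q = pcomp a (pcomp q' c)" by (rule imageE)
          then have "(q, p) \<in> step" using stepI[OF asc(1)] asc(2) by simp
          then show ?thesis using rho_less[of q p] p(3) by (simp add: r_into_trancl')
        qed
        have k: "q \<in> keys x \<and> q \<noteq> p \<or> rho q < m" if q: "q \<in> keys (r x)" for q
        proof (cases "q \<in> keys g")
          case True
          then show ?thesis using gk by simp
        next
          case False
          have "q \<noteq> p" using q rxp by (metis in_keys_iff)
          moreover have "lookup (r x) q = lookup x q"
            using False \<open>q \<noteq> p\<close> by (simp add: rx lookup_add lookup_minus lookup_bas in_keys_iff)
          ultimately show ?thesis using q by (metis in_keys_iff)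
        qed
        have rxP: "r x \<in> kspace PQ" by (rule basic_kspace[OF rB less.prems(1)])
        have "?K (r x) \<subset> ?K x"
        proof (rule psubsetI)
          show "?K (r x) \<subseteq> ?K x"
          proof
            fix q assume "q \<in> ?K (r x)"
            then have q: "q \<in> keys (r x)" "wred SW (parr q)" "rho q = m" by simp_all
            then have "q \<in> keys x" using k[OF q(1)] by simp
            then show "q \<in> ?K x" using q by simp
          qed
          have "p \<in> ?K x" using p by simp
          moreover have "p \<notin> ?K (r x)" using rxp by (simp add: in_keys_iff)
          ultimately show "?K (r x) \<noteq> ?K x" by metis
        qed
        then have "card (?K (r x)) < card (?K x)" by (intro psubset_card_mono) simp_all
        moreover have "\<forall>q\<in>keys (r x). wred SW (parr q) \<longrightarrow> rho q < Suc m"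
          using k less.prems(2) by (metis less_SucI)
        ultimately obtain r' where r': "r' \<in> reductions Q R" "irred Q R (r' (r x))"
          using less.hyps[of "r x"] rxP by metis
        have "r' \<circ> r \<in> reductions Q R" by (rule reductions_comp[OF r'(1) reductions_basic[OF rB]])
        moreover have "irred Q R ((r' \<circ> r) x)" using r'(2) by simp
        ultimately show ?thesis by metis
      qed
    qed
  qed
  moreover have "\<forall>p\<in>keys x. wred SW (parr p) \<longrightarrow> rho p < Suc (Max (rho ` keys x))"
    by (simp add: less_Suc_eq_le)
  ultimately show ?thesis using assms by metis
qed

text \<open>Reductions fix irreducible elements, so the members of \<open>F\<close> can be treated
  one after the other by a single composite. Having one linear map for all of \<open>F\<close> is
  the key to the additivity of normal forms.\<close>

lemma ex_common_reduction:
  assumes "finite F" "F \<subseteq> kspace PQ"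
  shows "\<exists>r\<in>reductions Q R. \<forall>x\<in>F. irred Q R (r x)"
  using assms
proof (induction F)
  case empty
  show ?case using reductions_id by (metis empty_iff)
next
  case (insert x F)
  then obtain r where r: "r \<in> reductions Q R" "\<forall>x\<in>F. irred Q R (r x)" by (metis insert_subset)
  have "r x \<in> kspace PQ" using insert.prems by (intro reduction_kspace[OF r(1)]) simp
  then obtain r' where r': "r' \<in> reductions Q R" "irred Q R (r' (r x))" using ex_irreducible_reduction by metis
  have "irred Q R ((r' \<circ> r) y)" if "y \<in> insert x F" for y
  proof (cases "y = x")
    case True
    then show ?thesis using r'(2) by simp
  next
    case False
    then have "irred Q R (r y)" using that r(2) by simp
    then show ?thesis using irred_fixed[OF r'(1)] by simp
  qed
  then show ?case using reductions_comp[OF r'(1) r(1)] by metis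
qed

text \<open>The choice is immaterial for paths by reduction-uniqueness. That condition speaks of
  single paths, so linear combinations are reached by the linear extension \<open>N\<close>.\<close>

definition NF :: "('v, 'e) qpath \<Rightarrow> ('v, 'e, 'k) kq" where
  "NF p = (SOME y. \<exists>r\<in>reductions Q R. y = r (bas p) \<and> irred Q R y)"

definition N :: "('v, 'e, 'k) kq \<Rightarrow> ('v, 'e, 'k) kq" where "N = lin_ext NF"

lemma klin_N [simp, intro]: "klin N" by (simp add: N_def)

lemma N_bas [simp]: "N (bas p) = NF p" by (simp add: N_def)

lemma NF_spec:
  assumes "p \<in> PQ"
  obtains r where "r \<in> reductions Q R" "NF p = r (bas p)" "irred Q R (NF p)"
proof -
  have "\<exists>r\<in>reductions Q R. irred Q R (r (bas p))" using ex_irreducible_reduction[of "bas p"] assms by simp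
  then have "\<exists>y. \<exists>r\<in>reductions Q R. y = r (bas p) \<and> irred Q R y" by metis
  then have "\<exists>r\<in>reductions Q R. NF p = r (bas p) \<and> irred Q R (NF p)" unfolding NF_def by (rule someI_ex)
  then show ?thesis using that by metis
qed

lemma NF_unique:
  assumes "p \<in> PQ" "r \<in> reductions Q R" "irred Q R (r (bas p))"
  shows "r (bas p) = NF p"
proof -
  obtain r' where r': "r' \<in> reductions Q R" "NF p = r' (bas p)" "irred Q R (NF p)" by (rule NF_spec[OF assms(1)])
  have "\<forall>r \<in> reductions Q R. \<forall>r' \<in> reductions Q R.
        irred Q R (r (bas p)) \<longrightarrow> irred Q R (r' (bas p)) \<longrightarrow> r (bas p) = r' (bas p)"
    using lozengeD(2)[OF assms(1)] unfolding reduction_unique_def by (rule conjunct2)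
  from bspec[OF bspec[OF this assms(2)] r'(1)] show ?thesis using assms(3) r' by simp
qed

lemma NF_keys:
  assumes "p \<in> PQ" "q \<in> keys (NF p)"
  shows "q \<in> B" "(q, p) \<in> step\<^sup>*"
proof -
  obtain r where r: "r \<in> reductions Q R" "NF p = r (bas p)" "irred Q R (NF p)" by (rule NF_spec[OF assms(1)])
  have k: "NF p \<in> kspace PQ" unfolding r(2) using assms(1) by (intro reduction_kspace[OF r(1)]) simp
  show "q \<in> B" using irred_iff[OF k] r(3) assms(2) kspace_key[OF k assms(2)] by (simp add: B_iff)
  from reduction_single[OF r(1) assms(1), of 1] show "(q, p) \<in> step\<^sup>*"
  proof
    assume "r (pscale 1 (bas p)) = pscale 1 (bas p)"
    then show ?thesis using assms(2) r(2) by simp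
  next
    assume "\<forall>q\<in>keys (r (pscale 1 (bas p))). (q, p) \<in> step\<^sup>+"
    then show ?thesis using assms(2) r(2) by (simp add: trancl_into_rtrancl)
  qed
qed

lemma NF_B: "b \<in> B \<Longrightarrow> NF b = bas b"
proof -
  assume b: "b \<in> B"
  then have "b \<in> PQ" "irred Q R (id (bas b))" by (simp_all add: irred_paths_def)
  from NF_unique[OF this(1) reductions_id this(2)] show ?thesis by simp
qed

lemma N_kspace: "x \<in> kspace PQ \<Longrightarrow> N x \<in> kspace B"
  unfolding N_def by (rule kspace_lin_ext) (auto intro: kspaceI dest: NF_keys(1))

lemma B_PQ: "kspace B \<subseteq> kspace PQ"
  unfolding kspace_def irred_paths_def by blast

lemma N_kspace': "x \<in> kspace PQ \<Longrightarrow> N x \<in> kspace PQ"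
  using N_kspace B_PQ by (metis subsetD)

lemma N_idem: "x \<in> kspace B \<Longrightarrow> N x = x"
  by (rule klin_eqI[OF klin_N klin_id]) (simp add: NF_B kspace_key)

text \<open>Choose one reduction \<open>r'\<close> that makes \<open>r p\<close> and each path of
  its support irreducible. Linearity gives \<open>N (r p) = r' (r p)\<close>, and this is the normal
  form of \<open>p\<close> because \<open>r'\<close> after \<open>r\<close> is again a
  reduction.\<close>

lemma N_basic:
  assumes "r \<in> basic_reductions Q R" "x \<in> kspace PQ"
  shows "N (r x) = N x"
proof (rule klin_eqI[where F = "\<lambda>x. N (r x)" and G = N])
  show "klin (\<lambda>x. N (r x))" by (rule klin_compose[OF klin_N klin_basic[OF assms(1)]])
  fix p assume "p \<in> keys x"
  then have p: "p \<in> PQ" by (rule kspace_key[OF assms(2)])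
  let ?y = "r (bas p)"
  have y: "?y \<in> kspace PQ" using p by (intro basic_kspace[OF assms(1)]) simp
  let ?F = "insert ?y (bas ` keys ?y)"
  have "finite ?F" by simp
  moreover have "?F \<subseteq> kspace PQ" using y kspace_key[OF y] by auto
  ultimately obtain r' where r': "r' \<in> reductions Q R" "\<forall>z\<in>?F. irred Q R (r' z)"
    using ex_common_reduction by metis
  have "N ?y = lin_ext (\<lambda>q. r' (bas q)) ?y"
    unfolding N_def by (rule lin_ext_cong) (use NF_unique[OF kspace_key[OF y] r'(1)] r'(2) in simp)
  also have "\<dots> = r' ?y" by (rule klin_eq_lin_ext[OF klin_reduction[OF r'(1)], symmetric])
  also have "\<dots> = (r' \<circ> r) (bas p)" by simp
  also have "\<dots> = NF p"
    using r'(2) by (intro NF_unique[OF p reductions_comp[OF r'(1) reductions_basic[OF assms(1)]]]) simp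
  finally show "N (r (bas p)) = N (bas p)" by simp
qed simp

section \<open>The quotient algebra through normal forms\<close>

abbreviation PA :: "('v, 'e, 'k) kq ring" where "PA \<equiv> path_algebra Q"
abbreviation A :: "('v, 'e, 'k) qa ring" where "A \<equiv> quot_algebra Q I"
abbreviation \<pi> :: "('v, 'e, 'k) kq \<Rightarrow> ('v, 'e, 'k) qa" where "\<pi> \<equiv> proj Q I"

lemma PA_simps [simp]:
  "carrier PA = kspace PQ" "mult PA = kq_mult" "add PA = (+)" "zero PA = 0"
  "one PA = (\<Sum>v \<in> verts Q. bas (v, [], v))"
  by (simp_all add: path_algebra_def)

text \<open>The ring axioms of the path algebra, with associativity and unit, are contained in the
  locale assumption that \<open>I\<close> is an ideal.\<close>

lemma ring_PA: "ring PA"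
  using ideal_I by (rule ideal.axioms(2))

lemma PA_minus:
  assumes "x \<in> kspace PQ" "y \<in> kspace PQ"
  shows "\<ominus>\<^bsub>PA\<^esub> y = - y" "x \<ominus>\<^bsub>PA\<^esub> y = x - y"
proof -
  interpret ring PA by (rule ring_PA)
  show *: "\<ominus>\<^bsub>PA\<^esub> y = - y" using assms by (intro minus_equality) (simp_all add: kspace_uminus)
  show "x \<ominus>\<^bsub>PA\<^esub> y = x - y" unfolding a_minus_def * by simp
qed

lemma kq_mult_closed:
  fixes x y :: "('v, 'e, 'k) kq"
  shows "x \<in> kspace PQ \<Longrightarrow> y \<in> kspace PQ \<Longrightarrow> kq_mult x y \<in> kspace PQ"
  using ring.ring_simprules(5)[OF ring_PA, of x y] by simp

lemma kq_mult_assoc: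
  fixes x y z :: "('v, 'e, 'k) kq"
  shows "x \<in> kspace PQ \<Longrightarrow> y \<in> kspace PQ \<Longrightarrow> z \<in> kspace PQ \<Longrightarrow>
    kq_mult (kq_mult x y) z = kq_mult x (kq_mult y z)"
  using ring.ring_simprules(11)[OF ring_PA, of x y z] by simp

lemma one_kspace: "(\<Sum>v \<in> verts Q. bas (v, [], v) :: ('v, 'e, 'k) kq) \<in> kspace PQ"
  by (rule kspace_sum) (simp add: triv_in)

lemma kq_mult_one:
  fixes x :: "('v, 'e, 'k) kq"
  shows "x \<in> kspace PQ \<Longrightarrow> kq_mult x (\<Sum>v \<in> verts Q. bas (v, [], v)) = x"
    "x \<in> kspace PQ \<Longrightarrow> kq_mult (\<Sum>v \<in> verts Q. bas (v, [], v)) x = x"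
  using monoid.r_one[OF ring.is_monoid[OF ring_PA], of x] monoid.l_one[OF ring.is_monoid[OF ring_PA], of x] by simp_all

lemma kq_mult_pscale:
  fixes x y :: "('v, 'e, 'k) kq"
  shows "kq_mult (pscale c x) y = pscale c (kq_mult x y)" "kq_mult x (pscale c y) = pscale c (kq_mult x y)"
  using klin_pscale[OF klin_kq_mult_left] klin_pscale[OF klin_kq_mult_right] by metis+

lemma I_kspace: "x \<in> I \<Longrightarrow> x \<in> kspace PQ"
  using ideal.Icarr[OF ideal_I] by simp

lemma I_closed:
  "x \<in> I \<Longrightarrow> y \<in> I \<Longrightarrow> x + y \<in> I" "0 \<in> I"
  "x \<in> I \<Longrightarrow> y \<in> kspace PQ \<Longrightarrow> kq_mult y x \<in> I" "x \<in> I \<Longrightarrow> y \<in> kspace PQ \<Longrightarrow> kq_mult x y \<in> I"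
  using additive_subgroup.a_closed[OF ideal.axioms(1)[OF ideal_I], of x y]
    additive_subgroup.zero_closed[OF ideal.axioms(1)[OF ideal_I]]
    ideal.I_l_closed[OF ideal_I, of x y] ideal.I_r_closed[OF ideal_I, of x y] by simp_all

lemma I_pscale: "x \<in> I \<Longrightarrow> pscale c x \<in> I"
  using I_closed(3)[of x "pscale c (\<Sum>v \<in> verts Q. bas (v, [], v))"] one_kspace kq_mult_one(2)[of x] I_kspace[of x]
  by (simp add: kq_mult_pscale kspace_pscale)

lemma basic_diff_I:
  assumes "r \<in> basic_reductions Q R"
  shows "r x - x \<in> I"
proof -
  obtain a s f c where r: "is_asc a s f c" "r = basic_reduction a s f c" by (rule basic_obtain[OF assms])
  note D = is_ascD[OF r(1)]
  have sub: "{bas s - f | s f. (s, f) \<in> R} \<subseteq> carrier PA"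
    using redsysD(1,2) by (auto intro!: kspace_diff)
  have "bas s - f \<in> {bas s - f | s f. (s, f) \<in> R}" using D(1) by blast
  then have "bas s - f \<in> I" using ring.genideal_self[OF ring_PA sub] unfolding lozengeD(1) by (rule subsetD[rotated])
  then have "kq_mult (bas a) (kq_mult (bas s - f) (bas c)) \<in> I"
    using D(2,3) by (intro I_closed(3) I_closed(4)) simp_all
  moreover have "kq_mult (bas a) (kq_mult (bas s - f) (bas c))
      = bas (pcomp a (pcomp s c)) - kq_mult (bas a) (kq_mult f (bas c))"
    using klin_diff[OF klin_kq_mult_left, of "bas s" f "bas c"]
      klin_diff[OF klin_kq_mult_right, of "bas a" "kq_mult (bas s) (bas c)" "kq_mult f (bas c)"] D(4,5) by simp
  ultimately have "pscale (- lookup x (pcomp a (pcomp s c)))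
      (bas (pcomp a (pcomp s c)) - kq_mult (bas a) (kq_mult f (bas c))) \<in> I" using I_pscale by simp
  moreover have "pscale (- c) (x - y) = pscale c (y - x)" for c :: 'k and x y :: "('v, 'e, 'k) kq"
    by (rule poly_mapping_eqI) (simp add: lookup_minus algebra_simps)
  ultimately show ?thesis unfolding r(2) basic_reduction_eq by simp
qed

lemma N_diff_I:
  assumes "x \<in> kspace PQ"
  shows "N x - x \<in> I"
  using assms
proof (induction rule: kspace_induct)
  case zero
  show ?case using I_closed(2) by (simp add: klin_0)
next
  case (step p c y)
  have red: "r x - x \<in> I" if "r \<in> reductions Q R" for r and x :: "('v, 'e, 'k) kq"
    using that
  proof (induction rule: reductions_induct)
    case id
    show ?case using I_closed(2) by simp
  next
    case (comp b r)
    show ?case using I_closed(1)[OF basic_diff_I[OF comp(1), of "r x"] comp(3)] by simp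
  qed
  obtain r where "r \<in> reductions Q R" "NF p = r (bas p)" by (rule NF_spec[OF step(1)])
  then have "NF p - bas p \<in> I" using red by simp
  then have "pscale c (NF p - bas p) + (N y - y) \<in> I" using step(3) by (intro I_closed(1) I_pscale)
  moreover have "N (pscale c (bas p) + y) - (pscale c (bas p) + y) = pscale c (NF p - bas p) + (N y - y)"
    by (simp add: klin_add[OF klin_N] klin_pscale[OF klin_N] pscale_diff)
  ultimately show ?case by (simp only:)
qed

text \<open>The kernel of \<open>N\<close> is not visibly an ideal. Demanding that \<open>N\<close>
  kills \<open>a x c\<close> for all paths \<open>a\<close> and \<open>c\<close> defines an ideal
  \<open>K\<close> by construction. It contains the generators \<open>s - f\<close>, as
  \<open>N\<close> does not distinguish \<open>a s c\<close> from \<open>a f c\<close>.\<close>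

lemma N_I:
  assumes "x \<in> I"
  shows "N x = 0"
proof -
  define K where "K = {x \<in> kspace PQ. \<forall>a\<in>PQ. \<forall>c\<in>PQ. N (kq_mult (bas a) (kq_mult x (bas c))) = 0}"
  have lin: "klin (\<lambda>x. N (kq_mult (bas a) (kq_mult x (bas c))))" for a c
    by (rule klin_compose[OF klin_N klin_compose[OF klin_kq_mult_right klin_kq_mult_left]])
  have K: "x \<in> kspace PQ" "a \<in> PQ \<Longrightarrow> c \<in> PQ \<Longrightarrow> N (kq_mult (bas a) (kq_mult x (bas c))) = 0" if "x \<in> K" for x a c
    using that unfolding K_def by simp_all
  have "ideal K PA"
  proof (rule idealI[OF ring_PA])
    show "subgroup K (add_monoid PA)"
    proof (rule group.subgroupI[OF abelian_group.a_group[OF ring.is_abelian_group[OF ring_PA]]])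
      show "K \<subseteq> carrier (add_monoid PA)" using K(1) by auto
      have "0 \<in> K" unfolding K_def using klin_0[OF lin] by simp
      then show "K \<noteq> {}" by blast
      fix x assume x: "x \<in> K"
      have "inv\<^bsub>add_monoid PA\<^esub> x = - x" using PA_minus(1)[OF K(1)[OF x] K(1)[OF x]] unfolding a_inv_def .
      moreover have "- x \<in> K" unfolding K_def using K[OF x] klin_uminus[OF lin] by (simp add: kspace_uminus)
      ultimately show "inv\<^bsub>add_monoid PA\<^esub> x \<in> K" by simp
      fix y assume y: "y \<in> K"
      show "x \<otimes>\<^bsub>add_monoid PA\<^esub> y \<in> K" unfolding K_def using K[OF x] K[OF y] klin_add[OF lin] by (simp add: kspace_add)
    qed
    fix x y assume x: "x \<in> K" and y: "y \<in> carrier PA"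
    have yP: "y \<in> kspace PQ" using y by simp
    note xP = K(1)[OF x]
    have "N (kq_mult (bas a) (kq_mult (kq_mult y x) (bas c))) = 0" if ac: "a \<in> PQ" "c \<in> PQ" for a c
    proof -
      have "N (kq_mult (bas a) (kq_mult (kq_mult y x) (bas c))) = N (kq_mult (kq_mult (bas a) y) (kq_mult x (bas c)))"
        using yP xP ac by (simp add: kq_mult_assoc kq_mult_closed)
      also have "\<dots> = 0"
      proof (rule klin_eqI[where F = "\<lambda>y. N (kq_mult (kq_mult (bas a) y) (kq_mult x (bas c)))" and G = "\<lambda>_. 0"])
        show "klin (\<lambda>y. N (kq_mult (kq_mult (bas a) y) (kq_mult x (bas c))))"
          by (rule klin_compose[OF klin_N klin_compose[OF klin_kq_mult_left klin_kq_mult_right]])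
        show "klin (\<lambda>_. 0 :: ('v, 'e, 'k) kq)" by (rule klinI) simp_all
        fix p assume "p \<in> keys y"
        then have "p \<in> PQ" by (rule kspace_key[OF yP])
        then show "N (kq_mult (kq_mult (bas a) (bas p)) (kq_mult x (bas c))) = 0"
          using K(2)[OF x, of "pcomp a p" c] ac
          by (simp add: pcomp_qpath klin_0[OF klin_kq_mult_left] klin_0[OF klin_N])
      qed
      finally show ?thesis .
    qed
    then show "y \<otimes>\<^bsub>PA\<^esub> x \<in> K" unfolding K_def using xP yP by (simp add: kq_mult_closed)
    have "N (kq_mult (bas a) (kq_mult (kq_mult x y) (bas c))) = 0" if ac: "a \<in> PQ" "c \<in> PQ" for a c
    proof -
      have "N (kq_mult (bas a) (kq_mult (kq_mult x y) (bas c))) = N (kq_mult (bas a) (kq_mult x (kq_mult y (bas c))))"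
        using yP xP ac by (simp add: kq_mult_assoc kq_mult_closed)
      also have "\<dots> = 0"
      proof (rule klin_eqI[where F = "\<lambda>y. N (kq_mult (bas a) (kq_mult x (kq_mult y (bas c))))" and G = "\<lambda>_. 0"])
        show "klin (\<lambda>y. N (kq_mult (bas a) (kq_mult x (kq_mult y (bas c)))))"
          by (rule klin_compose[OF klin_N klin_compose[OF klin_kq_mult_right klin_compose[OF klin_kq_mult_right klin_kq_mult_left]]])
        show "klin (\<lambda>_. 0 :: ('v, 'e, 'k) kq)" by (rule klinI) simp_all
        fix p assume "p \<in> keys y"
        then have "p \<in> PQ" by (rule kspace_key[OF yP])
        then show "N (kq_mult (bas a) (kq_mult x (kq_mult (bas p) (bas c)))) = 0"
          using K(2)[OF x, of a "pcomp p c"] ac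
          by (simp add: pcomp_qpath klin_0[OF klin_kq_mult_right] klin_0[OF klin_N])
      qed
      finally show ?thesis .
    qed
    then show "x \<otimes>\<^bsub>PA\<^esub> y \<in> K" unfolding K_def using xP yP by (simp add: kq_mult_closed)
  qed
  moreover have "{bas s - f | s f. (s, f) \<in> R} \<subseteq> K"
  proof
    fix z assume "z \<in> {bas s - f | s f. (s, f) \<in> R}"
    then obtain s f where z: "z = bas s - f" "(s, f) \<in> R" by blast
    note D = redsysD[OF z(2)]
    have "N (kq_mult (bas a) (kq_mult z (bas c))) = 0" if ac: "a \<in> PQ" "c \<in> PQ" for a c
    proof -
      have e: "N (kq_mult (bas a) (kq_mult z (bas c)))
          = N (kq_mult (bas a) (kq_mult (bas s) (bas c))) - N (kq_mult (bas a) (kq_mult f (bas c)))"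
        unfolding z(1) by (rule klin_diff[OF lin])
      show ?thesis
      proof (cases "composable a s \<and> composable s c")
        case True
        then have asc: "is_asc a s f c" unfolding is_asc_def using z(2) ac by simp
        have "bas (pcomp a (pcomp s c)) \<in> kspace PQ" using is_asc_path[OF asc] by simp
        from N_basic[OF basic_reductionI[OF asc] this] show ?thesis
          unfolding e using True by (simp add: basic_reduction_bas)
      next
        case False
        \<comment> \<open>The paths of \<open>f\<close> have the ends of \<open>s\<close>, so the
          products with \<open>f\<close> and with \<open>s\<close> vanish together.\<close>
        have "kq_mult (bas a) (kq_mult f (bas c)) = 0"
        proof (rule klin_eqI[where F = "\<lambda>f. kq_mult (bas a) (kq_mult f (bas c))" and G = "\<lambda>_. 0"])
          show "klin (\<lambda>f. kq_mult (bas a) (kq_mult f (bas c)))"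
            by (rule klin_compose[OF klin_kq_mult_right klin_kq_mult_left])
          show "klin (\<lambda>_. 0 :: ('v, 'e, 'k) kq)" by (rule klinI) simp_all
          fix q assume "q \<in> keys f"
          then have "psrc q = psrc s" "ptgt q = ptgt s" using D(5) by metis+
          then show "kq_mult (bas a) (kq_mult (bas q) (bas c)) = 0"
            using False by (simp add: composable_def klin_0[OF klin_kq_mult_right])
        qed
        moreover have "kq_mult (bas a) (kq_mult (bas s) (bas c)) = (0 :: ('v, 'e, 'k) kq)"
          using False by (simp add: klin_0[OF klin_kq_mult_right])
        ultimately show ?thesis unfolding e by (simp only: klin_0[OF klin_N] diff_self)
      qed
    qed
    moreover have "z \<in> kspace PQ" unfolding z(1) using D(1,2) by (intro kspace_diff) simp_all
    ultimately show "z \<in> K" unfolding K_def by simp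
  qed
  ultimately have "I \<subseteq> K" unfolding lozengeD(1) by (rule ring.genideal_minimal[OF ring_PA])
  then have x: "x \<in> K" using assms by (rule subsetD)
  let ?one = "\<Sum>v \<in> verts Q. bas (v, [], v) :: ('v, 'e, 'k) kq"
  \<comment> \<open>Membership in \<open>K\<close> is about products \<open>a x c\<close>; the unit,
    a sum of vertices, inserted on both sides recovers \<open>x\<close>.\<close>
  have "x = kq_mult ?one (kq_mult x ?one)" using K(1)[OF x] by (simp add: kq_mult_one)
  also have "N \<dots> = (\<Sum>v\<in>verts Q. \<Sum>w\<in>verts Q. N (kq_mult (bas (v, [], v)) (kq_mult x (bas (w, [], w)))))"
    by (subst klin_sum[OF klin_kq_mult_right], subst klin_sum[OF klin_kq_mult_right],
        subst klin_sum[OF klin_kq_mult_left], simp only: klin_sum[OF klin_N]) (rule sum.swap)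
  also have "\<dots> = 0" using K(2)[OF x] triv_in by simp
  finally show ?thesis .
qed

lemma N_eq_0_iff: "x \<in> kspace PQ \<Longrightarrow> N x = 0 \<longleftrightarrow> x \<in> I"
  using N_I N_diff_I[of x] I_pscale[of "- x" "- 1"] by auto

text \<open>\<open>N\<close> is linear, moves an element only inside its residue class and vanishes
  on \<open>I\<close>: a complete invariant of the class. This is the basis property of the
  irreducible paths.\<close>

lemma proj_eq_iff:
  assumes "x \<in> kspace PQ" "y \<in> kspace PQ"
  shows "\<pi> x = \<pi> y \<longleftrightarrow> N x = N y"
proof -
  have "\<pi> x = \<pi> y \<longleftrightarrow> x - y \<in> I"
    using ring.quotient_eq_iff_same_a_r_cos[OF ring_PA ideal_I, of x y] assms PA_minus(2)[OF assms]
    by (simp add: proj_def)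
  also have "\<dots> \<longleftrightarrow> N (x - y) = 0" using N_eq_0_iff[of "x - y"] assms by (simp add: kspace_diff)
  finally show ?thesis by (simp add: klin_diff[OF klin_N])
qed

lemma proj_N: "x \<in> kspace PQ \<Longrightarrow> \<pi> (N x) = \<pi> x"
  using proj_eq_iff[of "N x" x] N_kspace' N_kspace N_idem by simp

lemma ring_A: "ring A"
  unfolding quot_algebra_def by (rule ideal.quotient_is_ring[OF ideal_I])

lemma proj_hom: "\<pi> \<in> ring_hom PA A"
proof -
  have "\<pi> = (+>\<^bsub>PA\<^esub>) I" by (rule ext) (simp add: proj_def)
  then show ?thesis unfolding quot_algebra_def using ideal.rcos_ring_hom[OF ideal_I] by simp
qed

lemma proj_ops:
  assumes "x \<in> kspace PQ" "y \<in> kspace PQ"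
  shows "\<pi> x \<oplus>\<^bsub>A\<^esub> \<pi> y = \<pi> (x + y)" "\<pi> x \<otimes>\<^bsub>A\<^esub> \<pi> y = \<pi> (kq_mult x y)" "\<pi> x \<in> carrier A"
  using ring_hom_add[OF proj_hom, of x y] ring_hom_mult[OF proj_hom, of x y] ring_hom_closed[OF proj_hom, of x] assms
  by simp_all

lemma proj_one: "\<one>\<^bsub>A\<^esub> = \<pi> (\<Sum>v \<in> verts Q. bas (v, [], v))"
  using ring_hom_one[OF proj_hom] by simp

lemma proj_zero: "\<zero>\<^bsub>A\<^esub> = \<pi> 0"
proof -
  interpret ring_hom_ring PA A \<pi> by (rule ring_hom_ringI2[OF ring_PA ring_A proj_hom])
  show ?thesis using hom_zero by simp
qed

lemma carrier_A: "carrier A = \<pi> ` kspace PQ"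
proof -
  have "carrier A = a_rcosets\<^bsub>PA\<^esub> I" by (simp add: quot_algebra_def FactRing_def)
  then show ?thesis by (auto simp: A_RCOSETS_def' proj_def)
qed

text \<open>Coordinates of a residue class in the basis of irreducible paths; by
  \<open>proj_eq_iff\<close> any representative gives the same result.\<close>

definition nf :: "('v, 'e, 'k) qa \<Rightarrow> ('v, 'e, 'k) kq" where
  "nf a = N (SOME x. x \<in> kspace PQ \<and> \<pi> x = a)"

lemma nf_proj: "x \<in> kspace PQ \<Longrightarrow> nf (\<pi> x) = N x"
proof -
  assume x: "x \<in> kspace PQ"
  let ?z = "SOME y. y \<in> kspace PQ \<and> \<pi> y = \<pi> x"
  have z: "?z \<in> kspace PQ \<and> \<pi> ?z = \<pi> x"
    by (rule someI[of "\<lambda>y. y \<in> kspace PQ \<and> \<pi> y = \<pi> x" x]) (simp add: x)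
  show ?thesis unfolding nf_def
    by (rule iffD1[OF proj_eq_iff[OF conjunct1[OF z] x] conjunct2[OF z]])
qed

lemma carrier_A_cases:
  assumes "a \<in> carrier A"
  obtains x where "x \<in> kspace B" "a = \<pi> x" "nf a = x"
proof -
  obtain y where y: "y \<in> kspace PQ" "a = \<pi> y" using assms unfolding carrier_A by (rule imageE)
  show ?thesis
  proof (rule that)
    show "N y \<in> kspace B" by (rule N_kspace[OF y(1)])
    show "a = \<pi> (N y)" using proj_N[OF y(1)] y(2) by simp
    show "nf a = N y" unfolding y(2) by (rule nf_proj[OF y(1)])
  qed
qed

lemma scal_mult:
  assumes "x \<in> kspace PQ"
  shows "scal Q I c \<otimes>\<^bsub>A\<^esub> \<pi> x = \<pi> (pscale c x)"
  unfolding scal_def using assms one_kspace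
  by (simp add: proj_ops kspace_pscale kq_mult_pscale kq_mult_one)

end

section \<open>Coordinates on the tensor products\<close>

text \<open>Bridge from sums in a carrier-based group to type-class sums, along a map that is
  additive on the carrier only. The maps in question are \<open>\<kappa>\<close> and
  \<open>nf\<close>.\<close>

lemma finsum_hom:
  fixes h :: "'m \<Rightarrow> 'c::comm_monoid_add"
  assumes M: "abelian_group M"
    and h: "\<And>s t. s \<in> carrier M \<Longrightarrow> t \<in> carrier M \<Longrightarrow> h (s \<oplus>\<^bsub>M\<^esub> t) = h s + h t" "h \<zero>\<^bsub>M\<^esub> = 0"
    and F: "finite F" "\<And>z. z \<in> F \<Longrightarrow> f z \<in> carrier M"
  shows "finsum M f F \<in> carrier M \<and> h (finsum M f F) = (\<Sum>z\<in>F. h (f z))"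
  using F
proof (induction F)
  case empty
  interpret abelian_group M by (rule M)
  show ?case using h(2) by simp
next
  case (insert x F)
  interpret abelian_group M by (rule M)
  have f: "f \<in> F \<rightarrow> carrier M" "f x \<in> carrier M" using insert.prems by auto
  have IH: "finsum M f F \<in> carrier M \<and> h (finsum M f F) = (\<Sum>z\<in>F. h (f z))"
    using insert.IH insert.prems by simp
  have "finsum M f (insert x F) = f x \<oplus>\<^bsub>M\<^esub> finsum M f F"
    by (rule finsum_insert[OF insert.hyps(1,2) f])
  then show ?case using IH f h(1)[of "f x" "finsum M f F"] insert.hyps by simp
qed

type_synonym ('a, 'b) triple = "('a, 'b) qpath \<times> ('a, 'b) qpath \<times> ('a, 'b) qpath"

context quiver_diamond
begin

definition tri :: "('v, 'e) qpath set \<Rightarrow> ('v, 'e) triple set" where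
  "tri X = {(b, p, b'). b \<in> B \<and> p \<in> X \<and> b' \<in> B \<and> composable b p \<and> composable p b'}"

text \<open>The trilinear extension of the basis triples. Noncomposable triples go to 0, as the
  balancing over vertices forces.\<close>

definition tri3 :: "('v, 'e, 'k) kq \<Rightarrow> ('v, 'e, 'k) kq \<Rightarrow> ('v, 'e, 'k) kq \<Rightarrow> (('v, 'e) triple \<Rightarrow>\<^sub>0 'k)" where
  "tri3 x w y = lin_ext (\<lambda>b. lin_ext (\<lambda>p. lin_ext
     (\<lambda>b'. if composable b p \<and> composable p b' then bas (b, p, b') else 0) y) w) x"

lemma tri3_klin: "klin (\<lambda>x. tri3 x w y)" "klin (\<lambda>w. tri3 x w y)" "klin (\<lambda>y. tri3 x w y)"
  unfolding tri3_def by (intro klin_lin_ext klin_lin_ext_fun)+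

lemma tri3_bas [simp]:
  "tri3 (bas b) (bas p) (bas b') = (if composable b p \<and> composable p b' then bas (b, p, b') else 0)"
  by (simp add: tri3_def)

lemma tri3_0 [simp]: "tri3 0 w y = 0" "tri3 x 0 y = 0" "tri3 x w 0 = 0"
  by (rule klin_0[OF tri3_klin(1)] klin_0[OF tri3_klin(2)] klin_0[OF tri3_klin(3)])+

lemma klin3_eqI:
  fixes F G :: "('v, 'e, 'k) kq \<Rightarrow> ('v, 'e, 'k) kq \<Rightarrow> ('v, 'e, 'k) kq \<Rightarrow> ('z \<Rightarrow>\<^sub>0 'k)"
  assumes F: "\<And>w y. klin (\<lambda>x. F x w y)" "\<And>x y. klin (\<lambda>w. F x w y)" "\<And>x w. klin (\<lambda>y. F x w y)"
    and G: "\<And>w y. klin (\<lambda>x. G x w y)" "\<And>x y. klin (\<lambda>w. G x w y)" "\<And>x w. klin (\<lambda>y. G x w y)"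
    and eq: "\<And>b p b'. b \<in> keys x \<Longrightarrow> p \<in> keys w \<Longrightarrow> b' \<in> keys y \<Longrightarrow>
      F (bas b) (bas p) (bas b') = G (bas b) (bas p) (bas b')"
  shows "F x w y = G x w y"
proof (rule klin_eqI[OF F(1) G(1)])
  fix b assume b: "b \<in> keys x"
  show "F (bas b) w y = G (bas b) w y"
  proof (rule klin_eqI[OF F(2) G(2)])
    fix p assume p: "p \<in> keys w"
    show "F (bas b) (bas p) y = G (bas b) (bas p) y"
      by (rule klin_eqI[OF F(3) G(3)]) (rule eq[OF b p])
  qed
qed

lemma tri3_kspace:
  assumes "x \<in> kspace B" "w \<in> kspace X" "y \<in> kspace B"
  shows "tri3 x w y \<in> kspace (tri X)"
  unfolding tri3_def
  by (rule kspace_lin_ext[OF assms(1)], rule kspace_lin_ext[OF assms(2)], rule kspace_lin_ext[OF assms(3)])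
    (simp add: tri_def)

abbreviation "Q0 \<equiv> kspace (qpaths_of_length Q 0)"

lemma Q0_key: "e \<in> Q0 \<Longrightarrow> p \<in> keys e \<Longrightarrow> p \<in> PQ \<and> parr p = []"
  using kspace_key[of e "qpaths_of_length Q 0" p] by (simp add: qpaths_of_length_def)

lemma Q0_kspace: "e \<in> Q0 \<Longrightarrow> e \<in> kspace PQ"
  using Q0_key by (metis kspaceI)

text \<open>By linearity in \<open>e\<close> a vertex \<open>z\<close> suffices. Either side is
  nonzero only if \<open>z\<close> is the common end of its two neighbours, and both sides then give
  the same triple.\<close>

lemma tri3_balanced:
  assumes "e \<in> Q0"
  shows "tri3 (kq_mult x e) w y = tri3 x (kq_mult e w) y" "tri3 x (kq_mult w e) y = tri3 x w (kq_mult e y)"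
proof -
  show "tri3 (kq_mult x e) w y = tri3 x (kq_mult e w) y"
  proof (rule klin3_eqI[where F = "\<lambda>x w y. tri3 (kq_mult x e) w y" and G = "\<lambda>x w y. tri3 x (kq_mult e w) y"])
    show "klin (\<lambda>x. tri3 (kq_mult x e) w y)" for w y by (rule klin_compose[OF tri3_klin(1) klin_kq_mult_left])
    show "klin (\<lambda>w. tri3 x (kq_mult e w) y)" for x y by (rule klin_compose[OF tri3_klin(2) klin_kq_mult_right])
    fix b p b'
    show "tri3 (kq_mult (bas b) e) (bas p) (bas b') = tri3 (bas b) (kq_mult e (bas p)) (bas b')"
    proof (rule klin_eqI[where F = "\<lambda>e. tri3 (kq_mult (bas b) e) (bas p) (bas b')" and G = "\<lambda>e. tri3 (bas b) (kq_mult e (bas p)) (bas b')"])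
      show "klin (\<lambda>e. tri3 (kq_mult (bas b) e) (bas p) (bas b'))" by (rule klin_compose[OF tri3_klin(1) klin_kq_mult_right])
      show "klin (\<lambda>e. tri3 (bas b) (kq_mult e (bas p)) (bas b'))" by (rule klin_compose[OF tri3_klin(2) klin_kq_mult_left])
      fix z assume "z \<in> keys e"
      then have z: "z \<in> PQ" "parr z = []" using Q0_key[OF assms] by blast+
      show "tri3 (kq_mult (bas b) (bas z)) (bas p) (bas b') = tri3 (bas b) (kq_mult (bas z) (bas p)) (bas b')"
        using pcomp_triv(1)[of b z] pcomp_triv(2)[of z p] z triv_qpath[OF z]
        by (simp add: composable_def)
    qed
  qed (rule tri3_klin)+
  show "tri3 x (kq_mult w e) y = tri3 x w (kq_mult e y)"
  proof (rule klin3_eqI[where F = "\<lambda>x w y. tri3 x (kq_mult w e) y" and G = "\<lambda>x w y. tri3 x w (kq_mult e y)"])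
    show "klin (\<lambda>w. tri3 x (kq_mult w e) y)" for x y by (rule klin_compose[OF tri3_klin(2) klin_kq_mult_left])
    show "klin (\<lambda>y. tri3 x w (kq_mult e y))" for x w by (rule klin_compose[OF tri3_klin(3) klin_kq_mult_right])
    fix b p b'
    show "tri3 (bas b) (kq_mult (bas p) e) (bas b') = tri3 (bas b) (bas p) (kq_mult e (bas b'))"
    proof (rule klin_eqI[where F = "\<lambda>e. tri3 (bas b) (kq_mult (bas p) e) (bas b')" and G = "\<lambda>e. tri3 (bas b) (bas p) (kq_mult e (bas b'))"])
      show "klin (\<lambda>e. tri3 (bas b) (kq_mult (bas p) e) (bas b'))" by (rule klin_compose[OF tri3_klin(2) klin_kq_mult_right])
      show "klin (\<lambda>e. tri3 (bas b) (bas p) (kq_mult e (bas b')))" by (rule klin_compose[OF tri3_klin(3) klin_kq_mult_left])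
      fix z assume "z \<in> keys e"
      then have z: "z \<in> PQ" "parr z = []" using Q0_key[OF assms] by blast+
      show "tri3 (bas b) (kq_mult (bas p) (bas z)) (bas b') = tri3 (bas b) (bas p) (kq_mult (bas z) (bas b'))"
        using pcomp_triv(1)[of p z] pcomp_triv(2)[of z b'] z triv_qpath[OF z]
        by (simp add: composable_def)
    qed
  qed (rule tri3_klin)+
qed

abbreviation "CA \<equiv> carrier A"

lemma nf_kspace: "a \<in> CA \<Longrightarrow> nf a \<in> kspace B"
  and nf_kspace': "a \<in> CA \<Longrightarrow> nf a \<in> kspace PQ"
  and proj_nf: "a \<in> CA \<Longrightarrow> \<pi> (nf a) = a"
proof -
  assume "a \<in> CA"
  then obtain x where "x \<in> kspace B" "a = \<pi> x" "nf a = x" by (rule carrier_A_cases)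
  then show "nf a \<in> kspace B" "nf a \<in> kspace PQ" "\<pi> (nf a) = a" using subsetD[OF B_PQ] by simp_all
qed

lemma nf_add: "a \<in> CA \<Longrightarrow> a' \<in> CA \<Longrightarrow> nf (a \<oplus>\<^bsub>A\<^esub> a') = nf a + nf a'"
  and nf_mult: "a \<in> CA \<Longrightarrow> a' \<in> CA \<Longrightarrow> nf (a \<otimes>\<^bsub>A\<^esub> a') = N (kq_mult (nf a) (nf a'))"
proof -
  assume "a \<in> CA" "a' \<in> CA"
  then have *: "nf a \<in> kspace PQ" "\<pi> (nf a) = a" "nf a' \<in> kspace PQ" "\<pi> (nf a') = a'" "nf a + nf a' \<in> kspace B"
    by (simp_all add: nf_kspace' proj_nf nf_kspace kspace_add)
  show "nf (a \<oplus>\<^bsub>A\<^esub> a') = nf a + nf a'"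
    using proj_ops(1)[OF *(1,3)] nf_proj[of "nf a + nf a'"] N_idem[OF *(5)] * by (simp add: kspace_add)
  show "nf (a \<otimes>\<^bsub>A\<^esub> a') = N (kq_mult (nf a) (nf a'))"
    using proj_ops(2)[OF *(1,3)] nf_proj[of "kq_mult (nf a) (nf a')"] * by (simp add: kq_mult_closed)
qed

lemma nf_scal: "a \<in> CA \<Longrightarrow> nf (scal Q I c \<otimes>\<^bsub>A\<^esub> a) = pscale c (nf a)"
  using scal_mult[OF nf_kspace'[of a], of c] proj_nf[of a] nf_proj[of "pscale c (nf a)"]
    N_idem[of "pscale c (nf a)"] nf_kspace[of a] nf_kspace'[of a] by (simp add: kspace_pscale)

text \<open>The product of an irreducible path with a vertex is the path or 0, so no further
  reduction takes place.\<close>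

lemma nf_Q0:
  assumes "a \<in> CA" "e \<in> Q0"
  shows "nf (a \<otimes>\<^bsub>A\<^esub> \<pi> e) = kq_mult (nf a) e" "nf (\<pi> e \<otimes>\<^bsub>A\<^esub> a) = kq_mult e (nf a)"
proof -
  have e: "e \<in> kspace PQ" by (rule Q0_kspace[OF assms(2)])
  have a: "nf a \<in> kspace PQ" "\<pi> (nf a) = a" by (simp_all add: nf_kspace' proj_nf assms(1))
  have "kq_mult (nf a) e \<in> kspace B" "kq_mult e (nf a) \<in> kspace B"
  proof -
    have "kq_mult (bas b) e \<in> kspace B" "kq_mult e (bas b) \<in> kspace B" if b: "b \<in> B" for b
    proof -
      have "kq_mult (bas b) (bas z) \<in> kspace B" "kq_mult (bas z) (bas b) \<in> kspace B"
        if "z \<in> qpaths_of_length Q 0" for z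
      proof -
        have z: "z \<in> PQ" "parr z = []" using that by (simp_all add: qpaths_of_length_def)
        show "kq_mult (bas b) (bas z) \<in> kspace B" "kq_mult (bas z) (bas b) \<in> kspace B"
          using pcomp_triv(1)[of b z] pcomp_triv(2)[of z b] z b by simp_all
      qed
      then show "kq_mult (bas b) e \<in> kspace B" "kq_mult e (bas b) \<in> kspace B"
        using kspace_lin_ext[OF assms(2), of "\<lambda>z. kq_mult (bas b) (bas z)"] klin_eq_lin_ext[OF klin_kq_mult_right, of "bas b" e]
          kspace_lin_ext[OF assms(2), of "\<lambda>z. kq_mult (bas z) (bas b)"] klin_eq_lin_ext[OF klin_kq_mult_left, of e "bas b"]
        by metis+
    qed
    then show "kq_mult (nf a) e \<in> kspace B" "kq_mult e (nf a) \<in> kspace B"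
      using kspace_lin_ext[OF nf_kspace[OF assms(1)], of "\<lambda>b. kq_mult (bas b) e"] klin_eq_lin_ext[OF klin_kq_mult_left, of "nf a" e]
        kspace_lin_ext[OF nf_kspace[OF assms(1)], of "\<lambda>b. kq_mult e (bas b)"] klin_eq_lin_ext[OF klin_kq_mult_right, of e "nf a"]
      by metis+
  qed
  then show "nf (a \<otimes>\<^bsub>A\<^esub> \<pi> e) = kq_mult (nf a) e" "nf (\<pi> e \<otimes>\<^bsub>A\<^esub> a) = kq_mult e (nf a)"
    using proj_ops(2)[OF a(1) e] proj_ops(2)[OF e a(1)] a e
      nf_proj[of "kq_mult (nf a) e"] nf_proj[of "kq_mult e (nf a)"] by (simp_all add: kq_mult_closed N_idem)
qed

section \<open>The relations of the tensor product in coordinates\<close>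

abbreviation free :: "('v, 'e) qpath set \<Rightarrow> ('v, 'e, 'k) ftens set" where
  "free X \<equiv> kspace (CA \<times> kspace X \<times> CA)"
abbreviation "rels X \<equiv> tensor_rels Q I X"

definition cg :: "('v, 'e, 'k) qa \<times> ('v, 'e, 'k) kq \<times> ('v, 'e, 'k) qa \<Rightarrow> (('v, 'e) triple \<Rightarrow>\<^sub>0 'k)" where
  "cg z = tri3 (nf (fst z)) (fst (snd z)) (nf (snd (snd z)))"

definition coord :: "('v, 'e, 'k) ftens \<Rightarrow> (('v, 'e) triple \<Rightarrow>\<^sub>0 'k)" where
  "coord = lin_ext cg"

lemma klin_coord [simp, intro]: "klin coord" by (simp add: coord_def)

lemma coord_bas [simp]: "coord (bas (x, w, y)) = tri3 (nf x) w (nf y)"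
  by (simp add: coord_def cg_def)

lemma coord_kspace: "v \<in> free X \<Longrightarrow> coord v \<in> kspace (tri X)"
  unfolding coord_def cg_def
  by (rule kspace_lin_ext, assumption) (auto intro!: tri3_kspace nf_kspace)

lemma A_closed:
  "x \<in> CA \<Longrightarrow> y \<in> CA \<Longrightarrow> x \<otimes>\<^bsub>A\<^esub> y \<in> CA" "x \<in> CA \<Longrightarrow> y \<in> CA \<Longrightarrow> x \<oplus>\<^bsub>A\<^esub> y \<in> CA"
  "scal Q I c \<in> CA" "\<one>\<^bsub>A\<^esub> \<in> CA" "e \<in> kspace PQ \<Longrightarrow> \<pi> e \<in> CA"
  using ring.ring_simprules(5,1,6)[OF ring_A] proj_ops(3) one_kspace unfolding scal_def
  by (simp_all add: kspace_pscale)

lemma kq_mult_Q0: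
  assumes "X \<subseteq> PQ" "e \<in> Q0" "w \<in> kspace X"
  shows "kq_mult e w \<in> kspace X" "kq_mult w e \<in> kspace X"
proof -
  have "kq_mult (bas z) (bas p) \<in> kspace X" "kq_mult (bas p) (bas z) \<in> kspace X"
    if "z \<in> qpaths_of_length Q 0" "p \<in> X" for z p
  proof -
    have z: "z \<in> PQ" "parr z = []" using that by (simp_all add: qpaths_of_length_def)
    show "kq_mult (bas z) (bas p) \<in> kspace X" "kq_mult (bas p) (bas z) \<in> kspace X"
      using pcomp_triv(1)[of p z] pcomp_triv(2)[of z p] z that(2) by simp_all
  qed
  then have "kq_mult e (bas p) \<in> kspace X" "kq_mult (bas p) e \<in> kspace X" if "p \<in> X" for p
    using kspace_lin_ext[OF assms(2), of "\<lambda>z. kq_mult (bas p) (bas z)"] klin_eq_lin_ext[OF klin_kq_mult_right, of "bas p" e]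
      kspace_lin_ext[OF assms(2), of "\<lambda>z. kq_mult (bas z) (bas p)"] klin_eq_lin_ext[OF klin_kq_mult_left, of e "bas p"] that
    by metis+
  then show "kq_mult e w \<in> kspace X" "kq_mult w e \<in> kspace X"
    using kspace_lin_ext[OF assms(3), of "\<lambda>p. kq_mult e (bas p)"] klin_eq_lin_ext[OF klin_kq_mult_right, of e w]
      kspace_lin_ext[OF assms(3), of "\<lambda>p. kq_mult (bas p) e"] klin_eq_lin_ext[OF klin_kq_mult_left, of w e]
    by metis+
qed

text \<open>The elements of the free space with zero coordinates form a subspace, so only the eight
  generating families need to be checked; their identities are the linearity of \<open>nf\<close>
  and \<open>tri3\<close> and the balancing.\<close>

lemma rels_coord:
  assumes X: "X \<subseteq> PQ" and v: "v \<in> rels X"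
  shows "v \<in> free X" "coord v = 0"
proof -
  interpret kv: vector_space "pscale :: 'k \<Rightarrow> ('v, 'e, 'k) ftens \<Rightarrow> _" by (rule vector_space_pscale)
  let ?T = "{v \<in> free X. coord v = 0}"
  have sub: "kv.subspace ?T"
    by (rule kv.subspaceI)
      (simp_all add: klin_0 klin_add[OF klin_coord] klin_pscale[OF klin_coord] kspace_add kspace_pscale)
  note simps = klin_diff[OF klin_coord] klin_pscale[OF klin_coord] nf_add nf_scal nf_Q0 tri3_balanced A_closed
    klin_add[OF tri3_klin(1)] klin_add[OF tri3_klin(2)] klin_add[OF tri3_klin(3)]
    klin_pscale[OF tri3_klin(1)] klin_pscale[OF tri3_klin(2)] klin_pscale[OF tri3_klin(3)]
    kspace_diff kspace_add kspace_pscale kq_mult_Q0[OF X] Q0_kspace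
  have "rels X \<subseteq> ?T"
    unfolding tensor_rels_def Let_def
    apply (rule kv.span_minimal[OF _ sub])
    apply (intro Un_least; rule subsetI; unfold mem_Collect_eq; elim exE conjE; hypsubst)
    apply (simp_all add: simps)
    done
  then show "v \<in> free X" "coord v = 0" using v by auto
qed

lemma rels_subspace:
  shows "0 \<in> rels X" "u \<in> rels X \<Longrightarrow> v \<in> rels X \<Longrightarrow> u + v \<in> rels X"
    "u \<in> rels X \<Longrightarrow> v \<in> rels X \<Longrightarrow> u - v \<in> rels X" "u \<in> rels X \<Longrightarrow> pscale c u \<in> rels X"
proof -
  interpret kv: vector_space "pscale :: 'k \<Rightarrow> ('v, 'e, 'k) ftens \<Rightarrow> _" by (rule vector_space_pscale)
  have sub: "kv.subspace (rels X)" unfolding tensor_rels_def Let_def by (rule kv.subspace_span)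
  show "0 \<in> rels X" "u \<in> rels X \<Longrightarrow> v \<in> rels X \<Longrightarrow> u + v \<in> rels X"
    "u \<in> rels X \<Longrightarrow> v \<in> rels X \<Longrightarrow> u - v \<in> rels X" "u \<in> rels X \<Longrightarrow> pscale c u \<in> rels X"
    by (rule kv.subspace_0[OF sub] kv.subspace_add[OF sub] kv.subspace_diff[OF sub] kv.subspace_scale[OF sub]; assumption)+
qed

text \<open>One rule for each of the eight families, so that the nested union is taken apart only
  here.\<close>

lemma rels_gens:
  fixes X :: "('v, 'e) qpath set" and c :: 'k
  assumes "x \<in> CA" "x' \<in> CA" "w \<in> kspace X" "w' \<in> kspace X" "y \<in> CA" "y' \<in> CA" "e \<in> Q0"
  shows "bas (x \<oplus>\<^bsub>A\<^esub> x', w, y) - bas (x, w, y) - bas (x', w, y) \<in> rels X"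
    "bas (x, w + w', y) - bas (x, w, y) - bas (x, w', y) \<in> rels X"
    "bas (x, w, y \<oplus>\<^bsub>A\<^esub> y') - bas (x, w, y) - bas (x, w, y') \<in> rels X"
    "bas (scal Q I c \<otimes>\<^bsub>A\<^esub> x, w, y) - pscale c (bas (x, w, y)) \<in> rels X"
    "bas (x, pscale c w, y) - pscale c (bas (x, w, y)) \<in> rels X"
    "bas (x, w, scal Q I c \<otimes>\<^bsub>A\<^esub> y) - pscale c (bas (x, w, y)) \<in> rels X"
    "bas (x \<otimes>\<^bsub>A\<^esub> \<pi> e, w, y) - bas (x, kq_mult e w, y) \<in> rels X"
    "bas (x, kq_mult w e, y) - bas (x, w, \<pi> e \<otimes>\<^bsub>A\<^esub> y) \<in> rels X"
proof -
  interpret kv: vector_space "pscale :: 'k \<Rightarrow> ('v, 'e, 'k) ftens \<Rightarrow> _" by (rule vector_space_pscale)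
  note * = assms
  show "bas (x \<oplus>\<^bsub>A\<^esub> x', w, y) - bas (x, w, y) - bas (x', w, y) \<in> rels X"
    unfolding tensor_rels_def Let_def
    by (rule kv.span_base, rule UnI1, rule UnI1, rule UnI1, rule UnI1, rule UnI1, rule UnI1, rule UnI1,
        unfold mem_Collect_eq, rule exI[of _ x], rule exI[of _ x'], rule exI[of _ w], rule exI[of _ y]) (simp add: *)
  show "bas (x, w + w', y) - bas (x, w, y) - bas (x, w', y) \<in> rels X"
    unfolding tensor_rels_def Let_def
    by (rule kv.span_base, rule UnI1, rule UnI1, rule UnI1, rule UnI1, rule UnI1, rule UnI1, rule UnI2,
        unfold mem_Collect_eq, rule exI[of _ x], rule exI[of _ w], rule exI[of _ w'], rule exI[of _ y]) (simp add: *)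
  show "bas (x, w, y \<oplus>\<^bsub>A\<^esub> y') - bas (x, w, y) - bas (x, w, y') \<in> rels X"
    unfolding tensor_rels_def Let_def
    by (rule kv.span_base, rule UnI1, rule UnI1, rule UnI1, rule UnI1, rule UnI1, rule UnI2,
        unfold mem_Collect_eq, rule exI[of _ x], rule exI[of _ w], rule exI[of _ y], rule exI[of _ y']) (simp add: *)
  show "bas (scal Q I c \<otimes>\<^bsub>A\<^esub> x, w, y) - pscale c (bas (x, w, y)) \<in> rels X"
    unfolding tensor_rels_def Let_def
    by (rule kv.span_base, rule UnI1, rule UnI1, rule UnI1, rule UnI1, rule UnI2,
        unfold mem_Collect_eq, rule exI[of _ c], rule exI[of _ x], rule exI[of _ w], rule exI[of _ y]) (simp add: *)
  show "bas (x, pscale c w, y) - pscale c (bas (x, w, y)) \<in> rels X"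
    unfolding tensor_rels_def Let_def
    by (rule kv.span_base, rule UnI1, rule UnI1, rule UnI1, rule UnI2,
        unfold mem_Collect_eq, rule exI[of _ c], rule exI[of _ x], rule exI[of _ w], rule exI[of _ y]) (simp add: *)
  show "bas (x, w, scal Q I c \<otimes>\<^bsub>A\<^esub> y) - pscale c (bas (x, w, y)) \<in> rels X"
    unfolding tensor_rels_def Let_def
    by (rule kv.span_base, rule UnI1, rule UnI1, rule UnI2,
        unfold mem_Collect_eq, rule exI[of _ c], rule exI[of _ x], rule exI[of _ w], rule exI[of _ y]) (simp add: *)
  show "bas (x \<otimes>\<^bsub>A\<^esub> \<pi> e, w, y) - bas (x, kq_mult e w, y) \<in> rels X"
    unfolding tensor_rels_def Let_def
    by (rule kv.span_base, rule UnI1, rule UnI2,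
        unfold mem_Collect_eq, rule exI[of _ x], rule exI[of _ e], rule exI[of _ w], rule exI[of _ y]) (simp add: *)
  show "bas (x, kq_mult w e, y) - bas (x, w, \<pi> e \<otimes>\<^bsub>A\<^esub> y) \<in> rels X"
    unfolding tensor_rels_def Let_def
    by (rule kv.span_base, rule UnI2,
        unfold mem_Collect_eq, rule exI[of _ x], rule exI[of _ e], rule exI[of _ w], rule exI[of _ y]) (simp add: *)
qed

lemma rels_lin_ext:
  assumes "\<And>p. p \<in> keys x \<Longrightarrow> g p \<in> rels X"
  shows "lin_ext g x \<in> rels X"
proof -
  have "(\<Sum>p\<in>F. pscale (lookup x p) (g p)) \<in> rels X"
    if "finite F" "F \<subseteq> keys x" for F
    using that
  proof (induction F)
    case empty
    show ?case by (simp add: rels_subspace(1))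
  next
    case (insert p F)
    then have "pscale (lookup x p) (g p) \<in> rels X" "(\<Sum>p\<in>F. pscale (lookup x p) (g p)) \<in> rels X"
      using assms by (auto intro: rels_subspace(4))
    then show ?case using insert.hyps rels_subspace(2) by simp
  qed
  then show ?thesis unfolding lin_ext_def by simp
qed

lemma rels_lin_ext_cong:
  assumes "\<And>p. p \<in> keys x \<Longrightarrow> g p - h p \<in> rels X"
  shows "lin_ext g x - lin_ext h x \<in> rels X"
proof -
  have "lin_ext (\<lambda>p. g p + pscale (- 1) (h p)) x \<in> rels X" using assms by (intro rels_lin_ext) simp
  then show ?thesis unfolding lin_ext_fun_add lin_ext_fun_pscale by simp
qed

text \<open>A map that is linear modulo relations is determined modulo relations by its values on
  the basis \<open>U\<close>. It serves for each of the three tensor factors.\<close>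

lemma rels_expand:
  assumes "\<And>x y. x \<in> kspace U \<Longrightarrow> y \<in> kspace U \<Longrightarrow> G (x + y) - G x - G y \<in> rels X"
    and "\<And>c x. x \<in> kspace U \<Longrightarrow> G (pscale c x) - pscale c (G x) \<in> rels X"
    and "x \<in> kspace U"
  shows "G x - lin_ext (\<lambda>p. G (bas p)) x \<in> rels X"
  using assms(3)
proof (induction rule: kspace_induct)
  case zero
  have "G (pscale 0 0) - pscale 0 (G 0) \<in> rels X" by (rule assms(2)) simp
  then show ?case by simp
next
  case (step p c y)
  let ?L = "lin_ext (\<lambda>p. G (bas p))"
  have b: "bas p \<in> kspace U" using step(1) by simp
  have "(G (pscale c (bas p) + y) - G (pscale c (bas p)) - G y) + (G (pscale c (bas p)) - pscale c (G (bas p)))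
      + (G y - ?L y) \<in> rels X"
    using assms(1)[OF kspace_pscale[OF b] step(2), of c] assms(2)[OF b, of c] step(3)
    by (intro rels_subspace(2))
  moreover have "(G (pscale c (bas p) + y) - G (pscale c (bas p)) - G y) + (G (pscale c (bas p)) - pscale c (G (bas p)))
      + (G y - ?L y) = G (pscale c (bas p) + y) - ?L (pscale c (bas p) + y)"
    by (simp add: lin_ext_add lin_ext_pscale)
  ultimately show ?case by (simp only:)
qed

definition expand :: "(('v, 'e) triple \<Rightarrow>\<^sub>0 'k) \<Rightarrow> ('v, 'e, 'k) ftens" where
  "expand = lin_ext (\<lambda>z. bas (\<pi> (bas (fst z)), bas (fst (snd z)), \<pi> (bas (snd (snd z)))))"

lemma klin_expand [simp, intro]: "klin expand" by (simp add: expand_def)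

lemma expand_bas [simp]: "expand (bas (b, p, b')) = bas (\<pi> (bas b), bas p, \<pi> (bas b'))"
  by (simp add: expand_def)

lemma B_path: "b \<in> B \<Longrightarrow> b \<in> PQ"
  by (simp add: irred_paths_def)

lemma Q0_triv: "p \<in> PQ \<Longrightarrow> bas (psrc p, [], psrc p) \<in> Q0" "p \<in> PQ \<Longrightarrow> bas (ptgt p, [], ptgt p) \<in> Q0"
  using triv_src triv_tgt by (simp_all add: qpaths_of_length_def)

text \<open>Insert the vertex at the end of \<open>b\<close>: it is absorbed by \<open>b\<close>,
  whereas moved across the tensor sign it annihilates \<open>p\<close>. If instead \<open>p\<close>
  and \<open>b'\<close> do not compose, the vertex at the start of \<open>b'\<close> plays this
  role.\<close>

lemma rels_noncomposable:
  fixes X :: "('v, 'e) qpath set"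
  assumes X: "X \<subseteq> PQ" and b: "b \<in> B" "p \<in> X" "b' \<in> B" "\<not> (composable b p \<and> composable p b')"
  shows "bas (\<pi> (bas b), bas p, \<pi> (bas b')) \<in> rels X"
proof -
  note P = B_path[OF b(1)] B_path[OF b(3)] subsetD[OF X b(2)]
  have A: "\<pi> (bas b) \<in> CA" "\<pi> (bas b') \<in> CA" using P by (simp_all add: A_closed)
  have p: "bas p \<in> kspace X" using b(2) by simp
  \<comment> \<open>Homogeneity with the scalar 0 makes a triple with zero middle factor a
    relation.\<close>
  have z: "bas (x, 0, y) \<in> rels X" if "x \<in> CA" "y \<in> CA" for x y
    using rels_gens(5)[OF that(1,1) kspace_0 kspace_0 that(2,2), of "0 :: ('v, 'e, 'k) kq" 0] by simp
  show ?thesis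
  proof (cases "composable b p")
    case False
    let ?e = "(ptgt b, [], ptgt b)"
    have e: "bas ?e \<in> Q0" "bas ?e \<in> kspace PQ" using Q0_triv(2)[OF P(1)] triv_tgt[OF P(1)] by simp_all
    have eb: "composable b ?e" "pcomp b ?e = b" by (simp_all add: composable_def pcomp_triv(1)[OF _ triv_tgt[OF P(1)]])
    have "\<not> composable ?e p" using False by (simp add: composable_def)
    then have "bas (\<pi> (bas b) \<otimes>\<^bsub>A\<^esub> \<pi> (bas ?e), bas p, \<pi> (bas b')) - bas (\<pi> (bas b), 0, \<pi> (bas b')) \<in> rels X"
      using rels_gens(7)[OF A(1,1) p p A(2,2) e(1)] by simp
    moreover have "\<pi> (bas b) \<otimes>\<^bsub>A\<^esub> \<pi> (bas ?e) = \<pi> (bas b)" using proj_ops(2)[of "bas b" "bas ?e"] P e(2) eb by simp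
    ultimately show ?thesis using rels_subspace(2)[OF _ z[OF A]] by fastforce
  next
    case True
    then have nc: "\<not> composable p b'" using b(4) by simp
    let ?e = "(psrc b', [], psrc b')"
    have e: "bas ?e \<in> Q0" "bas ?e \<in> kspace PQ" using Q0_triv(1)[OF P(2)] triv_src[OF P(2)] by simp_all
    have eb: "composable ?e b'" "pcomp ?e b' = b'" by (simp_all add: composable_def pcomp_triv(2)[OF _ triv_src[OF P(2)]])
    have "\<not> composable p ?e" using nc by (simp add: composable_def)
    then have "bas (\<pi> (bas b), 0, \<pi> (bas b')) - bas (\<pi> (bas b), bas p, \<pi> (bas ?e) \<otimes>\<^bsub>A\<^esub> \<pi> (bas b')) \<in> rels X"
      using rels_gens(8)[OF A(1,1) p p A(2,2) e(1)] by simp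
    moreover have "\<pi> (bas ?e) \<otimes>\<^bsub>A\<^esub> \<pi> (bas b') = \<pi> (bas b')" using proj_ops(2)[of "bas ?e" "bas b'"] P e(2) eb by simp
    ultimately have "bas (\<pi> (bas b), 0, \<pi> (bas b')) - bas (\<pi> (bas b), bas p, \<pi> (bas b')) \<in> rels X" by simp
    from rels_subspace(3)[OF z[OF A] this] show ?thesis by simp
  qed
qed

text \<open>The factors are expanded into paths in turn, from left to right. Each stage is valid
  modulo relations, and the noncomposable triples disappear in the last one.\<close>

lemma rels_expand_coord_bas:
  fixes X :: "('v, 'e) qpath set"
  assumes X: "X \<subseteq> PQ" and x: "x \<in> CA" and w: "w \<in> kspace X" and y: "y \<in> CA"
  shows "bas (x, w, y) - expand (coord (bas (x, w, y))) \<in> rels X"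
proof -
  let ?x = "nf x" and ?y = "nf y"
  have nx: "?x \<in> kspace B" "?x \<in> kspace PQ" "\<pi> ?x = x" by (simp_all add: nf_kspace nf_kspace' proj_nf x)
  have ny: "?y \<in> kspace B" "?y \<in> kspace PQ" "\<pi> ?y = y" by (simp_all add: nf_kspace nf_kspace' proj_nf y)
  have e0: "(0 :: ('v, 'e, 'k) kq) \<in> Q0" by simp
  have PB: "z \<in> kspace PQ" "\<pi> z \<in> CA" if "z \<in> kspace B" for z :: "('v, 'e, 'k) kq"
    using subsetD[OF B_PQ that] by (simp_all add: A_closed)
  have 1: "bas (\<pi> ?x, w, y) - lin_ext (\<lambda>b. bas (\<pi> (bas b), w, y)) ?x \<in> rels X"
  proof (rule rels_expand[where G = "\<lambda>x. bas (\<pi> x, w, y)", OF _ _ nx(1)])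
    fix u v :: "('v, 'e, 'k) kq" and c :: 'k assume u: "u \<in> kspace B"
    show "bas (\<pi> (pscale c u), w, y) - pscale c (bas (\<pi> u, w, y)) \<in> rels X"
      using rels_gens(4)[OF PB(2)[OF u] PB(2)[OF u] w w y y e0, of c] scal_mult[OF PB(1)[OF u], of c] by simp
    assume v: "v \<in> kspace B"
    show "bas (\<pi> (u + v), w, y) - bas (\<pi> u, w, y) - bas (\<pi> v, w, y) \<in> rels X"
      using rels_gens(1)[OF PB(2)[OF u] PB(2)[OF v] w w y y e0] proj_ops(1)[OF PB(1)[OF u] PB(1)[OF v]] by simp
  qed
  have 2: "bas (x', w, y) - lin_ext (\<lambda>p. bas (x', bas p, y)) w \<in> rels X" if x': "x' \<in> CA" for x'
  proof (rule rels_expand[where G = "\<lambda>w. bas (x', w, y)", OF _ _ w])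
    fix u v :: "('v, 'e, 'k) kq" and c :: 'k assume u: "u \<in> kspace X"
    show "bas (x', pscale c u, y) - pscale c (bas (x', u, y)) \<in> rels X"
      using rels_gens(5)[OF x' x' u u y y e0, of c] .
    assume v: "v \<in> kspace X"
    show "bas (x', u + v, y) - bas (x', u, y) - bas (x', v, y) \<in> rels X"
      using rels_gens(2)[OF x' x' u v y y e0] .
  qed
  have 3: "bas (x', w', \<pi> ?y) - lin_ext (\<lambda>b'. bas (x', w', \<pi> (bas b'))) ?y \<in> rels X"
    if x': "x' \<in> CA" and w': "w' \<in> kspace X" for x' w'
  proof (rule rels_expand[where G = "\<lambda>y. bas (x', w', \<pi> y)", OF _ _ ny(1)])
    fix u v :: "('v, 'e, 'k) kq" and c :: 'k assume u: "u \<in> kspace B"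
    show "bas (x', w', \<pi> (pscale c u)) - pscale c (bas (x', w', \<pi> u)) \<in> rels X"
      using rels_gens(6)[OF x' x' w' w' PB(2)[OF u] PB(2)[OF u] e0, of c] scal_mult[OF PB(1)[OF u], of c] by simp
    assume v: "v \<in> kspace B"
    show "bas (x', w', \<pi> (u + v)) - bas (x', w', \<pi> u) - bas (x', w', \<pi> v) \<in> rels X"
      using rels_gens(3)[OF x' x' w' w' PB(2)[OF u] PB(2)[OF v] e0] proj_ops(1)[OF PB(1)[OF u] PB(1)[OF v]] by simp
  qed
  let ?t = "\<lambda>b p b'. if composable b p \<and> composable p b' then bas (b, p, b') else 0 :: ('v, 'e) triple \<Rightarrow>\<^sub>0 'k"
  have tr: "a - c \<in> rels X" if "a - b \<in> rels X" "b - c \<in> rels X" for a b c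
    using rels_subspace(2)[OF that] by simp
  have B: "b \<in> B" "\<pi> (bas b) \<in> CA" if "b \<in> keys ?x" for b
    using kspace_key[OF nx(1) that] B_path by (simp_all add: A_closed)
  have B': "b \<in> B" if "b \<in> keys ?y" for b using kspace_key[OF ny(1) that] .
  have c3: "bas (\<pi> (bas b), bas p, y) - lin_ext (\<lambda>b'. expand (?t b p b')) ?y \<in> rels X"
    if b: "b \<in> keys ?x" and p: "p \<in> keys w" for b p
  proof (rule tr)
    have pX: "p \<in> X" by (rule kspace_key[OF w p])
    show "bas (\<pi> (bas b), bas p, y) - lin_ext (\<lambda>b'. bas (\<pi> (bas b), bas p, \<pi> (bas b'))) ?y \<in> rels X"
      using 3[of "\<pi> (bas b)" "bas p"] B[OF b] pX ny(3) by simp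
    show "lin_ext (\<lambda>b'. bas (\<pi> (bas b), bas p, \<pi> (bas b'))) ?y - lin_ext (\<lambda>b'. expand (?t b p b')) ?y \<in> rels X"
    proof (rule rels_lin_ext_cong)
      fix b' assume b': "b' \<in> keys ?y"
      show "bas (\<pi> (bas b), bas p, \<pi> (bas b')) - expand (?t b p b') \<in> rels X"
        using rels_noncomposable[OF X B(1)[OF b] pX B'[OF b']] rels_subspace(1)
        by (simp add: klin_0[OF klin_expand])
    qed
  qed
  have c2: "bas (\<pi> (bas b), w, y) - lin_ext (\<lambda>p. lin_ext (\<lambda>b'. expand (?t b p b')) ?y) w \<in> rels X"
    if b: "b \<in> keys ?x" for b
    by (rule tr[OF 2[OF B(2)[OF b]]], rule rels_lin_ext_cong, rule c3[OF b])
  have c1: "bas (\<pi> ?x, w, y) - lin_ext (\<lambda>b. lin_ext (\<lambda>p. lin_ext (\<lambda>b'. expand (?t b p b')) ?y) w) ?x \<in> rels X"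
    by (rule tr[OF 1], rule rels_lin_ext_cong, rule c2)
  have "expand (coord (bas (x, w, y))) = lin_ext (\<lambda>b. lin_ext (\<lambda>p. lin_ext (\<lambda>b'. expand (?t b p b')) ?y) w) ?x"
    by (simp add: tri3_def klin_lin_ext_comp[OF klin_expand])
  then show ?thesis using c1 nx(3) by simp
qed

lemma rels_expand_coord:
  assumes X: "X \<subseteq> PQ" and v: "v \<in> free X"
  shows "v - expand (coord v) \<in> rels X"
proof -
  have "lin_ext bas v - lin_ext (\<lambda>z. expand (coord (bas z))) v \<in> rels X"
  proof (rule rels_lin_ext_cong)
    fix z assume "z \<in> keys v"
    then have z: "z \<in> CA \<times> kspace X \<times> CA" by (rule kspace_key[OF v])
    obtain x w y where zz: "z = (x, w, y)" by (rule prod_cases3)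
    show "bas z - expand (coord (bas z)) \<in> rels X"
      using rels_expand_coord_bas[OF X, of x w y] z unfolding zz by simp
  qed
  moreover have "lin_ext (\<lambda>z. expand (coord (bas z))) v = expand (coord v)"
    by (rule klin_eq_lin_ext[OF klin_compose[OF klin_expand klin_coord], symmetric])
  ultimately show ?thesis by simp
qed

text \<open>The coordinates detect the relations exactly; together with \<open>coord_expand\<close>
  this makes the composable triples a basis of the tensor product.\<close>

lemma rels_iff:
  assumes X: "X \<subseteq> PQ" and v: "v \<in> free X"
  shows "v \<in> rels X \<longleftrightarrow> coord v = 0"
  using rels_coord(2)[OF X] rels_expand_coord[OF assms] by (auto simp: klin_0[OF klin_expand])

lemma expand_free:
  assumes X: "X \<subseteq> PQ" and u: "u \<in> kspace (tri X)"
  shows "expand u \<in> free X"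
  unfolding expand_def
  by (rule kspace_lin_ext[OF u]) (auto simp: tri_def A_closed B_path)

lemma coord_expand:
  assumes X: "X \<subseteq> PQ" and u: "u \<in> kspace (tri X)"
  shows "coord (expand u) = u"
proof (rule klin_eqI[where F = "\<lambda>u. coord (expand u)" and G = "\<lambda>u. u"])
  show "klin (\<lambda>u. coord (expand u))" by (rule klin_compose[OF klin_coord klin_expand])
  fix z assume "z \<in> keys u"
  then have z: "z \<in> tri X" by (rule kspace_key[OF u])
  obtain b p b' where zz: "z = (b, p, b')" by (rule prod_cases3)
  have "b \<in> B" "b' \<in> B" "composable b p" "composable p b'" using z unfolding zz tri_def by simp_all
  then show "coord (expand (bas z)) = bas z" unfolding zz by (simp add: nf_proj B_path NF_B)
qed simp

section \<open>The tensor bimodules\<close>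

abbreviation cls :: "('v, 'e) qpath set \<Rightarrow> ('v, 'e, 'k) ftens \<Rightarrow> ('v, 'e, 'k) tens" where
  "cls X v \<equiv> tensor_class Q I X v"
abbreviation T :: "('v, 'e) qpath set \<Rightarrow> (('v, 'e, 'k) qa, ('v, 'e, 'k) tens) bimodule" where
  "T X \<equiv> tensor_bimod Q I X"

text \<open>Coordinates of a tensor, read off from some representative. By \<open>cls_eq\<close> the
  choice is harmless, and by \<open>\<kappa>_inj\<close> the coordinates determine the
  tensor.\<close>

definition \<kappa> :: "('v, 'e, 'k) tens \<Rightarrow> (('v, 'e) triple \<Rightarrow>\<^sub>0 'k)" where
  "\<kappa> t = coord (SOME v. v \<in> t)"

lemma cls_eq:
  assumes X: "X \<subseteq> PQ" and v: "v \<in> free X"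
  shows "cls X v = {u \<in> free X. coord u = coord v}"
proof -
  have "cls X v = {h + v | h. h \<in> rels X}"
    unfolding tensor_class_def a_r_coset_def' tensor_free_def by auto
  also have "\<dots> = {u \<in> free X. coord u = coord v}"
  proof (intro equalityI subsetI)
    fix u assume "u \<in> {h + v | h. h \<in> rels X}"
    then obtain h where h: "u = h + v" "h \<in> rels X" by blast
    show "u \<in> {u \<in> free X. coord u = coord v}"
      using rels_coord[OF X h(2)] v h(1) by (simp add: kspace_add klin_add[OF klin_coord])
  next
    fix u assume "u \<in> {u \<in> free X. coord u = coord v}"
    then have u: "u \<in> free X" "coord u = coord v" by simp_all
    then have "u - v \<in> rels X" using rels_iff[OF X kspace_diff[OF u(1) v]] by (simp add: klin_diff[OF klin_coord])
    then show "u \<in> {h + v | h. h \<in> rels X}" by (intro CollectI exI[of _ "u - v"]) simp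
  qed
  finally show ?thesis .
qed

lemma carrier_T: "carrier (T X) = cls X ` free X"
  unfolding tensor_bimod_def A_RCOSETS_def' tensor_class_def by (auto simp: tensor_free_def)

lemma cls_some:
  assumes X: "X \<subseteq> PQ" and v: "v \<in> free X"
  shows "(SOME u. u \<in> cls X v) \<in> free X" "coord (SOME u. u \<in> cls X v) = coord v"
proof -
  have "v \<in> cls X v" unfolding cls_eq[OF assms] using v by simp
  then have "(SOME u. u \<in> cls X v) \<in> cls X v" by (rule someI)
  then show "(SOME u. u \<in> cls X v) \<in> free X" "coord (SOME u. u \<in> cls X v) = coord v"
    unfolding cls_eq[OF assms] by simp_all
qed

lemma \<kappa>_cls: "X \<subseteq> PQ \<Longrightarrow> v \<in> free X \<Longrightarrow> \<kappa> (cls X v) = coord v"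
  unfolding \<kappa>_def by (rule cls_some(2))

lemma T_cases:
  assumes "t \<in> carrier (T X)"
  obtains v where "v \<in> free X" "t = cls X v"
  using assms unfolding carrier_T by (rule imageE) (rule that)

lemma \<kappa>_kspace: "X \<subseteq> PQ \<Longrightarrow> t \<in> carrier (T X) \<Longrightarrow> \<kappa> t \<in> kspace (tri X)"
  by (erule T_cases) (simp add: \<kappa>_cls coord_kspace)

lemma \<kappa>_inj:
  assumes X: "X \<subseteq> PQ" and t: "t \<in> carrier (T X)" "t' \<in> carrier (T X)" "\<kappa> t = \<kappa> t'"
  shows "t = t'"
proof -
  obtain v where v: "v \<in> free X" "t = cls X v" by (rule T_cases[OF t(1)])
  obtain v' where v': "v' \<in> free X" "t' = cls X v'" by (rule T_cases[OF t(2)])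
  have "coord v = coord v'" using t(3) unfolding v(2) v'(2) by (simp add: \<kappa>_cls[OF X] v v')
  then show ?thesis unfolding v(2) v'(2) by (simp add: cls_eq[OF X] v v')
qed

lemma cls_carrier: "v \<in> free X \<Longrightarrow> cls X v \<in> carrier (T X)"
  unfolding carrier_T by (rule imageI)

lemma T_add:
  assumes X: "X \<subseteq> PQ" and v: "v \<in> free X" "v' \<in> free X"
  shows "cls X v \<oplus>\<^bsub>T X\<^esub> cls X v' = cls X (v + v')"
proof -
  have "cls X v \<oplus>\<^bsub>T X\<^esub> cls X v' = (\<Union>h\<in>cls X v. \<Union>k\<in>cls X v'. {h + k})"
    by (simp add: tensor_bimod_def set_add_def' tensor_free_def)
  also have "\<dots> = {u \<in> free X. coord u = coord (v + v')}"
    unfolding cls_eq[OF X v(1)] cls_eq[OF X v(2)]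
  proof (intro equalityI subsetI)
    fix u assume "u \<in> (\<Union>h\<in>{u \<in> free X. coord u = coord v}. \<Union>k\<in>{u \<in> free X. coord u = coord v'}. {h + k})"
    then obtain h k where "h \<in> free X" "coord h = coord v" "k \<in> free X" "coord k = coord v'" "u = h + k" by blast
    then show "u \<in> {u \<in> free X. coord u = coord (v + v')}" by (simp add: klin_add[OF klin_coord] kspace_add)
  next
    fix u assume "u \<in> {u \<in> free X. coord u = coord (v + v')}"
    then have u: "u \<in> free X" "coord u = coord (v + v')" by simp_all
    have "u - v \<in> {u \<in> free X. coord u = coord v'}"
      using u v by (simp add: kspace_diff klin_diff[OF klin_coord] klin_add[OF klin_coord])
    moreover have "v \<in> {u \<in> free X. coord u = coord v}" using v by simp
    moreover have "u \<in> {v + (u - v)}" by simp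
    ultimately show "u \<in> (\<Union>h\<in>{u \<in> free X. coord u = coord v}. \<Union>k\<in>{u \<in> free X. coord u = coord v'}. {h + k})" by blast
  qed
  also have "\<dots> = cls X (v + v')" using cls_eq[OF X kspace_add[OF v]] by simp
  finally show ?thesis .
qed

lemma T_zero:
  assumes X: "X \<subseteq> PQ"
  shows "\<zero>\<^bsub>T X\<^esub> = cls X 0"
proof -
  have "rels X = {u \<in> free X. coord u = coord 0}"
    using rels_coord[OF X] rels_iff[OF X] by (auto simp: klin_0[OF klin_coord])
  then show ?thesis using cls_eq[OF X kspace_0] by (simp add: tensor_bimod_def)
qed

lemma \<kappa>_add:
  assumes X: "X \<subseteq> PQ" and t: "t \<in> carrier (T X)" "t' \<in> carrier (T X)"
  shows "t \<oplus>\<^bsub>T X\<^esub> t' \<in> carrier (T X)" "\<kappa> (t \<oplus>\<^bsub>T X\<^esub> t') = \<kappa> t + \<kappa> t'"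
proof -
  obtain v where v: "v \<in> free X" "t = cls X v" by (rule T_cases[OF t(1)])
  obtain v' where v': "v' \<in> free X" "t' = cls X v'" by (rule T_cases[OF t(2)])
  have vv: "v + v' \<in> free X" using v v' by (simp add: kspace_add)
  show "t \<oplus>\<^bsub>T X\<^esub> t' \<in> carrier (T X)" "\<kappa> (t \<oplus>\<^bsub>T X\<^esub> t') = \<kappa> t + \<kappa> t'"
    unfolding v(2) v'(2) T_add[OF X v(1) v'(1)]
    by (simp_all add: cls_carrier \<kappa>_cls[OF X] vv v v' klin_add[OF klin_coord])
qed

lemma \<kappa>_zero:
  assumes X: "X \<subseteq> PQ"
  shows "\<zero>\<^bsub>T X\<^esub> \<in> carrier (T X)" "\<kappa> \<zero>\<^bsub>T X\<^esub> = 0"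
  unfolding T_zero[OF X] by (simp_all add: cls_carrier \<kappa>_cls[OF X] klin_0[OF klin_coord])

text \<open>The laws are pulled back along the injective additive map \<open>\<kappa>\<close>; only
  the inverse is produced from a representative.\<close>

lemma abelian_group_T:
  assumes X: "X \<subseteq> PQ"
  shows "abelian_group (T X)"
proof (rule abelian_groupI)
  fix x y assume xy: "x \<in> carrier (T X)" "y \<in> carrier (T X)"
  show "x \<oplus>\<^bsub>T X\<^esub> y \<in> carrier (T X)" by (rule \<kappa>_add(1)[OF X xy])
  show "x \<oplus>\<^bsub>T X\<^esub> y = y \<oplus>\<^bsub>T X\<^esub> x"
    by (rule \<kappa>_inj[OF X]) (simp_all add: \<kappa>_add[OF X] xy add.commute)
  fix z assume z: "z \<in> carrier (T X)"
  show "x \<oplus>\<^bsub>T X\<^esub> y \<oplus>\<^bsub>T X\<^esub> z = x \<oplus>\<^bsub>T X\<^esub> (y \<oplus>\<^bsub>T X\<^esub> z)"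
    by (rule \<kappa>_inj[OF X]) (simp_all add: \<kappa>_add[OF X] xy z add.assoc)
next
  show "\<zero>\<^bsub>T X\<^esub> \<in> carrier (T X)" by (rule \<kappa>_zero(1)[OF X])
  fix x assume x: "x \<in> carrier (T X)"
  show "\<zero>\<^bsub>T X\<^esub> \<oplus>\<^bsub>T X\<^esub> x = x"
    by (rule \<kappa>_inj[OF X]) (simp_all add: \<kappa>_add[OF X] \<kappa>_zero[OF X] x)
  obtain v where v: "v \<in> free X" "x = cls X v" by (rule T_cases[OF x])
  have "cls X (- v) \<oplus>\<^bsub>T X\<^esub> x = \<zero>\<^bsub>T X\<^esub>"
    unfolding v(2) T_zero[OF X] using T_add[OF X kspace_uminus[OF v(1)] v(1)] by simp
  moreover have "cls X (- v) \<in> carrier (T X)" using v(1) by (simp add: cls_carrier kspace_uminus)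
  ultimately show "\<exists>y\<in>carrier (T X). y \<oplus>\<^bsub>T X\<^esub> x = \<zero>\<^bsub>T X\<^esub>" by (rule bexI)
qed

lemma \<kappa>_minus:
  assumes X: "X \<subseteq> PQ" and t: "t \<in> carrier (T X)" "t' \<in> carrier (T X)"
  shows "t \<ominus>\<^bsub>T X\<^esub> t' \<in> carrier (T X)" "\<kappa> (t \<ominus>\<^bsub>T X\<^esub> t') = \<kappa> t - \<kappa> t'"
proof -
  interpret abelian_group "T X" by (rule abelian_group_T[OF X])
  have n: "\<ominus>\<^bsub>T X\<^esub> t' \<in> carrier (T X)" using t(2) by simp
  have "\<kappa> (\<ominus>\<^bsub>T X\<^esub> t') + \<kappa> t' = 0"
    using \<kappa>_add(2)[OF X n t(2)] l_neg[OF t(2)] \<kappa>_zero(2)[OF X] by simp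
  then have "\<kappa> (\<ominus>\<^bsub>T X\<^esub> t') = - \<kappa> t'" by (simp add: eq_neg_iff_add_eq_0)
  then show "t \<ominus>\<^bsub>T X\<^esub> t' \<in> carrier (T X)" "\<kappa> (t \<ominus>\<^bsub>T X\<^esub> t') = \<kappa> t - \<kappa> t'"
    using \<kappa>_add[OF X t(1) n] by (simp_all add: a_minus_def)
qed

definition \<tau> :: "('v, 'e) qpath set \<Rightarrow> (('v, 'e) triple \<Rightarrow>\<^sub>0 'k) \<Rightarrow> ('v, 'e, 'k) tens" where
  "\<tau> X u = cls X (expand u)"

lemma \<tau>_props:
  assumes X: "X \<subseteq> PQ" and u: "u \<in> kspace (tri X)"
  shows "\<tau> X u \<in> carrier (T X)" "\<kappa> (\<tau> X u) = u"
  unfolding \<tau>_def using expand_free[OF assms] coord_expand[OF assms]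
  by (simp_all add: cls_carrier \<kappa>_cls[OF X])

lemma \<tau>_\<kappa>: "X \<subseteq> PQ \<Longrightarrow> t \<in> carrier (T X) \<Longrightarrow> \<tau> X (\<kappa> t) = t"
  by (rule \<kappa>_inj) (simp_all add: \<tau>_props \<kappa>_kspace)

section \<open>The two actions and bimodule maps in coordinates\<close>

definition lact :: "('v, 'e, 'k) kq \<Rightarrow> (('v, 'e) triple \<Rightarrow>\<^sub>0 'k) \<Rightarrow> (('v, 'e) triple \<Rightarrow>\<^sub>0 'k)" where
  "lact x = lin_ext (\<lambda>z. tri3 (N (kq_mult x (bas (fst z)))) (bas (fst (snd z))) (bas (snd (snd z))))"

definition ract :: "('v, 'e, 'k) kq \<Rightarrow> (('v, 'e) triple \<Rightarrow>\<^sub>0 'k) \<Rightarrow> (('v, 'e) triple \<Rightarrow>\<^sub>0 'k)" where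
  "ract y = lin_ext (\<lambda>z. tri3 (bas (fst z)) (bas (fst (snd z))) (N (kq_mult (bas (snd (snd z))) y)))"

lemma klin_lact [simp, intro]: "klin (lact x)" and klin_ract [simp, intro]: "klin (ract x)"
  by (simp_all add: lact_def ract_def)

lemma klin_lact': "klin (\<lambda>x. lact x u)" and klin_ract': "klin (\<lambda>x. ract x u)"
  unfolding lact_def ract_def
  by (rule klin_lin_ext_fun, rule klin_compose[OF tri3_klin(1) klin_compose[OF klin_N klin_kq_mult_left]])
    (rule klin_lin_ext_fun, rule klin_compose[OF tri3_klin(3) klin_compose[OF klin_N klin_kq_mult_right]])

lemma NF_ends: "p \<in> PQ \<Longrightarrow> q \<in> keys (NF p) \<Longrightarrow> psrc q = psrc p \<and> ptgt q = ptgt p"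
  using NF_keys(2) step_rtrancl_paths by metis

text \<open>Normal forms keep both ends, so multiplication on one side keeps the end of
  \<open>b\<close> on the other side. Hence a factor that fails to compose with its neighbour still
  fails after the action.\<close>

lemma keys_N_mult_bas:
  assumes "x \<in> kspace PQ" "b \<in> PQ"
  shows "q \<in> keys (N (kq_mult x (bas b))) \<Longrightarrow> q \<in> PQ \<and> ptgt q = ptgt b"
    and "q \<in> keys (N (kq_mult (bas b) x)) \<Longrightarrow> q \<in> PQ \<and> psrc q = psrc b"
proof -
  assume q: "q \<in> keys (N (kq_mult x (bas b)))"
  obtain p where p: "p \<in> keys x" "q \<in> keys (N (kq_mult (bas p) (bas b)))"
    using subsetD[OF keys_klin[OF klin_compose[OF klin_N klin_kq_mult_left]] q] by (rule UN_E)
  have pP: "p \<in> PQ" by (rule kspace_key[OF assms(1) p(1)])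
  have c: "composable p b" using p(2) by (cases "composable p b") (simp_all add: klin_0[OF klin_N])
  have pb: "pcomp p b \<in> PQ" by (rule pcomp_qpath[OF pP assms(2) c])
  have "q \<in> keys (NF (pcomp p b))" using p(2) c by simp
  then show "q \<in> PQ \<and> ptgt q = ptgt b" using NF_ends[OF pb] NF_keys(1)[OF pb] B_path by simp
next
  assume q: "q \<in> keys (N (kq_mult (bas b) x))"
  obtain p where p: "p \<in> keys x" "q \<in> keys (N (kq_mult (bas b) (bas p)))"
    using subsetD[OF keys_klin[OF klin_compose[OF klin_N klin_kq_mult_right]] q] by (rule UN_E)
  have pP: "p \<in> PQ" by (rule kspace_key[OF assms(1) p(1)])
  have c: "composable b p" using p(2) by (cases "composable b p") (simp_all add: klin_0[OF klin_N])
  have pb: "pcomp b p \<in> PQ" by (rule pcomp_qpath[OF assms(2) pP c])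
  have "q \<in> keys (NF (pcomp b p))" using p(2) c by simp
  then show "q \<in> PQ \<and> psrc q = psrc b" using NF_ends[OF pb] NF_keys(1)[OF pb] B_path by simp
qed

lemma tri3_noncomposable:
  "(\<And>b. b \<in> keys x \<Longrightarrow> \<not> composable b p) \<Longrightarrow> tri3 x (bas p) y = 0"
  "(\<And>b. b \<in> keys y \<Longrightarrow> \<not> composable p b) \<Longrightarrow> tri3 x (bas p) y = 0"
proof -
  have k0: "klin (\<lambda>_. 0 :: ('v, 'e) triple \<Rightarrow>\<^sub>0 'k)" by (rule klinI) simp_all
  show "tri3 x (bas p) y = 0" if h: "\<And>b. b \<in> keys x \<Longrightarrow> \<not> composable b p"
    by (rule klin3_eqI[where F = tri3 and G = "\<lambda>_ _ _. 0"]) (rule tri3_klin k0 | simp add: h)+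
  show "tri3 x (bas p) y = 0" if h: "\<And>b. b \<in> keys y \<Longrightarrow> \<not> composable p b"
    by (rule klin3_eqI[where F = tri3 and G = "\<lambda>_ _ _. 0"]) (rule tri3_klin k0 | simp add: h)+
qed

lemma lact_tri3:
  assumes a: "a \<in> kspace PQ" and x: "x \<in> kspace PQ"
  shows "lact a (tri3 x w y) = tri3 (N (kq_mult a x)) w y"
proof (rule klin3_eqI[where F = "\<lambda>x w y. lact a (tri3 x w y)" and G = "\<lambda>x w y. tri3 (N (kq_mult a x)) w y"])
  fix b p b' assume "b \<in> keys x"
  then have b: "b \<in> PQ" by (rule kspace_key[OF x])
  show "lact a (tri3 (bas b) (bas p) (bas b')) = tri3 (N (kq_mult a (bas b))) (bas p) (bas b')"
  proof (cases "composable b p \<and> composable p b'")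
    case True
    then show ?thesis by (simp add: lact_def)
  next
    case False
    have "tri3 (N (kq_mult a (bas b))) (bas p) (bas b') = 0"
    proof (cases "composable b p")
      case True
      then show ?thesis using False by (intro tri3_noncomposable(2)) simp
    next
      case nc: False
      then show ?thesis using keys_N_mult_bas(1)[OF a b] by (intro tri3_noncomposable(1)) (auto simp: composable_def)
    qed
    moreover have z: "tri3 (bas b) (bas p) (bas b') = 0" using False unfolding tri3_bas by (rule if_not_P)
    ultimately show ?thesis unfolding z by (simp only: klin_0[OF klin_lact])
  qed
qed (rule klin_compose[OF klin_lact tri3_klin(1)] klin_compose[OF klin_lact tri3_klin(2)] klin_compose[OF klin_lact tri3_klin(3)]
    klin_compose[OF tri3_klin(1) klin_compose[OF klin_N klin_kq_mult_right]] tri3_klin)+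

lemma ract_tri3:
  assumes a: "a \<in> kspace PQ" and y: "y \<in> kspace PQ"
  shows "ract a (tri3 x w y) = tri3 x w (N (kq_mult y a))"
proof (rule klin3_eqI[where F = "\<lambda>x w y. ract a (tri3 x w y)" and G = "\<lambda>x w y. tri3 x w (N (kq_mult y a))"])
  fix b p b' assume "b' \<in> keys y"
  then have b: "b' \<in> PQ" by (rule kspace_key[OF y])
  show "ract a (tri3 (bas b) (bas p) (bas b')) = tri3 (bas b) (bas p) (N (kq_mult (bas b') a))"
  proof (cases "composable b p \<and> composable p b'")
    case True
    then show ?thesis by (simp add: ract_def)
  next
    case False
    have "tri3 (bas b) (bas p) (N (kq_mult (bas b') a)) = 0"
    proof (cases "composable p b'")
      case True
      then show ?thesis using False by (intro tri3_noncomposable(1)) simp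
    next
      case nc: False
      then show ?thesis using keys_N_mult_bas(2)[OF a b] by (intro tri3_noncomposable(2)) (auto simp: composable_def)
    qed
    moreover have z: "tri3 (bas b) (bas p) (bas b') = 0" using False unfolding tri3_bas by (rule if_not_P)
    ultimately show ?thesis unfolding z by (simp only: klin_0[OF klin_ract])
  qed
qed (rule klin_compose[OF klin_ract tri3_klin(1)] klin_compose[OF klin_ract tri3_klin(2)] klin_compose[OF klin_ract tri3_klin(3)]
    klin_compose[OF tri3_klin(3) klin_compose[OF klin_N klin_kq_mult_left]] tri3_klin)+

lemma \<kappa>_smult:
  assumes X: "X \<subseteq> PQ" and a: "a \<in> CA" and t: "t \<in> carrier (T X)"
  shows "a \<odot>\<^bsub>T X\<^esub> t \<in> carrier (T X)" "\<kappa> (a \<odot>\<^bsub>T X\<^esub> t) = lact (nf a) (\<kappa> t)"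
    "rsmult (T X) t a \<in> carrier (T X)" "\<kappa> (rsmult (T X) t a) = ract (nf a) (\<kappa> t)"
proof -
  obtain v where v: "v \<in> free X" "t = cls X v" by (rule T_cases[OF t])
  let ?l = "lin_ext (\<lambda>(x, w, y). bas (a \<otimes>\<^bsub>A\<^esub> x, w, y))"
  let ?r = "lin_ext (\<lambda>(x, w, y). bas (x, w, y \<otimes>\<^bsub>A\<^esub> a))"
  have lf: "?l u \<in> free X" and rf: "?r u \<in> free X" if "u \<in> free X" for u
    by (rule kspace_lin_ext[OF that], auto simp: A_closed a)+
  have lc: "coord (?l u) = lact (nf a) (coord u)" if u: "u \<in> free X" for u
  proof (rule klin_eqI[where F = "\<lambda>u. coord (?l u)" and G = "\<lambda>u. lact (nf a) (coord u)"])
    show "klin (\<lambda>u. coord (?l u))" by (rule klin_compose[OF klin_coord klin_lin_ext])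
    show "klin (\<lambda>u. lact (nf a) (coord u))" by (rule klin_compose[OF klin_lact klin_coord])
    fix z assume "z \<in> keys u"
    then have z: "z \<in> CA \<times> kspace X \<times> CA" by (rule kspace_key[OF u])
    obtain x w y where zz: "z = (x, w, y)" by (rule prod_cases3)
    have x: "x \<in> CA" using z unfolding zz by simp
    show "coord (?l (bas z)) = lact (nf a) (coord (bas z))"
      unfolding zz by (simp add: nf_mult[OF a x] lact_tri3 nf_kspace' a x)
  qed
  have rc: "coord (?r u) = ract (nf a) (coord u)" if u: "u \<in> free X" for u
  proof (rule klin_eqI[where F = "\<lambda>u. coord (?r u)" and G = "\<lambda>u. ract (nf a) (coord u)"])
    show "klin (\<lambda>u. coord (?r u))" by (rule klin_compose[OF klin_coord klin_lin_ext])
    show "klin (\<lambda>u. ract (nf a) (coord u))" by (rule klin_compose[OF klin_ract klin_coord])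
    fix z assume "z \<in> keys u"
    then have z: "z \<in> CA \<times> kspace X \<times> CA" by (rule kspace_key[OF u])
    obtain x w y where zz: "z = (x, w, y)" by (rule prod_cases3)
    have y: "y \<in> CA" using z unfolding zz by simp
    show "coord (?r (bas z)) = ract (nf a) (coord (bas z))"
      unfolding zz by (simp add: nf_mult[OF y a] ract_tri3 nf_kspace' a y)
  qed
  \<comment> \<open>The action is defined as a union over all representatives of \<open>t\<close>.
    The coordinates of the result depend only on those of the representative, so all classes in the
    union coincide.\<close>
  have eq: "(\<Union>u\<in>t. cls X (f u)) = cls X (f v)"
    if f: "\<And>u. u \<in> free X \<Longrightarrow> f u \<in> free X" "\<And>u. u \<in> free X \<Longrightarrow> coord u = coord v \<Longrightarrow> coord (f u) = coord (f v)" for f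
  proof -
    have "cls X (f u) = cls X (f v)" if "u \<in> t" for u
    proof -
      have u: "u \<in> free X" "coord u = coord v" using that unfolding v(2) cls_eq[OF X v(1)] by simp_all
      show ?thesis unfolding cls_eq[OF X f(1)[OF u(1)]] cls_eq[OF X f(1)[OF v(1)]] using f(2)[OF u] by simp
    qed
    moreover have "v \<in> t" unfolding v(2) cls_eq[OF X v(1)] using v(1) by simp
    ultimately show ?thesis by blast
  qed
  have l: "a \<odot>\<^bsub>T X\<^esub> t = cls X (?l v)"
    using eq[of ?l, OF lf] lc v(1) by (simp add: tensor_bimod_def)
  have r: "rsmult (T X) t a = cls X (?r v)"
    using eq[of ?r, OF rf] rc v(1) by (simp add: tensor_bimod_def)
  show "a \<odot>\<^bsub>T X\<^esub> t \<in> carrier (T X)" "\<kappa> (a \<odot>\<^bsub>T X\<^esub> t) = lact (nf a) (\<kappa> t)"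
    unfolding l using lf[OF v(1)] lc[OF v(1)] v by (simp_all add: cls_carrier \<kappa>_cls[OF X])
  show "rsmult (T X) t a \<in> carrier (T X)" "\<kappa> (rsmult (T X) t a) = ract (nf a) (\<kappa> t)"
    unfolding r using rf[OF v(1)] rc[OF v(1)] v by (simp_all add: cls_carrier \<kappa>_cls[OF X])
qed

lemma \<kappa>_scal:
  assumes X: "X \<subseteq> PQ" and t: "t \<in> carrier (T X)"
  shows "\<kappa> (scal Q I c \<odot>\<^bsub>T X\<^esub> t) = pscale c (\<kappa> t)"
proof -
  let ?one = "\<Sum>v \<in> verts Q. bas (v, [], v) :: ('v, 'e, 'k) kq"
  have u: "\<kappa> t \<in> kspace (tri X)" by (rule \<kappa>_kspace[OF assms])
  have n: "nf (scal Q I c) = pscale c (N ?one)"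
    unfolding scal_def using nf_proj[of "pscale c ?one"] one_kspace by (simp add: kspace_pscale klin_pscale[OF klin_N])
  have "lact (N ?one) (\<kappa> t) = \<kappa> t"
  proof (rule klin_eqI[OF klin_lact klin_id])
    fix z assume "z \<in> keys (\<kappa> t)"
    then have z: "z \<in> tri X" by (rule kspace_key[OF u])
    obtain b p b' where zz: "z = (b, p, b')" by (rule prod_cases3)
    have b: "b \<in> B" "composable b p" "composable p b'" using z unfolding zz tri_def by simp_all
    have "N (kq_mult (N ?one) (bas b)) = N (kq_mult ?one (bas b))"
    proof -
      have bP: "bas b \<in> kspace PQ" using b(1) B_path by simp
      have "\<pi> (kq_mult (N ?one) (bas b)) = \<pi> (kq_mult ?one (bas b))"
        using proj_ops(2)[OF N_kspace'[OF one_kspace] bP] proj_ops(2)[OF one_kspace bP] proj_N[OF one_kspace] by simp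
      then show ?thesis
        using proj_eq_iff[OF kq_mult_closed[OF N_kspace'[OF one_kspace] bP] kq_mult_closed[OF one_kspace bP]] by simp
    qed
    also have "\<dots> = bas b" using kq_mult_one(2)[of "bas b"] b(1) B_path by (simp add: NF_B)
    finally show "lact (N ?one) (bas z) = bas z" unfolding zz using b by (simp add: lact_def)
  qed
  then show ?thesis using \<kappa>_smult(2)[OF X A_closed(3) t, of c] n klin_pscale[OF klin_lact', of c "N ?one" "\<kappa> t"] by simp
qed

text \<open>\<open>bimod_ext\<close> is evaluated at an arbitrary representative. By
  \<open>H\<close> the value on an elementary tensor depends on its coordinates alone, so the choice
  drops out. The target \<open>M\<close> is general in order to include \<open>A\<close>, the target
  of the augmentation.\<close>

lemma bimod_ext_coord:
  fixes M :: "(('v, 'e, 'k) qa, 'm) bimodule" and h :: "'m \<Rightarrow> ('z \<Rightarrow>\<^sub>0 'k)"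
  assumes X: "X \<subseteq> PQ" and M: "abelian_group M"
    and h: "\<And>s t. s \<in> carrier M \<Longrightarrow> t \<in> carrier M \<Longrightarrow> h (s \<oplus>\<^bsub>M\<^esub> t) = h s + h t" "h \<zero>\<^bsub>M\<^esub> = 0"
    and act: "\<And>a m. a \<in> CA \<Longrightarrow> m \<in> carrier M \<Longrightarrow> a \<odot>\<^bsub>M\<^esub> m \<in> carrier M"
      "\<And>a m. a \<in> CA \<Longrightarrow> m \<in> carrier M \<Longrightarrow> rsmult M m a \<in> carrier M"
    and scal: "\<And>c m. m \<in> carrier M \<Longrightarrow> h (scal Q I c \<odot>\<^bsub>M\<^esub> m) = pscale c (h m)"
    and g: "\<And>q. q \<in> X \<Longrightarrow> g q \<in> carrier M"
    and H: "\<And>x y q. x \<in> CA \<Longrightarrow> y \<in> CA \<Longrightarrow> q \<in> X \<Longrightarrow>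
      h (rsmult M (x \<odot>\<^bsub>M\<^esub> g q) y) = lin_ext H (tri3 (nf x) (bas q) (nf y))"
    and t: "t \<in> carrier (T X)"
  shows "bimod_ext Q I M g t \<in> carrier M" "h (bimod_ext Q I M g t) = lin_ext H (\<kappa> t)"
proof -
  define v where "v = (SOME v. v \<in> t)"
  obtain v' where v': "v' \<in> free X" "t = cls X v'" by (rule T_cases[OF t])
  have v: "v \<in> free X" "\<kappa> t = coord v"
    using cls_some(1)[OF X v'(1)] unfolding v_def v'(2) \<kappa>_def by simp_all
  define inner where "inner z = (case z of (x, w, y) \<Rightarrow>
        (\<Oplus>\<^bsub>M\<^esub> q \<in> keys w.
           scal Q I (lookup v z * lookup w q) \<odot>\<^bsub>M\<^esub>
             rsmult M (x \<odot>\<^bsub>M\<^esub> g q) y))" for z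
  have e: "bimod_ext Q I M g t = (\<Oplus>\<^bsub>M\<^esub> z \<in> keys v. inner z)"
    unfolding bimod_ext_def Let_def v_def[symmetric] inner_def ..
  have inner: "inner z \<in> carrier M \<and> h (inner z) = pscale (lookup v z) (lin_ext H (cg z))"
    if "z \<in> keys v" for z
  proof -
    have z: "z \<in> CA \<times> kspace X \<times> CA" by (rule kspace_key[OF v(1) that])
    obtain x w y where zz: "z = (x, w, y)" by (rule prod_cases3)
    have x: "x \<in> CA" and w: "w \<in> kspace X" and y: "y \<in> CA" using z unfolding zz by simp_all
    have wX: "q \<in> X" if "q \<in> keys w" for q by (rule kspace_key[OF w that])
    have c: "rsmult M (x \<odot>\<^bsub>M\<^esub> g q) y \<in> carrier M" if "q \<in> X" for q using that act g x y by simp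
    let ?f = "\<lambda>q. scal Q I (lookup v z * lookup w q) \<odot>\<^bsub>M\<^esub> rsmult M (x \<odot>\<^bsub>M\<^esub> g q) y"
    have i: "inner z = (\<Oplus>\<^bsub>M\<^esub> q \<in> keys w. ?f q)" by (simp add: inner_def zz)
    have fin: "finite (keys w)" by simp
    have "?f q \<in> carrier M" if "q \<in> keys w" for q using c[OF wX[OF that]] act(1) A_closed(3) by simp
    from finsum_hom[OF M h fin this]
    have "inner z \<in> carrier M" "h (inner z) = (\<Sum>q\<in>keys w. h (?f q))" unfolding i by simp_all
    moreover have "(\<Sum>q\<in>keys w. h (?f q)) = (\<Sum>q\<in>keys w.
        pscale (lookup v z) (pscale (lookup w q) (lin_ext H (tri3 (nf x) (bas q) (nf y)))))"
      by (rule sum.cong) (simp_all add: scal c wX H x y)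
    moreover have "\<dots> = pscale (lookup v z) (lin_ext (\<lambda>q. lin_ext H (tri3 (nf x) (bas q) (nf y))) w)"
      by (simp add: lin_ext_def[of _ w] pscale_sum)
    moreover have "lin_ext (\<lambda>q. lin_ext H (tri3 (nf x) (bas q) (nf y))) w = lin_ext H (cg z)"
      unfolding cg_def zz using klin_eq_lin_ext[OF klin_compose[OF klin_lin_ext tri3_klin(2)], of H "nf x" w "nf y"] by simp
    ultimately show ?thesis by simp
  qed
  have fin: "finite (keys v)" by simp
  from finsum_hom[OF M h fin conjunct1[OF inner]]
  have "bimod_ext Q I M g t \<in> carrier M" "h (bimod_ext Q I M g t) = (\<Sum>z\<in>keys v. h (inner z))"
    unfolding e by simp_all
  moreover have "(\<Sum>z\<in>keys v. h (inner z)) = lin_ext (\<lambda>z. lin_ext H (cg z)) v"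
    unfolding lin_ext_def[of _ v] using inner by simp
  moreover have "\<dots> = lin_ext H (\<kappa> t)"
    unfolding v(2) coord_def by (rule klin_lin_ext_comp[OF klin_lin_ext, symmetric])
  ultimately show "bimod_ext Q I M g t \<in> carrier M" "h (bimod_ext Q I M g t) = lin_ext H (\<kappa> t)" by simp_all
qed

text \<open>In coordinates, \<open>bmap G\<close> is the bimodule map with \<open>1 \<otimes> q \<otimes> 1 \<mapsto> G q\<close>.\<close>

definition bmap :: "(('v, 'e) qpath \<Rightarrow> (('v, 'e) triple \<Rightarrow>\<^sub>0 'k)) \<Rightarrow> (('v, 'e) triple \<Rightarrow>\<^sub>0 'k) \<Rightarrow> (('v, 'e) triple \<Rightarrow>\<^sub>0 'k)" where
  "bmap G = lin_ext (\<lambda>z. ract (bas (snd (snd z))) (lact (bas (fst z)) (G (fst (snd z)))))"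

lemma klin_bmap [simp, intro]: "klin (bmap G)" by (simp add: bmap_def)

lemma ract_lact_bas:
  assumes "b \<in> PQ" "b' \<in> PQ" "z \<in> tri X"
  shows "ract (bas b') (lact (bas b) (bas z)) =
    tri3 (N (kq_mult (bas b) (bas (fst z)))) (bas (fst (snd z))) (N (kq_mult (bas (snd (snd z))) (bas b')))"
proof -
  obtain a p c where zz: "z = (a, p, c)" by (rule prod_cases3)
  have z: "a \<in> PQ" "c \<in> PQ" "composable a p" "composable p c" using assms(3) B_path unfolding zz tri_def by simp_all
  have "lact (bas b) (bas z) = tri3 (N (kq_mult (bas b) (bas a))) (bas p) (bas c)"
    by (simp add: zz lact_def)
  then show ?thesis using ract_tri3[of "bas b'" "bas c"] assms(2) z(2) zz by simp
qed

text \<open>For paths that do not compose with \<open>q\<close> the right side is 0 because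
  \<open>tri3\<close> is; the left side vanishes because \<open>G q\<close> is parallel to
  \<open>q\<close>, as stated in \<open>par\<close>.\<close>

lemma ract_lact_tri3:
  assumes b: "x \<in> kspace PQ" "y \<in> kspace PQ" and q: "q \<in> PQ" and G: "G q \<in> kspace (tri X)"
    and par: "\<And>z. z \<in> keys (G q) \<Longrightarrow> psrc (fst z) = psrc q \<and> ptgt (snd (snd z)) = ptgt q"
  shows "ract y (lact x (G q)) = bmap G (tri3 x (bas q) y)"
proof (rule klin_eqI[where F = "\<lambda>x. ract y (lact x (G q))" and G = "\<lambda>x. bmap G (tri3 x (bas q) y)"])
  show "klin (\<lambda>x. ract y (lact x (G q)))" by (rule klin_compose[OF klin_ract klin_lact'])
  show "klin (\<lambda>x. bmap G (tri3 x (bas q) y))" by (rule klin_compose[OF klin_bmap tri3_klin(1)])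
  fix b assume "b \<in> keys x"
  then have b: "b \<in> PQ" by (rule kspace_key[OF b(1)])
  show "ract y (lact (bas b) (G q)) = bmap G (tri3 (bas b) (bas q) y)"
  proof (rule klin_eqI[where F = "\<lambda>y. ract y (lact (bas b) (G q))" and G = "\<lambda>y. bmap G (tri3 (bas b) (bas q) y)"])
    show "klin (\<lambda>y. ract y (lact (bas b) (G q)))" by (rule klin_ract')
    show "klin (\<lambda>y. bmap G (tri3 (bas b) (bas q) y))" by (rule klin_compose[OF klin_bmap tri3_klin(3)])
    fix b' assume "b' \<in> keys y"
    then have b': "b' \<in> PQ" by (rule kspace_key[OF assms(2)])
    show "ract (bas b') (lact (bas b) (G q)) = bmap G (tri3 (bas b) (bas q) (bas b'))"
    proof (cases "composable b q \<and> composable q b'")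
      case True
      then show ?thesis by (simp add: bmap_def)
    next
      case False
      have "ract (bas b') (lact (bas b) (G q)) = 0"
      proof (rule klin_eqI[where F = "\<lambda>u. ract (bas b') (lact (bas b) u)" and G = "\<lambda>_. 0"])
        show "klin (\<lambda>u. ract (bas b') (lact (bas b) u))" by (rule klin_compose[OF klin_ract klin_lact])
        show "klin (\<lambda>_. 0 :: ('v, 'e) triple \<Rightarrow>\<^sub>0 'k)" by (rule klinI) simp_all
        fix z assume z: "z \<in> keys (G q)"
        have "\<not> composable b (fst z) \<or> \<not> composable (snd (snd z)) b'"
          using False par[OF z] by (auto simp: composable_def)
        then have "kq_mult (bas b) (bas (fst z)) = (0 :: ('v, 'e, 'k) kq) \<or> kq_mult (bas (snd (snd z))) (bas b') = (0 :: ('v, 'e, 'k) kq)"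
          unfolding kq_mult_bas by auto
        then show "ract (bas b') (lact (bas b) (bas z)) = 0"
          unfolding ract_lact_bas[OF b b' kspace_key[OF G z]] by (auto simp only: klin_0[OF klin_N] tri3_0)
      qed
      moreover have "tri3 (bas b) (bas q) (bas b') = 0" using False unfolding tri3_bas by (rule if_not_P)
      ultimately show ?thesis by (simp only: klin_0[OF klin_bmap])
    qed
  qed
qed

lemma T_ext_coord:
  assumes X: "X \<subseteq> PQ" and X': "X' \<subseteq> PQ"
    and g: "\<And>q. q \<in> X \<Longrightarrow> g q \<in> carrier (T X')"
    and par: "\<And>q z. q \<in> X \<Longrightarrow> z \<in> keys (\<kappa> (g q)) \<Longrightarrow> psrc (fst z) = psrc q \<and> ptgt (snd (snd z)) = ptgt q"
    and t: "t \<in> carrier (T X)"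
  shows "bimod_ext Q I (T X') g t \<in> carrier (T X')" "\<kappa> (bimod_ext Q I (T X') g t) = bmap (\<lambda>q. \<kappa> (g q)) (\<kappa> t)"
proof -
  have H: "\<kappa> (rsmult (T X') (x \<odot>\<^bsub>T X'\<^esub> g q) y) = bmap (\<lambda>q. \<kappa> (g q)) (tri3 (nf x) (bas q) (nf y))"
    if x: "x \<in> CA" and y: "y \<in> CA" and q: "q \<in> X" for x y q
    using \<kappa>_smult(4)[OF X' y \<kappa>_smult(1)[OF X' x g[OF q]]] \<kappa>_smult(2)[OF X' x g[OF q]]
      ract_lact_tri3[OF nf_kspace'[OF x] nf_kspace'[OF y] subsetD[OF X q], of "\<lambda>q. \<kappa> (g q)" X']
      \<kappa>_kspace[OF X' g[OF q]] par[OF q] by simp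
  show "bimod_ext Q I (T X') g t \<in> carrier (T X')" "\<kappa> (bimod_ext Q I (T X') g t) = bmap (\<lambda>q. \<kappa> (g q)) (\<kappa> t)"
    using bimod_ext_coord[where h = \<kappa>, OF X abelian_group_T[OF X'] \<kappa>_add(2)[OF X'] \<kappa>_zero(2)[OF X'] \<kappa>_smult(1)[OF X']
      \<kappa>_smult(3)[OF X'] \<kappa>_scal[OF X'] g H[unfolded bmap_def] t] unfolding bmap_def by simp_all
qed

definition unit_ten :: "('v, 'e) qpath set \<Rightarrow> ('v, 'e) qpath \<Rightarrow> ('v, 'e, 'k) tens" where
  "unit_ten X q = ten Q I X \<one>\<^bsub>A\<^esub> (bas q) \<one>\<^bsub>A\<^esub>"

lemma \<kappa>_ten:
  assumes X: "X \<subseteq> PQ" and "x \<in> CA" "w \<in> kspace X" "y \<in> CA"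
  shows "ten Q I X x w y \<in> carrier (T X)" "\<kappa> (ten Q I X x w y) = tri3 (nf x) w (nf y)"
proof -
  have "bas (x, w, y) \<in> free X" using assms by simp
  then show "ten Q I X x w y \<in> carrier (T X)" "\<kappa> (ten Q I X x w y) = tri3 (nf x) w (nf y)"
    unfolding ten_def by (simp_all add: cls_carrier \<kappa>_cls[OF X])
qed

lemma nf_bas: "b \<in> B \<Longrightarrow> nf (\<pi> (bas b)) = bas b"
  by (simp add: nf_proj B_path NF_B)

lemma N_mult_one: "b \<in> B \<Longrightarrow> N (kq_mult (bas b) (nf \<one>\<^bsub>A\<^esub>)) = bas b"
  "b \<in> B \<Longrightarrow> N (kq_mult (nf \<one>\<^bsub>A\<^esub>) (bas b)) = bas b"
proof -
  assume b: "b \<in> B"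
  have pb: "\<pi> (bas b) \<in> CA" using b B_path by (simp add: A_closed)
  interpret ring A by (rule ring_A)
  show "N (kq_mult (bas b) (nf \<one>\<^bsub>A\<^esub>)) = bas b" "N (kq_mult (nf \<one>\<^bsub>A\<^esub>) (bas b)) = bas b"
    using nf_mult[OF pb A_closed(4)] nf_mult[OF A_closed(4) pb] pb nf_bas[OF b] by simp_all
qed

text \<open>The basis triple \<open>(b, q, b')\<close> arises from the elementary tensor of
  \<open>q\<close> by acting with \<open>b\<close> and \<open>b'\<close>, so the values on these
  tensors determine the map.\<close>

lemma hom_coord:
  assumes X: "X \<subseteq> PQ" and X': "X' \<subseteq> PQ" and f: "f \<in> bimod_hom A (T X) (T X')"
    and t: "t \<in> carrier (T X)"
  shows "\<kappa> (f t) = bmap (\<lambda>q. \<kappa> (f (unit_ten X q))) (\<kappa> t)"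
proof -
  have fc: "f x \<in> carrier (T X')" if "x \<in> carrier (T X)" for x using f that unfolding bimod_hom_def by blast
  have fa: "f (x \<oplus>\<^bsub>T X\<^esub> y) = f x \<oplus>\<^bsub>T X'\<^esub> f y" if "x \<in> carrier (T X)" "y \<in> carrier (T X)" for x y
    using f that unfolding bimod_hom_def by blast
  have fs: "f (a \<odot>\<^bsub>T X\<^esub> x) = a \<odot>\<^bsub>T X'\<^esub> f x" "f (rsmult (T X) x a) = rsmult (T X') (f x) a"
    if "a \<in> CA" "x \<in> carrier (T X)" for x a using f that unfolding bimod_hom_def by blast+
  have "\<kappa> (f (\<tau> X u)) = bmap (\<lambda>q. \<kappa> (f (unit_ten X q))) u" if "u \<in> kspace (tri X)" for u
    using that
  proof (induction rule: kspace_induct)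
    case zero
    let ?z = "\<tau> X 0"
    have z: "?z \<in> carrier (T X)" "\<kappa> ?z = 0" using \<tau>_props[OF X kspace_0] by simp_all
    \<comment> \<open>\<open>bimod_hom\<close> does not mention zero; its preservation follows from
      additivity, as the image of zero equals its own double.\<close>
    have "?z \<oplus>\<^bsub>T X\<^esub> ?z = ?z" by (rule \<kappa>_inj[OF X]) (simp_all add: \<kappa>_add[OF X] z)
    then have "f ?z = f ?z \<oplus>\<^bsub>T X'\<^esub> f ?z" using fa[OF z(1) z(1)] by simp
    then have "\<kappa> (f ?z) = \<kappa> (f ?z) + \<kappa> (f ?z)" using \<kappa>_add(2)[OF X' fc[OF z(1)] fc[OF z(1)]] by simp
    then show ?case by (simp add: klin_0[OF klin_bmap])
  next
    case (step z c u)
    obtain b q b' where zz: "z = (b, q, b')" by (rule prod_cases3)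
    have z: "b \<in> B" "q \<in> X" "b' \<in> B" "composable b q" "composable q b'" using step(1) unfolding zz tri_def by simp_all
    have pb: "\<pi> (bas b) \<in> CA" "\<pi> (bas b') \<in> CA" using z B_path by (simp_all add: A_closed)
    have un: "unit_ten X q \<in> carrier (T X)" "\<kappa> (unit_ten X q) = tri3 (nf \<one>\<^bsub>A\<^esub>) (bas q) (nf \<one>\<^bsub>A\<^esub>)"
      unfolding unit_ten_def using \<kappa>_ten[OF X A_closed(4) _ A_closed(4), of "bas q"] z(2) by simp_all
    let ?s = "rsmult (T X) (\<pi> (bas b) \<odot>\<^bsub>T X\<^esub> unit_ten X q) (\<pi> (bas b'))"
    have l: "\<pi> (bas b) \<odot>\<^bsub>T X\<^esub> unit_ten X q \<in> carrier (T X)" by (rule \<kappa>_smult(1)[OF X pb(1) un(1)])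
    have s: "?s \<in> carrier (T X)" by (rule \<kappa>_smult(3)[OF X pb(2) l])
    have n1: "nf \<one>\<^bsub>A\<^esub> \<in> kspace PQ" by (rule nf_kspace'[OF A_closed(4)])
    have bP: "bas b \<in> kspace PQ" "bas b' \<in> kspace PQ" using z B_path by simp_all
    have ks: "\<kappa> ?s = bas z"
      unfolding \<kappa>_smult(4)[OF X pb(2) l] \<kappa>_smult(2)[OF X pb(1) un(1)] un(2) nf_bas[OF z(1)] nf_bas[OF z(3)]
        lact_tri3[OF bP(1) n1] ract_tri3[OF bP(2) n1] N_mult_one(1)[OF z(1)] N_mult_one(2)[OF z(3)]
      using z by (simp add: zz)
    have fl: "\<kappa> (f ?s) = ract (bas b') (lact (bas b) (\<kappa> (f (unit_ten X q))))"
      unfolding fs(2)[OF pb(2) l] fs(1)[OF pb(1) un(1)]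
      using \<kappa>_smult(4)[OF X' pb(2) \<kappa>_smult(1)[OF X' pb(1) fc[OF un(1)]]] \<kappa>_smult(2)[OF X' pb(1) fc[OF un(1)]]
      by (simp add: nf_bas z)
    have tu: "\<tau> X u \<in> carrier (T X)" "\<kappa> (\<tau> X u) = u" using \<tau>_props[OF X step(2)] by simp_all
    have cs: "scal Q I c \<odot>\<^bsub>T X\<^esub> ?s \<in> carrier (T X)" by (rule \<kappa>_smult(1)[OF X A_closed(3) s])
    have cz: "pscale c (bas z) + u \<in> kspace (tri X)" using step by (simp add: kspace_add kspace_pscale)
    have "\<tau> X (pscale c (bas z) + u) = scal Q I c \<odot>\<^bsub>T X\<^esub> ?s \<oplus>\<^bsub>T X\<^esub> \<tau> X u"
      by (rule \<kappa>_inj[OF X]) (simp_all add: \<tau>_props[OF X cz] \<kappa>_add[OF X cs tu(1)] \<kappa>_scal[OF X s] ks tu(2))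
    then have "f (\<tau> X (pscale c (bas z) + u)) = scal Q I c \<odot>\<^bsub>T X'\<^esub> f ?s \<oplus>\<^bsub>T X'\<^esub> f (\<tau> X u)"
      using fa[OF cs tu(1)] fs(1)[OF A_closed(3) s] by simp
    then have "\<kappa> (f (\<tau> X (pscale c (bas z) + u))) = pscale c (\<kappa> (f ?s)) + \<kappa> (f (\<tau> X u))"
      using \<kappa>_add(2)[OF X' \<kappa>_smult(1)[OF X' A_closed(3) fc[OF s]] fc[OF tu(1)]] \<kappa>_scal[OF X' fc[OF s]] by simp
    also have "\<dots> = bmap (\<lambda>q. \<kappa> (f (unit_ten X q))) (pscale c (bas z) + u)"
      using step(3) by (simp add: fl klin_add[OF klin_bmap] klin_pscale[OF klin_bmap]) (simp add: bmap_def zz)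
    finally show ?case .
  qed
  from this[OF \<kappa>_kspace[OF X t]] show ?thesis using \<tau>_\<kappa>[OF X t] by simp
qed

section \<open>Leading terms of the differentials\<close>

abbreviation "AM n \<equiv> ambig Q R n"

lemma AM_PQ: "AM n \<subseteq> PQ" using ambig_path by (rule subsetI)

definition wt :: "('v, 'e) triple \<Rightarrow> ('v, 'e) qpath" where
  "wt z = pcomp (fst z) (pcomp (fst (snd z)) (snd (snd z)))"

text \<open>For a fixed word the second component is the length of the word minus that of the left
  factor, so it falls when arrows move into the left factor.\<close>

definition rk :: "('v, 'e) triple \<Rightarrow> nat \<times> nat" where
  "rk z = (rho (wt z), length (parr (fst (snd z))) + length (parr (snd (snd z))))"

text \<open>The error terms allowed in the image of the elementary tensor of \<open>q\<close>. Its
  left factor is a vertex, so the second alternative says that the left factor has grown.\<close>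

definition below :: "int \<Rightarrow> ('v, 'e) qpath \<Rightarrow> ('v, 'e) triple \<Rightarrow> bool" where
  "below n q z \<longleftrightarrow> z \<in> tri (AM (n - 1)) \<and> ((wt z, q) \<in> step\<^sup>+ \<or> wt z = q \<and> parr (fst z) \<noteq> [])"

definition striv :: "('v, 'e) qpath \<Rightarrow> ('v, 'e) qpath" where "striv q = (psrc q, [], psrc q)"

text \<open>The leading term is \<open>1 \<otimes> q' \<otimes> u\<close>; in the basis of
  composable triples its left unit shrinks to the source vertex \<open>striv q\<close>.\<close>

definition leads_ok :: "int \<Rightarrow> (('v, 'e) qpath \<Rightarrow> (('v, 'e) triple \<Rightarrow>\<^sub>0 'k)) \<Rightarrow> bool" where
  "leads_ok n G \<longleftrightarrow> (\<forall>q q' u. lsplit n q q' u \<longrightarrow> (\<exists>\<epsilon>. \<epsilon> \<noteq> 0 \<and>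
     (\<forall>z \<in> keys (G q - pscale \<epsilon> (bas (striv q, q', u))). below n q z)))"

lemma rtrancl_strict: "(v, w) \<in> step\<^sup>* \<Longrightarrow> v \<noteq> w \<Longrightarrow> (v, w) \<in> step\<^sup>+"
  by (metis rtranclD)

text \<open>Compatibility of \<open>step\<close> with multiplication, used for the left factor with
  \<open>y\<close> fixed and then for the right factor with \<open>x'\<close> fixed. A strict change
  on one side makes the whole change strict.\<close>

lemma rtrancl_sandwich:
  assumes x: "(x, x') \<in> step\<^sup>*" "x' \<in> PQ" and y: "(y, y') \<in> step\<^sup>*" "y' \<in> PQ" and p: "p \<in> PQ"
    and c: "composable x' p" "composable p y'"
  shows "(pcomp x (pcomp p y), pcomp x' (pcomp p y')) \<in> step\<^sup>*"
    "x \<noteq> x' \<or> y \<noteq> y' \<Longrightarrow> (pcomp x (pcomp p y), pcomp x' (pcomp p y')) \<in> step\<^sup>+"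
    "composable x p" "composable p y"
proof -
  note X = step_rtrancl_paths[OF x] and Y = step_rtrancl_paths[OF y]
  show cxp: "composable x p" and cpy: "composable p y" using c X Y by (simp_all add: composable_def)
  have py: "pcomp p y \<in> PQ" and py': "pcomp p y' \<in> PQ" using p Y(1) y(2) cpy c(2) by (simp_all add: pcomp_qpath)
  have cx'py: "composable x' (pcomp p y)" "composable x' (pcomp p y')" using c by simp_all
  have 1: "(pcomp x (pcomp p y), pcomp x' (pcomp p y)) \<in> step\<^sup>*"
    by (rule step_rtrancl_right[OF x py cx'py(1)])
  have "(pcomp p y, pcomp p y') \<in> step\<^sup>*" by (rule step_rtrancl_left[OF y p c(2)])
  then have 2: "(pcomp x' (pcomp p y), pcomp x' (pcomp p y')) \<in> step\<^sup>*"
    by (rule step_rtrancl_left[OF _ py' x(2) cx'py(2)])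
  show "(pcomp x (pcomp p y), pcomp x' (pcomp p y')) \<in> step\<^sup>*" by (rule rtrancl_trans[OF 1 2])
  assume "x \<noteq> x' \<or> y \<noteq> y'"
  then show "(pcomp x (pcomp p y), pcomp x' (pcomp p y')) \<in> step\<^sup>+"
  proof
    assume "x \<noteq> x'"
    then have "(pcomp x (pcomp p y), pcomp x' (pcomp p y)) \<in> step\<^sup>+"
      by (intro step_trancl_right[OF rtrancl_strict[OF x(1)] x(2) py cx'py(1)])
    then show ?thesis using 2 by (rule trancl_rtrancl_trancl)
  next
    assume "y \<noteq> y'"
    then have "(pcomp p y, pcomp p y') \<in> step\<^sup>+"
      by (intro step_trancl_left[OF rtrancl_strict[OF y(1)] y(2) p c(2)])
    then have "(pcomp x' (pcomp p y), pcomp x' (pcomp p y')) \<in> step\<^sup>+"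
      by (rule step_trancl_left[OF _ py' x(2) cx'py(2)])
    with 1 show ?thesis by (rule rtrancl_trancl_trancl)
  qed
qed

lemma keys_tri3_obtain:
  assumes "z \<in> keys (tri3 x (bas p) y)"
  obtains a c where "z = (a, p, c)" "a \<in> keys x" "c \<in> keys y" "composable a p" "composable p c"
proof -
  obtain a where a: "a \<in> keys x" "z \<in> keys (tri3 (bas a) (bas p) y)"
    using subsetD[OF keys_klin[OF tri3_klin(1)] assms] by (rule UN_E)
  obtain c where c: "c \<in> keys y" "z \<in> keys (tri3 (bas a) (bas p) (bas c))"
    using subsetD[OF keys_klin[OF tri3_klin(3)] a(2)] by (rule UN_E)
  show ?thesis using that[OF _ a(1) c(1)] c(2) by (cases "composable a p \<and> composable p c") auto
qed

lemma keys_act: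
  assumes z: "z \<in> tri X" "X \<subseteq> PQ" and b: "b \<in> PQ" "b' \<in> PQ" "composable b (fst z)" "composable (snd (snd z)) b'"
    and y: "y \<in> keys (ract (bas b') (lact (bas b) (bas z)))"
  obtains a c where "y = (a, fst (snd z), c)" "y \<in> tri X"
    "(a, pcomp b (fst z)) \<in> step\<^sup>*" "(c, pcomp (snd (snd z)) b') \<in> step\<^sup>*"
proof -
  obtain a0 p c0 where zz: "z = (a0, p, c0)" by (rule prod_cases3)
  have z0: "a0 \<in> PQ" "p \<in> X" "c0 \<in> PQ" using z(1) B_path unfolding zz tri_def by simp_all
  have c: "composable b a0" "composable c0 b'" using b unfolding zz by simp_all
  have P: "pcomp b a0 \<in> PQ" "pcomp c0 b' \<in> PQ" using b z0 c by (simp_all add: pcomp_qpath)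
  have "ract (bas b') (lact (bas b) (bas z)) = tri3 (NF (pcomp b a0)) (bas p) (NF (pcomp c0 b'))"
    using ract_lact_bas[OF b(1,2) z(1)] c by (simp add: zz)
  then have "y \<in> keys (tri3 (NF (pcomp b a0)) (bas p) (NF (pcomp c0 b')))"
    using y by simp
  then obtain a c where ac: "y = (a, p, c)" "a \<in> keys (NF (pcomp b a0))"
    "c \<in> keys (NF (pcomp c0 b'))" "composable a p" "composable p c" by (rule keys_tri3_obtain)
  show ?thesis
  proof (rule that)
    show "y = (a, fst (snd z), c)" using ac zz by simp
    show "y \<in> tri X" unfolding ac(1) tri_def using NF_keys(1)[OF P(1) ac(2)] NF_keys(1)[OF P(2) ac(3)] ac(4,5) z0(2) by simp
    show "(a, pcomp b (fst z)) \<in> step\<^sup>*" "(c, pcomp (snd (snd z)) b') \<in> step\<^sup>*"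
      using NF_keys(2)[OF P(1) ac(2)] NF_keys(2)[OF P(2) ac(3)] zz by simp_all
  qed
qed

lemma rk_less_rho: "rho (wt y) < rho (wt z) \<Longrightarrow> rk y < rk z"
  by (simp add: rk_def less_prod_def')

lemma rho_le: "(v, w) \<in> step\<^sup>* \<Longrightarrow> rho v \<le> rho w"
  using rho_less rtrancl_strict by (metis less_imp_le order_refl)

text \<open>A word that has already dropped stays below after multiplication. If only the left
  factor \<open>a0\<close> has grown, either normalization lowers the word, or nothing is normalized
  and the new left factor \<open>b a0\<close> is longer than \<open>b\<close>.\<close>

lemma below_act:
  assumes z: "below n q z" and q: "q \<in> PQ" and bq: "b \<in> PQ" "b' \<in> PQ" "composable b q" "composable q b'"
    and y: "y \<in> keys (ract (bas b') (lact (bas b) (bas z)))"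
  shows "y \<in> tri (AM (n - 1))" "rk y < rk (b, q, b')"
proof -
  have zt: "z \<in> tri (AM (n - 1))" using z by (simp add: below_def)
  obtain a0 p c0 where zz: "z = (a0, p, c0)" by (rule prod_cases3)
  have z0: "a0 \<in> PQ" "p \<in> PQ" "c0 \<in> PQ" "composable a0 p" "composable p c0"
    using zt B_path ambig_path[of p "n - 1"] unfolding zz tri_def by simp_all
  have wz: "wt z = pcomp a0 (pcomp p c0)" by (simp add: wt_def zz)
  have wq: "(wt z, q) \<in> step\<^sup>*" using z unfolding below_def by (metis rtrancl.rtrancl_refl trancl_into_rtrancl)
  have ends: "psrc a0 = psrc q" "ptgt c0 = ptgt q"
    using step_rtrancl_paths(2,3)[OF wq q] unfolding wz by simp_all
  have c: "composable b a0" "composable c0 b'" using bq ends by (simp_all add: composable_def)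
  obtain a c' where ac: "y = (a, fst (snd z), c')" "y \<in> tri (AM (n - 1))"
    "(a, pcomp b (fst z)) \<in> step\<^sup>*" "(c', pcomp (snd (snd z)) b') \<in> step\<^sup>*"
    by (rule keys_act[OF zt AM_PQ bq(1,2) _ _ y]) (use c zz in simp_all)
  show "y \<in> tri (AM (n - 1))" by (rule ac(2))
  have y': "y = (a, p, c')" "(a, pcomp b a0) \<in> step\<^sup>*" "(c', pcomp c0 b') \<in> step\<^sup>*" using ac zz by simp_all
  have P: "pcomp b a0 \<in> PQ" "pcomp c0 b' \<in> PQ" using bq z0 c by (simp_all add: pcomp_qpath)
  have cc: "composable (pcomp b a0) p" "composable p (pcomp c0 b')" using z0 by simp_all
  have wy: "wt y = pcomp a (pcomp p c')" by (simp add: wt_def y'(1))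
  have e: "pcomp (pcomp b a0) (pcomp p (pcomp c0 b')) = pcomp b (pcomp (wt z) b')" unfolding wz by (simp add: pcomp_assoc)
  note S = rtrancl_sandwich[OF y'(2) P(1) y'(3) P(2) z0(2) cc]
  have qb: "pcomp q b' \<in> PQ" using q bq by (simp add: pcomp_qpath)
  have wb: "wt (b, q, b') = pcomp b (pcomp q b')" by (simp add: wt_def)
  show "rk y < rk (b, q, b')"
  proof (cases "(wt z, q) \<in> step\<^sup>+")
    case True
    have "(pcomp (wt z) b', pcomp q b') \<in> step\<^sup>+" by (rule step_trancl_right[OF True q bq(2,4)])
    then have "(pcomp b (pcomp (wt z) b'), pcomp b (pcomp q b')) \<in> step\<^sup>+"
      by (rule step_trancl_left[OF _ qb bq(1)]) (simp add: bq(3))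
    then have "rho (pcomp b (pcomp (wt z) b')) < rho (wt (b, q, b'))" unfolding wb by (rule rho_less)
    moreover have "rho (wt y) \<le> rho (pcomp b (pcomp (wt z) b'))" using rho_le[OF S(1)] unfolding wy e .
    ultimately show ?thesis by (intro rk_less_rho) simp
  next
    case False
    then have wzq: "wt z = q" "parr a0 \<noteq> []" using z unfolding below_def zz by simp_all
    show ?thesis
    proof (cases "a \<noteq> pcomp b a0 \<or> c' \<noteq> pcomp c0 b'")
      case True
      have "rho (wt y) < rho (wt (b, q, b'))" using rho_less[OF S(2)[OF True]] unfolding wy wb e wzq(1) .
      then show ?thesis by (rule rk_less_rho)
    next
      case False
      then have "wt y = wt (b, q, b')" using e unfolding wy wb wzq(1) by simp
      moreover have "length (parr q) = length (parr a0) + (length (parr p) + length (parr c0))"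
        using arg_cong[OF wzq(1), of "\<lambda>w. length (parr w)"] unfolding wz by simp
      ultimately show ?thesis using False wzq(2) by (simp add: rk_def y'(1) less_prod_def')
    qed
  qed
qed

text \<open>Acting on the leading term leaves \<open>b\<close> and \<open>q'\<close> and replaces
  \<open>u b'\<close> by its normal form. If \<open>u b'\<close> is reducible, every path of that
  normal form lies strictly below it, so nothing of full rank survives.\<close>

lemma bmap_lead:
  assumes G: "leads_ok n G" and n: "0 \<le> n" and z: "(b, q, b') \<in> tri (AM n)" and ls: "lsplit n q q' u"
  shows "\<exists>\<epsilon>. \<epsilon> \<noteq> 0 \<and> (\<forall>y \<in> keys (bmap G (bas (b, q, b')) -
      (if pcomp u b' \<in> B then pscale \<epsilon> (bas (b, q', pcomp u b')) else 0)). y \<in> tri (AM (n - 1)) \<and> rk y < rk (b, q, b'))"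
proof -
  note D = lsplitD[OF ls n]
  have bq: "b \<in> B" "b \<in> PQ" "b' \<in> B" "b' \<in> PQ" "composable b q" "composable q b'" using z B_path unfolding tri_def by simp_all
  obtain \<epsilon> where e: "\<epsilon> \<noteq> 0" "\<forall>z \<in> keys (G q - pscale \<epsilon> (bas (striv q, q', u))). below n q z"
    using G ls unfolding leads_ok_def by metis
  let ?L = "G q - pscale \<epsilon> (bas (striv q, q', u))"
  let ?act = "\<lambda>v. ract (bas b') (lact (bas b) v)"
  have lin: "klin ?act" by (rule klin_compose[OF klin_ract klin_lact])
  have low: "y \<in> tri (AM (n - 1)) \<and> rk y < rk (b, q, b')" if y: "y \<in> keys (?act ?L)" for y
  proof -
    obtain z where "z \<in> keys ?L" "y \<in> keys (?act (bas z))"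
      using subsetD[OF keys_klin[OF lin] y] by (rule UN_E)
    then show ?thesis using below_act[OF bspec[OF e(2)] D(9) bq(2,4,5,6)] by simp
  qed
  have src: "psrc q' = psrc q" using D(6) by simp
  have sB: "striv q \<in> B" using triv_src[OF D(9)] not_wred_short by (simp add: striv_def B_iff)
  have st: "(striv q, q', u) \<in> tri (AM (n - 1))"
  proof -
    have "composable (striv q) q'" using src by (simp add: composable_def striv_def)
    then show ?thesis unfolding tri_def using sB D(2,3,5) by simp
  qed
  have bs: "kq_mult (bas b) (bas (striv q)) = (bas b :: ('v, 'e, 'k) kq)"
  proof -
    have "composable b (striv q)" using bq(5) by (simp add: composable_def striv_def)
    moreover have "pcomp b (striv q) = b"
      by (rule pcomp_triv(1)[OF calculation B_path[OF sB]]) (simp add: striv_def)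
    ultimately show ?thesis by simp
  qed
  have ub: "composable u b'" using bq(6) unfolding D(6) by simp
  have ubP: "pcomp u b' \<in> PQ" by (rule pcomp_qpath[OF D(8) bq(4) ub])
  have lead: "?act (bas (striv q, q', u)) = tri3 (bas b) (bas q') (NF (pcomp u b'))"
    using ract_lact_bas[OF bq(2,4) st] ub bs by (simp add: NF_B bq(1))
  have bq': "composable b q'" using bq(5) src by (simp add: composable_def)
  have DDz: "bmap G (bas (b, q, b')) = ?act ?L + pscale \<epsilon> (?act (bas (striv q, q', u)))"
    using klin_diff[OF lin] klin_pscale[OF lin] by (simp add: bmap_def)
  show ?thesis
  proof (cases "pcomp u b' \<in> B")
    case True
    have "?act (bas (striv q, q', u)) = bas (b, q', pcomp u b')"
      unfolding lead NF_B[OF True] using bq' D(5) by simp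
    then have "bmap G (bas (b, q, b')) - pscale \<epsilon> (bas (b, q', pcomp u b')) = ?act ?L" unfolding DDz by simp
    then show ?thesis using low e(1) True by (intro exI[of _ \<epsilon>]) simp
  next
    case False
    have "y \<in> tri (AM (n - 1)) \<and> rk y < rk (b, q, b')" if y: "y \<in> keys (bmap G (bas (b, q, b')))" for y
    proof (cases "y \<in> keys (?act ?L)")
      case True
      then show ?thesis by (rule low)
    next
      case nL: False
      have "y \<in> keys (pscale \<epsilon> (?act (bas (striv q, q', u))))"
        using subsetD[OF keys_add y[unfolded DDz]] nL by simp
      then have "y \<in> keys (tri3 (bas b) (bas q') (NF (pcomp u b')))"
        unfolding lead using e(1) by (simp add: keys_pscale)
      then obtain a c where ac: "y = (a, q', c)" "a \<in> keys (bas b :: ('v, 'e, 'k) kq)"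
        "c \<in> keys (NF (pcomp u b'))" "composable a q'" "composable q' c" by (rule keys_tri3_obtain)
      have ab: "a = b" using ac(2) by simp
      have cB: "c \<in> B" "(c, pcomp u b') \<in> step\<^sup>*" using NF_keys[OF ubP ac(3)] by simp_all
      have neq: "c \<noteq> pcomp u b'" using cB(1) False by auto
      have "(pcomp b (pcomp q' c), pcomp b (pcomp q' (pcomp u b'))) \<in> step\<^sup>+"
        using rtrancl_sandwich(2)[OF rtrancl_refl bq(2) cB(2) ubP D(7) bq'] D(5) neq by simp
      then have "rho (wt y) < rho (wt (b, q, b'))"
        using rho_less D(6) by (simp add: wt_def ac(1) ab pcomp_assoc)
      moreover have "y \<in> tri (AM (n - 1))" unfolding tri_def ac(1) ab using bq(1) D(2) cB(1) ac(4,5) ab by simp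
      ultimately show ?thesis using rk_less_rho by simp
    qed
    \<comment> \<open>Any nonzero scalar would do, because for reducible \<open>u b'\<close> the
      subtracted term is 0.\<close>
    then show ?thesis using False by (intro exI[of _ 1]) simp
  qed
qed

section \<open>The maps \<delta> in coordinates\<close>

definition oneE :: "('v, 'e, 'k) kq" where "oneE = (\<Sum>v \<in> verts Q. bas (v, [], v))"

definition ttriv :: "('v, 'e) qpath \<Rightarrow> ('v, 'e) qpath" where "ttriv q = (ptgt q, [], ptgt q)"

lemma triv_props:
  assumes "p \<in> PQ"
  shows "striv p \<in> PQ" "ttriv p \<in> PQ" "striv p \<in> B" "ttriv p \<in> B" "striv p \<in> AM (- 1)" "ttriv p \<in> AM (- 1)"
    "composable (striv p) p" "composable p (ttriv p)" "pcomp (striv p) p = p" "pcomp p (ttriv p) = p"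
    "parr (striv p) = []" "parr (ttriv p) = []"
proof -
  show PQ: "striv p \<in> PQ" "ttriv p \<in> PQ" unfolding striv_def ttriv_def by (rule triv_src[OF assms] triv_tgt[OF assms])+
  show e: "parr (striv p) = []" "parr (ttriv p) = []" by (simp_all add: striv_def ttriv_def)
  show "striv p \<in> B" "ttriv p \<in> B" using PQ e not_wred_short[of "[]"] by (simp_all add: B_iff)
  show "striv p \<in> AM (- 1)" "ttriv p \<in> AM (- 1)" using PQ e by (simp_all add: ambig_m1_iff)
  show c: "composable (striv p) p" "composable p (ttriv p)" by (simp_all add: composable_def striv_def ttriv_def)
  show "pcomp (striv p) p = p" "pcomp p (ttriv p) = p"
    by (rule pcomp_triv(2)[OF c(1) PQ(1) e(1)], rule pcomp_triv(1)[OF c(2) PQ(2) e(2)])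
qed

lemma oneE_in: "oneE \<in> kspace (AM (- 1))" "oneE \<in> kspace B" "oneE \<in> kspace PQ"
proof -
  show "oneE \<in> kspace (AM (- 1))" unfolding oneE_def by (rule kspace_sum) (simp add: ambig_m1_iff triv_in)
  then show "oneE \<in> kspace B" "oneE \<in> kspace PQ"
    using not_wred_short[of "[]"] by (auto simp: kspace_def ambig_m1_iff B_iff)
qed

lemma nf_one: "nf \<one>\<^bsub>A\<^esub> = oneE"
  unfolding proj_one oneE_def[symmetric] using nf_proj[OF oneE_in(3)] N_idem[OF oneE_in(2)] by simp

text \<open>In the unit, a sum over all vertices, only the vertex at the adjacent end of
  \<open>p\<close> composes with \<open>p\<close>.\<close>

lemma tri3_oneE:
  assumes p: "p \<in> PQ"
  shows "tri3 x (bas p) oneE = tri3 x (bas p) (bas (ttriv p))"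
    "tri3 oneE (bas p) x = tri3 (bas (striv p)) (bas p) x"
    "tri3 (bas p) oneE x = tri3 (bas p) (bas (ttriv p)) x"
    "tri3 x oneE (bas p) = tri3 x (bas (striv p)) (bas p)"
proof -
  have v: "ptgt p \<in> verts Q" "psrc p \<in> verts Q" using qpath_verts[OF p] by simp_all
  have sum1: "(\<Sum>v\<in>verts Q. f v) = f w" if "w \<in> verts Q" "\<And>v. v \<noteq> w \<Longrightarrow> f v = 0" for f :: "'v \<Rightarrow> (('v, 'e) triple \<Rightarrow>\<^sub>0 'k)" and w
  proof -
    have "(\<Sum>v\<in>verts Q. f v) = (\<Sum>v\<in>{w}. f v)"
      by (rule sum.mono_neutral_right[OF fin_verts]) (use that in auto)
    then show ?thesis by simp
  qed
  show "tri3 x (bas p) oneE = tri3 x (bas p) (bas (ttriv p))"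
    unfolding oneE_def klin_sum[OF tri3_klin(3)] ttriv_def
    by (rule sum1[OF v(1)], rule tri3_noncomposable(2)) (auto simp: composable_def)
  show "tri3 oneE (bas p) x = tri3 (bas (striv p)) (bas p) x"
    unfolding oneE_def klin_sum[OF tri3_klin(1)] striv_def
    by (rule sum1[OF v(2)], rule tri3_noncomposable(1)) (auto simp: composable_def)
  show "tri3 (bas p) oneE x = tri3 (bas p) (bas (ttriv p)) x"
    unfolding oneE_def klin_sum[OF tri3_klin(2)] ttriv_def
    by (rule sum1[OF v(1)], rule tri3_noncomposable(1)) (auto simp: composable_def)
  show "tri3 x oneE (bas p) = tri3 x (bas (striv p)) (bas p)"
    unfolding oneE_def klin_sum[OF tri3_klin(2)] striv_def
    by (rule sum1[OF v(2)], rule tri3_noncomposable(2)) (auto simp: composable_def)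
qed

lemma lsplit_0:
  assumes "lsplit 0 q q' u"
  shows "u = q" "q' = striv q"
proof -
  note D = lsplitD[OF assms order_refl]
  have e: "q' \<in> PQ" "parr q' = []" using D(2) by (simp_all add: ambig_m1_iff)
  have "pcomp q' u = u" by (rule pcomp_triv(2)[OF D(5) e])
  then show "u = q" using D(6) by simp
  have "psrc q = psrc q'" using D(6) by simp
  then show "q' = striv q" using e triv_qpath[OF e] by (intro path_eqI) (simp_all add: striv_def)
qed

lemma delta_gen_0:
  assumes "lsplit 0 q q' u"
  shows "delta_gen Q I R 0 q \<in> carrier (T (AM (- 1)))"
    "\<kappa> (delta_gen Q I R 0 q) = bas (q, ttriv q, ttriv q) - bas (striv q, striv q, q)"
proof -
  have u: "u = q" by (rule lsplit_0(1)[OF assms])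
  have q: "q \<in> B" "q \<in> PQ" using lsplitD(3)[OF assms order_refl] B_path by (simp_all add: u)
  have pq: "\<pi> (bas q) \<in> CA" using q by (simp add: A_closed)
  have d: "delta_gen Q I R 0 q = ten Q I (AM (- 1)) (\<pi> (bas q)) oneE \<one>\<^bsub>A\<^esub> \<ominus>\<^bsub>T (AM (- 1))\<^esub> ten Q I (AM (- 1)) \<one>\<^bsub>A\<^esub> oneE (\<pi> (bas q))"
    by (simp add: delta_gen_def Let_def res_term_def oneE_def)
  note t1 = \<kappa>_ten[OF AM_PQ pq oneE_in(1) A_closed(4)] and t2 = \<kappa>_ten[OF AM_PQ A_closed(4) oneE_in(1) pq]
  show "delta_gen Q I R 0 q \<in> carrier (T (AM (- 1)))" unfolding d by (rule \<kappa>_minus(1)[OF AM_PQ t1(1) t2(1)])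
  have "tri3 (bas q) oneE oneE = bas (q, ttriv q, ttriv q)"
    unfolding tri3_oneE(3)[OF q(2)] tri3_oneE(1)[OF triv_props(2)[OF q(2)]]
    by (simp add: ttriv_def composable_def)
  moreover have "tri3 oneE oneE (bas q) = bas (striv q, striv q, q)"
    unfolding tri3_oneE(4)[OF q(2)] tri3_oneE(2)[OF triv_props(1)[OF q(2)]]
    by (simp add: striv_def composable_def)
  ultimately show "\<kappa> (delta_gen Q I R 0 q) = bas (q, ttriv q, ttriv q) - bas (striv q, striv q, q)"
    unfolding d \<kappa>_minus(2)[OF AM_PQ t1(1) t2(1)] t1(2) t2(2) nf_one nf_bas[OF q(1)] by simp
qed

text \<open>The term with the minus sign, from the left factorization, is the leading one. The other
  has the same word \<open>q\<close> but the nontrivial left factor \<open>v\<close>.\<close>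

lemma delta_gen_even:
  assumes ls: "lsplit n q q' u" and n: "0 < n" "even n"
  obtains v q'' where "v \<in> B" "parr v \<noteq> []" "q'' \<in> AM (n - 1)" "composable v q''" "q = pcomp v q''"
    "delta_gen Q I R n q \<in> carrier (T (AM (n - 1)))"
    "\<kappa> (delta_gen Q I R n q) = bas (v, q'', ttriv q) - bas (striv q, q', u)"
proof -
  have n1: "1 \<le> n" "0 \<le> n" "n \<noteq> 0" using n by simp_all
  note D = lsplitD[OF ls n1(2)]
  define vs where "vs = (THE vs. right_factorization Q R (nat n) q vs)"
  define us where "us = (THE us. left_factorization Q R (nat n) q us)"
  define v where "v = vs ! nat n"
  define q'' where "q'' = pprod (rev (take (nat n) vs))"
  have v: "v \<in> B" "parr v \<noteq> []" "q'' \<in> AM (n - 1)" "composable v q''" "q = pcomp v q''"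
    using right_factorization_split[OF D(1) n1(1)] unfolding v_def q''_def vs_def by simp_all
  have us: "pprod (take (nat n) us) = q'" "us ! nat n = u"
    using left_factorization_lsplit(2,3)[OF ls n1(1)] unfolding us_def by simp_all
  have d: "delta_gen Q I R n q = ten Q I (AM (n - 1)) (\<pi> (bas v)) (bas q'') \<one>\<^bsub>A\<^esub> \<ominus>\<^bsub>T (AM (n - 1))\<^esub>
      ten Q I (AM (n - 1)) \<one>\<^bsub>A\<^esub> (bas q') (\<pi> (bas u))"
    unfolding delta_gen_def Let_def res_term_def vs_def[symmetric] us_def[symmetric] v_def[symmetric] q''_def[symmetric] us
    using n n1 by simp
  have c: "\<pi> (bas v) \<in> CA" "\<pi> (bas u) \<in> CA" "bas q'' \<in> kspace (AM (n - 1))" "bas q' \<in> kspace (AM (n - 1))"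
    using v D(2,3) B_path by (simp_all add: A_closed)
  note t1 = \<kappa>_ten[OF AM_PQ c(1,3) A_closed(4)] and t2 = \<kappa>_ten[OF AM_PQ A_closed(4) c(4,2)]
  have car: "delta_gen Q I R n q \<in> carrier (T (AM (n - 1)))" unfolding d by (rule \<kappa>_minus(1)[OF AM_PQ t1(1) t2(1)])
  have qP: "q'' \<in> PQ" by (rule ambig_path[OF v(3)])
  have tt: "ttriv q'' = ttriv q" using v(5) by (simp add: ttriv_def)
  have ss: "striv q' = striv q" using D(6) by (simp add: striv_def)
  have "tri3 (bas v) (bas q'') oneE = bas (v, q'', ttriv q)"
    unfolding tri3_oneE(1)[OF qP] using v(4) triv_props(8)[OF qP] by (simp add: tt)
  moreover have "tri3 oneE (bas q') (bas u) = bas (striv q, q', u)"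
    unfolding tri3_oneE(2)[OF D(7)] using D(5) triv_props(7)[OF D(7)] by (simp add: ss)
  ultimately have "\<kappa> (delta_gen Q I R n q) = bas (v, q'', ttriv q) - bas (striv q, q', u)"
    unfolding d \<kappa>_minus(2)[OF AM_PQ t1(1) t2(1)] t1(2) t2(2) nf_one nf_bas[OF v(1)] nf_bas[OF D(3)] by simp
  then show ?thesis using that[OF v car] by simp
qed

text \<open>The paths \<open>a\<close> and \<open>c\<close> are arbitrary and may be reducible,
  hence the normal forms in the coordinates.\<close>

lemma delta_gen_odd:
  assumes ls: "lsplit n q q' u" and n: "0 < n" "odd n"
  defines "Z \<equiv> {(a, p, c). a \<in> PQ \<and> p \<in> AM (n - 1) \<and> c \<in> PQ \<and> composable a p \<and> composable p c \<and> pcomp a (pcomp p c) = q}"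
  shows "delta_gen Q I R n q \<in> carrier (T (AM (n - 1)))" "finite Z"
    "\<kappa> (delta_gen Q I R n q) = (\<Sum>z\<in>Z. tri3 (NF (fst z)) (bas (fst (snd z))) (NF (snd (snd z))))"
proof -
  have "Z \<subseteq> decomps q" unfolding Z_def decomps_def using ambig_path by fast
  then show fin: "finite Z" using finite_decomps by (rule finite_subset)
  let ?f = "\<lambda>z. case z of (a, p, c) \<Rightarrow> ten Q I (AM (n - 1)) (\<pi> (bas a)) (bas p) (\<pi> (bas c))"
  have d: "delta_gen Q I R n q = (\<Oplus>\<^bsub>T (AM (n - 1))\<^esub> z \<in> Z. ?f z)"
    unfolding delta_gen_def Let_def res_term_def Z_def using n by simp
  have f: "?f z \<in> carrier (T (AM (n - 1)))" "\<kappa> (?f z) = tri3 (NF (fst z)) (bas (fst (snd z))) (NF (snd (snd z)))" if "z \<in> Z" for z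
  proof -
    obtain a p c where zz: "z = (a, p, c)" by (rule prod_cases3)
    have z: "a \<in> PQ" "p \<in> AM (n - 1)" "c \<in> PQ" using that unfolding zz Z_def by simp_all
    have c: "\<pi> (bas a) \<in> CA" "\<pi> (bas c) \<in> CA" "bas p \<in> kspace (AM (n - 1))" using z by (simp_all add: A_closed)
    show "?f z \<in> carrier (T (AM (n - 1)))" "\<kappa> (?f z) = tri3 (NF (fst z)) (bas (fst (snd z))) (NF (snd (snd z)))"
      using \<kappa>_ten[OF AM_PQ c(1,3,2)] nf_proj[of "bas a"] nf_proj[of "bas c"] z by (simp_all add: zz)
  qed
  from finsum_hom[where h = \<kappa>, OF abelian_group_T[OF AM_PQ] \<kappa>_add(2)[OF AM_PQ] \<kappa>_zero(2)[OF AM_PQ] fin f(1)]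
  show "delta_gen Q I R n q \<in> carrier (T (AM (n - 1)))"
    "\<kappa> (delta_gen Q I R n q) = (\<Sum>z\<in>Z. tri3 (NF (fst z)) (bas (fst (snd z))) (NF (snd (snd z))))"
    unfolding d using f(2) by simp_all
qed

text \<open>The leading coefficient is -1 in even degrees and 1 in odd ones. In odd degrees a
  further summand either loses in the word by normalization or keeps the word \<open>q\<close> with
  a nontrivial left factor.\<close>

lemma delta_gen_lead:
  assumes ls: "lsplit n q q' u" and n: "0 \<le> n"
  shows "delta_gen Q I R n q \<in> carrier (T (AM (n - 1)))"
    "\<exists>\<epsilon>. \<epsilon> \<noteq> 0 \<and> (\<forall>z \<in> keys (\<kappa> (delta_gen Q I R n q) - pscale \<epsilon> (bas (striv q, q', u))). below n q z)"
proof -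
  note D = lsplitD[OF ls n]
  note Tq = triv_props[OF D(9)]
  consider "n = 0" | "0 < n" "even n" | "0 < n" "odd n" using n by linarith
  then have "delta_gen Q I R n q \<in> carrier (T (AM (n - 1))) \<and> (\<exists>\<epsilon>. \<epsilon> \<noteq> 0 \<and>
      (\<forall>z \<in> keys (\<kappa> (delta_gen Q I R n q) - pscale \<epsilon> (bas (striv q, q', u))). below n q z))"
  proof cases
    case 1
    have ls0: "lsplit 0 q q' u" using ls 1 by simp
    have u: "u = q" "q' = striv q" by (rule lsplit_0[OF ls0])+
    have tt: "composable (ttriv q) (ttriv q)" by (simp add: composable_def ttriv_def)
    have "(q, ttriv q, ttriv q) \<in> tri (AM (n - 1))" unfolding tri_def 1 using Tq D(3) tt by (simp add: u)
    moreover have "pcomp q (pcomp (ttriv q) (ttriv q)) = q"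
      using pcomp_triv(1)[OF tt Tq(2,12)] Tq(10) by simp
    ultimately have "below n q (q, ttriv q, ttriv q)" unfolding below_def using D(4) by (simp add: u wt_def)
    then have "\<forall>z \<in> keys (\<kappa> (delta_gen Q I R n q) - pscale (- 1) (bas (striv q, q', u))). below n q z"
      unfolding 1 delta_gen_0(2)[OF ls0] by (simp add: u)
    moreover have "delta_gen Q I R n q \<in> carrier (T (AM (n - 1)))" unfolding 1 using delta_gen_0(1)[OF ls0] by simp
    ultimately show ?thesis by (intro conjI exI[of _ "- 1"]) simp_all
  next
    case 2
    obtain v q'' where v: "v \<in> B" "parr v \<noteq> []" "q'' \<in> AM (n - 1)" "composable v q''" "q = pcomp v q''"
      "delta_gen Q I R n q \<in> carrier (T (AM (n - 1)))"
      "\<kappa> (delta_gen Q I R n q) = bas (v, q'', ttriv q) - bas (striv q, q', u)"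
      by (rule delta_gen_even[OF ls 2])
    have c: "composable q'' (ttriv q)" unfolding v(5) by (simp add: composable_def ttriv_def)
    have "(v, q'', ttriv q) \<in> tri (AM (n - 1))" unfolding tri_def using v(1,3,4) Tq(4) c by simp
    moreover have "pcomp v (pcomp q'' (ttriv q)) = q" using pcomp_triv(1)[OF c Tq(2,12)] v(5) by simp
    ultimately have "below n q (v, q'', ttriv q)" unfolding below_def using v(2) by (simp add: wt_def)
    then have "\<forall>z \<in> keys (\<kappa> (delta_gen Q I R n q) - pscale (- 1) (bas (striv q, q', u))). below n q z"
      unfolding v(7) by simp
    then show ?thesis using v(6) by (intro conjI exI[of _ "- 1"]) simp_all
  next
    case 3
    let ?Z = "{(a, p, c). a \<in> PQ \<and> p \<in> AM (n - 1) \<and> c \<in> PQ \<and> composable a p \<and> composable p c \<and> pcomp a (pcomp p c) = q}"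
    let ?t = "\<lambda>z. tri3 (NF (fst z)) (bas (fst (snd z))) (NF (snd (snd z)))"
    note O = delta_gen_odd[OF ls 3]
    let ?z0 = "(striv q, q', u)"
    have src: "composable (striv q) q'" unfolding D(6) by (simp add: composable_def striv_def)
    have eq0: "pcomp (striv q) (pcomp q' u) = q" using Tq(9) unfolding D(6)[symmetric] .
    have z0: "?z0 \<in> ?Z" using Tq(1) D(2,8,5) src eq0 by simp
    have t0: "?t ?z0 = bas ?z0" using src D(5) by (simp add: NF_B Tq(3) D(3))
    have k: "\<kappa> (delta_gen Q I R n q) - pscale 1 (bas ?z0) = (\<Sum>z\<in>?Z - {?z0}. ?t z)"
      unfolding O(3) using sum.remove[OF O(2) z0, of ?t] t0 by simp
    have low: "below n q y" if hy: "y \<in> keys (\<Sum>z\<in>?Z - {?z0}. ?t z)" for y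
    proof -
      obtain z where z: "z \<in> ?Z - {?z0}" "y \<in> keys (?t z)"
        using subsetD[OF keys_sum_subset hy] by (rule UN_E)
      obtain a p c where zz: "z = (a, p, c)" by (rule prod_cases3)
      have zp: "a \<in> PQ" "p \<in> AM (n - 1)" "c \<in> PQ" "composable a p" "composable p c" "pcomp a (pcomp p c) = q"
        and ne: "(a, p, c) \<noteq> ?z0" using z(1) unfolding zz by simp_all
      have "y \<in> keys (tri3 (NF a) (bas p) (NF c))" using z(2) unfolding zz by simp
      then obtain x w where y: "y = (x, p, w)" "x \<in> keys (NF a)" "w \<in> keys (NF c)"
        "composable x p" "composable p w" by (rule keys_tri3_obtain)
      note xk = NF_keys[OF zp(1) y(2)] and wk = NF_keys[OF zp(3) y(3)]
      have tr: "y \<in> tri (AM (n - 1))" unfolding tri_def y(1) using xk(1) wk(1) zp(2) y(4,5) by simp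
      note S = rtrancl_sandwich[OF xk(2) zp(1) wk(2) zp(3) ambig_path[OF zp(2)] zp(4,5)]
      have "(wt y, q) \<in> step\<^sup>+ \<or> wt y = q \<and> parr (fst y) \<noteq> []"
      proof (cases "x \<noteq> a \<or> w \<noteq> c")
        case True
        then show ?thesis using S(2) zp(6) by (simp add: wt_def y(1))
      next
        case False
        \<comment> \<open>With trivial \<open>a\<close> the ambiguity \<open>p\<close> would start
          \<open>q\<close>, so by \<open>lsplit_prefix\<close> this would be the leading summand,
          which has been removed.\<close>
        have "parr a \<noteq> []"
        proof
          assume e: "parr a = []"
          have cpc: "composable a (pcomp p c)" using zp(4) by simp
          have qpc: "q = pcomp p c" using pcomp_triv(2)[OF cpc zp(1) e] zp(6) by simp
          have n1: "1 \<le> n" using 3 by simp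
          have pc: "p = q' \<and> c = u" by (rule lsplit_prefix[OF ls n1 zp(2) qpc zp(5,3)])
          have "psrc a = psrc q" using arg_cong[OF zp(6), of psrc] by simp
          then have "a = striv q" using e triv_qpath[OF zp(1) e] by (intro path_eqI) (simp_all add: striv_def)
          then show False using ne pc by simp
        qed
        then show ?thesis using False zp(6) by (simp add: wt_def y(1))
      qed
      then show ?thesis using tr unfolding below_def by simp
    qed
    have "\<forall>z \<in> keys (\<kappa> (delta_gen Q I R n q) - pscale 1 (bas (striv q, q', u))). below n q z"
      unfolding k using low by blast
    then show ?thesis using O(1) by (intro conjI exI[of _ 1]) simp_all
  qed
  then show "delta_gen Q I R n q \<in> carrier (T (AM (n - 1)))"
    "\<exists>\<epsilon>. \<epsilon> \<noteq> 0 \<and> (\<forall>z \<in> keys (\<kappa> (delta_gen Q I R n q) - pscale \<epsilon> (bas (striv q, q', u))). below n q z)"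
    by (rule conjunct1, rule conjunct2)
qed

lemma below_ends:
  assumes "below n q z" "q \<in> PQ"
  shows "psrc (fst z) = psrc q \<and> ptgt (snd (snd z)) = ptgt q"
proof -
  have "(wt z, q) \<in> step\<^sup>*" using assms(1) unfolding below_def by (metis rtrancl.rtrancl_refl trancl_into_rtrancl)
  from step_rtrancl_paths(2,3)[OF this assms(2)] show ?thesis by (simp add: wt_def)
qed

lemma delta_gen_props:
  assumes q: "q \<in> AM n" and n: "0 \<le> n"
  shows "delta_gen Q I R n q \<in> carrier (T (AM (n - 1)))"
    "z \<in> keys (\<kappa> (delta_gen Q I R n q)) \<Longrightarrow> psrc (fst z) = psrc q \<and> ptgt (snd (snd z)) = ptgt q"
proof -
  obtain q' u where ls: "lsplit n q q' u" by (rule lsplit_ex[OF assms])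
  note D = lsplitD[OF ls n]
  show "delta_gen Q I R n q \<in> carrier (T (AM (n - 1)))" by (rule delta_gen_lead(1)[OF ls n])
  obtain \<epsilon> where e: "\<forall>z \<in> keys (\<kappa> (delta_gen Q I R n q) - pscale \<epsilon> (bas (striv q, q', u))). below n q z"
    using delta_gen_lead(2)[OF ls n] by metis
  assume z: "z \<in> keys (\<kappa> (delta_gen Q I R n q))"
  show "psrc (fst z) = psrc q \<and> ptgt (snd (snd z)) = ptgt q"
  proof (cases "z = (striv q, q', u)")
    case True
    then show ?thesis using D(6) by (simp add: striv_def)
  next
    case False
    then have "z \<in> keys (\<kappa> (delta_gen Q I R n q) - pscale \<epsilon> (bas (striv q, q', u)))"
      using z by (simp add: in_keys_iff lookup_minus lookup_bas)
    then show ?thesis using e below_ends[OF _ D(9)] by metis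
  qed
qed

lemma delta_coord:
  assumes n: "0 \<le> n" and t: "t \<in> carrier (T (AM n))"
  shows "delta Q I R n t \<in> carrier (T (AM (n - 1)))" "\<kappa> (delta Q I R n t) = bmap (\<lambda>q. \<kappa> (delta_gen Q I R n q)) (\<kappa> t)"
  using T_ext_coord[OF AM_PQ AM_PQ delta_gen_props(1)[OF _ n] delta_gen_props(2)[OF _ n] t]
  unfolding delta_def res_term_def by simp_all

lemma unit_ten_props:
  assumes "q \<in> AM n"
  shows "unit_ten (AM n) q \<in> carrier (T (AM n))" "\<kappa> (unit_ten (AM n) q) = bas (striv q, q, ttriv q)"
proof -
  have q: "q \<in> PQ" "bas q \<in> kspace (AM n)" using assms ambig_path by simp_all
  note t = \<kappa>_ten[OF AM_PQ A_closed(4) q(2) A_closed(4)]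
  show "unit_ten (AM n) q \<in> carrier (T (AM n))" unfolding unit_ten_def by (rule t(1))
  have "tri3 oneE (bas q) oneE = bas (striv q, q, ttriv q)"
    unfolding tri3_oneE(1)[OF q(1)] tri3_oneE(2)[OF q(1)] using triv_props(7,8)[OF q(1)] by simp
  then show "\<kappa> (unit_ten (AM n) q) = bas (striv q, q, ttriv q)" unfolding unit_ten_def t(2) nf_one .
qed

text \<open>Evaluation at the elementary tensor of \<open>q\<close> multiplies by the vertices at
  the ends of \<open>q\<close>. These act as identities because the image is parallel to
  \<open>q\<close>.\<close>

lemma delta_unit:
  assumes q: "q \<in> AM n" and n: "0 \<le> n"
  shows "\<kappa> (delta Q I R n (unit_ten (AM n) q)) = \<kappa> (delta_gen Q I R n q)"
proof -
  let ?G = "\<kappa> (delta_gen Q I R n q)"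
  have qP: "q \<in> PQ" by (rule ambig_path[OF q])
  note Tq = triv_props[OF qP]
  note un = unit_ten_props[OF q]
  have "\<kappa> (delta Q I R n (unit_ten (AM n) q)) = ract (bas (ttriv q)) (lact (bas (striv q)) ?G)"
    unfolding delta_coord(2)[OF n un(1)] un(2) by (simp add: bmap_def)
  also have "\<dots> = ?G"
  proof (rule klin_eqI[where F = "\<lambda>u. ract (bas (ttriv q)) (lact (bas (striv q)) u)" and G = "\<lambda>u. u"])
    show "klin (\<lambda>u. ract (bas (ttriv q)) (lact (bas (striv q)) u))" by (rule klin_compose[OF klin_ract klin_lact])
    fix z assume z: "z \<in> keys ?G"
    have zt: "z \<in> tri (AM (n - 1))" by (rule kspace_key[OF \<kappa>_kspace[OF AM_PQ delta_gen_props(1)[OF q n]] z])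
    obtain a p c where zz: "z = (a, p, c)" by (rule prod_cases3)
    have ends: "psrc a = psrc q" "ptgt c = ptgt q" using delta_gen_props(2)[OF q n z] unfolding zz by simp_all
    have t: "a \<in> B" "c \<in> B" "composable a p" "composable p c" using zt unfolding zz tri_def by simp_all
    have c: "composable (striv q) a" "composable c (ttriv q)" using ends by (simp_all add: composable_def striv_def ttriv_def)
    have e: "pcomp (striv q) a = a" "pcomp c (ttriv q) = c"
      by (rule pcomp_triv(2)[OF c(1) Tq(1,11)], rule pcomp_triv(1)[OF c(2) Tq(2,12)])
    show "ract (bas (ttriv q)) (lact (bas (striv q)) (bas z)) = bas z"
      using ract_lact_bas[OF Tq(1,2) zt] c e t by (simp add: zz NF_B)
  qed simp
  finally show ?thesis .
qed

section \<open>Perturbed differentials and exactness in nonnegative degrees\<close>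

lemma kspan_Lbar:
  assumes q: "q \<in> PQ" and s: "s \<in> kspan Q I (T (AM m)) (Lbar Q I R m (bas q))"
  shows "s \<in> carrier (T (AM m))"
    "z \<in> keys (\<kappa> s) \<Longrightarrow> z \<in> tri (AM m) \<and> (wt z, q) \<in> step\<^sup>+"
proof -
  obtain F c where F: "s = (\<Oplus>\<^bsub>T (AM m)\<^esub> y \<in> F. scal Q I (c y) \<odot>\<^bsub>T (AM m)\<^esub> y)" "finite F" "F \<subseteq> Lbar Q I R m (bas q)"
    using s unfolding kspan_def by blast
  have L: "y \<in> carrier (T (AM m)) \<and> (\<forall>z \<in> keys (\<kappa> y). z \<in> tri (AM m) \<and> (wt z, q) \<in> step\<^sup>+)"
    if "y \<in> Lbar Q I R m (bas q)" for y
  proof -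
    obtain c b p b' where y: "y = scal Q I c \<odot>\<^bsub>T (AM m)\<^esub> ten Q I (AM m) (\<pi> (bas b)) (bas p) (\<pi> (bas b'))"
      "b \<in> B" "b' \<in> B" "p \<in> AM m" "prec Q R (pscale c (kq_mult (bas b) (kq_mult (bas p) (bas b')))) (bas q)"
      using \<open>y \<in> Lbar Q I R m (bas q)\<close> unfolding Lbar_def res_term_def by blast
    have A: "\<pi> (bas b) \<in> CA" "\<pi> (bas b') \<in> CA" "bas p \<in> kspace (AM m)" using y(2-4) B_path by (simp_all add: A_closed)
    note t = \<kappa>_ten[OF AM_PQ A(1,3,2)]
    have car: "y \<in> carrier (T (AM m))" unfolding y(1) by (rule \<kappa>_smult(1)[OF AM_PQ A_closed(3) t(1)])
    have k: "\<kappa> y = pscale c (tri3 (bas b) (bas p) (bas b'))"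
      unfolding y(1) \<kappa>_scal[OF AM_PQ t(1)] t(2) nf_bas[OF y(2)] nf_bas[OF y(3)] ..
    have "z \<in> tri (AM m) \<and> (wt z, q) \<in> step\<^sup>+" if "z \<in> keys (\<kappa> y)" for z
    proof -
      have c0: "c \<noteq> 0" and comp: "composable b p" "composable p b'" and z: "z = (b, p, b')"
        using \<open>z \<in> keys (\<kappa> y)\<close> unfolding k by (simp_all add: keys_pscale split: if_splits)
      have "prec Q R (Poly_Mapping.single (pcomp b (pcomp p b')) c) (bas q)"
        using y(5) comp by (simp add: single_eq_pscale)
      then have "(wt z, q) \<in> step\<^sup>+" unfolding z wt_def using prec_step c0 by simp
      moreover have "z \<in> tri (AM m)" unfolding z tri_def using y comp by simp
      ultimately show ?thesis by simp
    qed
    then show ?thesis using car by blast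
  qed
  have fc: "scal Q I (c y) \<odot>\<^bsub>T (AM m)\<^esub> y \<in> carrier (T (AM m))" if "y \<in> F" for y
    using \<kappa>_smult(1)[OF AM_PQ A_closed(3)] L[OF subsetD[OF F(3) that]] by simp
  from finsum_hom[where h = \<kappa>, OF abelian_group_T[OF AM_PQ] \<kappa>_add(2)[OF AM_PQ] \<kappa>_zero(2)[OF AM_PQ] F(2) fc]
  have s': "s \<in> carrier (T (AM m))" "\<kappa> s = (\<Sum>y\<in>F. \<kappa> (scal Q I (c y) \<odot>\<^bsub>T (AM m)\<^esub> y))" unfolding F(1) by simp_all
  show "s \<in> carrier (T (AM m))" by (rule s'(1))
  assume z: "z \<in> keys (\<kappa> s)"
  obtain y where y: "y \<in> F" "z \<in> keys (\<kappa> (scal Q I (c y) \<odot>\<^bsub>T (AM m)\<^esub> y))"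
    using subsetD[OF keys_sum_subset z[unfolded s'(2)]] by (rule UN_E)
  note Ly = L[OF subsetD[OF F(3) y(1)]]
  have "z \<in> keys (\<kappa> y)"
    using y(2) unfolding \<kappa>_scal[OF AM_PQ conjunct1[OF Ly]] by (simp add: keys_pscale split: if_splits)
  then show "z \<in> tri (AM m) \<and> (wt z, q) \<in> step\<^sup>+" using Ly by simp
qed

text \<open>The leading term spells \<open>q\<close>, the corrections only words strictly below
  \<open>q\<close>. They join the error terms and leave the leading coefficient alone.\<close>

lemma leads_ok_perturb:
  assumes n: "0 \<le> n"
    and G: "\<And>q. q \<in> AM n \<Longrightarrow> \<forall>z \<in> keys (G q - \<kappa> (delta_gen Q I R n q)). z \<in> tri (AM (n - 1)) \<and> (wt z, q) \<in> step\<^sup>+"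
  shows "leads_ok n G"
  unfolding leads_ok_def
proof (intro allI impI)
  fix q q' u assume ls: "lsplit n q q' u"
  obtain \<epsilon> where e: "\<epsilon> \<noteq> 0" "\<forall>z \<in> keys (\<kappa> (delta_gen Q I R n q) - pscale \<epsilon> (bas (striv q, q', u))). below n q z"
    using delta_gen_lead(2)[OF ls n] by metis
  have "below n q z" if z: "z \<in> keys (G q - pscale \<epsilon> (bas (striv q, q', u)))" for z
  proof -
    have eq: "G q - pscale \<epsilon> (bas (striv q, q', u)) = (G q - \<kappa> (delta_gen Q I R n q)) +
        (\<kappa> (delta_gen Q I R n q) - pscale \<epsilon> (bas (striv q, q', u)))" by simp
    have "z \<in> keys (G q - \<kappa> (delta_gen Q I R n q)) \<or>
        z \<in> keys (\<kappa> (delta_gen Q I R n q) - pscale \<epsilon> (bas (striv q, q', u)))"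
      using subsetD[OF keys_add z[unfolded eq]] by simp
    then show ?thesis
    proof
      assume "z \<in> keys (G q - \<kappa> (delta_gen Q I R n q))"
      then show ?thesis using bspec[OF G[OF lsplitD(1)[OF ls n]]] unfolding below_def by simp
    next
      assume "z \<in> keys (\<kappa> (delta_gen Q I R n q) - pscale \<epsilon> (bas (striv q, q', u)))"
      then show ?thesis using e(2) by simp
    qed
  qed
  then show "\<exists>\<epsilon>. \<epsilon> \<noteq> 0 \<and> (\<forall>z \<in> keys (G q - pscale \<epsilon> (bas (striv q, q', u))). below n q z)"
    using e(1) by (intro exI[of _ \<epsilon>]) simp
qed

text \<open>Moving \<open>u2\<close> from the middle to the right factor changes neither the word
  nor the combined length of these two factors.\<close>

lemma rk_extend:
  assumes "q2 = pcomp q u2"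
  shows "rk (b, q2, c2) = rk (b, q, pcomp u2 c2)"
  unfolding rk_def wt_def assms by (simp add: pcomp_assoc)

text \<open>The lift is \<open>(b, q2, c2)\<close>, whose leading term is the given triple.
  Admitting \<open>n = -1\<close> lets it serve the augmentation too.\<close>

lemma bmap_lift:
  assumes G: "leads_ok (n + 1) G" and n: "- 1 \<le> n" and t: "(b, q, c) \<in> tri (AM n)"
    and ls: "lsplit (n + 1) q2 q u2" "c = pcomp u2 c2" "c2 \<in> B" "composable q2 c2"
  shows "\<exists>z\<in>tri (AM (n + 1)). \<exists>\<epsilon>. \<epsilon> \<noteq> 0 \<and>
    (\<forall>y \<in> keys (bmap G (bas z) - pscale \<epsilon> (bas (b, q, c))). y \<in> tri (AM n) \<and> rk y < rk (b, q, c))"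
proof -
  have n1: "0 \<le> n + 1" using n by simp
  note D = lsplitD[OF ls(1) n1]
  have b: "b \<in> B" "c \<in> B" "composable b q" using t unfolding tri_def by simp_all
  have "composable b q2" using b(3) D(6) by (simp add: composable_def)
  then have z: "(b, q2, c2) \<in> tri (AM (n + 1))" unfolding tri_def using b(1) D(1) ls(3,4) by simp
  have r: "rk (b, q2, c2) = rk (b, q, c)" unfolding ls(2) by (rule rk_extend[OF D(6)])
  have "pcomp u2 c2 \<in> B" using b(2) ls(2) by simp
  then show ?thesis using bmap_lead[OF G n1 z ls(1)] z unfolding r ls(2)[symmetric] by auto
qed

lemma bmap_exact:
  assumes n: "0 \<le> n" and G: "leads_ok n G" "leads_ok (n + 1) G'"
    and complex: "\<And>y. y \<in> kspace (tri (AM (n + 1))) \<Longrightarrow> bmap G (bmap G' y) = 0"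
    and x: "x \<in> kspace (tri (AM n))" "bmap G x = 0"
  shows "\<exists>y\<in>kspace (tri (AM (n + 1))). bmap G' y = x"
proof -
  \<comment> \<open>Fixes a splitting of every ambiguity, so that taking leading terms becomes a
    function \<open>\<mu>\<close> on triples.\<close>
  define sp where "sp q = (SOME w. lsplit n q (fst w) (snd w))" for q
  have sp: "lsplit n q (fst (sp q)) (snd (sp q))" if q: "q \<in> AM n" for q
  proof -
    obtain q' u where "lsplit n q q' u" by (rule lsplit_ex[OF q n])
    then have "lsplit n q (fst (q', u)) (snd (q', u))" by simp
    then show ?thesis unfolding sp_def by (rule someI[of "\<lambda>w. lsplit n q (fst w) (snd w)"])
  qed
  define M where "M = {z \<in> tri (AM n). pcomp (snd (sp (fst (snd z)))) (snd (snd z)) \<in> B}"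
  define \<mu> where "\<mu> z = (fst z, fst (sp (fst (snd z))), pcomp (snd (sp (fst (snd z)))) (snd (snd z)))" for z :: "('v, 'e) triple"
  have inj: "inj_on \<mu> M"
  proof (rule inj_onI)
    fix y z assume y: "y \<in> M" and z: "z \<in> M" and e: "\<mu> y = \<mu> z"
    obtain b q c where yy: "y = (b, q, c)" by (rule prod_cases3)
    obtain b2 q2 c2 where zz: "z = (b2, q2, c2)" by (rule prod_cases3)
    have t: "q \<in> AM n" "q2 \<in> AM n" "c \<in> PQ" "c2 \<in> PQ" "composable q c" "composable q2 c2"
      using y z B_path unfolding yy zz M_def tri_def by simp_all
    note s1 = sp[OF t(1)] and s2 = sp[OF t(2)]
    have e': "b = b2" "fst (sp q) = fst (sp q2)" "pcomp (snd (sp q)) c = pcomp (snd (sp q2)) c2"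
      using e unfolding \<mu>_def yy zz by simp_all
    have qq: "q = q2" using lsplit_same_tail[OF s1 _ n e'(3)] s2 e'(2) by simp
    have "parr c = parr c2" using arg_cong[OF e'(3), of parr] qq by simp
    moreover have "psrc c = psrc c2" using t(5,6) qq by (simp add: composable_def)
    ultimately have "c = c2" using qpath_eqI_src[OF t(3,4)] by simp
    then show "y = z" using yy zz e'(1) qq by simp
  qed
  show ?thesis
  proof (rule exact_of_leading_terms[where ?D1.0 = "bmap G" and ?D2.0 = "bmap G'" and M = M and \<mu> = \<mu> and ?rk0.0 = rk and ?rk1.0 = rk,
        OF klin_bmap klin_bmap complex inj _ _ _ x])
    fix z assume z: "z \<in> tri (AM n)"
    obtain b q c where zz: "z = (b, q, c)" by (rule prod_cases3)
    have t: "b \<in> B" "q \<in> AM n" "c \<in> B" "composable b q" "composable q c" using z unfolding zz tri_def by simp_all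
    note s = sp[OF t(2)]
    note D = lsplitD[OF s n]
    note lead = bmap_lead[OF G(1) n z[unfolded zz] s]
    have uc: "composable (snd (sp q)) c" using t(5) arg_cong[OF D(6), of ptgt] by (simp add: composable_def)
    { assume "z \<in> M"
      then have uB: "pcomp (snd (sp q)) c \<in> B" unfolding M_def zz by simp
      have "\<mu> z = (b, fst (sp q), pcomp (snd (sp q)) c)" by (simp add: \<mu>_def zz)
      moreover have "rk (b, fst (sp q), pcomp (snd (sp q)) c) = rk z" unfolding zz by (rule rk_extend[OF D(6), symmetric])
      ultimately show "rk (\<mu> z) = rk z \<and> (\<exists>\<epsilon>. \<epsilon> \<noteq> 0 \<and>
          (\<forall>u\<in>keys (bmap G (bas z) - pscale \<epsilon> (bas (\<mu> z))). rk u < rk z))"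
        using lead uB unfolding zz by auto }
    { assume nM: "z \<notin> M"
      then have uB: "pcomp (snd (sp q)) c \<notin> B" using z unfolding M_def zz by simp
      show "\<forall>u\<in>keys (bmap G (bas z)). rk u < rk z" using lead uB unfolding zz by auto
      have cP: "c \<in> PQ" by (rule B_path[OF t(3)])
      have "wred SW (parr (snd (sp q)) @ parr c)"
        using uB pcomp_qpath[OF D(8) cP uc] by (simp add: B_iff)
      then obtain q2 u2 c2 where e: "lsplit (n + 1) q2 q u2" "c = pcomp u2 c2" "c2 \<in> B" "composable q2 c2" "composable u2 c2"
        by (rule lsplit_extend[OF s n t(3,5)])
      show "\<exists>y\<in>tri (AM (n + 1)). \<exists>\<epsilon>. \<epsilon> \<noteq> 0 \<and>
          (\<forall>u\<in>keys (bmap G' (bas y) - pscale \<epsilon> (bas z)). u \<in> tri (AM n) \<and> rk u < rk z)"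
        unfolding zz by (rule bmap_lift[OF G(2) _ z[unfolded zz] e(1-4)]) (use n in simp) }
  qed
qed

section \<open>The augmentation\<close>

definition augm :: "(('v, 'e) triple \<Rightarrow>\<^sub>0 'k) \<Rightarrow> ('v, 'e, 'k) kq" where
  "augm = lin_ext (\<lambda>z. N (kq_mult (bas (fst z)) (kq_mult (bas (fst (snd z))) (bas (snd (snd z))))))"

lemma klin_augm [simp, intro]: "klin augm" by (simp add: augm_def)

lemma augm_tri3: "augm (tri3 x w y) = N (kq_mult x (kq_mult w y))"
proof (rule klin3_eqI[where F = "\<lambda>x w y. augm (tri3 x w y)" and G = "\<lambda>x w y. N (kq_mult x (kq_mult w y))"])
  fix b p b'
  show "augm (tri3 (bas b) (bas p) (bas b')) = N (kq_mult (bas b) (kq_mult (bas p) (bas b')))"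
    by (simp add: augm_def klin_0[OF klin_N] klin_0[OF klin_lin_ext] klin_0[OF klin_kq_mult_right])
qed (rule klin_compose[OF klin_augm tri3_klin(1)] klin_compose[OF klin_augm tri3_klin(2)] klin_compose[OF klin_augm tri3_klin(3)]
    klin_compose[OF klin_N klin_kq_mult_left] klin_compose[OF klin_N klin_compose[OF klin_kq_mult_right klin_kq_mult_left]]
    klin_compose[OF klin_N klin_compose[OF klin_kq_mult_right klin_kq_mult_right]])+

lemma N_mult_N:
  assumes "x \<in> kspace PQ" "y \<in> kspace PQ"
  shows "N (kq_mult (N x) y) = N (kq_mult x y)" "N (kq_mult x (N y)) = N (kq_mult x y)"
proof -
  note Nx = N_kspace'[OF assms(1)] and Ny = N_kspace'[OF assms(2)]
  show "N (kq_mult (N x) y) = N (kq_mult x y)"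
    using proj_eq_iff[OF kq_mult_closed[OF Nx assms(2)] kq_mult_closed[OF assms]]
      proj_ops(2)[OF Nx assms(2)] proj_ops(2)[OF assms] proj_N[OF assms(1)] by simp
  show "N (kq_mult x (N y)) = N (kq_mult x y)"
    using proj_eq_iff[OF kq_mult_closed[OF assms(1) Ny] kq_mult_closed[OF assms]]
      proj_ops(2)[OF assms(1) Ny] proj_ops(2)[OF assms] proj_N[OF assms(2)] by simp
qed

text \<open>The two terms \<open>b q \<otimes> c\<close> and \<open>b \<otimes> q c\<close> multiply
  to the same path, and by \<open>N_mult_N\<close> it does not matter that one factor was normalized
  beforehand.\<close>

lemma augm_bmap_0:
  assumes "y \<in> kspace (tri (AM 0))" and G: "\<And>q. q \<in> AM 0 \<Longrightarrow> G q = \<kappa> (delta_gen Q I R 0 q)"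
  shows "augm (bmap G y) = 0"
proof (rule klin_eqI[where F = "\<lambda>y. augm (bmap G y)" and G = "\<lambda>_. 0"])
  show "klin (\<lambda>y. augm (bmap G y))" by (rule klin_compose[OF klin_augm klin_bmap])
  show "klin (\<lambda>_. 0 :: ('v, 'e, 'k) kq)" by (rule klinI) simp_all
  fix z assume "z \<in> keys y"
  then have zt: "z \<in> tri (AM 0)" by (rule kspace_key[OF assms(1)])
  obtain b q c where zz: "z = (b, q, c)" by (rule prod_cases3)
  have t: "b \<in> B" "q \<in> AM 0" "c \<in> B" "composable b q" "composable q c" using zt unfolding zz tri_def by simp_all
  note P = B_path[OF t(1)] B_path[OF t(3)]
  obtain q' u where ls: "lsplit 0 q q' u" by (rule lsplit_ex[OF t(2)]) simp
  have qB: "q \<in> B" using lsplitD(3)[OF ls] lsplit_0(1)[OF ls] by simp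
  have qP: "q \<in> PQ" by (rule B_path[OF qB])
  note Tq = triv_props[OF qP]
  have "composable (ttriv q) (ttriv q)" "composable (striv q) (striv q)"
    by (simp_all add: composable_def ttriv_def striv_def)
  then have z12: "(q, ttriv q, ttriv q) \<in> tri (AM (- 1))" "(striv q, striv q, q) \<in> tri (AM (- 1))"
    unfolding tri_def using Tq qB by simp_all
  have tc: "composable (ttriv q) c" "composable b (striv q)" using t by (simp_all add: composable_def ttriv_def striv_def)
  have e: "pcomp (ttriv q) c = c" "pcomp b (striv q) = b"
    by (rule pcomp_triv(2)[OF tc(1) Tq(2,12)], rule pcomp_triv(1)[OF tc(2) Tq(1,11)])
  let ?act = "\<lambda>v. ract (bas c) (lact (bas b) v)"
  have lin: "klin ?act" by (rule klin_compose[OF klin_ract klin_lact])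
  have "bmap G (bas z) = ?act (bas (q, ttriv q, ttriv q)) - ?act (bas (striv q, striv q, q))"
    unfolding klin_diff[OF lin, symmetric] delta_gen_0(2)[OF ls, symmetric] by (simp add: bmap_def zz G[OF t(2)])
  also have "?act (bas (q, ttriv q, ttriv q)) = tri3 (NF (pcomp b q)) (bas (ttriv q)) (bas c)"
    using ract_lact_bas[OF P z12(1)] t(4) tc e by (simp add: NF_B t(3))
  also have "?act (bas (striv q, striv q, q)) = tri3 (bas b) (bas (striv q)) (NF (pcomp q c))"
    using ract_lact_bas[OF P z12(2)] t(5) tc e by (simp add: NF_B t(1))
  finally have "augm (bmap G (bas z)) = N (kq_mult (NF (pcomp b q)) (kq_mult (bas (ttriv q)) (bas c)))
      - N (kq_mult (bas b) (kq_mult (bas (striv q)) (NF (pcomp q c))))"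
    by (simp add: klin_diff[OF klin_augm] augm_tri3)
  also have "kq_mult (bas (ttriv q)) (bas c) = (bas c :: ('v, 'e, 'k) kq)" using tc e by simp
  also have "kq_mult (bas b) (kq_mult (bas (striv q)) (NF (pcomp q c))) = kq_mult (bas b) (NF (pcomp q c))"
  proof -
    have "NF (pcomp q c) \<in> kspace PQ" using N_kspace'[of "bas (pcomp q c)"] pcomp_qpath[OF qP P(2) t(5)] by simp
    then have "kq_mult (bas b) (kq_mult (bas (striv q)) (NF (pcomp q c))) = kq_mult (kq_mult (bas b) (bas (striv q))) (NF (pcomp q c))"
      using P(1) Tq(1) by (intro kq_mult_assoc[symmetric]) simp_all
    then show ?thesis using tc e by simp
  qed
  also have "N (kq_mult (NF (pcomp b q)) (bas c)) = NF (pcomp b (pcomp q c))"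
    using N_mult_N(1)[of "bas (pcomp b q)" "bas c"] pcomp_qpath[OF P(1) qP t(4)] P(2) t(5) by (simp add: pcomp_assoc)
  also have "N (kq_mult (bas b) (NF (pcomp q c))) = NF (pcomp b (pcomp q c))"
    using N_mult_N(2)[of "bas b" "bas (pcomp q c)"] pcomp_qpath[OF qP P(2) t(5)] P(1) t(4) by simp
  finally show "augm (bmap G (bas z)) = 0" by simp
qed

lemma augm_bas_vertex:
  assumes "(b, e, c) \<in> tri (AM (- 1))"
  shows "augm (bas (b, e, c)) = NF (pcomp b c)" "pcomp b (pcomp e c) = pcomp b c" "composable b c" "parr e = []"
proof -
  have t: "b \<in> B" "c \<in> B" "composable b e" "composable e c" "e \<in> PQ" "parr e = []"
    using assms unfolding tri_def by (simp_all add: ambig_m1_iff)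
  have ec: "pcomp e c = c" by (rule pcomp_triv(2)[OF t(4-6)])
  then show "pcomp b (pcomp e c) = pcomp b c" by simp
  show "composable b c" using t(3,4) triv_qpath[OF t(5,6)] by (simp add: composable_def)
  then show "augm (bas (b, e, c)) = NF (pcomp b c)" using t(4) ec by (simp add: augm_def)
  show "parr e = []" by (rule t(6))
qed

text \<open>The same scheme in lowest degree. A leading term survives exactly when the right factor
  is a vertex, and it is then the left factor \<open>b\<close>; otherwise the first arrow of the
  right factor yields the lift.\<close>

lemma augm_exact:
  assumes G: "\<And>q. q \<in> AM 0 \<Longrightarrow> G q = \<kappa> (delta_gen Q I R 0 q)" and ok: "leads_ok 0 G"
    and x: "x \<in> kspace (tri (AM (- 1)))" "augm x = 0"
  shows "\<exists>y\<in>kspace (tri (AM 0)). bmap G y = x"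
proof -
  define M where "M = {z \<in> tri (AM (- 1)). parr (snd (snd z)) = []}"
  \<comment> \<open>The 0 is the second rank component of a triple whose middle and right factors
    are vertices. If the right factor is nontrivial, that component is positive, so the product has
    smaller rank even when its word is irreducible.\<close>
  let ?rk0 = "\<lambda>w. (rho w, 0 :: nat)"
  have inj: "inj_on fst M"
  proof (rule inj_onI)
    fix y z assume y: "y \<in> M" and z: "z \<in> M" and e: "fst y = fst z"
    obtain b q c where yy: "y = (b, q, c)" by (rule prod_cases3)
    obtain b2 q2 c2 where zz: "z = (b2, q2, c2)" by (rule prod_cases3)
    have t: "q \<in> PQ" "parr q = []" "q2 \<in> PQ" "parr q2 = []" "c \<in> PQ" "parr c = []" "c2 \<in> PQ" "parr c2 = []"
      "composable q c" "composable q2 c2" "composable b q" "composable b q2"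
      using y z B_path e unfolding yy zz M_def tri_def by (simp_all add: ambig_m1_iff)
    have "psrc q = psrc q2" using t(11,12) by (simp add: composable_def)
    then have q: "q = q2" using t by (intro qpath_eqI_src) simp_all
    then have "psrc c = psrc c2" using t(9,10) by (simp add: composable_def)
    then have "c = c2" using t by (intro qpath_eqI_src) simp_all
    then show "y = z" using e q unfolding yy zz by simp
  qed
  show ?thesis
  proof (rule exact_of_leading_terms[where ?D1.0 = augm and ?D2.0 = "bmap G" and M = M and \<mu> = fst and ?rk0.0 = ?rk0 and ?rk1.0 = rk,
        OF klin_augm klin_bmap augm_bmap_0[OF _ G] inj _ _ _ x])
    fix z assume z: "z \<in> tri (AM (- 1))"
    obtain b e c where zz: "z = (b, e, c)" by (rule prod_cases3)
    have t: "b \<in> B" "e \<in> AM (- 1)" "c \<in> B" "composable b e" "composable e c" using z unfolding zz tri_def by simp_all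
    note E = augm_bas_vertex[OF z[unfolded zz]]
    have w: "wt z = pcomp b c" using E(2) by (simp add: wt_def zz)
    { assume "z \<in> M"
      then have c: "parr c = []" unfolding M_def zz by simp
      have bc: "pcomp b c = b" by (rule pcomp_triv(1)[OF E(3) B_path[OF t(3)] c])
      have "?rk0 (fst z) = rk z" using w bc c E(4) by (simp add: rk_def zz)
      moreover have "augm (bas z) - pscale 1 (bas (fst z)) = 0" using E(1) bc by (simp add: zz NF_B t(1))
      ultimately show "?rk0 (fst z) = rk z \<and> (\<exists>\<epsilon>. \<epsilon> \<noteq> 0 \<and>
          (\<forall>u\<in>keys (augm (bas z) - pscale \<epsilon> (bas (fst z))). ?rk0 u < rk z))"
        by (intro conjI exI[of _ 1]) simp_all }
    { assume nM: "z \<notin> M"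
      then have c: "parr c \<noteq> []" using z unfolding M_def zz by simp
      have bc: "pcomp b c \<in> PQ" by (rule pcomp_qpath[OF B_path[OF t(1)] B_path[OF t(3)] E(3)])
      show "\<forall>u\<in>keys (augm (bas z)). ?rk0 u < rk z"
      proof
        fix u assume "u \<in> keys (augm (bas z))"
        then have "(u, pcomp b c) \<in> step\<^sup>*" unfolding zz E(1) by (rule NF_keys(2)[OF bc])
        then have "rho u \<le> rho (wt z)" unfolding w by (rule rho_le)
        then have "rho u < rho (wt z) \<or> rho u = rho (wt z)" by (simp add: le_less)
        then show "?rk0 u < rk z" using c by (auto simp: rk_def zz less_prod_def')
      qed
      obtain q2 u2 c2 where l: "lsplit 0 q2 e u2" "c = pcomp u2 c2" "c2 \<in> B" "composable q2 c2" "composable u2 c2"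
        by (rule lsplit_arrow[OF t(2,3,5) c])
      show "\<exists>y\<in>tri (AM 0). \<exists>\<epsilon>. \<epsilon> \<noteq> 0 \<and>
          (\<forall>u\<in>keys (bmap G (bas y) - pscale \<epsilon> (bas z)). u \<in> tri (AM (- 1)) \<and> rk u < rk z)"
        using bmap_lift[of "- 1" G b e c q2 u2 c2] ok z l unfolding zz by simp }
  qed
qed

text \<open>\<open>bimod_ext_coord\<close> applied to \<open>A\<close> as a bimodule over itself,
  with \<open>nf\<close> as the coordinate map.\<close>

lemma delta_aug_coord:
  assumes t: "t \<in> carrier (T (AM (- 1)))"
  shows "delta_aug Q I t \<in> CA" "nf (delta_aug Q I t) = augm (\<kappa> t)"
proof -
  let ?M = "regular_bimod A"
  interpret A: ring A by (rule ring_A)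
  have s: "carrier ?M = CA" "add ?M = add A" "zero ?M = zero A" "smult ?M = mult A" "rsmult ?M = mult A"
    by (simp_all add: regular_bimod_def)
  have ag: "abelian_group ?M"
  proof (rule abelian_groupI)
    fix x assume x: "x \<in> carrier ?M"
    then show "\<exists>y\<in>carrier ?M. y \<oplus>\<^bsub>?M\<^esub> x = \<zero>\<^bsub>?M\<^esub>" unfolding s by (intro bexI[of _ "\<ominus>\<^bsub>A\<^esub> x"]) (simp_all add: A.l_neg)
  qed (simp_all add: s A.a_assoc, simp add: A.a_comm)
  have n0: "nf \<zero>\<^bsub>A\<^esub> = 0" unfolding proj_zero using nf_proj[of 0] by (simp add: klin_0[OF klin_N])
  have scal: "nf (scal Q I c \<odot>\<^bsub>?M\<^esub> m) = pscale c (nf m)" if "m \<in> carrier ?M" for c m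
    using nf_scal that unfolding s by simp
  have H: "nf (rsmult ?M (x \<odot>\<^bsub>?M\<^esub> \<pi> (bas q)) y) = augm (tri3 (nf x) (bas q) (nf y))"
    if x: "x \<in> CA" and y: "y \<in> CA" and q: "q \<in> AM (- 1)" for x y q
  proof -
    have qP: "bas q \<in> kspace PQ" using q ambig_path by simp
    note k = nf_kspace'[OF x] nf_kspace'[OF y]
    have "x \<otimes>\<^bsub>A\<^esub> \<pi> (bas q) \<otimes>\<^bsub>A\<^esub> y = \<pi> (kq_mult (kq_mult (nf x) (bas q)) (nf y))"
      using proj_ops(2)[OF k(1) qP] proj_ops(2)[OF kq_mult_closed[OF k(1) qP] k(2)] proj_nf[OF x] proj_nf[OF y] by simp
    then have "nf (x \<otimes>\<^bsub>A\<^esub> \<pi> (bas q) \<otimes>\<^bsub>A\<^esub> y) = N (kq_mult (kq_mult (nf x) (bas q)) (nf y))"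
      using nf_proj[OF kq_mult_closed[OF kq_mult_closed[OF k(1) qP] k(2)]] by simp
    then show ?thesis unfolding s augm_tri3 kq_mult_assoc[OF k(1) qP k(2)] .
  qed
  have g: "\<pi> (bas q) \<in> carrier ?M" if "q \<in> AM (- 1)" for q
    using that ambig_path unfolding s by (simp add: A_closed)
  have add: "nf (x \<oplus>\<^bsub>?M\<^esub> y) = nf x + nf y" if "x \<in> carrier ?M" "y \<in> carrier ?M" for x y
    using nf_add that unfolding s by simp
  have zr: "nf \<zero>\<^bsub>?M\<^esub> = 0" unfolding s by (rule n0)
  have cl: "a \<odot>\<^bsub>?M\<^esub> m \<in> carrier ?M" "rsmult ?M m a \<in> carrier ?M" if "a \<in> CA" "m \<in> carrier ?M" for a m
    using that unfolding s by simp_all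
  show "delta_aug Q I t \<in> CA" "nf (delta_aug Q I t) = augm (\<kappa> t)"
    using bimod_ext_coord[where h = nf and M = ?M and g = "\<lambda>q. \<pi> (bas q)", OF AM_PQ ag add zr cl scal g H[unfolded augm_def] t]
    unfolding delta_aug_def augm_def s by simp_all
qed

section \<open>Exactness\<close>

text \<open>Carries the exactness from coordinates to tensors. The length of the complex is called
  \<open>K\<close> because \<open>N\<close> denotes the normal form in this context.\<close>

lemma exactness:
  fixes d :: "int \<Rightarrow> ('v, 'e, 'k) tens \<Rightarrow> ('v, 'e, 'k) tens" and K :: nat
  assumes d_0: "\<forall>t \<in> carrier (res_term Q I R 0). d 0 t = delta Q I R 0 t"
    and d_hom: "\<forall>i \<in> {1..int K}.
       d i \<in> bimod_hom (quot_algebra Q I) (res_term Q I R i) (res_term Q I R (i - 1))"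
    and complex: "\<forall>i \<in> {1..int K}. \<forall>t \<in> carrier (res_term Q I R i).
       d (i - 1) (d i t) = \<zero>\<^bsub>res_term Q I R (i - 2)\<^esub>"
    and approx: "\<forall>i \<in> {1..int K}. \<forall>q \<in> ambig Q R i.
       (let t = res_ten Q I R i \<one>\<^bsub>quot_algebra Q I\<^esub> (bas q) \<one>\<^bsub>quot_algebra Q I\<^esub>
        in d i t \<ominus>\<^bsub>res_term Q I R (i - 1)\<^esub> delta Q I R i t)
       \<in> kspan Q I (res_term Q I R (i - 1)) (Lbar Q I R (i - 1) (bas q))"
  shows "(\<forall>i \<in> {0..<int K}.
            a_kernel (res_term Q I R i) (res_term Q I R (i - 1)) (d i)
              = d (i + 1) ` carrier (res_term Q I R (i + 1)))
       \<and> a_kernel (res_term Q I R (- 1)) (regular_bimod (quot_algebra Q I)) (delta_aug Q I)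
              = d 0 ` carrier (res_term Q I R 0)
       \<and> delta_aug Q I ` carrier (res_term Q I R (- 1)) = carrier (quot_algebra Q I)"
proof -
  define G where "G i q = \<kappa> (d i (unit_ten (AM i) q))" for i q
  have d0: "d 0 t = delta Q I R 0 t" if "t \<in> carrier (T (AM 0))" for t
    using d_0 that unfolding res_term_def by simp
  have G0: "G 0 q = \<kappa> (delta_gen Q I R 0 q)" if "q \<in> AM 0" for q
    unfolding G_def d0[OF unit_ten_props(1)[OF that]] using delta_unit[OF that] by simp
  have dG: "d i t \<in> carrier (T (AM (i - 1))) \<and> \<kappa> (d i t) = bmap (G i) (\<kappa> t)"
    if i: "0 \<le> i" "i \<le> int K" and t: "t \<in> carrier (T (AM i))" for i t
  proof (cases "i = 0")
    case True
    \<comment> \<open>\<open>d 0\<close> is given by its agreement with \<delta> on the carrier, so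
      its coordinates come from \<open>delta_coord\<close> and not from
      \<open>hom_coord\<close>.\<close>
    have t0: "t \<in> carrier (T (AM 0))" using t True by simp
    have "bmap (\<lambda>q. \<kappa> (delta_gen Q I R 0 q)) (\<kappa> t) = bmap (G 0) (\<kappa> t)"
    proof (rule klin_eqI[OF klin_bmap klin_bmap])
      fix z assume "z \<in> keys (\<kappa> t)"
      then have z: "z \<in> tri (AM 0)" by (rule kspace_key[OF \<kappa>_kspace[OF AM_PQ t0]])
      obtain b q c where zz: "z = (b, q, c)" by (rule prod_cases3)
      have "q \<in> AM 0" using z unfolding zz tri_def by simp
      then show "bmap (\<lambda>q. \<kappa> (delta_gen Q I R 0 q)) (bas z) = bmap (G 0) (bas z)" by (simp add: bmap_def zz G0)
    qed
    then show ?thesis using delta_coord[OF order_refl t0] d0[OF t0] True by simp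
  next
    case False
    then have "i \<in> {1..int K}" using i by simp
    then have f: "d i \<in> bimod_hom A (T (AM i)) (T (AM (i - 1)))" using d_hom unfolding res_term_def by blast
    then have "d i t \<in> carrier (T (AM (i - 1)))" using t unfolding bimod_hom_def by blast
    moreover have "(\<lambda>q. \<kappa> (d i (unit_ten (AM i) q))) = G i" by (rule ext) (simp add: G_def)
    ultimately show ?thesis using hom_coord[OF AM_PQ AM_PQ f t] by simp
  qed
  have ok: "leads_ok i (G i)" if i: "0 \<le> i" "i \<le> int K" for i
  proof (rule leads_ok_perturb[OF i(1)])
    fix q assume q: "q \<in> AM i"
    note un = unit_ten_props(1)[OF q]
    show "\<forall>z\<in>keys (G i q - \<kappa> (delta_gen Q I R i q)). z \<in> tri (AM (i - 1)) \<and> (wt z, q) \<in> step\<^sup>+"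
    proof (cases "i = 0")
      case True
      then show ?thesis using G0 q by simp
    next
      case False
      then have "i \<in> {1..int K}" using i by simp
      then have k: "d i (unit_ten (AM i) q) \<ominus>\<^bsub>T (AM (i - 1))\<^esub> delta Q I R i (unit_ten (AM i) q)
          \<in> kspan Q I (T (AM (i - 1))) (Lbar Q I R (i - 1) (bas q))"
        using approx q unfolding res_term_def unit_ten_def Let_def by blast
      have "\<kappa> (d i (unit_ten (AM i) q) \<ominus>\<^bsub>T (AM (i - 1))\<^esub> delta Q I R i (unit_ten (AM i) q))
          = G i q - \<kappa> (delta_gen Q I R i q)"
        using \<kappa>_minus(2)[OF AM_PQ conjunct1[OF dG[OF i un]] delta_coord(1)[OF i(1) un]] delta_unit[OF q i(1)]
        by (simp add: G_def)
      then show ?thesis using kspan_Lbar(2)[OF ambig_path[OF q] k] by simp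
    qed
  qed
  have "a_kernel (T (AM i)) (T (AM (i - 1))) (d i) = d (i + 1) ` carrier (T (AM (i + 1)))"
    if i: "0 \<le> i" "i < int K" for i
  proof -
    have i1: "0 \<le> i + 1" "i + 1 \<le> int K" "i \<le> int K" using i by simp_all
    have cx: "d i (d (i + 1) t) = \<zero>\<^bsub>T (AM (i - 1))\<^esub>" if "t \<in> carrier (T (AM (i + 1)))" for t
    proof -
      have "i + 1 \<in> {1..int K}" using i by simp
      then have "d (i + 1 - 1) (d (i + 1) t) = \<zero>\<^bsub>res_term Q I R (i + 1 - 2)\<^esub>"
        using complex that unfolding res_term_def by blast
      then show ?thesis by (simp add: res_term_def)
    qed
    \<comment> \<open>The assumption \<open>complex\<close> is about tensors; \<open>\<tau>\<close>
      realizes each coordinate vector by one.\<close>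
    have DD0: "bmap (G i) (bmap (G (i + 1)) y) = 0" if y: "y \<in> kspace (tri (AM (i + 1)))" for y
    proof -
      note ty = \<tau>_props[OF AM_PQ y]
      have 1: "d (i + 1) (\<tau> (AM (i + 1)) y) \<in> carrier (T (AM i))"
        "\<kappa> (d (i + 1) (\<tau> (AM (i + 1)) y)) = bmap (G (i + 1)) y"
        using dG[OF i1(1,2) ty(1)] ty(2) by simp_all
      have "bmap (G i) (bmap (G (i + 1)) y) = \<kappa> (d i (d (i + 1) (\<tau> (AM (i + 1)) y)))"
        using dG[OF i(1) i1(3) 1(1)] 1(2) by simp
      then show ?thesis unfolding cx[OF ty(1)] \<kappa>_zero(2)[OF AM_PQ] .
    qed
    show ?thesis
    proof (intro equalityI subsetI)
      fix t assume "t \<in> a_kernel (T (AM i)) (T (AM (i - 1))) (d i)"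
      then have t: "t \<in> carrier (T (AM i))" "d i t = \<zero>\<^bsub>T (AM (i - 1))\<^esub>" by (simp_all add: a_kernel_def')
      have "bmap (G i) (\<kappa> t) = 0" using dG[OF i(1) i1(3) t(1)] t(2) \<kappa>_zero(2)[OF AM_PQ] by simp
      then obtain y where y: "y \<in> kspace (tri (AM (i + 1)))" "bmap (G (i + 1)) y = \<kappa> t"
        using bmap_exact[OF i(1) ok[OF i(1) i1(3)] ok[OF i1(1,2)] DD0 \<kappa>_kspace[OF AM_PQ t(1)]] by metis
      note ty = \<tau>_props[OF AM_PQ y(1)]
      have "d (i + 1) (\<tau> (AM (i + 1)) y) \<in> carrier (T (AM i))" "\<kappa> (d (i + 1) (\<tau> (AM (i + 1)) y)) = \<kappa> t"
        using dG[OF i1(1,2) ty(1)] ty(2) y(2) by simp_all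
      then have "d (i + 1) (\<tau> (AM (i + 1)) y) = t" using \<kappa>_inj[OF AM_PQ _ t(1)] by simp
      then show "t \<in> d (i + 1) ` carrier (T (AM (i + 1)))" using ty(1) by (metis imageI)
    next
      fix t assume "t \<in> d (i + 1) ` carrier (T (AM (i + 1)))"
      then obtain s where s: "t = d (i + 1) s" "s \<in> carrier (T (AM (i + 1)))" by (rule imageE)
      have "t \<in> carrier (T (AM i))" using dG[OF i1(1,2) s(2)] s(1) by simp
      then show "t \<in> a_kernel (T (AM i)) (T (AM (i - 1))) (d i)"
        using cx[OF s(2)] s(1) by (simp add: a_kernel_def')
    qed
  qed
  moreover have "a_kernel (T (AM (- 1))) (regular_bimod A) (delta_aug Q I) = d 0 ` carrier (T (AM 0))"
  proof (intro equalityI subsetI)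
    have z0: "\<zero>\<^bsub>regular_bimod A\<^esub> = \<pi> 0" by (simp add: regular_bimod_def proj_zero)
    have K0: "(0::int) \<le> int K" by simp
    {
      fix t assume "t \<in> a_kernel (T (AM (- 1))) (regular_bimod A) (delta_aug Q I)"
      then have t: "t \<in> carrier (T (AM (- 1)))" "delta_aug Q I t = \<pi> 0" using z0 by (simp_all add: a_kernel_def')
      have "augm (\<kappa> t) = 0" using delta_aug_coord(2)[OF t(1)] nf_proj[of 0] t(2) by (simp add: klin_0[OF klin_N])
      then obtain y where y: "y \<in> kspace (tri (AM 0))" "bmap (G 0) y = \<kappa> t"
        using augm_exact[OF G0 ok[OF order_refl K0] \<kappa>_kspace[OF AM_PQ t(1)]] by metis
      note ty = \<tau>_props[OF AM_PQ y(1)]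
      have "d 0 (\<tau> (AM 0) y) \<in> carrier (T (AM (- 1)))" "\<kappa> (d 0 (\<tau> (AM 0) y)) = \<kappa> t"
        using dG[OF order_refl K0 ty(1)] ty(2) y(2) by simp_all
      then have "d 0 (\<tau> (AM 0) y) = t" using \<kappa>_inj[OF AM_PQ _ t(1)] by simp
      then show "t \<in> d 0 ` carrier (T (AM 0))" using ty(1) by (metis imageI)
    next
      fix t assume "t \<in> d 0 ` carrier (T (AM 0))"
      then obtain s where s: "t = d 0 s" "s \<in> carrier (T (AM 0))" by (rule imageE)
      have t: "t \<in> carrier (T (AM (- 1)))" "\<kappa> t = bmap (G 0) (\<kappa> s)" using dG[OF order_refl K0 s(2)] s(1) by simp_all
      have "nf (delta_aug Q I t) = 0"
        using delta_aug_coord(2)[OF t(1)] t(2) augm_bmap_0[OF \<kappa>_kspace[OF AM_PQ s(2)] G0] by simp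
      then have "delta_aug Q I t = \<pi> 0" using proj_nf[OF delta_aug_coord(1)[OF t(1)]] by simp
      then show "t \<in> a_kernel (T (AM (- 1))) (regular_bimod A) (delta_aug Q I)"
        using t(1) z0 by (simp add: a_kernel_def')
    }
  qed
  moreover have "delta_aug Q I ` carrier (T (AM (- 1))) = CA"
  proof (intro equalityI subsetI)
    fix a assume "a \<in> delta_aug Q I ` carrier (T (AM (- 1)))"
    then obtain t where t: "a = delta_aug Q I t" "t \<in> carrier (T (AM (- 1)))" by (rule imageE)
    show "a \<in> CA" unfolding t(1) by (rule delta_aug_coord(1)[OF t(2)])
  next
    fix a assume a: "a \<in> CA"
    \<comment> \<open>A preimage of \<open>a\<close>: each path \<open>b\<close> of its normal form
      is followed by two copies of the vertex at its end.\<close>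
    define u where "u = lin_ext (\<lambda>b. bas (b, ttriv b, ttriv b)) (nf a)"
    have tb: "(b, ttriv b, ttriv b) \<in> tri (AM (- 1))" if "b \<in> B" for b
    proof -
      have "composable (ttriv b) (ttriv b)" by (simp add: composable_def ttriv_def)
      then show ?thesis unfolding tri_def using that triv_props[OF B_path[OF that]] by simp
    qed
    have uk: "u \<in> kspace (tri (AM (- 1)))" unfolding u_def by (rule kspace_lin_ext[OF nf_kspace[OF a]]) (simp add: tb)
    have "augm u = lin_ext (\<lambda>b. augm (bas (b, ttriv b, ttriv b))) (nf a)" unfolding u_def by (rule klin_lin_ext_comp[OF klin_augm])
    also have "\<dots> = lin_ext bas (nf a)"
    proof (rule lin_ext_cong)
      fix b assume "b \<in> keys (nf a)"
      then have b: "b \<in> B" by (rule kspace_key[OF nf_kspace[OF a]])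
      show "augm (bas (b, ttriv b, ttriv b)) = bas b"
        using augm_bas_vertex(1)[OF tb[OF b]] triv_props(10)[OF B_path[OF b]] by (simp add: NF_B b)
    qed
    finally have Du: "augm u = nf a" by simp
    note tu = \<tau>_props[OF AM_PQ uk]
    note da = delta_aug_coord[OF tu(1)]
    have "delta_aug Q I (\<tau> (AM (- 1)) u) = a"
      using proj_nf[OF da(1)] da(2) tu(2) Du proj_nf[OF a] by simp
    then show "a \<in> delta_aug Q I ` carrier (T (AM (- 1)))" using tu(1) by (intro image_eqI[OF sym])
  qed
  ultimately show ?thesis unfolding res_term_def by simp
qed

end

theorem theorem4p1:
  fixes Q :: "('v, 'e) pre_digraph"
    and I :: "('v, 'e, 'k::field) kq set"
    and R :: "('v, 'e, 'k) redsys"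
    and N :: nat
    and d :: "int \<Rightarrow> ('v, 'e, 'k) tens \<Rightarrow> ('v, 'e, 'k) tens"
  assumes quiver: "wf_digraph Q" "finite (verts Q)"
    and ideal: "ideal I (path_algebra Q)"
    and indep: "proj_lin_indep Q I (qpaths_of_length Q 0 \<union> qpaths_of_length Q 1)"
    and redsys: "reduction_system Q R"
    and lozenge: "lozenge Q R I"
    and length_S: "fst ` R \<subseteq> (\<Union>i\<in>{2..}. qpaths_of_length Q i)"
    and d_0: "\<forall>t \<in> carrier (res_term Q I R 0). d 0 t = delta Q I R 0 t"
    and d_hom: "\<forall>i \<in> {1..int N}.
       d i \<in> bimod_hom (quot_algebra Q I) (res_term Q I R i) (res_term Q I R (i - 1))"
    and complex: "\<forall>i \<in> {1..int N}. \<forall>t \<in> carrier (res_term Q I R i).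
       d (i - 1) (d i t) = \<zero>\<^bsub>res_term Q I R (i - 2)\<^esub>"
    and approx: "\<forall>i \<in> {1..int N}. \<forall>q \<in> ambig Q R i.
       (let t = res_ten Q I R i \<one>\<^bsub>quot_algebra Q I\<^esub> (bas q) \<one>\<^bsub>quot_algebra Q I\<^esub>
        in d i t \<ominus>\<^bsub>res_term Q I R (i - 1)\<^esub> delta Q I R i t)
       \<in> kspan Q I (res_term Q I R (i - 1)) (Lbar Q I R (i - 1) (bas q))"
  shows "(\<forall>i \<in> {0..<int N}.
            a_kernel (res_term Q I R i) (res_term Q I R (i - 1)) (d i)
              = d (i + 1) ` carrier (res_term Q I R (i + 1)))
       \<and> a_kernel (res_term Q I R (- 1)) (regular_bimod (quot_algebra Q I)) (delta_aug Q I)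
              = d 0 ` carrier (res_term Q I R 0)
       \<and> delta_aug Q I ` carrier (res_term Q I R (- 1)) = carrier (quot_algebra Q I)"
proof -
  interpret quiver_diamond Q R I
    using quiver ideal redsys lozenge length_S
    by (intro quiver_diamond.intro quiver_redsys.intro quiver_redsys_axioms.intro quiver_diamond_axioms.intro)
  show ?thesis by (rule exactness[OF d_0 d_hom complex approx])
qed

end
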